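(* Let $\mathcal{E}$ be an exact category such that: (1) $\mathcal{E}$ has enough projectives; (2) $\mathcal{E}$ has kernels; (3) countable coproducts of projectives exist and the class of projectives satisfies axiom AB4-$k$ for some $k\in\mathbb{Z}$. Consider the cotorsion pair $(\mathfrak{L},\mathfrak{R})=(\mathbf{Proj}(\mathcal{E}),\mathbf{Ob}(\mathcal{E}))$ on $\mathcal{E}$, and let $\mathfrak{W}$ be the class of acyclic complexes in $Ch(\mathcal{E})$. Then $(\widetilde{dg\mathfrak{L}},\widetilde{\mathfrak{R}})$ and $(\widetilde{\mathfrak{L}},\widetilde{dg\mathfrak{R}})$ are complete cotorsion pairs on $Ch(\mathcal{E})$ with $\widetilde{dg\mathfrak{L}}\cap\mathfrak{W}=\widetilde{\mathfrak{L}}$ and $\widetilde{dg\mathfrak{R}}\cap\mathfrak{W}=\widetilde{\mathfrak{R}}$, and there is a model structure on $Ch(\mathcal{E})$ whose cofibrations (resp. acyclic cofibrations) are the admissible monomorphisms with cokernel in $\widetilde{dg\mathfrak{L}}$ (resp. $\widetilde{\mathfrak{L}}$) and whose fibrations (resp. acyclic fibrations) are the admissible epimorphisms with kernel in $\widetilde{dg\mathfrak{R}}$ (resp. $\widetilde{\mathfrak{R}}$).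
   Context: Exact categories are in the sense of Quillen; complexes are homologically graded; exactness in $Ch(\mathcal{E})$ is degree-wise. $\mathbf{Proj}(\mathcal{E})$ is the class of projective objects (those $P$ with $\mathrm{Hom}(P,-)$ exact), $\mathbf{Ob}(\mathcal{E})$ all objects. A complex is acyclic if every $d_n$ factors as $X_n\twoheadrightarrow Z_{n-1}X\rightarrowtail X_{n-1}$ (admissible epic, admissible monic) with every $Z_nX\rightarrowtail X_n\twoheadrightarrow Z_{n-1}X$ short exact. A cotorsion pair on an exact category is a pair $(\mathfrak{L},\mathfrak{R})$ of classes of objects such that $\mathfrak{L}=\{X:\mathrm{Ext}^1(X,R)=0\ \forall R\in\mathfrak{R}\}$ and $\mathfrak{R}=\{X:\mathrm{Ext}^1(L,X)=0\ \forall L\in\mathfrak{L}\}$. It is complete if for every $X$ there are an admissible epic $Y\to X$ with $Y\in\mathfrak{L}$ and kernel in $\mathfrak{R}$, and an admissible monic $X\to Z$ with $Z\in\mathfrak{R}$ and cokernel in $\mathfrak{L}$. Given a cotorsion pair $(\mathfrak{L},\mathfrak{R})$ on $\mathcal{E}$: $\widetilde{\mathfrak{L}}$ (resp. $\widetilde{\mathfrak{R}}$) is the class of acyclic complexes $X$ with all $Z_nX\in\mathfrak{L}$ (resp. $\mathfrak{R}$). $\widetilde{dg\mathfrak{L}}$ is the class of complexes $X$ with all $X_n\in\mathfrak{L}$ and $\mathbf{Hom}(X,B)$ exact for all $B\in\widetilde{\mathfrak{R}}$; $\widetilde{dg\mathfrak{R}}$ is the class of complexes $X$ with all $X_n\in\mathfrak{R}$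 and $\mathbf{Hom}(A,X)$ exact for all $A\in\widetilde{\mathfrak{L}}$. Here $\mathbf{Hom}$ is the usual Hom-complex of abelian groups, $\mathbf{Hom}(X,Y)_n=\prod_i\mathrm{Hom}(X_i,Y_{i+n})$. A model structure is a triple of wide subcategories (cofibrations $\mathcal{C}$, fibrations $\mathcal{F}$, weak equivalences $\mathcal{W}$) with $\mathcal{W}$ satisfying 2-out-of-6 and $(\mathcal{C}\cap\mathcal{W},\mathcal{F})$, $(\mathcal{C},\mathcal{F}\cap\mathcal{W})$ weak factorisation systems (no completeness or cocompleteness assumed). Axiom AB4-$k$: $\tau_{\ge n}X$ denotes the truncation with $0$ in degrees $<n$, $\mathrm{Ker}(d_n)$ in degree $n$ and $X_m$ for $m>n$; $X$ is homologically concentrated in degrees $\le k$ if $\tau_{\ge k}X$ is acyclic. The class of projectives satisfies AB4-$k$ if whenever $\{B_n\}_{n\in\mathbb{N}}$ are bounded below complexes of projectives, each homologically concentrated in degrees $\le0$, the coproduct $\bigoplus_nB_n$ exists and is homologically concentrated in degrees $\le -k+1$. *)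

theory Defs
  imports "HOL-Algebra.Product_Groups"
begin

section \<open>Exact categories\<close>

text \<open>
  The \<open>Hom\<close>-sets of a category are the carriers of a family of abelian groups, which
  \<^theory>\<open>HOL-Algebra.Group\<close> writes multiplicatively: \<open>\<one>\<close>, \<open>\<otimes>\<close> and \<open>inv\<close> of \<open>HomG C X Y\<close> are the zero
  morphism, the sum and the negative of morphisms \<open>X \<rightarrow> Y\<close>.  Different \<open>Hom\<close>-sets need not be
  disjoint, so a morphism is only meaningful together with its source and target, and classes
  of morphisms are sets of triples \<open>(X, Y, f)\<close>.  The field \<open>Conf\<close> is the class of short exact
  sequences: \<open>Conf C A i B p Z\<close> says that \<open>A \<rightarrow> B \<rightarrow> Z\<close>, with maps \<open>i\<close> and \<open>p\<close>, is one of them.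
\<close>

record ('o, 'm) excat =
  Obj :: "'o set"
  HomG :: "'o \<Rightarrow> 'o \<Rightarrow> 'm monoid"
  Comp :: "'m \<Rightarrow> 'm \<Rightarrow> 'm" (infixl \<open>\<cdot>\<index>\<close> 75)
  Ide :: "'o \<Rightarrow> 'm"
  Conf :: "'o \<Rightarrow> 'm \<Rightarrow> 'o \<Rightarrow> 'm \<Rightarrow> 'o \<Rightarrow> bool"

abbreviation Hom :: "('o, 'm) excat \<Rightarrow> 'o \<Rightarrow> 'o \<Rightarrow> 'm set" where
  "Hom C X Y \<equiv> carrier (HomG C X Y)"

abbreviation Zero :: "('o, 'm) excat \<Rightarrow> 'o \<Rightarrow> 'o \<Rightarrow> 'm" where
  "Zero C X Y \<equiv> \<one>\<^bsub>HomG C X Y\<^esub>"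

definition Mor :: "('o, 'm) excat \<Rightarrow> ('o \<times> 'o \<times> 'm) set" where
  "Mor C = {(X, Y, f). X \<in> Obj C \<and> Y \<in> Obj C \<and> f \<in> Hom C X Y}"

definition is_iso :: "('o, 'm) excat \<Rightarrow> 'o \<Rightarrow> 'o \<Rightarrow> 'm \<Rightarrow> bool" where
  "is_iso C X Y f \<longleftrightarrow> f \<in> Hom C X Y \<and>
     (\<exists>g \<in> Hom C Y X. g \<cdot>\<^bsub>C\<^esub> f = Ide C X \<and> f \<cdot>\<^bsub>C\<^esub> g = Ide C Y)"

definition is_zero_object :: "('o, 'm) excat \<Rightarrow> 'o \<Rightarrow> bool" where
  "is_zero_object C Z \<longleftrightarrow> Z \<in> Obj C \<and>
     (\<forall>X \<in> Obj C. (\<exists>!f. f \<in> Hom C X Z) \<and> (\<exists>!f. f \<in> Hom C Z X))"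

definition is_biproduct ::
  "('o, 'm) excat \<Rightarrow> 'o \<Rightarrow> 'o \<Rightarrow> 'o \<Rightarrow> 'm \<Rightarrow> 'm \<Rightarrow> 'm \<Rightarrow> 'm \<Rightarrow> bool" where
  "is_biproduct C X Y S i j p q \<longleftrightarrow> S \<in> Obj C \<and>
     i \<in> Hom C X S \<and> j \<in> Hom C Y S \<and> p \<in> Hom C S X \<and> q \<in> Hom C S Y \<and>
     p \<cdot>\<^bsub>C\<^esub> i = Ide C X \<and> q \<cdot>\<^bsub>C\<^esub> j = Ide C Y \<and>
     p \<cdot>\<^bsub>C\<^esub> j = Zero C Y X \<and> q \<cdot>\<^bsub>C\<^esub> i = Zero C X Y \<and>
     (i \<cdot>\<^bsub>C\<^esub> p) \<otimes>\<^bsub>HomG C S S\<^esub> (j \<cdot>\<^bsub>C\<^esub> q) = Ide C S"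

text \<open>\<open>i : K \<rightarrow> A\<close> is a kernel of \<open>f : A \<rightarrow> B\<close>; dually, \<open>p : B \<rightarrow> Q\<close> is a cokernel of \<open>f : A \<rightarrow> B\<close>.\<close>

definition is_kernel :: "('o, 'm) excat \<Rightarrow> 'o \<Rightarrow> 'm \<Rightarrow> 'o \<Rightarrow> 'm \<Rightarrow> 'o \<Rightarrow> bool" where
  "is_kernel C K i A f B \<longleftrightarrow> K \<in> Obj C \<and> i \<in> Hom C K A \<and> f \<cdot>\<^bsub>C\<^esub> i = Zero C K B \<and>
     (\<forall>T \<in> Obj C. \<forall>g \<in> Hom C T A. f \<cdot>\<^bsub>C\<^esub> g = Zero C T B \<longrightarrow>
        (\<exists>!h. h \<in> Hom C T K \<and> i \<cdot>\<^bsub>C\<^esub> h = g))"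

definition is_cokernel :: "('o, 'm) excat \<Rightarrow> 'o \<Rightarrow> 'm \<Rightarrow> 'o \<Rightarrow> 'm \<Rightarrow> 'o \<Rightarrow> bool" where
  "is_cokernel C A f B p Q \<longleftrightarrow> Q \<in> Obj C \<and> p \<in> Hom C B Q \<and> p \<cdot>\<^bsub>C\<^esub> f = Zero C A Q \<and>
     (\<forall>T \<in> Obj C. \<forall>g \<in> Hom C B T. g \<cdot>\<^bsub>C\<^esub> f = Zero C A T \<longrightarrow>
        (\<exists>!h. h \<in> Hom C Q T \<and> h \<cdot>\<^bsub>C\<^esub> p = g))"

text \<open>The square \<open>f' i = i' f\<close> with \<open>i : A \<rightarrow> B\<close>, \<open>f : A \<rightarrow> A'\<close>, \<open>f' : B \<rightarrow> S\<close>, \<open>i' : A' \<rightarrow> S\<close>.\<close>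

definition is_pushout ::
  "('o, 'm) excat \<Rightarrow> 'o \<Rightarrow> 'o \<Rightarrow> 'o \<Rightarrow> 'm \<Rightarrow> 'm \<Rightarrow> 'o \<Rightarrow> 'm \<Rightarrow> 'm \<Rightarrow> bool" where
  "is_pushout C A B A' i f S f' i' \<longleftrightarrow> S \<in> Obj C \<and> f' \<in> Hom C B S \<and> i' \<in> Hom C A' S \<and>
     f' \<cdot>\<^bsub>C\<^esub> i = i' \<cdot>\<^bsub>C\<^esub> f \<and>
     (\<forall>T \<in> Obj C. \<forall>u \<in> Hom C B T. \<forall>v \<in> Hom C A' T. u \<cdot>\<^bsub>C\<^esub> i = v \<cdot>\<^bsub>C\<^esub> f \<longrightarrow>
        (\<exists>!h. h \<in> Hom C S T \<and> h \<cdot>\<^bsub>C\<^esub> f' = u \<and> h \<cdot>\<^bsub>C\<^esub> i' = v))"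

text \<open>The square \<open>p f' = f p'\<close> with \<open>p : B \<rightarrow> Z\<close>, \<open>f : Z' \<rightarrow> Z\<close>, \<open>f' : S \<rightarrow> B\<close>, \<open>p' : S \<rightarrow> Z'\<close>.\<close>

definition is_pullback ::
  "('o, 'm) excat \<Rightarrow> 'o \<Rightarrow> 'o \<Rightarrow> 'o \<Rightarrow> 'm \<Rightarrow> 'm \<Rightarrow> 'o \<Rightarrow> 'm \<Rightarrow> 'm \<Rightarrow> bool" where
  "is_pullback C Z B Z' p f S f' p' \<longleftrightarrow> S \<in> Obj C \<and> f' \<in> Hom C S B \<and> p' \<in> Hom C S Z' \<and>
     p \<cdot>\<^bsub>C\<^esub> f' = f \<cdot>\<^bsub>C\<^esub> p' \<and>
     (\<forall>T \<in> Obj C. \<forall>u \<in> Hom C T B. \<forall>v \<in> Hom C T Z'. p \<cdot>\<^bsub>C\<^esub> u = f \<cdot>\<^bsub>C\<^esub> v \<longrightarrow>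
        (\<exists>!h. h \<in> Hom C T S \<and> f' \<cdot>\<^bsub>C\<^esub> h = u \<and> p' \<cdot>\<^bsub>C\<^esub> h = v))"

definition is_coproduct ::
  "('o, 'm) excat \<Rightarrow> 'i set \<Rightarrow> ('i \<Rightarrow> 'o) \<Rightarrow> 'o \<Rightarrow> ('i \<Rightarrow> 'm) \<Rightarrow> bool" where
  "is_coproduct C I X S j \<longleftrightarrow> S \<in> Obj C \<and> (\<forall>n \<in> I. j n \<in> Hom C (X n) S) \<and>
     (\<forall>T \<in> Obj C. \<forall>g. (\<forall>n \<in> I. g n \<in> Hom C (X n) T) \<longrightarrow>
        (\<exists>!h. h \<in> Hom C S T \<and> (\<forall>n \<in> I. h \<cdot>\<^bsub>C\<^esub> j n = g n)))"

definition adm_mono :: "('o, 'm) excat \<Rightarrow> 'o \<Rightarrow> 'o \<Rightarrow> 'm \<Rightarrow> bool" where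
  "adm_mono C A B i \<longleftrightarrow> (\<exists>Z p. Conf C A i B p Z)"

definition adm_epi :: "('o, 'm) excat \<Rightarrow> 'o \<Rightarrow> 'o \<Rightarrow> 'm \<Rightarrow> bool" where
  "adm_epi C B Z p \<longleftrightarrow> (\<exists>A i. Conf C A i B p Z)"

locale category =
  fixes C :: "('o, 'm) excat" (structure)
  assumes comp_closed:
      "\<lbrakk>X \<in> Obj C; Y \<in> Obj C; Z \<in> Obj C; f \<in> Hom C X Y; g \<in> Hom C Y Z\<rbrakk> \<Longrightarrow> g \<cdot> f \<in> Hom C X Z"
    and ide_closed: "X \<in> Obj C \<Longrightarrow> Ide C X \<in> Hom C X X"
    and comp_assoc:
      "\<lbrakk>W \<in> Obj C; X \<in> Obj C; Y \<in> Obj C; Z \<in> Obj C;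
        f \<in> Hom C W X; g \<in> Hom C X Y; h \<in> Hom C Y Z\<rbrakk> \<Longrightarrow> (h \<cdot> g) \<cdot> f = h \<cdot> (g \<cdot> f)"
    and ide_left: "\<lbrakk>X \<in> Obj C; Y \<in> Obj C; f \<in> Hom C X Y\<rbrakk> \<Longrightarrow> Ide C Y \<cdot> f = f"
    and ide_right: "\<lbrakk>X \<in> Obj C; Y \<in> Obj C; f \<in> Hom C X Y\<rbrakk> \<Longrightarrow> f \<cdot> Ide C X = f"

locale additive_category = category +
  assumes hom_group: "\<lbrakk>X \<in> Obj C; Y \<in> Obj C\<rbrakk> \<Longrightarrow> comm_group (HomG C X Y)"
    and comp_add_left:
      "\<lbrakk>X \<in> Obj C; Y \<in> Obj C; Z \<in> Obj C; f \<in> Hom C X Y; g \<in> Hom C Y Z; g' \<in> Hom C Y Z\<rbrakk>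
       \<Longrightarrow> (g \<otimes>\<^bsub>HomG C Y Z\<^esub> g') \<cdot> f = (g \<cdot> f) \<otimes>\<^bsub>HomG C X Z\<^esub> (g' \<cdot> f)"
    and comp_add_right:
      "\<lbrakk>X \<in> Obj C; Y \<in> Obj C; Z \<in> Obj C; f \<in> Hom C X Y; f' \<in> Hom C X Y; g \<in> Hom C Y Z\<rbrakk>
       \<Longrightarrow> g \<cdot> (f \<otimes>\<^bsub>HomG C X Y\<^esub> f') = (g \<cdot> f) \<otimes>\<^bsub>HomG C X Z\<^esub> (g \<cdot> f')"
    and zero_object: "\<exists>Z. is_zero_object C Z"
    and biproducts: "\<lbrakk>X \<in> Obj C; Y \<in> Obj C\<rbrakk> \<Longrightarrow> \<exists>S i j p q. is_biproduct C X Y S i j p q"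

text \<open>
  Quillen's exact categories, in the self-dual axiomatisation of Keller and Buehler (Quillen's
  remaining ``obscure'' axiom is a consequence).
\<close>

locale exact_category = additive_category +
  assumes conf_objects:
      "Conf C A i B p Z \<Longrightarrow> A \<in> Obj C \<and> B \<in> Obj C \<and> Z \<in> Obj C"
    and conf_kernel: "Conf C A i B p Z \<Longrightarrow> is_kernel C A i B p Z"
    and conf_cokernel: "Conf C A i B p Z \<Longrightarrow> is_cokernel C A i B p Z"
    and conf_iso:
      "\<lbrakk>Conf C A i B p Z; A' \<in> Obj C; B' \<in> Obj C; Z' \<in> Obj C;
        i' \<in> Hom C A' B'; p' \<in> Hom C B' Z';
        is_iso C A A' a; is_iso C B B' b; is_iso C Z Z' c;
        b \<cdot> i = i' \<cdot> a; c \<cdot> p = p' \<cdot> b\<rbrakk> \<Longrightarrow> Conf C A' i' B' p' Z'"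
    and ide_adm_mono: "A \<in> Obj C \<Longrightarrow> adm_mono C A A (Ide C A)"
    and ide_adm_epi: "A \<in> Obj C \<Longrightarrow> adm_epi C A A (Ide C A)"
    and adm_mono_comp:
      "\<lbrakk>adm_mono C X Y f; adm_mono C Y Z g\<rbrakk> \<Longrightarrow> adm_mono C X Z (g \<cdot> f)"
    and adm_epi_comp:
      "\<lbrakk>adm_epi C X Y f; adm_epi C Y Z g\<rbrakk> \<Longrightarrow> adm_epi C X Z (g \<cdot> f)"
    and adm_mono_pushout:
      "\<lbrakk>adm_mono C A B i; A' \<in> Obj C; f \<in> Hom C A A'\<rbrakk>
       \<Longrightarrow> \<exists>S f' i'. is_pushout C A B A' i f S f' i' \<and> adm_mono C A' S i'"
    and adm_epi_pullback:
      "\<lbrakk>adm_epi C B Z p; Z' \<in> Obj C; f \<in> Hom C Z' Z\<rbrakk>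
       \<Longrightarrow> \<exists>S f' p'. is_pullback C Z B Z' p f S f' p' \<and> adm_epi C S Z' p'"

definition has_kernels :: "('o, 'm) excat \<Rightarrow> bool" where
  "has_kernels C \<longleftrightarrow>
     (\<forall>A \<in> Obj C. \<forall>B \<in> Obj C. \<forall>f \<in> Hom C A B. \<exists>K i. is_kernel C K i A f B)"

text \<open>\<open>P\<close> is projective if \<open>0 \<rightarrow> Hom(P,A) \<rightarrow> Hom(P,B) \<rightarrow> Hom(P,Z) \<rightarrow> 0\<close> is exact for each short
  exact sequence \<open>A \<rightarrow> B \<rightarrow> Z\<close>.\<close>

definition Proj :: "('o, 'm) excat \<Rightarrow> 'o set" where
  "Proj C = {P \<in> Obj C. \<forall>A i B p Z. Conf C A i B p Z \<longrightarrow>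
     inj_on (\<lambda>f. i \<cdot>\<^bsub>C\<^esub> f) (Hom C P A) \<and>
     (\<lambda>f. i \<cdot>\<^bsub>C\<^esub> f) ` Hom C P A = kernel (HomG C P B) (HomG C P Z) (\<lambda>g. p \<cdot>\<^bsub>C\<^esub> g) \<and>
     (\<lambda>g. p \<cdot>\<^bsub>C\<^esub> g) ` Hom C P B = Hom C P Z}"

definition enough_projectives :: "('o, 'm) excat \<Rightarrow> bool" where
  "enough_projectives C \<longleftrightarrow> (\<forall>X \<in> Obj C. \<exists>P \<in> Proj C. \<exists>p. adm_epi C P X p)"

definition countable_coproducts_of_projectives :: "('o, 'm) excat \<Rightarrow> bool" where
  "countable_coproducts_of_projectives C \<longleftrightarrow>
     (\<forall>(I :: nat set) P. (\<forall>n \<in> I. P n \<in> Proj C) \<longrightarrow> (\<exists>S j. is_coproduct C I P S j))"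

section \<open>Cotorsion pairs\<close>

text \<open>
  \<open>Ext1 C X A\<close> is the underlying set of the Yoneda group of extensions \<open>A \<rightarrow> E \<rightarrow> X\<close>; the group
  vanishes precisely if this set has a single element.
\<close>

definition extensions :: "('o, 'm) excat \<Rightarrow> 'o \<Rightarrow> 'o \<Rightarrow> ('m \<times> 'o \<times> 'm) set" where
  "extensions C X A = {(i, E, p). Conf C A i E p X}"

definition ext_equiv ::
  "('o, 'm) excat \<Rightarrow> 'o \<Rightarrow> 'o \<Rightarrow> (('m \<times> 'o \<times> 'm) \<times> ('m \<times> 'o \<times> 'm)) set" where
  "ext_equiv C X A = {((i, E, p), (i', E', p')).
     (i, E, p) \<in> extensions C X A \<and> (i', E', p') \<in> extensions C X A \<and>
     (\<exists>h. is_iso C E E' h \<and> h \<cdot>\<^bsub>C\<^esub> i = i' \<and> p' \<cdot>\<^bsub>C\<^esub> h = p)}"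

definition Ext1 :: "('o, 'm) excat \<Rightarrow> 'o \<Rightarrow> 'o \<Rightarrow> ('m \<times> 'o \<times> 'm) set set" where
  "Ext1 C X A = extensions C X A // ext_equiv C X A"

definition Ext1_vanishes :: "('o, 'm) excat \<Rightarrow> 'o \<Rightarrow> 'o \<Rightarrow> bool" where
  "Ext1_vanishes C X A \<longleftrightarrow> is_singleton (Ext1 C X A)"

definition cotorsion_pair :: "('o, 'm) excat \<Rightarrow> 'o set \<Rightarrow> 'o set \<Rightarrow> bool" where
  "cotorsion_pair C L R \<longleftrightarrow>
     L = {X \<in> Obj C. \<forall>Y \<in> R. Ext1_vanishes C X Y} \<and>
     R = {X \<in> Obj C. \<forall>Y \<in> L. Ext1_vanishes C Y X}"

definition complete_cotorsion_pair :: "('o, 'm) excat \<Rightarrow> 'o set \<Rightarrow> 'o set \<Rightarrow> bool" where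
  "complete_cotorsion_pair C L R \<longleftrightarrow> cotorsion_pair C L R \<and>
     (\<forall>X \<in> Obj C.
        (\<exists>Y \<in> L. \<exists>K \<in> R. \<exists>i p. Conf C K i Y p X) \<and>
        (\<exists>Z \<in> R. \<exists>Q \<in> L. \<exists>i p. Conf C X i Z p Q))"

section \<open>Chain complexes\<close>

datatype ('o, 'm) cplx = Cplx (ob: "int \<Rightarrow> 'o") (dif: "int \<Rightarrow> 'm")

definition is_cplx :: "('o, 'm) excat \<Rightarrow> ('o, 'm) cplx \<Rightarrow> bool" where
  "is_cplx C X \<longleftrightarrow> (\<forall>n. ob X n \<in> Obj C \<and> dif X n \<in> Hom C (ob X n) (ob X (n - 1)) \<and>
     dif X (n - 1) \<cdot>\<^bsub>C\<^esub> dif X n = Zero C (ob X n) (ob X (n - 1 - 1)))"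

definition chain_maps ::
  "('o, 'm) excat \<Rightarrow> ('o, 'm) cplx \<Rightarrow> ('o, 'm) cplx \<Rightarrow> (int \<Rightarrow> 'm) set" where
  "chain_maps C X Y = {f. \<forall>n. f n \<in> Hom C (ob X n) (ob Y n) \<and>
     dif Y n \<cdot>\<^bsub>C\<^esub> f n = f (n - 1) \<cdot>\<^bsub>C\<^esub> dif X n}"

definition Ch :: "('o, 'm) excat \<Rightarrow> (('o, 'm) cplx, int \<Rightarrow> 'm) excat" where
  "Ch C = \<lparr>
     Obj = Collect (is_cplx C),
     HomG = (\<lambda>X Y. (product_group UNIV (\<lambda>n. HomG C (ob X n) (ob Y n)))
                      \<lparr>carrier := chain_maps C X Y\<rparr>),
     Comp = (\<lambda>g f n. g n \<cdot>\<^bsub>C\<^esub> f n),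
     Ide = (\<lambda>X n. Ide C (ob X n)),
     Conf = (\<lambda>X f Y g Z. is_cplx C X \<and> is_cplx C Y \<and> is_cplx C Z \<and>
               f \<in> chain_maps C X Y \<and> g \<in> chain_maps C Y Z \<and>
               (\<forall>n. Conf C (ob X n) (f n) (ob Y n) (g n) (ob Z n)))\<rparr>"

text \<open>\<open>Z n\<close> are the cycle objects of \<open>X\<close>, and \<open>dif X n\<close> factors through \<open>Z (n - 1)\<close>.\<close>

definition acyclic_via ::
  "('o, 'm) excat \<Rightarrow> ('o, 'm) cplx \<Rightarrow> (int \<Rightarrow> 'o) \<Rightarrow> (int \<Rightarrow> 'm) \<Rightarrow> (int \<Rightarrow> 'm) \<Rightarrow> bool" where
  "acyclic_via C X Z i p \<longleftrightarrow> is_cplx C X \<and>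
     (\<forall>n. Conf C (Z n) (i n) (ob X n) (p n) (Z (n - 1)) \<and> dif X n = i (n - 1) \<cdot>\<^bsub>C\<^esub> p n)"

definition acyclics :: "('o, 'm) excat \<Rightarrow> ('o, 'm) cplx set" where
  "acyclics C = {X. \<exists>Z i p. acyclic_via C X Z i p}"

definition tilde :: "('o, 'm) excat \<Rightarrow> 'o set \<Rightarrow> ('o, 'm) cplx set" where
  "tilde C S = {X. \<exists>Z i p. acyclic_via C X Z i p \<and> (\<forall>n. Z n \<in> S)}"

definition hom_cplx ::
  "('o, 'm) excat \<Rightarrow> ('o, 'm) cplx \<Rightarrow> ('o, 'm) cplx \<Rightarrow> int \<Rightarrow> (int \<Rightarrow> 'm) monoid" where
  "hom_cplx C X Y n = product_group UNIV (\<lambda>i. HomG C (ob X i) (ob Y (i + n)))"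

text \<open>\<open>f \<mapsto> d\<^sub>Y f - (-1)\<^sup>n f d\<^sub>X\<close> for \<open>f\<close> of degree \<open>n\<close>.\<close>

definition hom_cplx_dif ::
  "('o, 'm) excat \<Rightarrow> ('o, 'm) cplx \<Rightarrow> ('o, 'm) cplx \<Rightarrow> int \<Rightarrow> (int \<Rightarrow> 'm) \<Rightarrow> (int \<Rightarrow> 'm)" where
  "hom_cplx_dif C X Y n f = (\<lambda>i.
     let G = HomG C (ob X i) (ob Y (i + (n - 1)));
         t = f (i - 1) \<cdot>\<^bsub>C\<^esub> dif X i
     in (dif Y (i + n) \<cdot>\<^bsub>C\<^esub> f i) \<otimes>\<^bsub>G\<^esub> (if even n then inv\<^bsub>G\<^esub> t else t))"

definition hom_cplx_exact ::
  "('o, 'm) excat \<Rightarrow> ('o, 'm) cplx \<Rightarrow> ('o, 'm) cplx \<Rightarrow> bool" where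
  "hom_cplx_exact C X Y \<longleftrightarrow> (\<forall>n.
     hom_cplx_dif C X Y (n + 1) ` carrier (hom_cplx C X Y (n + 1)) =
     kernel (hom_cplx C X Y n) (hom_cplx C X Y (n - 1)) (hom_cplx_dif C X Y n))"

definition dg_left :: "('o, 'm) excat \<Rightarrow> 'o set \<Rightarrow> 'o set \<Rightarrow> ('o, 'm) cplx set" where
  "dg_left C L R = {X. is_cplx C X \<and> (\<forall>n. ob X n \<in> L) \<and> (\<forall>B \<in> tilde C R. hom_cplx_exact C X B)}"

definition dg_right :: "('o, 'm) excat \<Rightarrow> 'o set \<Rightarrow> 'o set \<Rightarrow> ('o, 'm) cplx set" where
  "dg_right C L R = {X. is_cplx C X \<and> (\<forall>n. ob X n \<in> R) \<and> (\<forall>A \<in> tilde C L. hom_cplx_exact C A X)}"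

section \<open>The axiom AB4-k\<close>

text \<open>\<open>T\<close> is a truncation \<open>\<tau>\<^bsub>\<ge>n\<^esub>X\<close>, which is determined up to the choice of a kernel of \<open>dif X n\<close> and
  of zero objects.\<close>

definition is_truncation ::
  "('o, 'm) excat \<Rightarrow> int \<Rightarrow> ('o, 'm) cplx \<Rightarrow> ('o, 'm) cplx \<Rightarrow> bool" where
  "is_truncation C n X T \<longleftrightarrow> is_cplx C T \<and>
     (\<forall>m < n. is_zero_object C (ob T m)) \<and>
     (\<forall>m > n. ob T m = ob X m) \<and> (\<forall>m > n + 1. dif T m = dif X m) \<and>
     (\<exists>i. is_kernel C (ob T n) i (ob X n) (dif X n) (ob X (n - 1)) \<and>
          i \<cdot>\<^bsub>C\<^esub> dif T (n + 1) = dif X (n + 1))"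

definition homologically_concentrated_le :: "('o, 'm) excat \<Rightarrow> int \<Rightarrow> ('o, 'm) cplx \<Rightarrow> bool" where
  "homologically_concentrated_le C k X \<longleftrightarrow> (\<exists>T. is_truncation C k X T \<and> T \<in> acyclics C)"

definition bounded_below :: "('o, 'm) excat \<Rightarrow> ('o, 'm) cplx \<Rightarrow> bool" where
  "bounded_below C X \<longleftrightarrow> (\<exists>N. \<forall>m < N. is_zero_object C (ob X m))"

definition projectives_AB4 :: "('o, 'm) excat \<Rightarrow> int \<Rightarrow> bool" where
  "projectives_AB4 C k \<longleftrightarrow> (\<forall>B :: nat \<Rightarrow> ('o, 'm) cplx.
     (\<forall>n. is_cplx C (B n) \<and> (\<forall>m. ob (B n) m \<in> Proj C) \<and> bounded_below C (B n) \<and>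
          homologically_concentrated_le C 0 (B n)) \<longrightarrow>
     (\<exists>S j. is_coproduct (Ch C) UNIV B S j \<and> homologically_concentrated_le C (- k + 1) S))"

section \<open>Model structures\<close>

definition wide_subcategory :: "('o, 'm) excat \<Rightarrow> ('o \<times> 'o \<times> 'm) set \<Rightarrow> bool" where
  "wide_subcategory C S \<longleftrightarrow> S \<subseteq> Mor C \<and> (\<forall>X \<in> Obj C. (X, X, Ide C X) \<in> S) \<and>
     (\<forall>X Y Z f g. (X, Y, f) \<in> S \<and> (Y, Z, g) \<in> S \<longrightarrow> (X, Z, g \<cdot>\<^bsub>C\<^esub> f) \<in> S)"

definition two_out_of_six :: "('o, 'm) excat \<Rightarrow> ('o \<times> 'o \<times> 'm) set \<Rightarrow> bool" where
  "two_out_of_six C W \<longleftrightarrow> (\<forall>X Y Z T f g h.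
     (X, Y, f) \<in> Mor C \<and> (Y, Z, g) \<in> Mor C \<and> (Z, T, h) \<in> Mor C \<and>
     (X, Z, g \<cdot>\<^bsub>C\<^esub> f) \<in> W \<and> (Y, T, h \<cdot>\<^bsub>C\<^esub> g) \<in> W \<longrightarrow>
     (X, Y, f) \<in> W \<and> (Y, Z, g) \<in> W \<and> (Z, T, h) \<in> W \<and> (X, T, h \<cdot>\<^bsub>C\<^esub> (g \<cdot>\<^bsub>C\<^esub> f)) \<in> W)"

fun lifts_against :: "('o, 'm) excat \<Rightarrow> 'o \<times> 'o \<times> 'm \<Rightarrow> 'o \<times> 'o \<times> 'm \<Rightarrow> bool" where
  "lifts_against C (A, B, i) (X, Y, p) \<longleftrightarrow>
     (\<forall>u \<in> Hom C A X. \<forall>v \<in> Hom C B Y. p \<cdot>\<^bsub>C\<^esub> u = v \<cdot>\<^bsub>C\<^esub> i \<longrightarrow>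
        (\<exists>h \<in> Hom C B X. h \<cdot>\<^bsub>C\<^esub> i = u \<and> p \<cdot>\<^bsub>C\<^esub> h = v))"

definition weak_factorisation_system ::
  "('o, 'm) excat \<Rightarrow> ('o \<times> 'o \<times> 'm) set \<Rightarrow> ('o \<times> 'o \<times> 'm) set \<Rightarrow> bool" where
  "weak_factorisation_system C L R \<longleftrightarrow>
     L = {l \<in> Mor C. \<forall>r \<in> R. lifts_against C l r} \<and>
     R = {r \<in> Mor C. \<forall>l \<in> L. lifts_against C l r} \<and>
     (\<forall>X Y f. (X, Y, f) \<in> Mor C \<longrightarrow>
        (\<exists>T l r. (X, T, l) \<in> L \<and> (T, Y, r) \<in> R \<and> f = r \<cdot>\<^bsub>C\<^esub> l))"

definition model_structure ::
  "('o, 'm) excat \<Rightarrow> ('o \<times> 'o \<times> 'm) set \<Rightarrow> ('o \<times> 'o \<times> 'm) set \<Rightarrow> ('o \<times> 'o \<times> 'm) set \<Rightarrow> bool" where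
  "model_structure C Cof Fib W \<longleftrightarrow>
     wide_subcategory C Cof \<and> wide_subcategory C Fib \<and> wide_subcategory C W \<and>
     two_out_of_six C W \<and>
     weak_factorisation_system C (Cof \<inter> W) Fib \<and>
     weak_factorisation_system C Cof (Fib \<inter> W)"

definition adm_monos_coker_in :: "('o, 'm) excat \<Rightarrow> 'o set \<Rightarrow> ('o \<times> 'o \<times> 'm) set" where
  "adm_monos_coker_in C S = {(X, Y, f). \<exists>Z \<in> S. \<exists>p. Conf C X f Y p Z}"

definition adm_epis_ker_in :: "('o, 'm) excat \<Rightarrow> 'o set \<Rightarrow> ('o \<times> 'o \<times> 'm) set" where
  "adm_epis_ker_in C S = {(X, Y, f). \<exists>K \<in> S. \<exists>i. Conf C K i X f Y}"

end

theory Submission imports Defs begin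

text \<open>Since kernels exist and there are enough projectives, the obscure axiom shows that a morphism is an
  admissible epimorphism iff every morphism from a projective lifts along it. Hence a complex \<open>X\<close> is acyclic iff
  all complexes \<open>Hom(P, X)\<close> with \<open>P\<close> projective are exact, and one may argue with elements.

  For the pair of projectives and all objects, the class \<open>dgR\<close> consists of all complexes, the tilde class of the
  projectives consists of the contractible complexes of projectives, and \<open>dgL\<close> consists of the K-projective
  complexes of projectives. The second cotorsion pair is therefore elementary. The first needs, for every \<open>X\<close>, a
  K-projective \<open>Q\<close> and an admissible epimorphism from \<open>Q\<close> to \<open>X\<close> with acyclic kernel. One builds bounded below
  complexes \<open>P\<^sub>0 \<rightarrow> P\<^sub>1 \<rightarrow> \<dots>\<close> of projectives over \<open>X\<close>, where \<open>P\<^sub>n\<close> resolves \<open>X\<close> in degrees \<open>\<ge> -n\<close>, and takes for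
  \<open>Q\<close> the telescope of this sequence, the cone of \<open>id - shift\<close> on \<open>\<Oplus>P\<^sub>m\<close>. In a fixed degree AB4-k allows
  one to compare it with the telescope of the sequence stopped at a sufficiently large \<open>n\<close>, which contracts onto
  \<open>P\<^sub>n\<close>.

  Applying the resolution to the cone of a chain map, and replacing the map by a twisted sum, gives the
  factorisations. Weak equivalences are the maps inducing isomorphisms on the homology of \<open>Hom(P, -)\<close> for all
  projective \<open>P\<close>.\<close>

subsection \<open>Arrows in preadditive categories\<close>

text \<open>Neither homology objects nor sequential colimits are at hand. A quasi-isomorphism that
  is degreewise an admissible epic is therefore encoded by one property of elements,
  \<open>lifting\<close>: a cycle of the source together with a chain bounding its image comes from
  a chain of the source. In all degrees this is equivalent to being degreewise an admissible epic
  with acyclic kernel. It can also be demanded in high degrees only, and it passes from a resolution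
  of a cone to a factorisation of a map.

  The infinite constructions are coproducts of projectives, and AB4-k is all that is known about
  their exactness: a common bound for the homology of bounded below summands becomes, up to a
  constant depending on \<open>k\<close>, a bound for the coproduct. This is why a telescope is
  compared with its stopped version: the cones of \<open>P (min m n) \<rightarrow> P m\<close> have
  a common bound that tends to minus infinity with \<open>n\<close>, so a constant loss is harmless,
  whatever the sign of \<open>k\<close>.

  \<open>Ch C\<close> enters as a preadditive category with a class of short exact sequences;
  kernels and degreewise splittings produce the sequences that are needed.\<close>

text \<open>Arrows remember their source and target. Ill-typed operations return \<open>Null\<close>, so associativity and
  distributivity hold without side conditions and can be used as rewrite rules.\<close>

datatype ('o, 'm) arrow = Null | Arrow (src: 'o) (tgt: 'o) (val: 'm)

locale preadditive_category = category C for C :: "('o, 'm) excat" (structure) +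
  assumes hom_comm_group: "\<lbrakk>X \<in> Obj C; Y \<in> Obj C\<rbrakk> \<Longrightarrow> comm_group (HomG C X Y)"
    and comp_distrib_left:
      "\<lbrakk>X \<in> Obj C; Y \<in> Obj C; Z \<in> Obj C; f \<in> Hom C X Y; g \<in> Hom C Y Z; g' \<in> Hom C Y Z\<rbrakk>
       \<Longrightarrow> (g \<otimes>\<^bsub>HomG C Y Z\<^esub> g') \<cdot> f = (g \<cdot> f) \<otimes>\<^bsub>HomG C X Z\<^esub> (g' \<cdot> f)"
    and comp_distrib_right:
      "\<lbrakk>X \<in> Obj C; Y \<in> Obj C; Z \<in> Obj C; f \<in> Hom C X Y; f' \<in> Hom C X Y; g \<in> Hom C Y Z\<rbrakk>
       \<Longrightarrow> g \<cdot> (f \<otimes>\<^bsub>HomG C X Y\<^esub> f') = (g \<cdot> f) \<otimes>\<^bsub>HomG C X Z\<^esub> (g \<cdot> f')"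

sublocale additive_category \<subseteq> preadditive_category
  by (intro preadditive_category.intro preadditive_category_axioms.intro)
    (fact category_axioms hom_group comp_add_left comp_add_right)+

context preadditive_category
begin

definition arr :: "('o, 'm) arrow \<Rightarrow> bool" where
  "arr f \<longleftrightarrow> f \<noteq> Null \<and> src f \<in> Obj C \<and> tgt f \<in> Obj C \<and> val f \<in> Hom C (src f) (tgt f)"

abbreviation isar :: "('o, 'm) arrow \<Rightarrow> 'o \<Rightarrow> 'o \<Rightarrow> bool" where
  "isar f X Y \<equiv> arr f \<and> src f = X \<and> tgt f = Y"

definition cmp :: "('o, 'm) arrow \<Rightarrow> ('o, 'm) arrow \<Rightarrow> ('o, 'm) arrow" (infixr \<open>\<bullet>\<close> 75) where
  "g \<bullet> f = (if arr g \<and> arr f \<and> src g = tgt f then Arrow (src f) (tgt g) (val g \<cdot> val f) else Null)"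

definition add :: "('o, 'm) arrow \<Rightarrow> ('o, 'm) arrow \<Rightarrow> ('o, 'm) arrow" (infixr \<open>\<boxplus>\<close> 65) where
  "f \<boxplus> g = (if arr f \<and> arr g \<and> src f = src g \<and> tgt f = tgt g
     then Arrow (src f) (tgt f) (val f \<otimes>\<^bsub>HomG C (src f) (tgt f)\<^esub> val g) else Null)"

definition neg :: "('o, 'm) arrow \<Rightarrow> ('o, 'm) arrow" (\<open>\<boxminus> _\<close> [80] 80) where
  "\<boxminus> f = (if arr f then Arrow (src f) (tgt f) (inv\<^bsub>HomG C (src f) (tgt f)\<^esub> (val f)) else Null)"

definition zer :: "'o \<Rightarrow> 'o \<Rightarrow> ('o, 'm) arrow" where
  "zer X Y = (if X \<in> Obj C \<and> Y \<in> Obj C then Arrow X Y (Zero C X Y) else Null)"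

definition idn :: "'o \<Rightarrow> ('o, 'm) arrow" where
  "idn X = (if X \<in> Obj C then Arrow X X (Ide C X) else Null)"

lemma arr_Arrow [simp]: "arr (Arrow X Y f) \<longleftrightarrow> X \<in> Obj C \<and> Y \<in> Obj C \<and> f \<in> Hom C X Y"
  by (simp add: arr_def)

lemma arr_Null [simp]: "\<not> arr Null"
  by (simp add: arr_def)

lemma src_in_Obj [simp]: "arr f \<Longrightarrow> src f \<in> Obj C"
  and tgt_in_Obj [simp]: "arr f \<Longrightarrow> tgt f \<in> Obj C"
  and val_in_Hom: "arr f \<Longrightarrow> val f \<in> Hom C (src f) (tgt f)"
  by (simp_all add: arr_def)

lemma isar_in_Obj: "isar f X Y \<Longrightarrow> X \<in> Obj C \<and> Y \<in> Obj C"
  by auto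

lemma Arrow_collapse [simp]: "arr f \<Longrightarrow> Arrow (src f) (tgt f) (val f) = f"
  unfolding arr_def by (blast intro: arrow.collapse)

lemma Arrow_val: "isar f X Y \<Longrightarrow> Arrow X Y (val f) = f"
  by auto

lemma val_Hom: "isar f X Y \<Longrightarrow> val f \<in> Hom C X Y"
  using val_in_Hom[of f] by auto

lemma arrow_eqI: "\<lbrakk>arr f; arr g; src f = src g; tgt f = tgt g; val f = val g\<rbrakk> \<Longrightarrow> f = g"
  by (cases f; cases g) auto

lemma hom_grp: "X \<in> Obj C \<Longrightarrow> Y \<in> Obj C \<Longrightarrow> Group.group (HomG C X Y)"
  by (simp add: comm_group.axioms(2) hom_comm_group)

lemma hom_monoid: "X \<in> Obj C \<Longrightarrow> Y \<in> Obj C \<Longrightarrow> Group.comm_monoid (HomG C X Y)"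
  by (simp add: comm_group.axioms(1) hom_comm_group)

lemma hom_mon: "X \<in> Obj C \<Longrightarrow> Y \<in> Obj C \<Longrightarrow> Group.monoid (HomG C X Y)"
  by (simp add: group.is_monoid hom_grp)

lemma arr_cmp [simp]: "arr (g \<bullet> f) \<longleftrightarrow> arr g \<and> arr f \<and> src g = tgt f"
  using comp_closed[of "src f" "tgt f" "tgt g" "val f" "val g"] val_in_Hom[of f] val_in_Hom[of g]
  by (auto simp: cmp_def)

lemma src_cmp [simp]: "arr g \<Longrightarrow> arr f \<Longrightarrow> src g = tgt f \<Longrightarrow> src (g \<bullet> f) = src f"
  and tgt_cmp [simp]: "arr g \<Longrightarrow> arr f \<Longrightarrow> src g = tgt f \<Longrightarrow> tgt (g \<bullet> f) = tgt g"
  by (simp_all add: cmp_def)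

lemma arr_add [simp]: "arr (f \<boxplus> g) \<longleftrightarrow> arr f \<and> arr g \<and> src f = src g \<and> tgt f = tgt g"
  using val_in_Hom[of f] val_in_Hom[of g] monoid.m_closed[OF hom_mon, of "src f" "tgt f" "val f" "val g"]
  by (auto simp: add_def)

lemma src_add [simp]: "arr f \<Longrightarrow> arr g \<Longrightarrow> src f = src g \<Longrightarrow> tgt f = tgt g \<Longrightarrow> src (f \<boxplus> g) = src g"
  and tgt_add [simp]: "arr f \<Longrightarrow> arr g \<Longrightarrow> src f = src g \<Longrightarrow> tgt f = tgt g \<Longrightarrow> tgt (f \<boxplus> g) = tgt g"
  by (simp_all add: add_def)

lemma arr_neg [simp]: "arr (\<boxminus> f) \<longleftrightarrow> arr f"
  using val_in_Hom group.inv_closed[OF hom_grp] by (auto simp: neg_def)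

lemma src_neg [simp]: "arr f \<Longrightarrow> src (\<boxminus> f) = src f"
  and tgt_neg [simp]: "arr f \<Longrightarrow> tgt (\<boxminus> f) = tgt f"
  by (simp_all add: neg_def)

lemma arr_zer [simp]: "arr (zer X Y) \<longleftrightarrow> X \<in> Obj C \<and> Y \<in> Obj C"
  using monoid.one_closed[OF hom_mon] by (auto simp: zer_def)

lemma src_zer [simp]: "X \<in> Obj C \<Longrightarrow> Y \<in> Obj C \<Longrightarrow> src (zer X Y) = X"
  and tgt_zer [simp]: "X \<in> Obj C \<Longrightarrow> Y \<in> Obj C \<Longrightarrow> tgt (zer X Y) = Y"
  by (simp_all add: zer_def)

lemma arr_idn [simp]: "arr (idn X) \<longleftrightarrow> X \<in> Obj C"
  using ide_closed by (auto simp: idn_def)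

lemma src_idn [simp]: "X \<in> Obj C \<Longrightarrow> src (idn X) = X"
  and tgt_idn [simp]: "X \<in> Obj C \<Longrightarrow> tgt (idn X) = X"
  by (simp_all add: idn_def)

lemma not_arr_ops [simp]:
  "\<not> arr f \<Longrightarrow> f \<bullet> g = Null" "\<not> arr f \<Longrightarrow> g \<bullet> f = Null"
  "\<not> arr f \<Longrightarrow> f \<boxplus> g = Null" "\<not> arr f \<Longrightarrow> g \<boxplus> f = Null" "\<not> arr f \<Longrightarrow> \<boxminus> f = Null"
  by (simp_all add: cmp_def add_def neg_def)

lemma cmp_eq_Null: "\<not> (arr g \<and> arr f \<and> src g = tgt f) \<Longrightarrow> g \<bullet> f = Null"
  by (auto simp: cmp_def)

lemma add_eq_Null: "\<not> (arr g \<and> arr f \<and> src g = src f \<and> tgt g = tgt f) \<Longrightarrow> g \<boxplus> f = Null"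
  by (auto simp: add_def)

lemma not_arr_cmp: "\<not> arr (g \<bullet> f) \<Longrightarrow> g \<bullet> f = Null"
  and not_arr_add: "\<not> arr (g \<boxplus> f) \<Longrightarrow> g \<boxplus> f = Null"
  using cmp_eq_Null add_eq_Null arr_cmp arr_add by blast+

lemma cmp_assoc [simp]: "(h \<bullet> g) \<bullet> f = h \<bullet> (g \<bullet> f)"
proof (cases "arr h \<and> arr g \<and> arr f \<and> src h = tgt g \<and> src g = tgt f")
  case True
  then have "arr ((h \<bullet> g) \<bullet> f)" "arr (h \<bullet> (g \<bullet> f))" by auto
  then show ?thesis
    using comp_assoc[of "src f" "tgt f" "tgt g" "tgt h" "val f" "val g" "val h"] True
      val_in_Hom[of f] val_in_Hom[of g] val_in_Hom[of h]
    by (intro arrow_eqI) (auto simp: cmp_def split: if_splits)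
next
  case False
  then have "\<not> arr ((h \<bullet> g) \<bullet> f)" "\<not> arr (h \<bullet> (g \<bullet> f))" by auto
  then show ?thesis by (metis not_arr_cmp)
qed

text \<open>Compositions are normalised to nest on the right, so an equation for
  \<open>g \<bullet> f\<close> no longer matches once something is composed on its right. Applied as
  \<open>THEN cmp_reassoc\<close>, this gives the form with an arbitrary tail
  \<open>z\<close>.\<close>

lemma cmp_reassoc: "g \<bullet> f = h \<Longrightarrow> g \<bullet> (f \<bullet> z) = h \<bullet> z"
  by (simp flip: cmp_assoc)

lemma add_commute: "f \<boxplus> g = g \<boxplus> f"
proof (cases "arr f \<and> arr g \<and> src f = src g \<and> tgt f = tgt g")
  case True
  then show ?thesis
    using comm_monoid.m_comm[OF hom_monoid[of "src f" "tgt f"], of "val f" "val g"] val_in_Hom[of f] val_in_Hom[of g]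
    by (auto simp: add_def)
qed (auto simp: add_def)

lemma add_assoc: "(f \<boxplus> g) \<boxplus> h = f \<boxplus> (g \<boxplus> h)"
proof (cases "arr f \<and> arr g \<and> arr h \<and> src f = src g \<and> tgt f = tgt g \<and> src g = src h \<and> tgt g = tgt h")
  case True
  then have "arr ((f \<boxplus> g) \<boxplus> h)" "arr (f \<boxplus> (g \<boxplus> h))" by auto
  then show ?thesis
    using monoid.m_assoc[OF hom_mon[of "src f" "tgt f"], of "val f" "val g" "val h"] True val_in_Hom[of f] val_in_Hom[of g] val_in_Hom[of h]
    by (intro arrow_eqI) (auto simp: add_def split: if_splits)
next
  case False
  then have "\<not> arr ((f \<boxplus> g) \<boxplus> h)" "\<not> arr (f \<boxplus> (g \<boxplus> h))" by auto
  then show ?thesis by (metis not_arr_add)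
qed

lemma add_left_commute: "f \<boxplus> (g \<boxplus> h) = g \<boxplus> (f \<boxplus> h)"
  using add_assoc[of f g h] add_assoc[of g f h] add_commute[of f g] by simp

lemmas add_ac = add_assoc add_commute add_left_commute

lemma cmp_add_left [simp]: "(g \<boxplus> g') \<bullet> f = g \<bullet> f \<boxplus> g' \<bullet> f"
proof (cases "arr f \<and> arr g \<and> arr g' \<and> src g = src g' \<and> tgt g = tgt g' \<and> src g = tgt f")
  case True
  then have "arr ((g \<boxplus> g') \<bullet> f)" "arr (g \<bullet> f \<boxplus> g' \<bullet> f)" by auto
  then show ?thesis
    using comp_distrib_left[of "src f" "tgt f" "tgt g" "val f" "val g" "val g'"] True
      val_in_Hom[of f] val_in_Hom[of g] val_in_Hom[of g']
    by (intro arrow_eqI) (auto simp: add_def cmp_def split: if_splits)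
next
  case False
  then have "\<not> arr ((g \<boxplus> g') \<bullet> f)" "\<not> arr (g \<bullet> f \<boxplus> g' \<bullet> f)" by auto
  then show ?thesis by (metis not_arr_add not_arr_cmp)
qed

lemma cmp_add_right [simp]: "g \<bullet> (f \<boxplus> f') = g \<bullet> f \<boxplus> g \<bullet> f'"
proof (cases "arr f \<and> arr f' \<and> arr g \<and> src f = src f' \<and> tgt f = tgt f' \<and> src g = tgt f")
  case True
  then have "arr (g \<bullet> (f \<boxplus> f'))" "arr (g \<bullet> f \<boxplus> g \<bullet> f')" by auto
  then show ?thesis
    using comp_distrib_right[of "src f" "tgt f" "tgt g" "val f" "val f'" "val g"] True
      val_in_Hom[of f] val_in_Hom[of g] val_in_Hom[of f']
    by (intro arrow_eqI) (auto simp: add_def cmp_def split: if_splits)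
next
  case False
  then have "\<not> arr (g \<bullet> (f \<boxplus> f'))" "\<not> arr (g \<bullet> f \<boxplus> g \<bullet> f')" by auto
  then show ?thesis by (metis not_arr_add not_arr_cmp)
qed

lemma cmp_idn_left [simp]: "arr f \<Longrightarrow> X = tgt f \<Longrightarrow> idn X \<bullet> f = f"
  using ide_left[of "src f" "tgt f" "val f"] ide_closed
  by (intro arrow_eqI) (auto simp: cmp_def idn_def val_in_Hom)

lemma cmp_idn_right [simp]: "arr f \<Longrightarrow> X = src f \<Longrightarrow> f \<bullet> idn X = f"
  using ide_right[of "src f" "tgt f" "val f"] ide_closed
  by (intro arrow_eqI) (auto simp: cmp_def idn_def val_in_Hom)

lemma add_zer_left [simp]: "arr f \<Longrightarrow> X = src f \<Longrightarrow> Y = tgt f \<Longrightarrow> zer X Y \<boxplus> f = f"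
  using monoid.l_one[OF hom_mon[of "src f" "tgt f"]] monoid.one_closed[OF hom_mon[of "src f" "tgt f"]]
  by (intro arrow_eqI) (auto simp: add_def zer_def val_in_Hom)

lemma add_zer_right [simp]: "arr f \<Longrightarrow> X = src f \<Longrightarrow> Y = tgt f \<Longrightarrow> f \<boxplus> zer X Y = f"
  by (simp add: add_commute[of f])

lemma add_neg_right [simp]: "arr f \<Longrightarrow> f \<boxplus> \<boxminus> f = zer (src f) (tgt f)"
  using group.r_inv[OF hom_grp[of "src f" "tgt f"]] group.inv_closed[OF hom_grp[of "src f" "tgt f"]]
    monoid.one_closed[OF hom_mon[of "src f" "tgt f"]]
  by (intro arrow_eqI) (auto simp: add_def neg_def zer_def val_in_Hom)

lemma add_neg_left [simp]: "arr f \<Longrightarrow> \<boxminus> f \<boxplus> f = zer (src f) (tgt f)"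
  by (simp add: add_commute[of "\<boxminus> f"])

lemma add_neg_cancel [simp]:
  "\<lbrakk>arr f; arr g; src f = src g; tgt f = tgt g\<rbrakk> \<Longrightarrow> f \<boxplus> (\<boxminus> f \<boxplus> g) = g"
  "\<lbrakk>arr f; arr g; src f = src g; tgt f = tgt g\<rbrakk> \<Longrightarrow> \<boxminus> f \<boxplus> (f \<boxplus> g) = g"
  by (simp_all flip: add_assoc)

lemma add_cancel:
  assumes "f \<boxplus> g = f \<boxplus> h" "arr f" "arr g" "arr h" "src f = src g" "tgt f = tgt g" "src f = src h" "tgt f = tgt h"
  shows "g = h"
proof -
  have "g = \<boxminus> f \<boxplus> (f \<boxplus> g)"
    using assms(2-6) by (intro add_neg_cancel(2)[symmetric])
  also have "\<dots> = \<boxminus> f \<boxplus> (f \<boxplus> h)"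
    by (simp only: assms(1))
  also have "\<dots> = h"
    using assms(2,4,7,8) by (intro add_neg_cancel(2))
  finally show ?thesis .
qed

lemma add_eq_zerD:
  assumes "f \<boxplus> g = zer X Y" "isar f X Y" "isar g X Y"
  shows "g = \<boxminus> f"
  by (rule add_cancel[of f]) (use assms in simp_all)

lemma cmp_zer_left [simp]:
  assumes "arr f" "X = tgt f" "Y \<in> Obj C"
  shows "zer X Y \<bullet> f = zer (src f) Y"
proof -
  have "zer X Y \<bullet> f \<boxplus> zer X Y \<bullet> f = zer X Y \<bullet> f \<boxplus> zer (src f) Y"
    using assms by (simp flip: cmp_add_left)
  then show ?thesis by (rule add_cancel) (use assms in auto)
qed

lemma cmp_zer_right [simp]:
  assumes "arr f" "Y = src f" "X \<in> Obj C"
  shows "f \<bullet> zer X Y = zer X (tgt f)"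
proof -
  have "f \<bullet> zer X Y \<boxplus> f \<bullet> zer X Y = f \<bullet> zer X Y \<boxplus> zer X (tgt f)"
    using assms by (simp flip: cmp_add_right)
  then show ?thesis by (rule add_cancel) (use assms in auto)
qed

lemma neg_unique: "\<lbrakk>f \<boxplus> g = zer (src f) (tgt f); arr f; arr g; src g = src f; tgt g = tgt f\<rbrakk> \<Longrightarrow> \<boxminus> f = g"
  using add_eq_zerD[of f g] by simp

lemma neg_neg [simp]: "arr f \<Longrightarrow> \<boxminus> \<boxminus> f = f"
  by (rule neg_unique) auto

lemma neg_zer [simp]: "\<boxminus> zer X Y = zer X Y"
proof (cases "X \<in> Obj C \<and> Y \<in> Obj C")
  case True then show ?thesis by (intro neg_unique) auto
qed (auto simp: zer_def)

lemma cmp_neg_left [simp]: "\<boxminus> g \<bullet> f = \<boxminus> (g \<bullet> f)"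
proof (cases "arr (g \<bullet> f)")
  case True
  then have "g \<bullet> f \<boxplus> \<boxminus> g \<bullet> f = zer (src f) (tgt g)" by (simp flip: cmp_add_left)
  then show ?thesis using True by (intro neg_unique[symmetric]) auto
next
  case False
  then show ?thesis using cmp_eq_Null[of "\<boxminus> g" f] by auto
qed

lemma cmp_neg_right [simp]: "g \<bullet> \<boxminus> f = \<boxminus> (g \<bullet> f)"
proof (cases "arr (g \<bullet> f)")
  case True
  then have "g \<bullet> f \<boxplus> g \<bullet> \<boxminus> f = zer (src f) (tgt g)" by (simp flip: cmp_add_right)
  then show ?thesis using True by (intro neg_unique[symmetric]) auto
next
  case False
  then show ?thesis using cmp_eq_Null[of g "\<boxminus> f"] by auto
qed

lemma neg_add [simp]: "\<boxminus> (f \<boxplus> g) = \<boxminus> f \<boxplus> \<boxminus> g"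
proof (cases "arr (f \<boxplus> g)")
  case True
  have "(f \<boxplus> g) \<boxplus> (\<boxminus> f \<boxplus> \<boxminus> g) = (f \<boxplus> \<boxminus> f) \<boxplus> (g \<boxplus> \<boxminus> g)"
    by (simp only: add_ac)
  then show ?thesis using True by (intro neg_unique) auto
next
  case False
  moreover from this have "\<not> arr (\<boxminus> f \<boxplus> \<boxminus> g)" by auto
  ultimately show ?thesis by (metis not_arr_add not_arr_ops(5))
qed

text \<open>Sorting by \<open>add_ac\<close> can leave \<open>f\<close> and
  \<open>\<boxminus> f\<close> up to three summands apart, and these rules cancel across the gap.
  Typing conditions on \<open>f\<close> and \<open>a\<close> are enough: if \<open>b\<close> or
  \<open>c\<close> does not fit, both sides are \<open>Null\<close>.\<close>

lemma add_cancel_deep: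
  "\<lbrakk>arr f; arr a; src f = src a; tgt f = tgt a\<rbrakk> \<Longrightarrow> f \<boxplus> (a \<boxplus> \<boxminus> f) = a"
  "\<lbrakk>arr f; arr a; src f = src a; tgt f = tgt a\<rbrakk> \<Longrightarrow> \<boxminus> f \<boxplus> (a \<boxplus> f) = a"
  "\<lbrakk>arr f; arr a; src f = src a; tgt f = tgt a\<rbrakk> \<Longrightarrow> f \<boxplus> (a \<boxplus> (\<boxminus> f \<boxplus> b)) = a \<boxplus> b"
  "\<lbrakk>arr f; arr a; src f = src a; tgt f = tgt a\<rbrakk> \<Longrightarrow> \<boxminus> f \<boxplus> (a \<boxplus> (f \<boxplus> b)) = a \<boxplus> b"
  "\<lbrakk>arr f; arr a; src f = src a; tgt f = tgt a\<rbrakk> \<Longrightarrow> f \<boxplus> (a \<boxplus> (b \<boxplus> \<boxminus> f)) = a \<boxplus> b"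
  "\<lbrakk>arr f; arr a; src f = src a; tgt f = tgt a\<rbrakk> \<Longrightarrow> \<boxminus> f \<boxplus> (a \<boxplus> (b \<boxplus> f)) = a \<boxplus> b"
  "\<lbrakk>arr f; arr a; src f = src a; tgt f = tgt a\<rbrakk> \<Longrightarrow> f \<boxplus> (a \<boxplus> (b \<boxplus> (\<boxminus> f \<boxplus> c))) = a \<boxplus> (b \<boxplus> c)"
  "\<lbrakk>arr f; arr a; src f = src a; tgt f = tgt a\<rbrakk> \<Longrightarrow> \<boxminus> f \<boxplus> (a \<boxplus> (b \<boxplus> (f \<boxplus> c))) = a \<boxplus> (b \<boxplus> c)"
  "\<lbrakk>arr f; arr a; src f = src a; tgt f = tgt a\<rbrakk> \<Longrightarrow> f \<boxplus> (a \<boxplus> (b \<boxplus> (c \<boxplus> \<boxminus> f))) = a \<boxplus> (b \<boxplus> c)"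
  "\<lbrakk>arr f; arr a; src f = src a; tgt f = tgt a\<rbrakk> \<Longrightarrow> \<boxminus> f \<boxplus> (a \<boxplus> (b \<boxplus> (c \<boxplus> f))) = a \<boxplus> (b \<boxplus> c)"
proof -
  assume a: "arr f" "arr a" "src f = src a" "tgt f = tgt a"
  have 1: "a = f \<boxplus> (\<boxminus> f \<boxplus> a)" "a = \<boxminus> f \<boxplus> (f \<boxplus> a)" using a by simp_all
  show "f \<boxplus> (a \<boxplus> \<boxminus> f) = a" by (subst (2) 1(1)) (simp only: add_ac)
  show "\<boxminus> f \<boxplus> (a \<boxplus> f) = a" by (subst (2) 1(1)) (simp only: add_ac)
  show "f \<boxplus> (a \<boxplus> (\<boxminus> f \<boxplus> b)) = a \<boxplus> b" by (subst (2) 1(1)) (simp only: add_ac)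
  show "\<boxminus> f \<boxplus> (a \<boxplus> (f \<boxplus> b)) = a \<boxplus> b" by (subst (2) 1(1)) (simp only: add_ac)
  show "f \<boxplus> (a \<boxplus> (b \<boxplus> \<boxminus> f)) = a \<boxplus> b" by (subst (2) 1(1)) (simp only: add_ac)
  show "\<boxminus> f \<boxplus> (a \<boxplus> (b \<boxplus> f)) = a \<boxplus> b" by (subst (2) 1(1)) (simp only: add_ac)
  show "f \<boxplus> (a \<boxplus> (b \<boxplus> (\<boxminus> f \<boxplus> c))) = a \<boxplus> (b \<boxplus> c)" by (subst (2) 1(1)) (simp only: add_ac)
  show "\<boxminus> f \<boxplus> (a \<boxplus> (b \<boxplus> (f \<boxplus> c))) = a \<boxplus> (b \<boxplus> c)" by (subst (2) 1(1)) (simp only: add_ac)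
  show "f \<boxplus> (a \<boxplus> (b \<boxplus> (c \<boxplus> \<boxminus> f))) = a \<boxplus> (b \<boxplus> c)" by (subst (2) 1(1)) (simp only: add_ac)
  show "\<boxminus> f \<boxplus> (a \<boxplus> (b \<boxplus> (c \<boxplus> f))) = a \<boxplus> (b \<boxplus> c)" by (subst (2) 1(1)) (simp only: add_ac)
qed

lemmas canc = add_ac add_cancel_deep

lemma diff_zerD:
  assumes "f \<boxplus> \<boxminus> g = zer (src f) (tgt f)" "arr f" "arr g" "src g = src f" "tgt g = tgt f"
  shows "f = g"
proof -
  have "\<boxminus> g = \<boxminus> f"
    by (rule add_eq_zerD[OF assms(1)]) (use assms(2-) in simp_all)
  then have "\<boxminus> \<boxminus> g = \<boxminus> \<boxminus> f" by (simp only:)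
  then show ?thesis by (simp only: neg_neg assms)
qed

lemma cmp_Arrow: "\<lbrakk>isar (Arrow X Y f) X Y; isar (Arrow Y Z g) Y Z\<rbrakk>
    \<Longrightarrow> Arrow Y Z g \<bullet> Arrow X Y f = Arrow X Z (g \<cdot> f)"
  by (simp add: cmp_def)

lemma add_Arrow: "\<lbrakk>isar (Arrow X Y f) X Y; isar (Arrow X Y g) X Y\<rbrakk>
    \<Longrightarrow> Arrow X Y f \<boxplus> Arrow X Y g = Arrow X Y (f \<otimes>\<^bsub>HomG C X Y\<^esub> g)"
  by (simp add: add_def)

lemma neg_Arrow: "isar (Arrow X Y f) X Y \<Longrightarrow> \<boxminus> Arrow X Y f = Arrow X Y (inv\<^bsub>HomG C X Y\<^esub> f)"
  by (simp add: neg_def)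

lemma zer_eq_Arrow: "X \<in> Obj C \<Longrightarrow> Y \<in> Obj C \<Longrightarrow> zer X Y = Arrow X Y (Zero C X Y)"
  by (simp add: zer_def)

lemma idn_eq_Arrow: "X \<in> Obj C \<Longrightarrow> idn X = Arrow X X (Ide C X)"
  by (simp add: idn_def)

lemma val_cmp: "arr g \<Longrightarrow> arr f \<Longrightarrow> src g = tgt f \<Longrightarrow> val (g \<bullet> f) = val g \<cdot> val f"
  by (simp add: cmp_def)

end

subsection \<open>Biproducts, kernels and cokernels\<close>

context additive_category
begin

text \<open>One choice of all five components at once, so that \<open>Bip\<close>, the inclusions
  and the projections fit together.\<close>

definition bip_data :: "'a \<Rightarrow> 'a \<Rightarrow> 'a \<times> 'b \<times> 'b \<times> 'b \<times> 'b" where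
  "bip_data X Y = (SOME (S, i, j, p, q). is_biproduct C X Y S i j p q)"

definition Bip :: "'a \<Rightarrow> 'a \<Rightarrow> 'a" where
  "Bip X Y = fst (bip_data X Y)"

definition in1 :: "'a \<Rightarrow> 'a \<Rightarrow> ('a, 'b) arrow" where
  "in1 X Y = (if X \<in> Obj C \<and> Y \<in> Obj C then Arrow X (Bip X Y) (fst (snd (bip_data X Y))) else Null)"

definition in2 :: "'a \<Rightarrow> 'a \<Rightarrow> ('a, 'b) arrow" where
  "in2 X Y = (if X \<in> Obj C \<and> Y \<in> Obj C then Arrow Y (Bip X Y) (fst (snd (snd (bip_data X Y)))) else Null)"

definition pr1 :: "'a \<Rightarrow> 'a \<Rightarrow> ('a, 'b) arrow" where
  "pr1 X Y = (if X \<in> Obj C \<and> Y \<in> Obj C then Arrow (Bip X Y) X (fst (snd (snd (snd (bip_data X Y))))) else Null)"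

definition pr2 :: "'a \<Rightarrow> 'a \<Rightarrow> ('a, 'b) arrow" where
  "pr2 X Y = (if X \<in> Obj C \<and> Y \<in> Obj C then Arrow (Bip X Y) Y (snd (snd (snd (snd (bip_data X Y))))) else Null)"

lemma is_biproduct_bip_data:
  assumes "X \<in> Obj C" "Y \<in> Obj C"
  shows "case bip_data X Y of (S, i, j, p, q) \<Rightarrow> is_biproduct C X Y S i j p q"
proof -
  have "\<exists>z. case z of (S, i, j, p, q) \<Rightarrow> is_biproduct C X Y S i j p q"
    using biproducts[OF assms] by auto
  then show ?thesis unfolding bip_data_def by (rule someI_ex)
qed

lemma Bip_in_Obj [simp]: "X \<in> Obj C \<Longrightarrow> Y \<in> Obj C \<Longrightarrow> Bip X Y \<in> Obj C"
  using is_biproduct_bip_data[of X Y] by (auto simp: is_biproduct_def Bip_def split: prod.splits)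

lemma arr_bip [simp]:
  "arr (in1 X Y) \<longleftrightarrow> X \<in> Obj C \<and> Y \<in> Obj C" "arr (in2 X Y) \<longleftrightarrow> X \<in> Obj C \<and> Y \<in> Obj C"
  "arr (pr1 X Y) \<longleftrightarrow> X \<in> Obj C \<and> Y \<in> Obj C" "arr (pr2 X Y) \<longleftrightarrow> X \<in> Obj C \<and> Y \<in> Obj C"
  using is_biproduct_bip_data[of X Y]
  by (auto simp: is_biproduct_def Bip_def in1_def in2_def pr1_def pr2_def split: prod.splits)

lemma src_tgt_bip [simp]:
  assumes "X \<in> Obj C" "Y \<in> Obj C"
  shows "src (in1 X Y) = X" "tgt (in1 X Y) = Bip X Y" "src (in2 X Y) = Y" "tgt (in2 X Y) = Bip X Y"
    "src (pr1 X Y) = Bip X Y" "tgt (pr1 X Y) = X" "src (pr2 X Y) = Bip X Y" "tgt (pr2 X Y) = Y"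
  using assms by (auto simp: in1_def in2_def pr1_def pr2_def)

lemma bip_identities [simp]:
  assumes "X \<in> Obj C" "Y \<in> Obj C"
  shows "pr1 X Y \<bullet> in1 X Y = idn X" "pr2 X Y \<bullet> in2 X Y = idn Y"
    "pr1 X Y \<bullet> in2 X Y = zer Y X" "pr2 X Y \<bullet> in1 X Y = zer X Y"
    "in1 X Y \<bullet> pr1 X Y \<boxplus> in2 X Y \<bullet> pr2 X Y = idn (Bip X Y)"
proof -
  note b = is_biproduct_bip_data[OF assms]
  note [simp] = assms
  obtain S i j p q where d: "bip_data X Y = (S, i, j, p, q)" using prod_cases5 by blast
  have B: "is_biproduct C X Y S i j p q" using b d by simp
  have [simp]: "S \<in> Obj C" "Bip X Y = S" using B by (auto simp: is_biproduct_def Bip_def d)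
  note e = in1_def in2_def pr1_def pr2_def d idn_eq_Arrow zer_eq_Arrow
  have h: "i \<in> Hom C X S" "j \<in> Hom C Y S" "p \<in> Hom C S X" "q \<in> Hom C S Y"
    and e: "p \<cdot> i = Ide C X" "q \<cdot> j = Ide C Y" "p \<cdot> j = Zero C Y X" "q \<cdot> i = Zero C X Y"
     "(i \<cdot> p) \<otimes>\<^bsub>HomG C S S\<^esub> (j \<cdot> q) = Ide C S"
    using B by (auto simp: is_biproduct_def)
  have a: "in1 X Y = Arrow X S i" "in2 X Y = Arrow Y S j" "pr1 X Y = Arrow S X p" "pr2 X Y = Arrow S Y q"
    by (simp_all add: in1_def in2_def pr1_def pr2_def d)
  have c: "i \<cdot> p \<in> Hom C S S" "j \<cdot> q \<in> Hom C S S"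
    using h comp_closed[of S X S p i] comp_closed[of S Y S q j] by simp_all
  show "pr1 X Y \<bullet> in1 X Y = idn X" "pr2 X Y \<bullet> in2 X Y = idn Y"
    "pr1 X Y \<bullet> in2 X Y = zer Y X" "pr2 X Y \<bullet> in1 X Y = zer X Y"
    using h e by (simp_all add: a cmp_Arrow idn_eq_Arrow zer_eq_Arrow)
  show "in1 X Y \<bullet> pr1 X Y \<boxplus> in2 X Y \<bullet> pr2 X Y = idn (Bip X Y)"
    using h e c by (simp add: a cmp_Arrow idn_eq_Arrow add_Arrow)
qed

lemmas bip_identities_reassoc [simp] = bip_identities(1-4)[THEN cmp_reassoc]

definition pair :: "('a, 'b) arrow \<Rightarrow> ('a, 'b) arrow \<Rightarrow> ('a, 'b) arrow" where
  "pair f g = in1 (tgt f) (tgt g) \<bullet> f \<boxplus> in2 (tgt f) (tgt g) \<bullet> g"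

definition cop :: "('a, 'b) arrow \<Rightarrow> ('a, 'b) arrow \<Rightarrow> ('a, 'b) arrow" where
  "cop f g = f \<bullet> pr1 (src f) (src g) \<boxplus> g \<bullet> pr2 (src f) (src g)"

lemma arr_pair [simp]: "arr (pair f g) \<longleftrightarrow> arr f \<and> arr g \<and> src f = src g"
  by (auto simp: pair_def)

lemma src_pair [simp]: "\<lbrakk>arr f; arr g; src f = src g\<rbrakk> \<Longrightarrow> src (pair f g) = src g"
  and tgt_pair [simp]: "\<lbrakk>arr f; arr g; src f = src g\<rbrakk> \<Longrightarrow> tgt (pair f g) = Bip (tgt f) (tgt g)"
  by (auto simp: pair_def)

lemma arr_cop [simp]: "arr (cop f g) \<longleftrightarrow> arr f \<and> arr g \<and> tgt f = tgt g"
  by (auto simp: cop_def)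

lemma src_cop [simp]: "\<lbrakk>arr f; arr g; tgt f = tgt g\<rbrakk> \<Longrightarrow> src (cop f g) = Bip (src f) (src g)"
  and tgt_cop [simp]: "\<lbrakk>arr f; arr g; tgt f = tgt g\<rbrakk> \<Longrightarrow> tgt (cop f g) = tgt g"
  by (auto simp: cop_def)

lemma pair_cmp [simp]: "pair f g \<bullet> h = pair (f \<bullet> h) (g \<bullet> h)"
proof (cases "arr f \<and> arr g \<and> arr h \<and> src f = src g \<and> src g = tgt h")
  case True
  then show ?thesis by (auto simp: pair_def)
next
  case False
  then have "\<not> arr (pair f g \<bullet> h)" "\<not> arr (pair (f \<bullet> h) (g \<bullet> h))" by auto
  then show ?thesis by (metis not_arr_cmp not_arr_add pair_def)
qed

lemma cmp_cop [simp]: "h \<bullet> cop f g = cop (h \<bullet> f) (h \<bullet> g)"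
proof (cases "arr f \<and> arr g \<and> arr h \<and> tgt f = tgt g \<and> tgt g = src h")
  case True
  then show ?thesis by (auto simp: cop_def)
next
  case False
  then have "\<not> arr (h \<bullet> cop f g)" "\<not> arr (cop (h \<bullet> f) (h \<bullet> g))" by auto
  then show ?thesis by (metis not_arr_cmp not_arr_add cop_def)
qed

lemma pr_pair [simp]:
  assumes "arr f" "arr g" "src f = src g" "X = tgt f" "Y = tgt g"
  shows "pr1 X Y \<bullet> pair f g = f" "pr2 X Y \<bullet> pair f g = g"
  using assms by (simp_all add: pair_def)

lemma cop_in [simp]:
  assumes "arr f" "arr g" "tgt f = tgt g" "X = src f" "Y = src g"
  shows "cop f g \<bullet> in1 X Y = f" "cop f g \<bullet> in2 X Y = g"
  using assms by (simp_all add: cop_def)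

lemma cop_pair [simp]:
  assumes "arr f" "arr g" "tgt f = tgt g" "arr a" "arr b" "src a = src b" "tgt a = src f" "tgt b = src g"
  shows "cop f g \<bullet> pair a b = f \<bullet> a \<boxplus> g \<bullet> b"
proof -
  have "cop f g \<bullet> pair a b = f \<bullet> (pr1 (src f) (src g) \<bullet> pair a b) \<boxplus> g \<bullet> (pr2 (src f) (src g) \<bullet> pair a b)"
    unfolding cop_def by (simp only: cmp_add_left cmp_assoc)
  also have "\<dots> = f \<bullet> a \<boxplus> g \<bullet> b" using assms by simp
  finally show ?thesis .
qed

lemma pair_eta: 
  assumes "arr z" "tgt z = Bip X Y" "X \<in> Obj C" "Y \<in> Obj C"
  shows "pair (pr1 X Y \<bullet> z) (pr2 X Y \<bullet> z) = z"
proof -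
  have "pair (pr1 X Y \<bullet> z) (pr2 X Y \<bullet> z) = (in1 X Y \<bullet> pr1 X Y \<boxplus> in2 X Y \<bullet> pr2 X Y) \<bullet> z"
    using assms unfolding pair_def by (simp del: bip_identities)
  then show ?thesis using assms by (simp del: cmp_add_left)
qed

lemma cop_eta: 
  assumes "arr z" "src z = Bip X Y" "X \<in> Obj C" "Y \<in> Obj C"
  shows "cop (z \<bullet> in1 X Y) (z \<bullet> in2 X Y) = z"
proof -
  have "cop (z \<bullet> in1 X Y) (z \<bullet> in2 X Y) = z \<bullet> (in1 X Y \<bullet> pr1 X Y \<boxplus> in2 X Y \<bullet> pr2 X Y)"
    using assms unfolding cop_def by (simp del: bip_identities)
  then show ?thesis using assms by (simp del: cmp_add_right)
qed

lemma pair_pr [simp]: "X \<in> Obj C \<Longrightarrow> Y \<in> Obj C \<Longrightarrow> pair (pr1 X Y) (pr2 X Y) = idn (Bip X Y)"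
  using pair_eta[of "idn (Bip X Y)" X Y] by simp

lemma pair_eq_iff:
  assumes "arr (pair a b)" "arr (pair c d)" "tgt a = tgt c" "tgt b = tgt d"
  shows "pair a b = pair c d \<longleftrightarrow> a = c \<and> b = d"
proof
  assume "pair a b = pair c d"
  then have "pr1 (tgt a) (tgt b) \<bullet> pair a b = pr1 (tgt a) (tgt b) \<bullet> pair c d"
    "pr2 (tgt a) (tgt b) \<bullet> pair a b = pr2 (tgt a) (tgt b) \<bullet> pair c d" by simp_all
  then show "a = c \<and> b = d" using assms by simp
qed simp

lemma bip_ext:
  assumes "arr f" "arr g" "src f = Bip X Y" "src g = Bip X Y" "X \<in> Obj C" "Y \<in> Obj C"
    "f \<bullet> in1 X Y = g \<bullet> in1 X Y" "f \<bullet> in2 X Y = g \<bullet> in2 X Y"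
  shows "f = g"
proof -
  have "f = cop (f \<bullet> in1 X Y) (f \<bullet> in2 X Y)" by (rule cop_eta[symmetric]) fact+
  also have "\<dots> = cop (g \<bullet> in1 X Y) (g \<bullet> in2 X Y)" by (simp only: assms(7,8))
  also have "\<dots> = g" by (rule cop_eta) fact+
  finally show ?thesis .
qed

lemma bip_ext_pr:
  assumes "pr1 X Y \<bullet> f = pr1 X Y \<bullet> g" "pr2 X Y \<bullet> f = pr2 X Y \<bullet> g"
    "arr f" "arr g" "tgt f = Bip X Y" "tgt g = Bip X Y" "X \<in> Obj C" "Y \<in> Obj C"
  shows "f = g"
proof -
  have "f = pair (pr1 X Y \<bullet> f) (pr2 X Y \<bullet> f)" by (rule pair_eta[symmetric]) fact+
  also have "\<dots> = pair (pr1 X Y \<bullet> g) (pr2 X Y \<bullet> g)" by (simp only: assms(1,2))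
  also have "\<dots> = g" by (rule pair_eta) fact+
  finally show ?thesis .
qed

lemma pair_add:
  assumes "arr (pair a b)" "arr (pair c d)" "tgt a = tgt c" "tgt b = tgt d"
  shows "pair a b \<boxplus> pair c d = pair (a \<boxplus> c) (b \<boxplus> d)"
proof (cases "src a = src c")
  case True
  have *: "(i \<bullet> a \<boxplus> j \<bullet> b) \<boxplus> (i \<bullet> c \<boxplus> j \<bullet> d) = i \<bullet> (a \<boxplus> c) \<boxplus> j \<bullet> (b \<boxplus> d)" for i j
    by (simp add: add_ac)
  have "tgt (a \<boxplus> c) = tgt c" "tgt (b \<boxplus> d) = tgt d" using True assms by auto
  then show ?thesis using *[of "in1 (tgt c) (tgt d)" "in2 (tgt c) (tgt d)"]
    by (simp only: pair_def assms(3,4))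
next
  case False
  then have "\<not> arr (pair a b \<boxplus> pair c d)" "\<not> arr (pair (a \<boxplus> c) (b \<boxplus> d))" using assms by auto
  then show ?thesis by (metis not_arr_add pair_def)
qed

lemma pair_zer: "T \<in> Obj C \<Longrightarrow> X \<in> Obj C \<Longrightarrow> Y \<in> Obj C \<Longrightarrow> pair (zer T X) (zer T Y) = zer T (Bip X Y)"
  by (simp add: pair_def)

lemma pair_eq_zer_iff:
  assumes "arr (pair a b)" "tgt a = X" "tgt b = Y" "src a = T"
  shows "pair a b = zer T (Bip X Y) \<longleftrightarrow> a = zer T X \<and> b = zer T Y"
proof -
  have "T \<in> Obj C" "X \<in> Obj C" "Y \<in> Obj C" using assms by auto
  then show ?thesis
    using pair_eq_iff[of a b "zer T X" "zer T Y"] assms by (simp add: pair_zer)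
qed

end

section \<open>Isomorphisms, kernels and cokernels of arrows\<close>

context preadditive_category
begin

definition isom :: "('o, 'm) arrow \<Rightarrow> bool" where
  "isom a \<longleftrightarrow> arr a \<and> (\<exists>b. isar b (tgt a) (src a) \<and> b \<bullet> a = idn (src a) \<and> a \<bullet> b = idn (tgt a))"

definition mono :: "('o, 'm) arrow \<Rightarrow> bool" where
  "mono i \<longleftrightarrow> arr i \<and> (\<forall>g h. arr g \<and> arr h \<and> src g = src h \<and> tgt g = src i \<and> tgt h = src i \<and> i \<bullet> g = i \<bullet> h \<longrightarrow> g = h)"

definition epi :: "('o, 'm) arrow \<Rightarrow> bool" where
  "epi p \<longleftrightarrow> arr p \<and> (\<forall>g h. arr g \<and> arr h \<and> tgt g = tgt h \<and> src g = tgt p \<and> src h = tgt p \<and> g \<bullet> p = h \<bullet> p \<longrightarrow> g = h)"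

definition kern :: "('o, 'm) arrow \<Rightarrow> ('o, 'm) arrow \<Rightarrow> bool" where
  "kern i f \<longleftrightarrow> mono i \<and> arr f \<and> src f = tgt i \<and> f \<bullet> i = zer (src i) (tgt f) \<and>
    (\<forall>g. arr g \<and> tgt g = src f \<and> f \<bullet> g = zer (src g) (tgt f) \<longrightarrow> (\<exists>h. isar h (src g) (src i) \<and> i \<bullet> h = g))"

definition cker :: "('o, 'm) arrow \<Rightarrow> ('o, 'm) arrow \<Rightarrow> bool" where
  "cker f p \<longleftrightarrow> epi p \<and> arr f \<and> src p = tgt f \<and> p \<bullet> f = zer (src f) (tgt p) \<and>
    (\<forall>g. arr g \<and> src g = tgt f \<and> g \<bullet> f = zer (src f) (tgt g) \<longrightarrow> (\<exists>h. isar h (tgt p) (tgt g) \<and> h \<bullet> p = g))"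

lemma monoD: "\<lbrakk>mono i; i \<bullet> g = i \<bullet> h; arr g; arr h; src g = src h; tgt g = src i; tgt h = src i\<rbrakk> \<Longrightarrow> g = h"
  unfolding mono_def by blast

lemma epiD: "\<lbrakk>epi p; g \<bullet> p = h \<bullet> p; arr g; arr h; tgt g = tgt h; src g = tgt p; src h = tgt p\<rbrakk> \<Longrightarrow> g = h"
  unfolding epi_def by blast

lemma is_iso_iff: "X \<in> Obj C \<Longrightarrow> Y \<in> Obj C \<Longrightarrow> is_iso C X Y f \<longleftrightarrow> isom (Arrow X Y f)"
proof 
  assume o: "X \<in> Obj C" "Y \<in> Obj C" and "is_iso C X Y f"
  then obtain g where "f \<in> Hom C X Y" "g \<in> Hom C Y X" "g \<cdot> f = Ide C X" "f \<cdot> g = Ide C Y"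
    by (auto simp: is_iso_def)
  then show "isom (Arrow X Y f)"
    using o unfolding isom_def by (auto intro!: exI[of _ "Arrow Y X g"] simp: cmp_Arrow idn_eq_Arrow)
next
  assume o: "X \<in> Obj C" "Y \<in> Obj C" and i: "isom (Arrow X Y f)"
  then obtain b where b: "isar b Y X" "b \<bullet> Arrow X Y f = idn X" "Arrow X Y f \<bullet> b = idn Y"
    by (auto simp: isom_def)
  have f: "f \<in> Hom C X Y" using i by (simp add: isom_def)
  have v: "val b \<in> Hom C Y X" using b(1) val_Hom by blast
  have "val b \<cdot> f = Ide C X" "f \<cdot> val b = Ide C Y"
    using b f o val_cmp[of b "Arrow X Y f"] val_cmp[of "Arrow X Y f" b] by (simp_all add: idn_eq_Arrow)
  then show "is_iso C X Y f" using f v by (auto simp: is_iso_def)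
qed

text \<open>Since \<open>f\<close> annihilates every composite \<open>i \<bullet> g\<close>,
  uniqueness of factorisations through the kernel amounts to \<open>mono i\<close>. In this way
  \<open>kern\<close> separates uniqueness, used as a cancellation rule, from existence.\<close>

lemma is_kernel_iff:
  assumes "A \<in> Obj C" "B \<in> Obj C" "f \<in> Hom C A B"
  shows "is_kernel C K i A f B \<longleftrightarrow> kern (Arrow K A i) (Arrow A B f)"
proof
  assume k: "is_kernel C K i A f B"
  then have K: "K \<in> Obj C" "i \<in> Hom C K A" "f \<cdot> i = Zero C K B" by (auto simp: is_kernel_def)
  have u: "\<exists>!h. h \<in> Hom C T K \<and> i \<cdot> h = g" if "T \<in> Obj C" "g \<in> Hom C T A" "f \<cdot> g = Zero C T B" for T g
    using k that by (auto simp: is_kernel_def)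
  have z: "Arrow A B f \<bullet> Arrow K A i = zer K B"
    using K assms by (simp add: cmp_Arrow zer_eq_Arrow)
  have raw: "f \<cdot> val g = Zero C (src g) B" if "Arrow A B f \<bullet> g = zer (src g) B" "arr g" "tgt g = A" for g
    using that val_cmp[of "Arrow A B f" g] assms src_in_Obj[OF that(2)] by (simp add: zer_eq_Arrow)
  show "kern (Arrow K A i) (Arrow A B f)"
    unfolding kern_def mono_def
  proof (intro conjI allI impI)
    fix g h assume a: "arr g \<and> arr h \<and> src g = src h \<and> tgt g = src (Arrow K A i) \<and>
       tgt h = src (Arrow K A i) \<and> Arrow K A i \<bullet> g = Arrow K A i \<bullet> h"
    have "Arrow A B f \<bullet> (Arrow K A i \<bullet> g) = zer (src g) B"
      using a K assms cmp_reassoc[OF z, of g] by simp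
    then have "f \<cdot> val (Arrow K A i \<bullet> g) = Zero C (src g) B"
      using raw[of "Arrow K A i \<bullet> g"] a K assms by simp
    moreover have "val (Arrow K A i \<bullet> g) \<in> Hom C (src g) A"
      using a K assms by (intro val_Hom) auto
    ultimately have "\<exists>!x. x \<in> Hom C (src g) K \<and> i \<cdot> x = val (Arrow K A i \<bullet> g)"
      using u a by auto
    moreover have "val g \<in> Hom C (src g) K" "val h \<in> Hom C (src g) K"
      using a by (auto intro!: val_Hom)
    moreover have "i \<cdot> val g = val (Arrow K A i \<bullet> g)" "i \<cdot> val h = val (Arrow K A i \<bullet> g)"
      using a K assms val_cmp[of "Arrow K A i" g] val_cmp[of "Arrow K A i" h] by auto
    ultimately have "val g = val h" by auto
    then show "g = h" using a by (intro arrow_eqI) auto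
  next
    fix g assume a: "arr g \<and> tgt g = src (Arrow A B f) \<and> Arrow A B f \<bullet> g = zer (src g) (tgt (Arrow A B f))"
    then have "f \<cdot> val g = Zero C (src g) B" using raw by simp
    moreover have "val g \<in> Hom C (src g) A" using a by (auto intro!: val_Hom)
    ultimately obtain h where h: "h \<in> Hom C (src g) K" "i \<cdot> h = val g" using u a by (metis src_in_Obj)
    have "Arrow K A i \<bullet> Arrow (src g) K h = g"
      using a h K assms Arrow_val[of g "src g" A] by (simp add: cmp_Arrow)
    then show "\<exists>h. isar h (src g) (src (Arrow K A i)) \<and> Arrow K A i \<bullet> h = g"
      using a h K by (intro exI[of _ "Arrow (src g) K h"]) simp
  qed (use K assms z in simp_all)
next
  assume k: "kern (Arrow K A i) (Arrow A B f)"
  then have K: "K \<in> Obj C" "i \<in> Hom C K A" unfolding kern_def mono_def by simp_all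
  have z: "Arrow A B f \<bullet> Arrow K A i = zer K B" using k by (auto simp: kern_def)
  then have fi: "f \<cdot> i = Zero C K B"
    using K assms arg_cong[OF z, of val] by (simp add: cmp_Arrow zer_eq_Arrow)
  show "is_kernel C K i A f B"
    unfolding is_kernel_def
  proof (intro conjI ballI impI)
    fix T g assume g: "T \<in> Obj C" "g \<in> Hom C T A" "f \<cdot> g = Zero C T B"
    then have "Arrow A B f \<bullet> Arrow T A g = zer T B" using assms by (simp add: cmp_Arrow zer_eq_Arrow)
    then obtain h where h: "isar h T K" "Arrow K A i \<bullet> h = Arrow T A g"
      using k g assms unfolding kern_def by (auto dest!: spec[of _ "Arrow T A g"])
    show "\<exists>!h. h \<in> Hom C T K \<and> i \<cdot> h = g"
    proof (intro ex1I[of _ "val h"] conjI)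
      show "val h \<in> Hom C T K" using h val_Hom by blast
      show "i \<cdot> val h = g" using h val_cmp[of "Arrow K A i" h] K assms by simp
      fix y assume y: "y \<in> Hom C T K \<and> i \<cdot> y = g"
      then have e: "Arrow K A i \<bullet> Arrow T K y = Arrow K A i \<bullet> h"
        using h g K assms by (simp add: cmp_Arrow)
      have "Arrow T K y = h"
        by (rule monoD[OF conjunct1[OF k[unfolded kern_def]] e]) (use h(1) g(1) y K in simp_all)
      then show "y = val h" by auto
    qed
  qed (use K fi in simp_all)
qed

lemma is_cokernel_imp_cker:
  assumes "A \<in> Obj C" "B \<in> Obj C" "f \<in> Hom C A B" "is_cokernel C A f B p Q"
  shows "cker (Arrow A B f) (Arrow B Q p)"
proof -
  have K: "Q \<in> Obj C" "p \<in> Hom C B Q" "p \<cdot> f = Zero C A Q" using assms(4) by (auto simp: is_cokernel_def)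
  have u: "\<exists>!h. h \<in> Hom C Q T \<and> h \<cdot> p = g" if "T \<in> Obj C" "g \<in> Hom C B T" "g \<cdot> f = Zero C A T" for T g
    using assms(4) that by (auto simp: is_cokernel_def)
  have z: "Arrow B Q p \<bullet> Arrow A B f = zer A Q"
    using K assms by (simp add: cmp_Arrow zer_eq_Arrow)
  have raw: "val g \<cdot> f = Zero C A (tgt g)" if "g \<bullet> Arrow A B f = zer A (tgt g)" "arr g" "src g = B" for g
    using that val_cmp[of g "Arrow A B f"] assms tgt_in_Obj[OF that(2)] by (simp add: zer_eq_Arrow)
  show ?thesis
    unfolding cker_def epi_def
  proof (intro conjI allI impI)
    fix g h assume a: "arr g \<and> arr h \<and> tgt g = tgt h \<and> src g = tgt (Arrow B Q p) \<and>
       src h = tgt (Arrow B Q p) \<and> g \<bullet> Arrow B Q p = h \<bullet> Arrow B Q p"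
    have "(g \<bullet> Arrow B Q p) \<bullet> Arrow A B f = zer A (tgt g)"
      using a K assms z by simp
    then have "val (g \<bullet> Arrow B Q p) \<cdot> f = Zero C A (tgt g)"
      using raw[of "g \<bullet> Arrow B Q p"] a K assms by simp
    moreover have "val (g \<bullet> Arrow B Q p) \<in> Hom C B (tgt g)"
      using a K assms by (intro val_Hom) auto
    ultimately have "\<exists>!x. x \<in> Hom C Q (tgt g) \<and> x \<cdot> p = val (g \<bullet> Arrow B Q p)"
      using u a by auto
    moreover have "val g \<in> Hom C Q (tgt g)" "val h \<in> Hom C Q (tgt g)"
      using a by (auto intro!: val_Hom)
    moreover have "val g \<cdot> p = val (g \<bullet> Arrow B Q p)" "val h \<cdot> p = val (g \<bullet> Arrow B Q p)"
      using a K assms val_cmp[of g "Arrow B Q p"] val_cmp[of h "Arrow B Q p"] by auto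
    ultimately have "val g = val h" by auto
    then show "g = h" using a by (intro arrow_eqI) auto
  next
    fix g assume a: "arr g \<and> src g = tgt (Arrow A B f) \<and> g \<bullet> Arrow A B f = zer (src (Arrow A B f)) (tgt g)"
    then have "val g \<cdot> f = Zero C A (tgt g)" using raw by simp
    moreover have "val g \<in> Hom C B (tgt g)" using a by (auto intro!: val_Hom)
    ultimately obtain h where h: "h \<in> Hom C Q (tgt g)" "h \<cdot> p = val g" using u a by (metis tgt_in_Obj)
    have "Arrow Q (tgt g) h \<bullet> Arrow B Q p = g"
      using a h K assms Arrow_val[of g B "tgt g"] by (simp add: cmp_Arrow)
    then show "\<exists>h. isar h (tgt (Arrow B Q p)) (tgt g) \<and> h \<bullet> Arrow B Q p = g"
      using a h K by (intro exI[of _ "Arrow Q (tgt g) h"]) simp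
  qed (use K assms z in simp_all)
qed

lemma kernD:
  assumes "kern i f"
  shows "mono i" "arr i" "arr f" "src f = tgt i" "f \<bullet> i = zer (src i) (tgt f)"
  using assms unfolding kern_def mono_def by blast+

lemma kern_lift:
  assumes "kern i f" "arr g" "tgt g = tgt i" "f \<bullet> g = zer (src g) (tgt f)"
  obtains h where "arr h" "src h = src g" "tgt h = src i" "i \<bullet> h = g"
  using assms unfolding kern_def by metis

lemma ckerD:
  assumes "cker f p"
  shows "epi p" "arr p" "arr f" "src p = tgt f" "p \<bullet> f = zer (src f) (tgt p)"
  using assms unfolding cker_def epi_def by blast+

lemma cker_desc:
  assumes "cker f p" "arr g" "src g = tgt f" "g \<bullet> f = zer (src f) (tgt g)"
  obtains h where "arr h" "src h = tgt p" "tgt h = tgt g" "h \<bullet> p = g"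
  using assms unfolding cker_def by metis

lemma isom_idn: "X \<in> Obj C \<Longrightarrow> isom (idn X)"
  unfolding isom_def by (auto intro!: exI[of _ "idn X"])

lemma isomI: "\<lbrakk>isar a X Y; isar b Y X; b \<bullet> a = idn X; a \<bullet> b = idn Y\<rbrakk> \<Longrightarrow> isom a"
  unfolding isom_def by auto

lemma kern_unique_iso:
  assumes "kern i f" "kern j f"
  obtains a where "isom a" "src a = src i" "tgt a = src j" "j \<bullet> a = i"
proof -
  note [simp] = kernD[OF assms(1)] kernD(2,5)[OF assms(2)]
  have [simp]: "tgt j = tgt i" using kernD(4)[OF assms(1)] kernD(4)[OF assms(2)] by simp
  obtain a where a: "arr a" "src a = src i" "tgt a = src j" "j \<bullet> a = i"
    by (rule kern_lift[OF assms(2), of i]) simp_all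
  obtain b where b: "arr b" "src b = src j" "tgt b = src i" "i \<bullet> b = j"
    by (rule kern_lift[OF assms(1), of j]) simp_all
  have "b \<bullet> a = idn (src i)"
    by (rule monoD[OF kernD(1)[OF assms(1)]]) (use a b in \<open>simp_all add: b(4)[THEN cmp_reassoc]\<close>)
  moreover have "a \<bullet> b = idn (src j)"
    by (rule monoD[OF kernD(1)[OF assms(2)]]) (use a b in \<open>simp_all add: a(4)[THEN cmp_reassoc]\<close>)
  ultimately have "isom a" using a b by (intro isomI) auto
  then show ?thesis using that a by blast
qed

end

subsection \<open>Exact categories\<close>

context exact_category
begin

definition cnf :: "('a, 'b) arrow \<Rightarrow> ('a, 'b) arrow \<Rightarrow> bool" where
  "cnf i p \<longleftrightarrow> arr i \<and> arr p \<and> src p = tgt i \<and> Conf C (src i) (val i) (tgt i) (val p) (tgt p)"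

definition aepi :: "('a, 'b) arrow \<Rightarrow> bool" where
  "aepi p \<longleftrightarrow> (\<exists>i. cnf i p)"

definition amono :: "('a, 'b) arrow \<Rightarrow> bool" where
  "amono i \<longleftrightarrow> (\<exists>p. cnf i p)"

lemma Conf_homs:
  assumes "Conf C A i B p Z"
  shows "A \<in> Obj C" "B \<in> Obj C" "Z \<in> Obj C" "i \<in> Hom C A B" "p \<in> Hom C B Z"
  using conf_objects[OF assms] conf_kernel[OF assms] conf_cokernel[OF assms]
  by (auto simp: is_kernel_def is_cokernel_def)

lemma Conf_iff_cnf: "Conf C A i B p Z \<longleftrightarrow> cnf (Arrow A B i) (Arrow B Z p)"
  using Conf_homs[of A i B p Z] by (auto simp: cnf_def)

lemma cnf_types: "cnf i p \<Longrightarrow> arr i \<and> arr p \<and> src p = tgt i"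
  by (simp add: cnf_def)

lemma cnf_kern:
  assumes "cnf i p" shows "kern i p"
proof -
  have c: "Conf C (src i) (val i) (tgt i) (val p) (tgt p)" and [simp]: "arr i" "arr p" "src p = tgt i"
    using assms by (auto simp: cnf_def)
  show ?thesis
    using is_kernel_iff[of "tgt i" "tgt p" "val p" "src i" "val i"] conf_kernel[OF c] Conf_homs[OF c]
      Arrow_val[of p "tgt i" "tgt p"] by simp
qed

lemma cnf_cker:
  assumes "cnf i p" shows "cker i p"
proof -
  have c: "Conf C (src i) (val i) (tgt i) (val p) (tgt p)" and [simp]: "arr i" "arr p" "src p = tgt i"
    using assms by (auto simp: cnf_def)
  show ?thesis
    using is_cokernel_imp_cker[OF _ _ _ conf_cokernel[OF c]] Conf_homs[OF c]
      Arrow_val[of p "tgt i" "tgt p"] by simp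
qed

lemma cnf_iso:
  assumes "cnf i p" "isom a" "isom b" "isom c" "arr i'" "arr p'" "src p' = tgt i'"
    "src a = src i" "src b = tgt i" "src c = tgt p" "tgt a = src i'" "tgt b = tgt i'" "tgt c = tgt p'"
    "b \<bullet> i = i' \<bullet> a" "c \<bullet> p = p' \<bullet> b"
  shows "cnf i' p'"
proof -
  have t: "arr i" "arr p" "src p = tgt i" "Conf C (src i) (val i) (tgt i) (val p) (tgt p)"
    using assms(1) by (auto simp: cnf_def)
  have ar: "arr a" "arr b" "arr c" using assms(2-4) by (auto simp: isom_def)
  have i: "is_iso C (src i) (src i') (val a)" "is_iso C (tgt i) (tgt i') (val b)" "is_iso C (tgt p) (tgt p') (val c)"
    using assms(2-6,8-13) ar t(1,2) Arrow_val[of a "src i" "src i'"] Arrow_val[of b "tgt i" "tgt i'"]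
      Arrow_val[of c "tgt p" "tgt p'"]
    by (simp_all add: is_iso_iff)
  have "val b \<cdot> val i = val i' \<cdot> val a"
    using val_cmp[of b i] val_cmp[of i' a] assms ar t by simp
  moreover have "val c \<cdot> val p = val p' \<cdot> val b"
    using val_cmp[of c p] val_cmp[of p' b] assms ar t by simp
  ultimately have "Conf C (src i') (val i') (tgt i') (val p') (tgt p')"
    using conf_iso[OF t(4) _ _ _ _ _ i] assms(5-7) val_Hom[of i' "src i'" "tgt i'"] val_Hom[of p' "tgt i'" "tgt p'"]
    by simp
  then show ?thesis using assms(5-7) by (simp add: cnf_def)
qed

lemma aepi_arr: "aepi p \<Longrightarrow> arr p" and amono_arr: "amono i \<Longrightarrow> arr i"
  by (auto simp: aepi_def amono_def cnf_def)

lemma adm_epi_iff: "adm_epi C B Z p \<longleftrightarrow> aepi (Arrow B Z p)"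
proof
  assume "aepi (Arrow B Z p)"
  then obtain i where "cnf i (Arrow B Z p)" by (auto simp: aepi_def)
  then show "adm_epi C B Z p" unfolding adm_epi_def cnf_def by auto
qed (auto simp: adm_epi_def aepi_def Conf_iff_cnf)

lemma adm_mono_iff: "adm_mono C A B i \<longleftrightarrow> amono (Arrow A B i)"
proof
  assume "amono (Arrow A B i)"
  then obtain p where "cnf (Arrow A B i) p" by (auto simp: amono_def)
  then show "adm_mono C A B i" unfolding adm_mono_def cnf_def by auto
qed (auto simp: adm_mono_def amono_def Conf_iff_cnf)

lemma aepi_idn: "A \<in> Obj C \<Longrightarrow> aepi (idn A)" and amono_idn: "A \<in> Obj C \<Longrightarrow> amono (idn A)"
  using ide_adm_epi ide_adm_mono by (simp_all add: idn_eq_Arrow adm_epi_iff adm_mono_iff)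

lemma aepi_cmp:
  assumes "aepi f" "aepi g" "src g = tgt f" shows "aepi (g \<bullet> f)"
proof -
  note [simp] = aepi_arr[OF assms(1)] aepi_arr[OF assms(2)] assms(3)
  have "adm_epi C (src f) (tgt f) (val f)" "adm_epi C (tgt f) (tgt g) (val g)"
    using assms(1,2) Arrow_val[of g "tgt f" "tgt g"] by (simp_all add: adm_epi_iff)
  then have "adm_epi C (src f) (tgt g) (val g \<cdot> val f)" by (rule adm_epi_comp)
  then show ?thesis by (simp add: adm_epi_iff cmp_def)
qed

lemma aepi_isom:
  assumes "isom a" shows "aepi a"
proof -
  have [simp]: "arr a" using assms by (simp add: isom_def)
  obtain k where k: "cnf k (idn (src a))" using aepi_idn[of "src a"] by (auto simp: aepi_def)
  have kt: "arr k" "tgt k = src a" using cnf_types[OF k] by simp_all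
  have "cnf k a"
    by (rule cnf_iso[OF k isom_idn[of "src k"] isom_idn[of "src a"] assms]) (use kt in simp_all)
  then show ?thesis by (auto simp: aepi_def)
qed

lemma aepi_pullback:
  assumes "aepi p" "arr f" "tgt f = tgt p"
  obtains f' p' where "arr f'" "aepi p'" "src f' = src p'" "tgt f' = src p" "tgt p' = src f" "p \<bullet> f' = f \<bullet> p'"
    "\<And>u v. \<lbrakk>arr u; arr v; src u = src v; tgt u = src p; tgt v = src f; p \<bullet> u = f \<bullet> v\<rbrakk>
       \<Longrightarrow> \<exists>h. isar h (src u) (src p') \<and> f' \<bullet> h = u \<and> p' \<bullet> h = v"
    "\<And>h h'. \<lbrakk>arr h; arr h'; src h = src h'; tgt h = src p'; tgt h' = src p'; f' \<bullet> h = f' \<bullet> h'; p' \<bullet> h = p' \<bullet> h'\<rbrakk> \<Longrightarrow> h = h'"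
proof -
  note [simp] = aepi_arr[OF assms(1)] assms(2,3)
  have "adm_epi C (src p) (tgt p) (val p)" using assms(1) by (simp add: adm_epi_iff)
  moreover have "val f \<in> Hom C (src f) (tgt p)" using val_Hom[of f "src f" "tgt p"] by simp
  ultimately obtain S g q where pb: "is_pullback C (tgt p) (src p) (src f) (val p) (val f) S g q"
    and q: "adm_epi C S (src f) q" using adm_epi_pullback by (metis src_in_Obj assms(2))
  have h: "S \<in> Obj C" "g \<in> Hom C S (src p)" "q \<in> Hom C S (src f)" "val p \<cdot> g = val f \<cdot> q"
    and u: "\<And>T u v. \<lbrakk>T \<in> Obj C; u \<in> Hom C T (src p); v \<in> Hom C T (src f); val p \<cdot> u = val f \<cdot> v\<rbrakk>
         \<Longrightarrow> \<exists>!h. h \<in> Hom C T S \<and> g \<cdot> h = u \<and> q \<cdot> h = v"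
    using pb by (auto simp: is_pullback_def)
  let ?g = "Arrow S (src p) g" and ?q = "Arrow S (src f) q"
  have a: "arr ?g" "arr ?q" using h by simp_all
  have eq: "p \<bullet> ?g = f \<bullet> ?q"
    using h a by (simp add: cmp_def)
  have ex: "\<exists>h. isar h (src u) (src ?q) \<and> ?g \<bullet> h = u \<and> ?q \<bullet> h = v"
    if t: "arr u" "arr v" "src u = src v" "tgt u = src p" "tgt v = src f" "p \<bullet> u = f \<bullet> v" for u v
  proof -
    have "val p \<cdot> val u = val f \<cdot> val v" using val_cmp[of p u] val_cmp[of f v] t by simp
    then obtain x where x: "x \<in> Hom C (src u) S" "g \<cdot> x = val u" "q \<cdot> x = val v"
      using u[of "src u" "val u" "val v"] t(1-5) val_Hom[of u "src u" "src p"] val_Hom[of v "src u" "src f"] by auto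
    have "?g \<bullet> Arrow (src u) S x = u" "?q \<bullet> Arrow (src u) S x = v"
      using x t h Arrow_val[of u "src v" "src p"] Arrow_val[of v "src v" "src f"] by (simp_all add: cmp_Arrow)
    then show ?thesis using x t h by (intro exI[of _ "Arrow (src u) S x"]) simp
  qed
  have un: "x = x'"
    if t: "arr x" "arr x'" "src x = src x'" "tgt x = src ?q" "tgt x' = src ?q" "?g \<bullet> x = ?g \<bullet> x'" "?q \<bullet> x = ?q \<bullet> x'" for x x'
  proof -
    let ?u = "?g \<bullet> x" and ?v = "?q \<bullet> x"
    have "p \<bullet> ?u = f \<bullet> ?v" using eq by (simp flip: cmp_assoc)
    then have "val p \<cdot> val ?u = val f \<cdot> val ?v" using val_cmp[of p ?u] val_cmp[of f ?v] t a by simp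
    then have ex1: "\<exists>!h. h \<in> Hom C (src x) S \<and> g \<cdot> h = val ?u \<and> q \<cdot> h = val ?v"
      using u[of "src x" "val ?u" "val ?v"] t(1,4) h(1-3) val_Hom[of ?u "src x" "src p"] val_Hom[of ?v "src x" "src f"] by simp
    have "val x \<in> Hom C (src x) S" "val x' \<in> Hom C (src x) S" using t val_Hom[of x "src x" S] val_Hom[of x' "src x" S] by simp_all
    moreover have "g \<cdot> val x = val ?u" "q \<cdot> val x = val ?v" using t h val_cmp[of ?g x] val_cmp[of ?q x] by simp_all
    moreover have "g \<cdot> val x' = val ?u" "q \<cdot> val x' = val ?v" using t h val_cmp[of ?g x'] val_cmp[of ?q x'] by simp_all
    ultimately have "val x = val x'" using ex1 by blast
    then show ?thesis using t by (intro arrow_eqI) auto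
  qed
  show ?thesis
    by (rule that[of ?g ?q, OF _ _ _ _ _ eq ex un]) (use a q in \<open>simp_all add: adm_epi_iff\<close>)
qed

lemma amono_pushout:
  assumes "amono i" "arr f" "src f = src i"
  obtains f' i' where "arr f'" "amono i'" "tgt f' = tgt i'" "src f' = tgt i" "src i' = tgt f" "f' \<bullet> i = i' \<bullet> f"
    "\<And>u v. \<lbrakk>arr u; arr v; tgt u = tgt v; src u = tgt i; src v = tgt f; u \<bullet> i = v \<bullet> f\<rbrakk>
       \<Longrightarrow> \<exists>h. isar h (tgt i') (tgt u) \<and> h \<bullet> f' = u \<and> h \<bullet> i' = v"
    "\<And>h h'. \<lbrakk>arr h; arr h'; tgt h = tgt h'; src h = tgt i'; src h' = tgt i'; h \<bullet> f' = h' \<bullet> f'; h \<bullet> i' = h' \<bullet> i'\<rbrakk> \<Longrightarrow> h = h'"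
proof -
  note [simp] = amono_arr[OF assms(1)] assms(2,3)
  have "adm_mono C (src i) (tgt i) (val i)" using assms(1) by (simp add: adm_mono_iff)
  moreover have "val f \<in> Hom C (src i) (tgt f)" using val_Hom[of f "src i" "tgt f"] by simp
  ultimately obtain S g q where pb: "is_pushout C (src i) (tgt i) (tgt f) (val i) (val f) S g q"
    and q: "adm_mono C (tgt f) S q" using adm_mono_pushout by (metis tgt_in_Obj assms(2))
  have h: "S \<in> Obj C" "g \<in> Hom C (tgt i) S" "q \<in> Hom C (tgt f) S" "g \<cdot> val i = q \<cdot> val f"
    and u: "\<And>T u v. \<lbrakk>T \<in> Obj C; u \<in> Hom C (tgt i) T; v \<in> Hom C (tgt f) T; u \<cdot> val i = v \<cdot> val f\<rbrakk>
         \<Longrightarrow> \<exists>!h. h \<in> Hom C S T \<and> h \<cdot> g = u \<and> h \<cdot> q = v"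
    using pb by (auto simp: is_pushout_def)
  let ?g = "Arrow (tgt i) S g" and ?q = "Arrow (tgt f) S q"
  have a: "arr ?g" "arr ?q" using h by simp_all
  have eq: "?g \<bullet> i = ?q \<bullet> f"
    using h a by (simp add: cmp_def)
  have ex: "\<exists>h. isar h (tgt ?q) (tgt u) \<and> h \<bullet> ?g = u \<and> h \<bullet> ?q = v"
    if t: "arr u" "arr v" "tgt u = tgt v" "src u = tgt i" "src v = tgt f" "u \<bullet> i = v \<bullet> f" for u v
  proof -
    have "val u \<cdot> val i = val v \<cdot> val f" using val_cmp[of u i] val_cmp[of v f] t by simp
    then obtain x where x: "x \<in> Hom C S (tgt u)" "x \<cdot> g = val u" "x \<cdot> q = val v"
      using u[of "tgt u" "val u" "val v"] t(1-5) val_Hom[of u "tgt i" "tgt u"] val_Hom[of v "tgt f" "tgt u"] by auto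
    have "Arrow S (tgt u) x \<bullet> ?g = u" "Arrow S (tgt u) x \<bullet> ?q = v"
      using x t h Arrow_val[of u "tgt i" "tgt v"] Arrow_val[of v "tgt f" "tgt v"] by (simp_all add: cmp_Arrow)
    then show ?thesis using x t h by (intro exI[of _ "Arrow S (tgt u) x"]) simp
  qed
  have un: "x = x'"
    if t: "arr x" "arr x'" "tgt x = tgt x'" "src x = tgt ?q" "src x' = tgt ?q" "x \<bullet> ?g = x' \<bullet> ?g" "x \<bullet> ?q = x' \<bullet> ?q" for x x'
  proof -
    let ?u = "x \<bullet> ?g" and ?v = "x \<bullet> ?q"
    have "?u \<bullet> i = ?v \<bullet> f" using eq by simp
    then have "val ?u \<cdot> val i = val ?v \<cdot> val f" using val_cmp[of ?u i] val_cmp[of ?v f] t a by simp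
    then have ex1: "\<exists>!h. h \<in> Hom C S (tgt x) \<and> h \<cdot> g = val ?u \<and> h \<cdot> q = val ?v"
      using u[of "tgt x" "val ?u" "val ?v"] t(1,4) h(1-3) val_Hom[of ?u "tgt i" "tgt x"] val_Hom[of ?v "tgt f" "tgt x"] by simp
    have "val x \<in> Hom C S (tgt x)" "val x' \<in> Hom C S (tgt x)" using t val_Hom[of x S "tgt x"] val_Hom[of x' S "tgt x"] by simp_all
    moreover have "val x \<cdot> g = val ?u" "val x \<cdot> q = val ?v" using t h val_cmp[of x ?g] val_cmp[of x ?q] by simp_all
    moreover have "val x' \<cdot> g = val ?u" "val x' \<cdot> q = val ?v" using t h val_cmp[of x' ?g] val_cmp[of x' ?q] by simp_all
    ultimately have "val x = val x'" using ex1 by blast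
    then show ?thesis using t by (intro arrow_eqI) auto
  qed
  show ?thesis
    by (rule that[of ?g ?q, OF _ _ _ _ _ eq ex un]) (use a q in \<open>simp_all add: adm_mono_iff\<close>)
qed

text \<open>\<open>pr2\<close> is the pullback of the admissible epic from \<open>B\<close> to a
  zero object along the map from \<open>Z\<close> to it: such a pullback is a product, hence
  isomorphic to \<open>Bip B Z\<close>. The zero object arises as the target of the cokernel
  \<open>q\<close> of the identity of \<open>B\<close>, which is what makes the map to it
  admissible.\<close>

lemma aepi_pr2:
  assumes o [simp]: "B \<in> Obj C" "Z \<in> Obj C"
  shows "aepi (pr2 B Z)"
proof -
  obtain q where q: "cnf (idn B) q" using amono_idn[of B] by (auto simp: amono_def)
  have [simp]: "arr q" "src q = B" using cnf_types[OF q] by simp_all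
  note ck = cnf_cker[OF q]
  have q0: "q = zer B (tgt q)" using ckerD(5)[OF ck] by simp
  have id0: "idn (tgt q) = zer (tgt q) (tgt q)"
    by (rule epiD[OF ckerD(1)[OF ck]]) (use q0 in simp_all)
  have all0: "f = zer (src f) (tgt q)" if "arr f" "tgt f = tgt q" for f
  proof -
    have "f = idn (tgt q) \<bullet> f" using that by simp
    also have "\<dots> = zer (src f) (tgt q)" unfolding id0 using that by simp
    finally show ?thesis .
  qed
  obtain f' p' where pb: "arr f'" "aepi p'" "src f' = src p'" "tgt f' = B" "tgt p' = Z"
    and ex: "\<And>u v. \<lbrakk>arr u; arr v; src u = src v; tgt u = B; tgt v = Z\<rbrakk>
       \<Longrightarrow> \<exists>h. isar h (src u) (src p') \<and> f' \<bullet> h = u \<and> p' \<bullet> h = v"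
    and un: "\<And>h h'. \<lbrakk>arr h; arr h'; src h = src h'; tgt h = src p'; tgt h' = src p'; f' \<bullet> h = f' \<bullet> h'; p' \<bullet> h = p' \<bullet> h'\<rbrakk> \<Longrightarrow> h = h'"
  proof (rule aepi_pullback[of q "zer Z (tgt q)"])
    fix f' p' assume a: "arr f'" "aepi p'" "src f' = src p'" "tgt f' = src q" "tgt p' = src (zer Z (tgt q))"
      "\<And>u v. \<lbrakk>arr u; arr v; src u = src v; tgt u = src q; tgt v = src (zer Z (tgt q)); q \<bullet> u = zer Z (tgt q) \<bullet> v\<rbrakk>
       \<Longrightarrow> \<exists>h. isar h (src u) (src p') \<and> f' \<bullet> h = u \<and> p' \<bullet> h = v"
      "\<And>h h'. \<lbrakk>arr h; arr h'; src h = src h'; tgt h = src p'; tgt h' = src p'; f' \<bullet> h = f' \<bullet> h'; p' \<bullet> h = p' \<bullet> h'\<rbrakk> \<Longrightarrow> h = h'"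
    show thesis
    proof (rule that[of f' p', OF _ _ _ _ _ _ a(7)])
      fix u v assume t: "arr u" "arr v" "src u = src v" "tgt u = B" "tgt v = Z"
      have "q \<bullet> u = zer Z (tgt q) \<bullet> v" using t all0[of "q \<bullet> u"] by simp
      then show "\<exists>h. isar h (src u) (src p') \<and> f' \<bullet> h = u \<and> p' \<bullet> h = v" using a(6)[of u v] t by simp
    qed (use a in simp_all)
  qed (use q in \<open>auto simp: aepi_def\<close>)
  note [simp] = pb(1,3,4,5) aepi_arr[OF pb(2)]
  obtain h where h: "isar h (Bip B Z) (src p')" "f' \<bullet> h = pr1 B Z" "p' \<bullet> h = pr2 B Z"
    using ex[of "pr1 B Z" "pr2 B Z"] by auto
  have "pair f' p' \<bullet> h = idn (Bip B Z)" using h by simp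
  moreover have "h \<bullet> pair f' p' = idn (src p')"
    by (rule un) (use h in \<open>simp_all add: h(2,3)[THEN cmp_reassoc]\<close>)
  ultimately have "isom h" using h by (intro isomI[of h "Bip B Z" "src p'" "pair f' p'"]) auto
  then have "aepi (p' \<bullet> h)" using h pb by (intro aepi_cmp[OF aepi_isom pb(2)]) auto
  then show ?thesis using h by simp
qed

text \<open>The sum of the identity of \<open>B\<close> and \<open>q\<close> is, up to isomorphism,
  the pullback of \<open>q\<close> along the projection from \<open>B \<oplus> Z\<close> to
  \<open>Z\<close>.\<close>

lemma aepi_pair_pr:
  assumes q: "aepi q" and o [simp]: "B \<in> Obj C"
  shows "aepi (pair (pr1 B (src q)) (q \<bullet> pr2 B (src q)))"
proof -
  note [simp] = aepi_arr[OF q]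
  define P Z where "P = src q" and "Z = tgt q"
  have [simp]: "P \<in> Obj C" "Z \<in> Obj C" "src q = P" "tgt q = Z" by (simp_all add: P_def Z_def)
  obtain f' p' where pb: "arr f'" "aepi p'" "src f' = src p'" "tgt f' = P" "tgt p' = Bip B Z" "q \<bullet> f' = pr2 B Z \<bullet> p'"
    and ex: "\<And>u v. \<lbrakk>arr u; arr v; src u = src v; tgt u = P; tgt v = Bip B Z; q \<bullet> u = pr2 B Z \<bullet> v\<rbrakk>
       \<Longrightarrow> \<exists>h. isar h (src u) (src p') \<and> f' \<bullet> h = u \<and> p' \<bullet> h = v"
    and un: "\<And>h h'. \<lbrakk>arr h; arr h'; src h = src h'; tgt h = src p'; tgt h' = src p'; f' \<bullet> h = f' \<bullet> h'; p' \<bullet> h = p' \<bullet> h'\<rbrakk> \<Longrightarrow> h = h'"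
    by (rule aepi_pullback[of q "pr2 B Z"]) (use q in simp_all)
  note [simp] = pb(1,3,4,5) aepi_arr[OF pb(2)]
  let ?m = "pair (pr1 B P) (q \<bullet> pr2 B P)"
  have "\<exists>h. isar h (src (pr2 B P)) (src p') \<and> f' \<bullet> h = pr2 B P \<and> p' \<bullet> h = ?m"
    by (rule ex) simp_all
  then obtain h where h: "isar h (Bip B P) (src p')" "f' \<bullet> h = pr2 B P" "p' \<bullet> h = ?m"
    by (elim exE conjE) simp
  let ?k = "pair (pr1 B Z \<bullet> p') f'"
  have "?k \<bullet> h = idn (Bip B P)" using h by simp
  moreover have "h \<bullet> ?k = idn (src p')"
  proof (rule un)
    show "p' \<bullet> (h \<bullet> ?k) = p' \<bullet> idn (src p')"
      using h(1) pb(6) pair_eta[of p' B Z] by (simp add: h(2,3)[THEN cmp_reassoc])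
  qed (use h in \<open>simp_all add: h(2)[THEN cmp_reassoc]\<close>)
  ultimately have "isom h" using h by (intro isomI[of h "Bip B P" "src p'" ?k]) auto
  then have "aepi (p' \<bullet> h)" using h pb by (intro aepi_cmp[OF aepi_isom pb(2)]) auto
  then show ?thesis using h by simp
qed

text \<open>The morphism \<open>(p, q)\<close> is the sum of an identity and \<open>q\<close>,
  followed by the automorphism \<open>(b, z) \<mapsto> (b, p b + z)\<close> and by the second
  projection; all three are admissible epics.\<close>

lemma aepi_cop:
  assumes q: "aepi q" and p: "arr p" "tgt p = tgt q"
  shows "aepi (cop p q)"
proof -
  note [simp] = aepi_arr[OF q] p
  let ?B = "src p" and ?Z = "tgt q" and ?P = "src q"
  let ?a = "pair (pr1 ?B ?Z) (p \<bullet> pr1 ?B ?Z \<boxplus> pr2 ?B ?Z)"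
  let ?b = "pair (pr1 ?B ?Z) (\<boxminus> (p \<bullet> pr1 ?B ?Z) \<boxplus> pr2 ?B ?Z)"
  let ?m = "pair (pr1 ?B ?P) (q \<bullet> pr2 ?B ?P)"
  have "isom ?a"
    by (rule isomI[of ?a "Bip ?B ?Z" "Bip ?B ?Z" ?b]) simp_all
  then have "aepi (pr2 ?B ?Z \<bullet> ?a \<bullet> ?m)"
    by (intro aepi_cmp aepi_isom aepi_pr2 aepi_pair_pr q) simp_all
  moreover have "pr2 ?B ?Z \<bullet> ?a \<bullet> ?m = cop p q" by (simp add: cop_def)
  ultimately show ?thesis by simp
qed

text \<open>Quillen's ``obscure'' axiom, which is derivable from the other axioms. Existence of the kernel has to be
  assumed.\<close>

lemma cnf_obscure:
  assumes k: "kern k p" and s: "arr s" "tgt s = src p" and ps: "aepi (p \<bullet> s)"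
  shows "cnf k p"
proof -
  define K B Z P where "K = src k" and "B = tgt k" and "Z = tgt p" and "P = src s"
  have [simp]: "arr k" "src k = K" "tgt k = B" "arr p" "src p = B" "tgt p = Z" "p \<bullet> k = zer K Z"
    "arr s" "src s = P" "tgt s = B"
    using kernD[OF k] s by (simp_all add: K_def B_def Z_def P_def)
  have [simp]: "K \<in> Obj C" "B \<in> Obj C" "Z \<in> Obj C" "P \<in> Obj C"
    using src_in_Obj[of k] tgt_in_Obj[of k] tgt_in_Obj[of p] src_in_Obj[of s] by simp_all
  \<comment> \<open>The automorphism \<open>(b, y) \<mapsto> (b - s y, y)\<close> of
    \<open>B \<oplus> P\<close> turns \<open>(p, p s)\<close> into \<open>(p, 0)\<close>, so that
    \<open>p \<bullet> pr1 B P\<close> is an admissible epic.\<close>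
  let ?a = "pair (pr1 B P \<boxplus> \<boxminus> (s \<bullet> pr2 B P)) (pr2 B P)"
  let ?b = "pair (pr1 B P \<boxplus> s \<bullet> pr2 B P) (pr2 B P)"
  have "isom ?a"
    by (rule isomI[of ?a "Bip B P" "Bip B P" ?b]) (simp_all add: canc)
  then have "aepi (cop p (p \<bullet> s) \<bullet> ?a)"
    by (intro aepi_cmp aepi_isom aepi_cop ps) simp_all
  moreover have "cop p (p \<bullet> s) \<bullet> ?a = p \<bullet> pr1 B P" by (simp add: canc)
  ultimately have e: "aepi (p \<bullet> pr1 B P)" by simp
  let ?k = "pair (k \<bullet> pr1 K P) (pr2 K P)"
  have kk: "kern ?k (p \<bullet> pr1 B P)"
    unfolding kern_def mono_def
  proof (intro conjI allI impI)
    fix g h assume a: "arr g \<and> arr h \<and> src g = src h \<and> tgt g = src ?k \<and> tgt h = src ?k \<and> ?k \<bullet> g = ?k \<bullet> h"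
    then have a': "arr g" "arr h" "src g = src h" "tgt g = Bip K P" "tgt h = Bip K P" by auto
    have e: "pair (k \<bullet> pr1 K P \<bullet> g) (pr2 K P \<bullet> g) = pair (k \<bullet> pr1 K P \<bullet> h) (pr2 K P \<bullet> h)"
      using a by simp
    then have e2: "k \<bullet> pr1 K P \<bullet> g = k \<bullet> pr1 K P \<bullet> h" "pr2 K P \<bullet> g = pr2 K P \<bullet> h"
      using a' by (simp_all add: pair_eq_iff)
    have "pr1 K P \<bullet> g = pr1 K P \<bullet> h"
      by (rule monoD[OF kernD(1)[OF k] e2(1)]) (use a' in simp_all)
    then show "g = h"
      using e2(2) by (rule bip_ext_pr) (use a' in simp_all)
  next
    fix g assume a: "arr g \<and> tgt g = src (p \<bullet> pr1 B P) \<and> (p \<bullet> pr1 B P) \<bullet> g = zer (src g) (tgt (p \<bullet> pr1 B P))"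
    then have a': "arr g" "tgt g = Bip B P" "p \<bullet> pr1 B P \<bullet> g = zer (src g) Z" by auto
    obtain h where h: "arr h" "src h = src g" "tgt h = K" "k \<bullet> h = pr1 B P \<bullet> g"
      by (rule kern_lift[OF k, of "pr1 B P \<bullet> g"]) (use a' in simp_all)
    have "?k \<bullet> pair h (pr2 B P \<bullet> g) = g"
      using a' h pair_eta[of g B P] by simp
    then show "\<exists>h. isar h (src g) (src ?k) \<and> ?k \<bullet> h = g"
      using a' h by (intro exI[of _ "pair h (pr2 B P \<bullet> g)"]) simp
  qed (simp_all add: kernD(5)[OF k, THEN cmp_reassoc])
  obtain k0 where k0: "cnf k0 (p \<bullet> pr1 B P)" using e by (auto simp: aepi_def)
  obtain a where a: "isom a" "src a = src k0" "tgt a = src ?k" "?k \<bullet> a = k0"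
    by (rule kern_unique_iso[OF cnf_kern[OF k0] kk])
  have t0: "arr k0" "tgt k0 = Bip B P" using cnf_types[OF k0] by simp_all
  have c1: "cnf ?k (p \<bullet> pr1 B P)"
    by (rule cnf_iso[OF k0 a(1) isom_idn[of "Bip B P"] isom_idn[of Z]]) (use a(2-4) t0 in simp_all)
  \<comment> \<open>Pushing the sequence out along \<open>pr1 K P\<close> divides the summand
    \<open>P\<close> out of \<open>B \<oplus> P\<close> again. The pushout object turns out to be
    isomorphic to \<open>B\<close>, with \<open>i'\<close> corresponding to \<open>k\<close>, so
    \<open>k\<close> is an admissible monic.\<close>
  obtain f' i' where po: "arr f'" "amono i'" "tgt f' = tgt i'" "src f' = Bip B P" "src i' = K" "f' \<bullet> ?k = i' \<bullet> pr1 K P"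
    and ex: "\<And>u v. \<lbrakk>arr u; arr v; tgt u = tgt v; src u = Bip B P; src v = K; u \<bullet> ?k = v \<bullet> pr1 K P\<rbrakk>
       \<Longrightarrow> \<exists>h. isar h (tgt i') (tgt u) \<and> h \<bullet> f' = u \<and> h \<bullet> i' = v"
    and un: "\<And>h h'. \<lbrakk>arr h; arr h'; tgt h = tgt h'; src h = tgt i'; src h' = tgt i'; h \<bullet> f' = h' \<bullet> f'; h \<bullet> i' = h' \<bullet> i'\<rbrakk> \<Longrightarrow> h = h'"
    by (rule amono_pushout[of ?k "pr1 K P"]) (use c1 in \<open>auto simp: amono_def\<close>)
  note [simp] = po(1,3,4,5) amono_arr[OF po(2)]
  have "\<exists>h. isar h (tgt i') (tgt (pr1 B P)) \<and> h \<bullet> f' = pr1 B P \<and> h \<bullet> i' = k"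
    by (rule ex) simp_all
  then obtain h where h: "isar h (tgt i') B" "h \<bullet> f' = pr1 B P" "h \<bullet> i' = k"
    by (elim exE conjE) simp
  have f2: "f' \<bullet> in2 B P = zer P (tgt i')"
  proof -
    have "f' \<bullet> in2 B P = f' \<bullet> (?k \<bullet> in2 K P)" by (simp add: pair_def)
    also have "\<dots> = zer P (tgt i')" using po(6)[THEN cmp_reassoc, of "in2 K P"] by simp
    finally show ?thesis .
  qed
  have f1: "f' \<bullet> in1 B P \<bullet> k = i'"
  proof -
    have "f' \<bullet> in1 B P \<bullet> k = f' \<bullet> (?k \<bullet> in1 K P)" by (simp add: pair_def)
    also have "\<dots> = i'" using po(6)[THEN cmp_reassoc, of "in1 K P"] by simp
    finally show ?thesis .
  qed
  have hi: "h \<bullet> (f' \<bullet> in1 B P) = idn B" using h by (simp add: h(2)[THEN cmp_reassoc])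
  have ih: "(f' \<bullet> in1 B P) \<bullet> h = idn (tgt i')"
  proof (rule un)
    show "((f' \<bullet> in1 B P) \<bullet> h) \<bullet> f' = idn (tgt i') \<bullet> f'"
      by (rule bip_ext[of _ _ B P]) (use h f2 in simp_all)
    show "((f' \<bullet> in1 B P) \<bullet> h) \<bullet> i' = idn (tgt i') \<bullet> i'"
      using h f1 by simp
  qed (use h in simp_all)
  have isoh: "isom h" using h hi ih by (intro isomI[of h "tgt i'" B "f' \<bullet> in1 B P"]) simp_all
  obtain c where c: "cnf i' c" using po(2) by (auto simp: amono_def)
  have [simp]: "arr c" "src c = tgt i'" using cnf_types[OF c] by simp_all
  define p' where "p' = c \<bullet> f' \<bullet> in1 B P"
  have [simp]: "arr p'" "src p' = B" "tgt p' = tgt c" by (simp_all add: p'_def)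
  have c2: "cnf k p'"
    by (rule cnf_iso[OF c isom_idn[of K] isoh isom_idn[of "tgt c"]]) (use h ih in \<open>simp_all add: p'_def\<close>)
  have ck: "cker k p'" and ck1: "cker ?k (p \<bullet> pr1 B P)" using c1 c2 cnf_cker by blast+
  have p'k [simp]: "p' \<bullet> k = zer K (tgt c)" using ckerD(5)[OF ck] by simp
  \<comment> \<open>It remains to identify \<open>p\<close> with the cokernel \<open>p'\<close> of
    \<open>k\<close>. On the one hand \<open>p\<close> annihilates \<open>k\<close> and factors
    through \<open>p'\<close>; on the other hand \<open>p' \<bullet> pr1 B P\<close> annihilates
    \<open>?k\<close> and factors through \<open>p \<bullet> pr1 B P\<close>. As \<open>p'\<close>
    and \<open>p \<bullet> pr1 B P\<close> are epic, the two factors are inverse to each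
    other.\<close>
  obtain e where e: "arr e" "src e = tgt c" "tgt e = Z" "e \<bullet> p' = p"
    by (rule cker_desc[OF ck, of p]) simp_all
  obtain e' where e': "arr e'" "src e' = Z" "tgt e' = tgt c" "e' \<bullet> (p \<bullet> pr1 B P) = p' \<bullet> pr1 B P"
    by (rule cker_desc[OF ck1, of "p' \<bullet> pr1 B P"]) (simp_all add: p'k[THEN cmp_reassoc])
  have e'p: "e' \<bullet> p = p'"
  proof -
    have "(e' \<bullet> (p \<bullet> pr1 B P)) \<bullet> in1 B P = (p' \<bullet> pr1 B P) \<bullet> in1 B P" by (simp only: e'(4))
    then show ?thesis using e'(1-3) by simp
  qed
  have "e \<bullet> e' = idn Z"
    by (rule epiD[OF ckerD(1)[OF ck1]]) (use e e' e'p in \<open>simp_all add: e(4)[THEN cmp_reassoc]\<close>)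
  moreover have "e' \<bullet> e = idn (tgt c)"
    by (rule epiD[OF ckerD(1)[OF ck]]) (use e e' e'p in simp_all)
  ultimately have "isom e" using e e' by (intro isomI[of e _ _ e']) auto
  then show ?thesis
    by (intro cnf_iso[OF c2 isom_idn[of K] isom_idn[of B], of e]) (use e in simp_all)
qed

end

subsection \<open>Exact categories with enough projectives and kernels\<close>

locale projective_exact_category = exact_category C for C :: "('o, 'm) excat" (structure) +
  assumes enough_proj: "enough_projectives C"
    and kernels: "has_kernels C"
begin

definition psurj :: "('o, 'm) arrow \<Rightarrow> bool" where
  "psurj p \<longleftrightarrow> arr p \<and> (\<forall>P \<in> Proj C. \<forall>y. isar y P (tgt p) \<longrightarrow> (\<exists>x. isar x P (src p) \<and> p \<bullet> x = y))"

lemma psurjD: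
  assumes "psurj p" "P \<in> Proj C" "isar y P (tgt p)"
  obtains x where "arr x" "src x = P" "tgt x = src p" "p \<bullet> x = y"
  using assms unfolding psurj_def by metis

lemma Proj_Obj [simp]: "P \<in> Proj C \<Longrightarrow> P \<in> Obj C"
  by (simp add: Proj_def)

lemma cnf_psurj:
  assumes "cnf i p" shows "psurj p"
proof -
  have t: "arr i" "arr p" "src p = tgt i" "Conf C (src i) (val i) (tgt i) (val p) (tgt p)"
    using assms by (auto simp: cnf_def)
  have "\<exists>x. isar x P (src p) \<and> p \<bullet> x = y" if P: "P \<in> Proj C" and y: "isar y P (tgt p)" for P y
  proof -
    have "(\<lambda>g. val p \<cdot> g) ` Hom C P (tgt i) = Hom C P (tgt p)"
      using P t(4) unfolding Proj_def by blast
    moreover have "val y \<in> Hom C P (tgt p)" using y val_Hom by blast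
    ultimately obtain g where g: "g \<in> Hom C P (tgt i)" "val p \<cdot> g = val y" by (metis image_iff)
    have "isar (Arrow P (tgt i) g) P (src p)" using g P t by simp
    moreover have "p \<bullet> Arrow P (tgt i) g = y"
      using g P t y Arrow_val[OF y] by (simp add: cmp_def)
    ultimately show ?thesis by blast
  qed
  then show ?thesis using t(2) by (auto simp: psurj_def)
qed

lemma kernel_exists:
  assumes "arr f"
  obtains i where "kern i f"
proof -
  obtain K i where "is_kernel C K i (src f) (val f) (tgt f)"
    using kernels assms val_in_Hom[of f] unfolding has_kernels_def by (metis src_in_Obj tgt_in_Obj)
  then have "kern (Arrow K (src f) i) f"
    using assms is_kernel_iff[of "src f" "tgt f" "val f" K i] val_in_Hom[of f] by simp
  then show ?thesis by (rule that)
qed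

lemma projective_cover:
  assumes "X \<in> Obj C"
  obtains q where "aepi q" "src q \<in> Proj C" "tgt q = X"
proof -
  obtain P p where "P \<in> Proj C" "adm_epi C P X p"
    using enough_proj assms unfolding enough_projectives_def by metis
  then show ?thesis using that[of "Arrow P X p"] by (simp add: adm_epi_iff)
qed

text \<open>A projective cover \<open>q\<close> of the target lifts along \<open>p\<close>. For the
  lift \<open>s\<close> the composite \<open>p \<bullet> s\<close> is an admissible epic, and the
  obscure axiom applies.\<close>

lemma cnf_iff: "cnf i p \<longleftrightarrow> kern i p \<and> psurj p"
proof
  assume a: "kern i p \<and> psurj p"
  then have [simp]: "arr p" by (simp add: psurj_def)
  obtain q where q: "aepi q" "src q \<in> Proj C" "tgt q = tgt p"
    using projective_cover[of "tgt p"] by auto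
  obtain s where "arr s" "src s = src q" "tgt s = src p" "p \<bullet> s = q"
    by (rule psurjD[OF conjunct2[OF a] q(2), of q]) (use q aepi_arr in auto)
  then show "cnf i p" using cnf_obscure[of i p s] a q by simp
qed (simp add: cnf_kern cnf_psurj)

lemma cnf_exists:
  assumes "psurj p"
  obtains i where "cnf i p"
proof -
  have "arr p" using assms by (simp add: psurj_def)
  then obtain i where "kern i p" by (rule kernel_exists)
  then show ?thesis using that[of i] assms by (simp add: cnf_iff)
qed

text \<open>\<open>Hom(P, -)\<close> is left exact for every object \<open>P\<close>, because
  \<open>i\<close> is a kernel of \<open>p\<close>; only surjectivity is a condition on
  \<open>P\<close>.\<close>

lemma Proj_iff:
  "P \<in> Proj C \<longleftrightarrow> P \<in> Obj C \<and> (\<forall>p y. psurj p \<and> isar y P (tgt p) \<longrightarrow> (\<exists>x. isar x P (src p) \<and> p \<bullet> x = y))"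
    (is "_ \<longleftrightarrow> ?R")
proof
  assume "P \<in> Proj C"
  then show ?R unfolding psurj_def by simp
next
  assume R: ?R
  then have [simp]: "P \<in> Obj C" by blast
  have "inj_on (\<lambda>f. i \<cdot> f) (Hom C P A) \<and>
     (\<lambda>f. i \<cdot> f) ` Hom C P A = kernel (HomG C P B) (HomG C P Z) (\<lambda>g. p \<cdot> g) \<and>
     (\<lambda>g. p \<cdot> g) ` Hom C P B = Hom C P Z" if c: "Conf C A i B p Z" for A i B p Z
  proof (intro conjI)
    note [simp] = Conf_homs[OF c]
    have ck: "cnf (Arrow A B i) (Arrow B Z p)" using c by (simp add: Conf_iff_cnf)
    have u: "\<exists>!h. h \<in> Hom C P A \<and> i \<cdot> h = g" if "g \<in> Hom C P B" "p \<cdot> g = Zero C P Z" for g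
      using conf_kernel[OF c] that by (auto simp: is_kernel_def)
    have z: "p \<cdot> (i \<cdot> f) = Zero C P Z" if f: "f \<in> Hom C P A" for f
    proof -
      have "Arrow B Z p \<bullet> Arrow A B i = zer A Z" using kernD(5)[OF cnf_kern[OF ck]] by simp
      then have "Arrow B Z p \<bullet> (Arrow A B i \<bullet> Arrow P A f) = zer P Z"
        using f by (simp add: cmp_reassoc)
      moreover have "i \<cdot> f \<in> Hom C P B" using f comp_closed[of P A B f i] by simp
      ultimately show ?thesis using f by (simp add: cmp_Arrow zer_eq_Arrow)
    qed
    have cl: "i \<cdot> f \<in> Hom C P B" if "f \<in> Hom C P A" for f
      using that comp_closed[of P A B f i] by simp
    show "inj_on (\<lambda>f. i \<cdot> f) (Hom C P A)"
    proof (rule inj_onI)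
      fix x y assume "x \<in> Hom C P A" "y \<in> Hom C P A" "i \<cdot> x = i \<cdot> y"
      then show "x = y" using u[of "i \<cdot> x"] z[of x] cl[of x] by metis
    qed
    show "(\<lambda>f. i \<cdot> f) ` Hom C P A = kernel (HomG C P B) (HomG C P Z) (\<lambda>g. p \<cdot> g)"
    proof
      show "(\<lambda>f. i \<cdot> f) ` Hom C P A \<subseteq> kernel (HomG C P B) (HomG C P Z) (\<lambda>g. p \<cdot> g)"
        using z cl by (auto simp: kernel_def)
      show "kernel (HomG C P B) (HomG C P Z) (\<lambda>g. p \<cdot> g) \<subseteq> (\<lambda>f. i \<cdot> f) ` Hom C P A"
      proof
        fix g assume "g \<in> kernel (HomG C P B) (HomG C P Z) (\<lambda>g. p \<cdot> g)"
        then have "g \<in> Hom C P B" "p \<cdot> g = Zero C P Z" by (auto simp: kernel_def)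
        from ex1_implies_ex[OF u[OF this]] obtain h where "h \<in> Hom C P A" "i \<cdot> h = g" by blast
        then show "g \<in> (\<lambda>f. i \<cdot> f) ` Hom C P A" by blast
      qed
    qed
    show "(\<lambda>g. p \<cdot> g) ` Hom C P B = Hom C P Z"
    proof
      show "(\<lambda>g. p \<cdot> g) ` Hom C P B \<subseteq> Hom C P Z" using comp_closed[of P B Z _ p] by auto
      show "Hom C P Z \<subseteq> (\<lambda>g. p \<cdot> g) ` Hom C P B"
      proof
        fix y assume y: "y \<in> Hom C P Z"
        have "\<exists>x. isar x P (src (Arrow B Z p)) \<and> Arrow B Z p \<bullet> x = Arrow P Z y"
          using conjunct2[OF R, rule_format, of "Arrow B Z p" "Arrow P Z y"] cnf_psurj[OF ck] y by simp
        then obtain x where x: "isar x P B" "Arrow B Z p \<bullet> x = Arrow P Z y" by auto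
        then have "p \<cdot> val x = y" using val_cmp[of "Arrow B Z p" x] by simp
        moreover have "val x \<in> Hom C P B" using x val_Hom by blast
        ultimately show "y \<in> (\<lambda>g. p \<cdot> g) ` Hom C P B" by blast
      qed
    qed
  qed
  then show "P \<in> Proj C" using conjunct1[OF R] unfolding Proj_def by blast
qed

lemma Proj_lift:
  assumes "P \<in> Proj C" "psurj p" "isar y P (tgt p)"
  obtains x where "arr x" "src x = P" "tgt x = src p" "p \<bullet> x = y"
  using assms psurjD by blast

lemma Proj_retract:
  assumes "P \<in> Proj C" "isar s X P" "isar r P X" "r \<bullet> s = idn X"
  shows "X \<in> Proj C"
  unfolding Proj_iff
proof (intro conjI allI impI)
  show "X \<in> Obj C" using assms by auto
  fix p y assume a: "psurj p \<and> isar y X (tgt p)"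
  obtain x where x: "arr x" "src x = P" "tgt x = src p" "p \<bullet> x = y \<bullet> r"
    by (rule Proj_lift[OF assms(1) conjunct1[OF a], of "y \<bullet> r"]) (use a assms in simp_all)
  have "arr p" using a by (simp add: psurj_def)
  then have "p \<bullet> x \<bullet> s = y" using x a assms by (simp add: x(4)[THEN cmp_reassoc])
  then show "\<exists>x. isar x X (src p) \<and> p \<bullet> x = y"
    using x assms by (intro exI[of _ "x \<bullet> s"]) simp
qed

lemma Proj_Bip:
  assumes "P \<in> Proj C" "Q \<in> Proj C"
  shows "Bip P Q \<in> Proj C"
  unfolding Proj_iff
proof (intro conjI allI impI)
  note [simp] = Proj_Obj[OF assms(1)] Proj_Obj[OF assms(2)]
  show "Bip P Q \<in> Obj C" by simp
  fix p y assume a: "psurj p \<and> isar y (Bip P Q) (tgt p)"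
  obtain x1 where x1: "arr x1" "src x1 = P" "tgt x1 = src p" "p \<bullet> x1 = y \<bullet> in1 P Q"
    by (rule Proj_lift[OF assms(1) conjunct1[OF a], of "y \<bullet> in1 P Q"]) (use a in simp_all)
  obtain x2 where x2: "arr x2" "src x2 = Q" "tgt x2 = src p" "p \<bullet> x2 = y \<bullet> in2 P Q"
    by (rule Proj_lift[OF assms(2) conjunct1[OF a], of "y \<bullet> in2 P Q"]) (use a in simp_all)
  have "arr p" using a by (simp add: psurj_def)
  then have "p \<bullet> cop x1 x2 = y"
    using x1 x2 a cop_eta[of y P Q] by simp
  then show "\<exists>x. isar x (Bip P Q) (src p) \<and> p \<bullet> x = y"
    using x1 x2 by (intro exI[of _ "cop x1 x2"]) simp
qed

text \<open>A morphism out of \<open>S\<close> lifts on each summand, and the lifts assemble to one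
  morphism; that this is a lift follows from the uniqueness part of the universal property.\<close>

lemma Proj_coproduct:
  assumes "\<And>n. n \<in> I \<Longrightarrow> P n \<in> Proj C" "is_coproduct C I P S j"
  shows "S \<in> Proj C"
  unfolding Proj_iff
proof (intro conjI allI impI)
  show S: "S \<in> Obj C" using assms(2) by (simp add: is_coproduct_def)
  have j: "j n \<in> Hom C (P n) S" if "n \<in> I" for n using assms(2) that by (simp add: is_coproduct_def)
  have u: "\<exists>!h. h \<in> Hom C S T \<and> (\<forall>n \<in> I. h \<cdot> j n = g n)" if "T \<in> Obj C" "\<forall>n \<in> I. g n \<in> Hom C (P n) T" for T g
    using assms(2) that by (simp add: is_coproduct_def)
  fix p y assume a: "psurj p \<and> isar y S (tgt p)"
  then have p: "arr p" by (simp add: psurj_def)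
  have "\<exists>x. x \<in> Hom C (P n) (src p) \<and> val p \<cdot> x = val y \<cdot> j n" if n: "n \<in> I" for n
  proof -
    have t: "arr (Arrow (P n) S (j n))" using n j S assms(1)[OF n] by simp
    obtain x where x: "arr x" "src x = P n" "tgt x = src p" "p \<bullet> x = y \<bullet> Arrow (P n) S (j n)"
      by (rule Proj_lift[OF assms(1)[OF n] conjunct1[OF a], of "y \<bullet> Arrow (P n) S (j n)"]) (use a t in simp_all)
    then show ?thesis using val_Hom[of x "P n" "src p"] val_cmp[of p x] val_cmp[of y "Arrow (P n) S (j n)"] a t p
      by (intro exI[of _ "val x"]) simp
  qed
  then obtain g where g: "\<forall>n \<in> I. g n \<in> Hom C (P n) (src p) \<and> val p \<cdot> g n = val y \<cdot> j n" by metis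
  then obtain h where h: "h \<in> Hom C S (src p)" "\<forall>n \<in> I. h \<cdot> j n = g n"
    using u[of "src p" g] p by auto
  have yv: "val y \<in> Hom C S (tgt p)" using a val_Hom by blast
  have ph: "val p \<cdot> h \<in> Hom C S (tgt p)" using comp_closed[of S "src p" "tgt p" h "val p"] S p h val_in_Hom by simp
  have "(val p \<cdot> h) \<cdot> j n = val y \<cdot> j n" if "n \<in> I" for n
    using comp_assoc[of "P n" S "src p" "tgt p" "j n" h "val p"] that S p h(1) j val_in_Hom[of p] assms(1)[OF that] h(2) g by simp
  moreover have "\<forall>n \<in> I. val y \<cdot> j n \<in> Hom C (P n) (tgt p)"
    using comp_closed[of _ S "tgt p" _ "val y"] S p j yv assms(1) by simp
  ultimately have "val p \<cdot> h = val y"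
    using ex1E[OF u[of "tgt p" "\<lambda>n. val y \<cdot> j n"]] ph yv p by (metis tgt_in_Obj)
  then have "p \<bullet> Arrow S (src p) h = y"
    using h p S a Arrow_val[of y S "tgt p"] by (simp add: cmp_def)
  then show "\<exists>x. isar x S (src p) \<and> p \<bullet> x = y"
    using h S p by (intro exI[of _ "Arrow S (src p) h"]) simp
qed

lemma psurj_split: "\<lbrakk>isar p X Y; isar s Y X; p \<bullet> s = idn Y\<rbrakk> \<Longrightarrow> psurj p"
  unfolding psurj_def
proof (intro conjI ballI allI impI)
  fix P y assume a: "isar p X Y" "isar s Y X" "p \<bullet> s = idn Y" "isar y P (tgt p)"
  then show "\<exists>x. isar x P (src p) \<and> p \<bullet> x = y"
    by (intro exI[of _ "s \<bullet> y"]) (simp add: a(3)[THEN cmp_reassoc])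
qed simp

lemma cnf_bip:
  assumes [simp]: "X \<in> Obj C" "Y \<in> Obj C"
  shows "cnf (in1 X Y) (pr2 X Y)"
  unfolding cnf_iff kern_def mono_def
proof (intro conjI allI impI)
  fix g h assume a: "arr g \<and> arr h \<and> src g = src h \<and> tgt g = src (in1 X Y) \<and> tgt h = src (in1 X Y) \<and> in1 X Y \<bullet> g = in1 X Y \<bullet> h"
  then have a': "arr g" "arr h" "tgt g = X" "tgt h = X" by simp_all
  have "pr1 X Y \<bullet> (in1 X Y \<bullet> g) = pr1 X Y \<bullet> (in1 X Y \<bullet> h)" using a by (simp only:)
  then show "g = h" using a' by simp
next
  fix g assume a: "arr g \<and> tgt g = src (pr2 X Y) \<and> pr2 X Y \<bullet> g = zer (src g) (tgt (pr2 X Y))"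
  then have a': "arr g" "tgt g = Bip X Y" "pr2 X Y \<bullet> g = zer (src g) Y" by simp_all
  have "in1 X Y \<bullet> (pr1 X Y \<bullet> g) = g"
    by (rule bip_ext_pr[of X Y]) (use a' in simp_all)
  then show "\<exists>h. isar h (src g) (src (in1 X Y)) \<and> in1 X Y \<bullet> h = g" using a' by (intro exI[of _ "pr1 X Y \<bullet> g"]) simp
next
  show "psurj (pr2 X Y)" by (rule psurj_split[of _ "Bip X Y" Y "in2 X Y"]) simp_all
qed simp_all

section \<open>Zero objects\<close>

lemma zero_object_arr_to:
  assumes "is_zero_object C Z" "arr f" "tgt f = Z" shows "f = zer (src f) Z"
proof -
  have "\<exists>!g. g \<in> Hom C (src f) Z" "Z \<in> Obj C" using assms by (auto simp: is_zero_object_def)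
  moreover have "val f \<in> Hom C (src f) Z" using assms val_Hom by blast
  moreover have "Zero C (src f) Z \<in> Hom C (src f) Z" using arr_zer[of "src f" Z] assms(2) \<open>Z \<in> Obj C\<close> by (simp add: zer_eq_Arrow)
  ultimately have "val f = Zero C (src f) Z" by blast
  then show ?thesis
    using Arrow_val[of f "src f" Z] zer_eq_Arrow[of "src f" Z] assms(2,3) \<open>Z \<in> Obj C\<close> by simp
qed

lemma zero_object_arr_from:
  assumes "is_zero_object C Z" "arr f" "src f = Z" shows "f = zer Z (tgt f)"
proof -
  have "\<exists>!g. g \<in> Hom C Z (tgt f)" "Z \<in> Obj C" using assms by (auto simp: is_zero_object_def)
  moreover have "val f \<in> Hom C Z (tgt f)" using assms val_Hom by blast
  moreover have "Zero C Z (tgt f) \<in> Hom C Z (tgt f)" using arr_zer[of Z "tgt f"] assms(2) \<open>Z \<in> Obj C\<close> by (simp add: zer_eq_Arrow)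
  ultimately have "val f = Zero C Z (tgt f)" by blast
  then show ?thesis
    using Arrow_val[of f Z "tgt f"] zer_eq_Arrow[of Z "tgt f"] assms(2,3) \<open>Z \<in> Obj C\<close> by simp
qed

lemma zero_object_Proj:
  assumes "is_zero_object C Z" shows "Z \<in> Proj C"
  unfolding Proj_iff
proof (intro conjI allI impI)
  show [simp]: "Z \<in> Obj C" using assms by (simp add: is_zero_object_def)
  fix p y assume a: "psurj p \<and> isar y Z (tgt p)"
  then have "arr p" by (simp add: psurj_def)
  then have "p \<bullet> zer Z (src p) = y" using zero_object_arr_from[OF assms, of y] a by simp
  then show "\<exists>x. isar x Z (src p) \<and> p \<bullet> x = y" using \<open>arr p\<close> by (intro exI[of _ "zer Z (src p)"]) simp
qed

lemma zero_objectI: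
  assumes "Z \<in> Obj C" "idn Z = zer Z Z" shows "is_zero_object C Z"
proof -
  have "(\<exists>!f. f \<in> Hom C X Z) \<and> (\<exists>!f. f \<in> Hom C Z X)" if X: "X \<in> Obj C" for X
  proof (intro conjI ex1I)
    show "val (zer X Z) \<in> Hom C X Z" "val (zer Z X) \<in> Hom C Z X" using X assms by (auto intro!: val_Hom)
    fix f
    {
      assume "f \<in> Hom C X Z"
      then have "idn Z \<bullet> Arrow X Z f = Arrow X Z f" "zer Z Z \<bullet> Arrow X Z f = zer X Z" using X assms(1) by simp_all
      then show "f = val (zer X Z)" using assms(2) by (metis arrow.sel(3))
    next
      assume "f \<in> Hom C Z X"
      then have "Arrow Z X f \<bullet> idn Z = Arrow Z X f" "Arrow Z X f \<bullet> zer Z Z = zer Z X" using X assms(1) by simp_all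
      then show "f = val (zer Z X)" using assms(2) by (metis arrow.sel(3))
    }
  qed
  then show ?thesis using assms(1) by (simp add: is_zero_object_def)
qed

lemma zero_object_idn: "is_zero_object C Z \<Longrightarrow> idn Z = zer Z Z"
  using zero_object_arr_to[of Z "idn Z"] by (simp add: is_zero_object_def)

lemma zero_object_Bip:
  assumes "is_zero_object C X" "is_zero_object C Y" shows "is_zero_object C (Bip X Y)"
proof (rule zero_objectI)
  have o [simp]: "X \<in> Obj C" "Y \<in> Obj C" using assms by (simp_all add: is_zero_object_def)
  show "Bip X Y \<in> Obj C" by simp
  show "idn (Bip X Y) = zer (Bip X Y) (Bip X Y)"
    using zero_object_arr_to[OF assms(1), of "pr1 X Y"] zero_object_arr_to[OF assms(2), of "pr2 X Y"]
      pair_pr[of X Y] pair_zer[of "Bip X Y" X Y] by simp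
qed

subsection \<open>Complexes\<close>

text \<open>Degrees are kept in the form \<open>k + c\<close> with one constant on the right, so
  that equal degrees of a complex also match syntactically.\<close>

lemma one_plus_int [simp]: "(1 :: int) + k = k + 1"
  by simp

lemma add_one_one_int [simp]: "(k :: int) + 1 + 1 = k + 2"
  by simp

definition D :: "('o, 'm) cplx \<Rightarrow> int \<Rightarrow> ('o, 'm) arrow" where
  "D X n = Arrow (ob X n) (ob X (n - 1)) (dif X n)"

definition mkc :: "(int \<Rightarrow> 'o) \<Rightarrow> (int \<Rightarrow> ('o, 'm) arrow) \<Rightarrow> ('o, 'm) cplx" where
  "mkc w d = Cplx w (\<lambda>n. val (d n))"

definition cmap :: "('o, 'm) cplx \<Rightarrow> ('o, 'm) cplx \<Rightarrow> (int \<Rightarrow> ('o, 'm) arrow) \<Rightarrow> bool" where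
  "cmap X Y F \<longleftrightarrow> is_cplx C X \<and> is_cplx C Y \<and>
     (\<forall>n. isar (F n) (ob X n) (ob Y n) \<and> D Y n \<bullet> F n = F (n - 1) \<bullet> D X n)"

abbreviation cyc :: "('o, 'm) cplx \<Rightarrow> int \<Rightarrow> ('o, 'm) arrow \<Rightarrow> bool" where
  "cyc X n x \<equiv> D X n \<bullet> x = zer (src x) (ob X (n - 1))"

lemma src_D [simp]: "src (D X n) = ob X n" and tgt_D [simp]: "tgt (D X n) = ob X (n - 1)"
  by (simp_all add: D_def)

lemma arr_D [simp]: "is_cplx C X \<Longrightarrow> arr (D X n)"
  by (simp add: D_def is_cplx_def)

lemma cplx_ob [simp]: "is_cplx C X \<Longrightarrow> ob X n \<in> Obj C"
  by (simp add: is_cplx_def)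

lemma is_cplx_iff:
  "is_cplx C X \<longleftrightarrow> (\<forall>n. arr (D X n) \<and> D X (n - 1) \<bullet> D X n = zer (ob X n) (ob X (n - 1 - 1)))"
proof
  assume X: "is_cplx C X"
  have "D X (n - 1) \<bullet> D X n = zer (ob X n) (ob X (n - 1 - 1))" for n
    using X[unfolded is_cplx_def, rule_format, of n] X[unfolded is_cplx_def, rule_format, of "n - 1"]
      cplx_ob[OF X, of "n - 1 - 1"]
    by (simp add: D_def cmp_Arrow zer_eq_Arrow)
  then show "\<forall>n. arr (D X n) \<and> D X (n - 1) \<bullet> D X n = zer (ob X n) (ob X (n - 1 - 1))"
    using X by simp
next
  assume a: "\<forall>n. arr (D X n) \<and> D X (n - 1) \<bullet> D X n = zer (ob X n) (ob X (n - 1 - 1))"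
  have o: "ob X n \<in> Obj C \<and> dif X n \<in> Hom C (ob X n) (ob X (n - 1))" for n
    using a[rule_format, of n] by (simp add: D_def)
  have "dif X (n - 1) \<cdot> dif X n = Zero C (ob X n) (ob X (n - 1 - 1))" for n
    using a[rule_format, of n] o[of n] o[of "n - 1"] o[of "n - 1 - 1"] by (simp add: D_def cmp_Arrow zer_eq_Arrow)
  then show "is_cplx C X" using o by (simp add: is_cplx_def)
qed

lemma DD [simp]:
  assumes "is_cplx C X" "m = n - 1"
  shows "D X m \<bullet> D X n = zer (ob X n) (ob X (m - 1))"
  using assms(2) is_cplx_iff[THEN iffD1, OF assms(1)] by simp

lemma DD_reassoc [simp]:
  assumes "is_cplx C X" "m = n - 1" "arr z" "tgt z = ob X n"
  shows "D X m \<bullet> D X n \<bullet> z = zer (src z) (ob X (m - 1))"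
  using assms cmp_reassoc[OF DD[OF assms(1,2)], of z] by simp

lemma ob_mkc [simp]: "ob (mkc w d) = w"
  by (simp add: mkc_def)

lemma D_mkc: "isar (d n) (w n) (w (n - 1)) \<Longrightarrow> D (mkc w d) n = d n"
  using Arrow_val[of "d n" "w n" "w (n - 1)"] by (simp add: mkc_def D_def)

lemma is_cplx_mkc:
  assumes "\<And>n. isar (d n) (w n) (w (n - 1))" "\<And>n. d (n - 1) \<bullet> d n = zer (w n) (w (n - 1 - 1))"
  shows "is_cplx C (mkc w d)"
  unfolding is_cplx_iff using assms by (simp add: D_mkc)

lemma cmapD:
  assumes "cmap X Y F"
  shows "is_cplx C X" "is_cplx C Y" "arr (F n)" "src (F n) = ob X n" "tgt (F n) = ob Y n"
    "D Y n \<bullet> F n = F (n - 1) \<bullet> D X n" "D Y n \<bullet> F n \<bullet> z = F (n - 1) \<bullet> D X n \<bullet> z"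
proof -
  show "is_cplx C X" "is_cplx C Y" "arr (F n)" "src (F n) = ob X n" "tgt (F n) = ob Y n"
   and e: "D Y n \<bullet> F n = F (n - 1) \<bullet> D X n" using assms by (auto simp: cmap_def)
  show "D Y n \<bullet> F n \<bullet> z = F (n - 1) \<bullet> D X n \<bullet> z" using cmp_reassoc[OF e, of z] by simp
qed

lemma cmap_id: "is_cplx C X \<Longrightarrow> cmap X X (\<lambda>n. idn (ob X n))"
  by (simp add: cmap_def)

lemma cmap_cmp:
  assumes "cmap X Y F" "cmap Y Z G" shows "cmap X Z (\<lambda>n. G n \<bullet> F n)"
  using cmapD[OF assms(1)] cmapD[OF assms(2)] by (simp add: cmap_def)

lemma chain_map_iff:
  assumes "is_cplx C X" "is_cplx C Y"
  shows "f \<in> chain_maps C X Y \<longleftrightarrow> cmap X Y (\<lambda>n. Arrow (ob X n) (ob Y n) (f n))"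
proof -
  have "dif Y n \<cdot> f n = f (n - 1) \<cdot> dif X n \<longleftrightarrow>
      D Y n \<bullet> Arrow (ob X n) (ob Y n) (f n) = Arrow (ob X (n - 1)) (ob Y (n - 1)) (f (n - 1)) \<bullet> D X n"
    if "\<And>n. f n \<in> Hom C (ob X n) (ob Y n)" for n
    using that arr_D[OF assms(1), of n] arr_D[OF assms(2), of n] assms
    by (simp add: cmp_def) (simp add: D_def)
  then show ?thesis using assms by (auto simp: chain_maps_def cmap_def)
qed

lemma cmap_Arrow_val: "cmap X Y F \<Longrightarrow> Arrow (ob X n) (ob Y n) (val (F n)) = F n"
  by (intro Arrow_val) (simp add: cmapD)

lemma cmap_val:
  assumes "cmap X Y F" shows "(\<lambda>n. val (F n)) \<in> chain_maps C X Y"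
proof -
  have "(\<lambda>n. Arrow (ob X n) (ob Y n) (val (F n))) = F"
    using cmap_Arrow_val[OF assms] by (intro ext)
  then show ?thesis using assms cmapD(1,2)[OF assms] by (simp add: chain_map_iff)
qed

section \<open>Acyclicity tested on projectives\<close>

text \<open>Exactness of \<open>Hom(P, X)\<close> in degree \<open>n\<close> for all projective \<open>P\<close>.\<close>

definition ex_at :: "('o, 'm) cplx \<Rightarrow> int \<Rightarrow> bool" where
  "ex_at X n \<longleftrightarrow> (\<forall>x. src x \<in> Proj C \<and> arr x \<and> tgt x = ob X n \<and> cyc X n x \<longrightarrow>
     (\<exists>y. isar y (src x) (ob X (n + 1)) \<and> D X (n + 1) \<bullet> y = x))"

lemma ex_atE:
  assumes "ex_at X n" "src x \<in> Proj C" "arr x" "tgt x = ob X n" "cyc X n x"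
  obtains y where "arr y" "src y = src x" "tgt y = ob X (n + 1)" "D X (n + 1) \<bullet> y = x"
  using assms unfolding ex_at_def by blast

lemma ex_atI:
  assumes "\<And>P x. \<lbrakk>P \<in> Proj C; arr x; src x = P; tgt x = ob X n; D X n \<bullet> x = zer P (ob X (n - 1))\<rbrakk>
    \<Longrightarrow> \<exists>y. isar y P (ob X (n + 1)) \<and> D X (n + 1) \<bullet> y = x"
  shows "ex_at X n"
  using assms unfolding ex_at_def by blast

lemma ex_at_retract:
  assumes s: "cmap X Y s" and r: "cmap Y X r" and rs: "\<And>n. r n \<bullet> s n = idn (ob X n)" and e: "ex_at Y n"
  shows "ex_at X n"
  unfolding ex_at_def
proof (intro allI impI)
  note [simp] = cmapD(1-5)[OF s] cmapD(1-5)[OF r]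
  fix x assume x: "src x \<in> Proj C \<and> arr x \<and> tgt x = ob X n \<and> cyc X n x"
  obtain y where y: "arr y" "src y = src x" "tgt y = ob Y (n + 1)" "D Y (n + 1) \<bullet> y = s n \<bullet> x"
    by (rule ex_atE[OF e, of "s n \<bullet> x"]) (use x in \<open>simp_all add: cmapD(7)[OF s]\<close>)
  have "D X (n + 1) \<bullet> r (n + 1) \<bullet> y = x"
    using x y rs[of n, THEN cmp_reassoc, of x] by (simp add: cmapD(7)[OF r])
  then show "\<exists>y. isar y (src x) (ob X (n + 1)) \<and> D X (n + 1) \<bullet> y = x"
    using y by (intro exI[of _ "r (n + 1) \<bullet> y"]) simp
qed

text \<open>The differential corestricts to a map \<open>p n\<close> into the next cycles. Its
  kernel is \<open>i n\<close> because \<open>i (n - 1)\<close> is monic, and exactness in degree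
  \<open>n - 1\<close> makes it surjective on morphisms from projectives. The cycles are an
  argument, since \<open>tilde_Proj_iff\<close> has to show that given cycle objects are
  projective.\<close>

lemma acyclic_viaI:
  assumes X: "is_cplx C X" and e: "\<And>n. ex_at X n"
    and i: "\<And>n. kern (i n) (D X n)"
  shows "\<exists>p. acyclic_via C X (\<lambda>n. src (i n)) (\<lambda>n. val (i n)) p"
proof -
  note [simp] = X kernD(2)[OF i]
  have ti [simp]: "tgt (i n) = ob X n" for n using kernD(4)[OF i[of n]] by simp
  have ki [simp]: "D X n \<bullet> i n = zer (src (i n)) (ob X (n - 1))" for n using kernD(5)[OF i[of n]] by simp
  have "\<exists>p. isar p (ob X n) (src (i (n - 1))) \<and> i (n - 1) \<bullet> p = D X n" for n
    using kern_lift[OF i[of "n - 1"], of "D X n"] by (metis DD X arr_D src_D tgt_D ti)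
  then obtain p where p: "\<And>n. isar (p n) (ob X n) (src (i (n - 1)))" "\<And>n. i (n - 1) \<bullet> p n = D X n" by metis
  note [simp] = p(1)[THEN conjunct1] p(1)[THEN conjunct2, THEN conjunct1] p(1)[THEN conjunct2, THEN conjunct2]
  have ip: "i (n - 1) \<bullet> p n \<bullet> z = D X n \<bullet> z" for n z using cmp_reassoc[OF p(2)] by simp
  have "cnf (i n) (p n)" for n
    unfolding cnf_iff kern_def psurj_def
  proof (intro conjI allI impI ballI)
    show "mono (i n)" using kernD(1)[OF i] .
    show "p n \<bullet> i n = zer (src (i n)) (tgt (p n))"
      by (rule monoD[OF kernD(1)[OF i[of "n - 1"]]]) (simp_all add: ip)
  next
    fix g assume g: "arr g \<and> tgt g = src (p n) \<and> p n \<bullet> g = zer (src g) (tgt (p n))"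
    then have "D X n \<bullet> g = zer (src g) (ob X (n - 1))" using ip[of n g] by simp
    then obtain h where "arr h" "src h = src g" "tgt h = src (i n)" "i n \<bullet> h = g"
      using kern_lift[OF i[of n], of g] g by auto
    then show "\<exists>h. isar h (src g) (src (i n)) \<and> i n \<bullet> h = g" by blast
  next
    fix P y assume P: "P \<in> Proj C" and y: "isar y P (tgt (p n))"
    obtain x where x: "arr x" "src x = src (i (n - 1) \<bullet> y)" "tgt x = ob X n" "D X n \<bullet> x = i (n - 1) \<bullet> y"
      by (rule ex_atE[OF e[of "n - 1"], of "i (n - 1) \<bullet> y"])
         (use P y in \<open>simp_all add: ki[THEN cmp_reassoc]\<close>)
    have "p n \<bullet> x = y"
      by (rule monoD[OF kernD(1)[OF i[of "n - 1"]]]) (use x y in \<open>simp_all add: ip\<close>)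
    then show "\<exists>x. isar x P (src (p n)) \<and> p n \<bullet> x = y" using x y by (intro exI[of _ x]) simp
  qed simp_all
  then have "Conf C (src (i n)) (val (i n)) (ob X n) (val (p n)) (src (i (n - 1)))" for n
    unfolding cnf_def by simp
  moreover have "dif X n = val (i (n - 1)) \<cdot> val (p n)" for n
    using val_cmp[of "i (n - 1)" "p n"] p(2)[of n] by (simp add: D_def)
  ultimately show ?thesis by (intro exI[of _ "\<lambda>n. val (p n)"]) (simp add: acyclic_via_def)
qed

lemma acyclic_viaD:
  assumes "acyclic_via C X Z i p"
  shows "is_cplx C X" "cnf (Arrow (Z n) (ob X n) (i n)) (Arrow (ob X n) (Z (n - 1)) (p n))"
    "D X n = Arrow (Z (n - 1)) (ob X (n - 1)) (i (n - 1)) \<bullet> Arrow (ob X n) (Z (n - 1)) (p n)"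
proof -
  show X: "is_cplx C X" and c: "cnf (Arrow (Z n) (ob X n) (i n)) (Arrow (ob X n) (Z (n - 1)) (p n))" for n
    using assms by (auto simp: acyclic_via_def Conf_iff_cnf)
  have "arr (Arrow (Z (n - 1)) (ob X (n - 1)) (i (n - 1)))" "arr (Arrow (ob X n) (Z (n - 1)) (p n))"
    using cnf_types[OF c[of n]] cnf_types[OF c[of "n - 1"]] by blast+
  then show "D X n = Arrow (Z (n - 1)) (ob X (n - 1)) (i (n - 1)) \<bullet> Arrow (ob X n) (Z (n - 1)) (p n)"
    using assms by (simp add: D_def acyclic_via_def cmp_def)
qed

lemma acyclic_iff: "X \<in> acyclics C \<longleftrightarrow> is_cplx C X \<and> (\<forall>n. ex_at X n)"
proof
  assume "X \<in> acyclics C"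
  then obtain Z i p where a: "acyclic_via C X Z i p" by (auto simp: acyclics_def)
  define I where "I n = Arrow (Z n) (ob X n) (i n)" for n
  define P where "P n = Arrow (ob X n) (Z (n - 1)) (p n)" for n
  have X [simp]: "is_cplx C X" and c: "cnf (I n) (P n)" and d: "D X n = I (n - 1) \<bullet> P n" for n
    using acyclic_viaD[OF a] by (simp_all add: I_def P_def)
  have [simp]: "src (I n) = Z n" "tgt (I n) = ob X n" "src (P n) = ob X n" "tgt (P n) = Z (n - 1)" for n
    by (simp_all add: I_def P_def)
  have [simp]: "arr (I n)" "arr (P n)" for n using cnf_types[OF c[of n]] by simp_all
  have "ex_at X n" for n
    unfolding ex_at_def
  proof (intro allI impI)
    fix x assume x: "src x \<in> Proj C \<and> arr x \<and> tgt x = ob X n \<and> cyc X n x"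
    then have "I (n - 1) \<bullet> P n \<bullet> x = I (n - 1) \<bullet> zer (src x) (Z (n - 1))" by (simp add: d src_in_Obj[of "I (n - 1)", simplified])
    then have "P n \<bullet> x = zer (src x) (Z (n - 1))"
      by (rule monoD[OF kernD(1)[OF cnf_kern[OF c[of "n - 1"]]]]) (use x src_in_Obj[of "I (n - 1)"] in simp_all)
    then obtain z where z: "arr z" "src z = src x" "tgt z = Z n" "I n \<bullet> z = x"
      using kern_lift[OF cnf_kern[OF c[of n]], of x] x by auto
    obtain y where y: "arr y" "src y = src x" "tgt y = ob X (n + 1)" "P (n + 1) \<bullet> y = z"
      by (rule psurjD[OF cnf_psurj[OF c[of "n + 1"]], of "src x" z]) (use x z in simp_all)
    have "D X (n + 1) \<bullet> y = x" using y z by (simp add: d)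
    then show "\<exists>y. isar y (src x) (ob X (n + 1)) \<and> D X (n + 1) \<bullet> y = x" using y by blast
  qed
  then show "is_cplx C X \<and> (\<forall>n. ex_at X n)" by simp
next
  assume a: "is_cplx C X \<and> (\<forall>n. ex_at X n)"
  have "\<exists>i. kern i (D X n)" for n using kernel_exists[of "D X n"] a by (metis arr_D)
  then obtain i where "\<And>n. kern (i n) (D X n)" by metis
  then show "X \<in> acyclics C"
    using acyclic_viaI[of X i] a unfolding acyclics_def by blast
qed

lemma acyclic_cplx: "X \<in> acyclics C \<Longrightarrow> is_cplx C X"
  by (simp add: acyclic_iff)

text \<open>In degree \<open>k\<close> the truncation consists of the cycles of \<open>X\<close> and
  is followed by zero, so there every element is a cycle. In degree \<open>k + 1\<close> the cycles
  of \<open>T\<close> and of \<open>X\<close> agree because \<open>i\<close> is monic, and above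
  that the complexes coincide.\<close>

lemma concentrated_imp_ex_at:
  assumes X: "is_cplx C X" and h: "homologically_concentrated_le C k X" and n: "k \<le> n"
  shows "ex_at X n"
proof -
  obtain T where t: "is_truncation C k X T" and ac: "T \<in> acyclics C"
    using h by (auto simp: homologically_concentrated_le_def)
  have T [simp]: "is_cplx C T" and e: "\<And>n. ex_at T n" using ac by (auto simp: acyclic_iff)
  obtain i0 where zo: "\<And>m. m < k \<Longrightarrow> is_zero_object C (ob T m)" and o: "\<And>m. m > k \<Longrightarrow> ob T m = ob X m"
    and d: "\<And>m. m > k + 1 \<Longrightarrow> dif T m = dif X m"
    and ik: "is_kernel C (ob T k) i0 (ob X k) (dif X k) (ob X (k - 1))" and id: "i0 \<cdot> dif T (k + 1) = dif X (k + 1)"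
    using t unfolding is_truncation_def by blast
  define i where "i = Arrow (ob T k) (ob X k) i0"
  note [simp] = X
  have "dif X k \<in> Hom C (ob X k) (ob X (k - 1))" using X by (simp add: is_cplx_def)
  then have ki: "kern i (D X k)" using ik is_kernel_iff[of "ob X k" "ob X (k - 1)" "dif X k"] by (simp add: i_def D_def)
  have ti [simp]: "src i = ob T k" "tgt i = ob X k" by (simp_all add: i_def)
  have ai [simp]: "arr i" using kernD(2)[OF ki] .
  have D1: "i \<bullet> D T (k + 1) = D X (k + 1)"
    using ai arr_D[OF T, of "k + 1"] id o[of "k + 1"] by (simp add: cmp_def) (simp add: i_def D_def)
  have D2: "D T m = D X m" if "m > k + 1" for m using that d o by (simp add: D_def)
  show ?thesis
    unfolding ex_at_def
  proof (intro allI impI)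
    fix x assume x: "src x \<in> Proj C \<and> arr x \<and> tgt x = ob X n \<and> cyc X n x"
    consider "n = k" | "n = k + 1" | "n > k + 1" using n by linarith
    then show "\<exists>y. isar y (src x) (ob X (n + 1)) \<and> D X (n + 1) \<bullet> y = x"
    proof cases
      case 1
      obtain z where z: "arr z" "src z = src x" "tgt z = ob T k" "i \<bullet> z = x"
        by (rule kern_lift[OF ki, of x]) (use x 1 in simp_all)
      have "cyc T k z" using zero_object_arr_to[OF zo[of "k - 1"], of "D T k \<bullet> z"] z by simp
      then obtain y where y: "arr y" "src y = src z" "tgt y = ob T (k + 1)" "D T (k + 1) \<bullet> y = z"
        using ex_atE[OF e[of k], of z] z x by auto
      have "D X (k + 1) \<bullet> y = x" using cmp_reassoc[OF D1, of y] y z by simp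
      then show ?thesis using y z o[of "k + 1"] 1 by (intro exI[of _ y]) simp
    next
      case 2
      have "i \<bullet> (D T (k + 1) \<bullet> x) = i \<bullet> zer (src x) (ob T k)"
        using cmp_reassoc[OF D1, of x] x 2 by simp
      then have "D T (k + 1) \<bullet> x = zer (src x) (ob T k)"
        by (rule monoD[OF kernD(1)[OF ki]]) (use x 2 o[of "k + 1"] in simp_all)
      then have "cyc T n x" using 2 by simp
      then obtain y where "arr y" "src y = src x" "tgt y = ob T (n + 1)" "D T (n + 1) \<bullet> y = x"
        using ex_atE[OF e[of n], of x] x o[of n] 2 by auto
      then show ?thesis using o[of "n + 1"] D2[of "n + 1"] 2 by (intro exI[of _ y]) simp
    next
      case 3
      then have "cyc T n x" using x D2[of n] o[of "n - 1"] by simp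
      then obtain y where "arr y" "src y = src x" "tgt y = ob T (n + 1)" "D T (n + 1) \<bullet> y = x"
        using ex_atE[OF e[of n], of x] x o[of n] 3 by auto
      then show ?thesis using o[of "n + 1"] D2[of "n + 1"] 3 by (intro exI[of _ y]) simp
    qed
  qed
qed

text \<open>The truncation is assembled from a zero object, a kernel \<open>i\<close> of
  \<open>D X k\<close> and the corestriction \<open>b\<close> of \<open>D X (k + 1)\<close> to it.
  Together with the preceding lemma this replaces homological concentration by exactness in all
  degrees \<open>\<ge> k\<close>.\<close>

lemma ex_at_imp_concentrated:
  assumes X: "is_cplx C X" and e: "\<And>n. k \<le> n \<Longrightarrow> ex_at X n"
  shows "homologically_concentrated_le C k X"
proof -
  note [simp] = X
  obtain Z where Z: "is_zero_object C Z" using zero_object by blast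
  then have [simp]: "Z \<in> Obj C" by (simp add: is_zero_object_def)
  obtain i where ki: "kern i (D X k)" by (rule kernel_exists[of "D X k"]) simp
  have ai [simp]: "arr i" "tgt i = ob X k" using kernD(2,4)[OF ki] by simp_all
  have Di [simp]: "D X k \<bullet> i = zer (src i) (ob X (k - 1))" using kernD(5)[OF ki] by simp
  obtain b where b: "arr b" "src b = ob X (k + 1)" "tgt b = src i" "i \<bullet> b = D X (k + 1)"
    by (rule kern_lift[OF ki, of "D X (k + 1)"]) simp_all
  define w where "w m = (if m < k then Z else if m = k then src i else ob X m)" for m
  define d where "d m = (if m \<le> k then zer (w m) (w (m - 1)) else if m = k + 1 then b else D X m)" for m
  have ow [simp]: "w m \<in> Obj C" for m by (simp add: w_def)
  have td: "isar (d m) (w m) (w (m - 1))" for m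
    using b by (auto simp: d_def w_def)
  have dd: "d (m - 1) \<bullet> d m = zer (w m) (w (m - 1 - 1))" for m
  proof -
    consider "m \<le> k + 1" | "m = k + 2" | "m > k + 2" by linarith
    then show ?thesis
    proof cases
      case 1
      then have "d (m - 1) = zer (w (m - 1)) (w (m - 1 - 1))" by (simp add: d_def)
      then show ?thesis using td[of m] by simp
    next
      case 2
      have "i \<bullet> (b \<bullet> D X (k + 2)) = i \<bullet> zer (ob X (k + 2)) (src i)"
        using b by (simp add: b(4)[THEN cmp_reassoc])
      then have "b \<bullet> D X (k + 2) = zer (ob X (k + 2)) (src i)"
        by (rule monoD[OF kernD(1)[OF ki]]) (use b in simp_all)
      then show ?thesis using 2 by (simp add: d_def w_def)
    next
      case 3
      then show ?thesis by (simp add: d_def w_def)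
    qed
  qed
  define T where "T = mkc w d"
  have T [simp]: "is_cplx C T" unfolding T_def by (rule is_cplx_mkc) (use td dd in blast)+
  have DT: "D T m = d m" for m unfolding T_def by (rule D_mkc[of d m w, OF td])
  have oT: "ob T = w" by (simp add: T_def)
  have "ex_at T n" for n
    unfolding ex_at_def
  proof (intro allI impI)
    fix x assume x: "src x \<in> Proj C \<and> arr x \<and> tgt x = ob T n \<and> cyc T n x"
    consider "n < k" | "n = k" | "n = k + 1" | "n > k + 1" by linarith
    then show "\<exists>y. isar y (src x) (ob T (n + 1)) \<and> D T (n + 1) \<bullet> y = x"
    proof cases
      case 1
      then have "x = zer (src x) (w n)" using zero_object_arr_to[OF Z, of x] x by (simp add: oT w_def)
      then show ?thesis using x td[of "n + 1"] by (intro exI[of _ "zer (src x) (w (n + 1))"]) (simp add: DT oT)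
    next
      case 2
      obtain y where y: "arr y" "src y = src (i \<bullet> x)" "tgt y = ob X (k + 1)" "D X (k + 1) \<bullet> y = i \<bullet> x"
        by (rule ex_atE[OF e[of k], of "i \<bullet> x"]) (use x 2 in \<open>simp_all add: oT w_def Di[THEN cmp_reassoc]\<close>)
      have "b \<bullet> y = x"
        by (rule monoD[OF kernD(1)[OF ki]]) (use x y b 2 in \<open>simp_all add: b(4)[THEN cmp_reassoc] oT w_def\<close>)
      then show ?thesis using x y 2 by (intro exI[of _ y]) (simp add: DT d_def oT w_def)
    next
      case 3
      have "b \<bullet> x = zer (src x) (src i)" using x 3 by (simp add: DT d_def oT w_def)
      then have "i \<bullet> b \<bullet> x = zer (src x) (ob X k)" using x by simp
      then have "cyc X n x" using x 3 b by (simp add: b(4)[THEN cmp_reassoc] oT w_def)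
      then obtain y where "arr y" "src y = src x" "tgt y = ob X (n + 1)" "D X (n + 1) \<bullet> y = x"
        using ex_atE[OF e[of n], of x] x 3 by (auto simp: oT w_def)
      then show ?thesis using 3 by (intro exI[of _ y]) (simp add: DT d_def oT w_def)
    next
      case 4
      then have "cyc X n x" using x by (simp add: DT d_def oT w_def)
      then obtain y where "arr y" "src y = src x" "tgt y = ob X (n + 1)" "D X (n + 1) \<bullet> y = x"
        using ex_atE[OF e[of n], of x] x 4 by (auto simp: oT w_def)
      then show ?thesis using 4 by (intro exI[of _ y]) (simp add: DT d_def oT w_def)
    qed
  qed
  then have "T \<in> acyclics C" by (simp add: acyclic_iff)
  moreover have "is_truncation C k X T"
    unfolding is_truncation_def
  proof (intro conjI allI impI exI[of _ "val i"])
    fix m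
    show "dif T m = dif X m" if "k + 1 < m"
      using that DT[of m] by (simp add: d_def D_def)
    have "val i \<in> Hom C (src i) (ob X k)" by (intro val_Hom) simp
    show "is_kernel C (ob T k) (val i) (ob X k) (dif X k) (ob X (k - 1))"
      using is_kernel_iff[of "ob X k" "ob X (k - 1)" "dif X k" "src i" "val i"] ki X Arrow_val[of i "src i" "ob X k"]
      by (simp add: oT w_def is_cplx_def D_def)
    have "val i \<cdot> val b = dif X (k + 1)" using val_cmp[of i b] b by (simp add: D_def)
    moreover have "dif T (k + 1) = val b" using DT[of "k + 1"] by (auto simp: d_def D_def)
    ultimately show "val i \<cdot> dif T (k + 1) = dif X (k + 1)" by simp
  qed (use Z in \<open>simp_all add: oT w_def\<close>)
  ultimately show ?thesis by (auto simp: homologically_concentrated_le_def)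
qed

subsection \<open>Twisted sums and cones\<close>

text \<open>A twisting family \<open>\<theta> : A \<rightarrow> B\<close> of degree \<open>-1\<close> is what is needed to turn the graded object \<open>B \<oplus> A\<close> into an
  extension of \<open>A\<close> by \<open>B\<close>.\<close>

definition twist :: "('o, 'm) cplx \<Rightarrow> ('o, 'm) cplx \<Rightarrow> (int \<Rightarrow> ('o, 'm) arrow) \<Rightarrow> bool" where
  "twist B A \<theta> \<longleftrightarrow> is_cplx C B \<and> is_cplx C A \<and>
     (\<forall>n. isar (\<theta> n) (ob A n) (ob B (n - 1)) \<and> D B (n - 1) \<bullet> \<theta> n = \<boxminus> (\<theta> (n - 1) \<bullet> D A n))"

text \<open>On elements \<open>(b, a)\<close> the differential is
  \<open>(d b + \<theta> a, d a)\<close>; the sign in \<open>twist\<close> is what makes its square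
  zero. \<open>B\<close> is the subcomplex and \<open>A\<close> the quotient.\<close>

definition Tw :: "('o, 'm) cplx \<Rightarrow> ('o, 'm) cplx \<Rightarrow> (int \<Rightarrow> ('o, 'm) arrow) \<Rightarrow> ('o, 'm) cplx" where
  "Tw B A \<theta> = mkc (\<lambda>n. Bip (ob B n) (ob A n))
     (\<lambda>n. pair (cop (D B n) (\<theta> n)) (D A n \<bullet> pr2 (ob B n) (ob A n)))"

lemma twistD:
  assumes "twist B A \<theta>"
  shows "is_cplx C B" "is_cplx C A" "arr (\<theta> n)" "src (\<theta> n) = ob A n" "tgt (\<theta> n) = ob B (n - 1)"
    "m = n - 1 \<Longrightarrow> D B m \<bullet> \<theta> n = \<boxminus> (\<theta> m \<bullet> D A n)"
    "m = n - 1 \<Longrightarrow> D B m \<bullet> \<theta> n \<bullet> z = \<boxminus> (\<theta> m \<bullet> D A n \<bullet> z)"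
proof -
  show "is_cplx C B" "is_cplx C A" "arr (\<theta> n)" "src (\<theta> n) = ob A n" "tgt (\<theta> n) = ob B (n - 1)"
   and e: "m = n - 1 \<Longrightarrow> D B m \<bullet> \<theta> n = \<boxminus> (\<theta> m \<bullet> D A n)" using assms by (auto simp: twist_def)
  show "m = n - 1 \<Longrightarrow> D B m \<bullet> \<theta> n \<bullet> z = \<boxminus> (\<theta> m \<bullet> D A n \<bullet> z)" using cmp_reassoc[OF e, of z] by simp
qed

lemma ob_Tw [simp]: "ob (Tw B A \<theta>) n = Bip (ob B n) (ob A n)"
  by (simp add: Tw_def)

lemma D_Tw:
  assumes "twist B A \<theta>"
  shows "D (Tw B A \<theta>) n = pair (cop (D B n) (\<theta> n)) (D A n \<bullet> pr2 (ob B n) (ob A n))"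
  unfolding Tw_def by (rule D_mkc) (use twistD(1-5)[OF assms] in simp)

lemma D_Tw_pair:
  assumes "twist B A \<theta>" "arr b" "arr a" "src b = src a" "tgt b = ob B n" "tgt a = ob A n"
  shows "D (Tw B A \<theta>) n \<bullet> pair b a = pair (D B n \<bullet> b \<boxplus> \<theta> n \<bullet> a) (D A n \<bullet> a)"
  using twistD(1-5)[OF assms(1)] assms(2-) by (simp add: D_Tw[OF assms(1)])

lemma is_cplx_Tw [simp]:
  assumes "twist B A \<theta>" shows "is_cplx C (Tw B A \<theta>)"
  unfolding is_cplx_iff
proof (intro allI conjI)
  fix n
  note t [simp] = twistD(1-5)[OF assms]
  show a: "arr (D (Tw B A \<theta>) n)" by (simp add: D_Tw[OF assms])
  have "D (Tw B A \<theta>) (n - 1) \<bullet> D (Tw B A \<theta>) n = D (Tw B A \<theta>) (n - 1) \<bullet> D (Tw B A \<theta>) n \<bullet> pair (pr1 (ob B n) (ob A n)) (pr2 (ob B n) (ob A n))"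
    using a by simp
  also have "\<dots> = zer (Bip (ob B n) (ob A n)) (Bip (ob B (n - 1 - 1)) (ob A (n - 1 - 1)))"
    by (simp add: D_Tw_pair[OF assms] twistD(7)[OF assms] pair_zer del: pair_pr)
  finally show "D (Tw B A \<theta>) (n - 1) \<bullet> D (Tw B A \<theta>) n = zer (ob (Tw B A \<theta>) n) (ob (Tw B A \<theta>) (n - 1 - 1))" by simp
qed

lemma Tw_pairE:
  assumes "twist B A \<theta>" "arr z" "src z = P" "tgt z = Bip (ob B n) (ob A n)"
  obtains b a where "arr b" "arr a" "src b = P" "src a = P" "tgt b = ob B n" "tgt a = ob A n" "z = pair b a"
proof -
  note [simp] = twistD(1,2)[OF assms(1)]
  show ?thesis
    by (rule that[of "pr1 (ob B n) (ob A n) \<bullet> z" "pr2 (ob B n) (ob A n) \<bullet> z"])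
       (use assms(2-) pair_eta[of z "ob B n" "ob A n"] in simp_all)
qed

lemma D_Tw_in1:
  assumes "twist B A \<theta>"
  shows "D (Tw B A \<theta>) n \<bullet> in1 (ob B n) (ob A n) = in1 (ob B (n - 1)) (ob A (n - 1)) \<bullet> D B n"
  using twistD(1-5)[OF assms] by (simp add: D_Tw[OF assms] pair_def)

lemma D_Tw_in2:
  assumes "twist B A \<theta>"
  shows "D (Tw B A \<theta>) n \<bullet> in2 (ob B n) (ob A n) = pair (\<theta> n) (D A n)"
  using twistD(1-5)[OF assms] by (simp add: D_Tw[OF assms])

lemma cmap_in1:
  assumes "twist B A \<theta>" shows "cmap B (Tw B A \<theta>) (\<lambda>n. in1 (ob B n) (ob A n))"
  using twistD(1-5)[OF assms] assms D_Tw_in1[OF assms] by (simp add: cmap_def)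

lemma cmap_pr2:
  assumes "twist B A \<theta>" shows "cmap (Tw B A \<theta>) A (\<lambda>n. pr2 (ob B n) (ob A n))"
  using twistD(1-5)[OF assms] assms by (simp add: cmap_def D_Tw[OF assms])

lemma cmap_from_Tw:
  assumes t: "twist B A \<theta>" and u: "cmap B Y u" and v: "\<And>n. isar (v n) (ob A n) (ob Y n)"
    and e: "\<And>n. D Y n \<bullet> v n = u (n - 1) \<bullet> \<theta> n \<boxplus> v (n - 1) \<bullet> D A n"
  shows "cmap (Tw B A \<theta>) Y (\<lambda>n. cop (u n) (v n))"
  unfolding cmap_def
proof (intro conjI allI)
  note [simp] = twistD(1-5)[OF t] cmapD(1-5)[OF u] v
  show "is_cplx C (Tw B A \<theta>)" "is_cplx C Y" using t by simp_all
  fix n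
  show "D Y n \<bullet> cop (u n) (v n) = cop (u (n - 1)) (v (n - 1)) \<bullet> D (Tw B A \<theta>) n"
    by (rule bip_ext[of _ _ "ob B n" "ob A n"])
       (simp_all add: D_Tw_in1[OF t] D_Tw_in2[OF t] e cmapD(6)[OF u] t cop_in(1)[THEN cmp_reassoc])
qed (use twistD(1-5)[OF t] cmapD(1-5)[OF u] v in simp_all)

definition Sg :: "('o, 'm) cplx \<Rightarrow> ('o, 'm) cplx" where
  "Sg A = mkc (\<lambda>n. ob A (n - 1)) (\<lambda>n. \<boxminus> D A (n - 1))"

lemma ob_Sg [simp]: "ob (Sg A) n = ob A (n - 1)"
  by (simp add: Sg_def)

lemma D_Sg [simp]: "is_cplx C A \<Longrightarrow> D (Sg A) n = \<boxminus> D A (n - 1)"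
  unfolding Sg_def by (rule D_mkc) simp

lemma is_cplx_Sg [simp]: "is_cplx C A \<Longrightarrow> is_cplx C (Sg A)"
  unfolding is_cplx_iff[of "Sg A"] by simp

text \<open>The sign in the differential of the suspension turns the commutation rule of a chain map
  into the anticommutation required of a twisting family.\<close>

lemma twist_Sg:
  assumes "cmap A X f" shows "twist X (Sg A) (\<lambda>n. f (n - 1))"
  unfolding twist_def using cmapD[OF assms] by simp

lemma cmap_neg:
  assumes "cmap A X f" shows "cmap A X (\<lambda>n. \<boxminus> f n)"
  using cmapD[OF assms] by (simp add: cmap_def)

lemma cmap_add:
  assumes "cmap A X f" "cmap A X g" shows "cmap A X (\<lambda>n. f n \<boxplus> g n)"
  using cmapD[OF assms(1)] cmapD[OF assms(2)] by (simp add: cmap_def)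

text \<open>With this sign the differential is \<open>(d x - f a, - d a)\<close>, so a cycle
  \<open>(x, a)\<close> is a cycle \<open>a\<close> of \<open>A\<close> together with a chain
  \<open>x\<close> bounding its image, which is the data of a lifting problem.\<close>

definition cone :: "('o, 'm) cplx \<Rightarrow> ('o, 'm) cplx \<Rightarrow> (int \<Rightarrow> ('o, 'm) arrow) \<Rightarrow> ('o, 'm) cplx" where
  "cone A X f = Tw X (Sg A) (\<lambda>n. \<boxminus> f (n - 1))"

lemma twist_cone: "cmap A X f \<Longrightarrow> twist X (Sg A) (\<lambda>n. \<boxminus> f (n - 1))"
  by (rule twist_Sg[OF cmap_neg])

lemma is_cplx_cone [simp]: "cmap A X f \<Longrightarrow> is_cplx C (cone A X f)"
  unfolding cone_def by (simp add: twist_cone)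

lemma ob_cone [simp]: "ob (cone A X f) n = Bip (ob X n) (ob A (n - 1))"
  by (simp add: cone_def)

lemma D_cone_pair:
  assumes "cmap A X f" "arr x" "arr a" "src x = src a" "tgt x = ob X n" "tgt a = ob A (n - 1)"
  shows "D (cone A X f) n \<bullet> pair x a = pair (D X n \<bullet> x \<boxplus> \<boxminus> (f (n - 1) \<bullet> a)) (\<boxminus> (D A (n - 1) \<bullet> a))"
  unfolding cone_def using D_Tw_pair[OF twist_cone[OF assms(1)] assms(2-5)] assms(6) cmapD(1)[OF assms(1)] by simp

section \<open>Lifting against inclusions of spheres into disks\<close>

text \<open>The right lifting property against the inclusions of the sphere \<open>S\<^sup>m(P)\<close> into the disk
  \<open>D\<^sup>m\<^sup>+\<^sup>1(P)\<close>, for projective \<open>P\<close>.\<close>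

definition lifting :: "('o, 'm) cplx \<Rightarrow> ('o, 'm) cplx \<Rightarrow> (int \<Rightarrow> ('o, 'm) arrow) \<Rightarrow> int \<Rightarrow> bool" where
  "lifting Q Y g m \<longleftrightarrow> (\<forall>P \<in> Proj C. \<forall>q y. isar y P (ob Y (m + 1)) \<and> isar q P (ob Q m) \<and>
     D Q m \<bullet> q = zer P (ob Q (m - 1)) \<and> D Y (m + 1) \<bullet> y = g m \<bullet> q \<longrightarrow>
     (\<exists>q'. isar q' P (ob Q (m + 1)) \<and> D Q (m + 1) \<bullet> q' = q \<and> g (m + 1) \<bullet> q' = y))"

lemma liftingI:
  assumes "\<And>P q y. \<lbrakk>P \<in> Proj C; arr q; src q = P; tgt q = ob Q m; arr y; src y = P; tgt y = ob Y (m + 1);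
    D Q m \<bullet> q = zer P (ob Q (m - 1)); D Y (m + 1) \<bullet> y = g m \<bullet> q\<rbrakk> \<Longrightarrow>
      \<exists>q'. isar q' P (ob Q (m + 1)) \<and> D Q (m + 1) \<bullet> q' = q \<and> g (m + 1) \<bullet> q' = y"
  shows "lifting Q Y g m"
  using assms unfolding lifting_def by blast

lemma liftingE:
  assumes "lifting Q Y g m" "P \<in> Proj C" "isar q P (ob Q m)" "D Q m \<bullet> q = zer P (ob Q (m - 1))"
    "isar y P (ob Y (m + 1))" "D Y (m + 1) \<bullet> y = g m \<bullet> q"
  obtains q' where "arr q'" "src q' = P" "tgt q' = ob Q (m + 1)" "D Q (m + 1) \<bullet> q' = q" "g (m + 1) \<bullet> q' = y"
  using assms unfolding lifting_def by blast

text \<open>A morphism \<open>y\<close> is lifted in two steps. The boundary of \<open>y\<close>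
  lifts to a cycle \<open>q1\<close>, by the lifting property at the zero cycle in degree
  \<open>n - 2\<close>; then \<open>y\<close> bounds the image of \<open>q1\<close> and lifts as
  such.\<close>

lemma lifting_imp_psurj:
  assumes c: "cmap Q Y g" and l: "\<And>m. lifting Q Y g m"
  shows "psurj (g n)"
  unfolding psurj_def
proof (intro conjI ballI allI impI)
  note [simp] = cmapD(1-5)[OF c]
  show "arr (g n)" by simp
  fix P y assume P: "P \<in> Proj C" and y: "isar y P (tgt (g n))"
  obtain q1 where q1: "arr q1" "src q1 = P" "tgt q1 = ob Q (n - 1)" "D Q (n - 1) \<bullet> q1 = zer P (ob Q (n - 2))"
      "g (n - 1) \<bullet> q1 = D Y n \<bullet> y"
    by (rule liftingE[OF l[of "n - 2"] P, of "zer P (ob Q (n - 2))" "D Y n \<bullet> y"]) (use P y in simp_all)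
  obtain q2 where "arr q2" "src q2 = P" "tgt q2 = ob Q n" "D Q n \<bullet> q2 = q1" "g n \<bullet> q2 = y"
    by (rule liftingE[OF l[of "n - 1"] P, of q1 y]) (use P y q1 in simp_all)
  then show "\<exists>x. isar x P (src (g n)) \<and> g n \<bullet> x = y" using q1 P by (intro exI[of _ q2]) simp
qed

text \<open>The components of \<open>g = (\<eta>, \<theta>)\<close> are used separately:
  \<open>\<theta>\<close> twists \<open>A \<oplus> Q\<close>, and \<open>\<pi> = (f, \<eta>)\<close>
  extends \<open>f\<close> to the twisted sum. A lifting problem for \<open>\<pi>\<close>, given by
  a cycle \<open>(a', q)\<close> and a chain \<open>x\<close>, is the lifting problem for
  \<open>g\<close> given by \<open>q\<close> and \<open>(x, a')\<close>; from a solution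
  \<open>q'\<close> of the latter one obtains the solution \<open>(0, q')\<close> of the
  former.\<close>

lemma lifting_factorization:
  assumes f: "cmap A X f" and g: "cmap Q (cone A X f) g"
  obtains \<theta> \<pi> where "twist A Q \<theta>" "cmap (Tw A Q \<theta>) X \<pi>" "\<And>n. \<pi> n \<bullet> in1 (ob A n) (ob Q n) = f n"
    "\<And>m. lifting Q (cone A X f) g m \<Longrightarrow> lifting (Tw A Q \<theta>) X \<pi> m"
proof -
  note [simp] = cmapD(1-5)[OF f] cmapD(1-5)[OF g]
  define \<theta> where "\<theta> n = pr2 (ob X n) (ob A (n - 1)) \<bullet> g n" for n
  define \<eta> where "\<eta> n = pr1 (ob X n) (ob A (n - 1)) \<bullet> g n" for n
  have t [simp]: "arr (\<theta> n)" "src (\<theta> n) = ob Q n" "tgt (\<theta> n) = ob A (n - 1)"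
    "arr (\<eta> n)" "src (\<eta> n) = ob Q n" "tgt (\<eta> n) = ob X n" for n
    by (simp_all add: \<theta>_def \<eta>_def)
  have gp: "g n = pair (\<eta> n) (\<theta> n)" for n
    using pair_eta[of "g n" "ob X n" "ob A (n - 1)"] by (simp add: \<theta>_def \<eta>_def)
  have "pair (D X n \<bullet> \<eta> n \<boxplus> \<boxminus> (f (n - 1) \<bullet> \<theta> n)) (\<boxminus> (D A (n - 1) \<bullet> \<theta> n)) = pair (\<eta> (n - 1) \<bullet> D Q n) (\<theta> (n - 1) \<bullet> D Q n)" for n
    using cmapD(6)[OF g, of n] unfolding gp by (simp add: D_cone_pair[OF f])
  then have e: "D X n \<bullet> \<eta> n \<boxplus> \<boxminus> (f (n - 1) \<bullet> \<theta> n) = \<eta> (n - 1) \<bullet> D Q n" "\<boxminus> (D A (n - 1) \<bullet> \<theta> n) = \<theta> (n - 1) \<bullet> D Q n" for n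
    by (simp_all add: pair_eq_iff)
  have e2: "D A (n - 1) \<bullet> \<theta> n = \<boxminus> (\<theta> (n - 1) \<bullet> D Q n)" for n
    unfolding e(2)[symmetric] by simp
  have e1: "D X n \<bullet> \<eta> n = f (n - 1) \<bullet> \<theta> n \<boxplus> \<eta> (n - 1) \<bullet> D Q n" for n
    unfolding e(1)[symmetric] by (simp add: canc)
  have tw: "twist A Q \<theta>" unfolding twist_def by (simp add: e2)
  have pi: "cmap (Tw A Q \<theta>) X (\<lambda>n. cop (f n) (\<eta> n))"
    by (rule cmap_from_Tw[OF tw f]) (simp_all add: e1)
  have "lifting (Tw A Q \<theta>) X (\<lambda>n. cop (f n) (\<eta> n)) m" if l: "lifting Q (cone A X f) g m" for m
  proof (rule liftingI)
    fix P z x assume P: "P \<in> Proj C" and z: "arr z" "src z = P" "tgt z = ob (Tw A Q \<theta>) m"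
      and x: "arr x" "src x = P" "tgt x = ob X (m + 1)"
      and cz: "D (Tw A Q \<theta>) m \<bullet> z = zer P (ob (Tw A Q \<theta>) (m - 1))" and dx: "D X (m + 1) \<bullet> x = cop (f m) (\<eta> m) \<bullet> z"
    obtain a' q where q: "arr a'" "arr q" "src a' = P" "src q = P" "tgt a' = ob A m" "tgt q = ob Q m" "z = pair a' q"
      by (rule Tw_pairE[OF tw z[unfolded ob_Tw]])
    have "pair (D A m \<bullet> a' \<boxplus> \<theta> m \<bullet> q) (D Q m \<bullet> q) = zer P (Bip (ob A (m - 1)) (ob Q (m - 1)))"
      using cz q(1-6) unfolding q(7) by (simp add: D_Tw_pair[OF tw])
    then have z1: "D A m \<bullet> a' \<boxplus> \<theta> m \<bullet> q = zer P (ob A (m - 1))" and z2: "D Q m \<bullet> q = zer P (ob Q (m - 1))"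
      using q(1-6) by (simp_all add: pair_eq_zer_iff)
    have tq: "\<theta> m \<bullet> q = \<boxminus> (D A m \<bullet> a')" by (rule add_eq_zerD[OF z1]) (use q in simp_all)
    have dx: "D X (m + 1) \<bullet> x = f m \<bullet> a' \<boxplus> \<eta> m \<bullet> q" using dx q(1-6) unfolding q(7) by simp
    obtain q' where q': "arr q'" "src q' = P" "tgt q' = ob Q (m + 1)" "D Q (m + 1) \<bullet> q' = q" "g (m + 1) \<bullet> q' = pair x a'"
    proof (rule liftingE[OF l P, of q "pair x a'"])
      show "D (cone A X f) (m + 1) \<bullet> pair x a' = g m \<bullet> q"
        using x q(1-6) by (simp add: D_cone_pair[OF f] dx gp tq canc)
    qed (use x z2 q(1-6) in simp_all)
    have "pair (\<eta> (m + 1) \<bullet> q') (\<theta> (m + 1) \<bullet> q') = pair x a'" using q'(5) by (simp add: gp)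
    then have xa: "\<eta> (m + 1) \<bullet> q' = x" "\<theta> (m + 1) \<bullet> q' = a'"
      using q' x q(1-6) by (simp_all add: pair_eq_iff)
    let ?z = "pair (zer P (ob A (m + 1))) q'"
    have so: "P \<in> Obj C" using P by simp
    have "D (Tw A Q \<theta>) (m + 1) \<bullet> ?z = z" "cop (f (m + 1)) (\<eta> (m + 1)) \<bullet> ?z = x"
      using q'(1-4) q(1-6) x so xa by (simp_all add: D_Tw_pair[OF tw] q(7))
    then show "\<exists>z'. isar z' P (ob (Tw A Q \<theta>) (m + 1)) \<and> D (Tw A Q \<theta>) (m + 1) \<bullet> z' = z \<and> cop (f (m + 1)) (\<eta> (m + 1)) \<bullet> z' = x"
      using q'(1-3) so by (intro exI[of _ ?z]) (simp del: cop_pair)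
  qed
  then show ?thesis using that[OF tw pi] by simp
qed

subsection \<open>Projective resolutions and K-projective complexes\<close>

text \<open>The kernel of \<open>?\<phi>\<close> consists of the pairs \<open>(q, y)\<close> with
  \<open>d q = 0\<close> and \<open>e y = f q\<close>, that is, of the lifting problems in this
  degree. A projective cover of it, with its two projections as \<open>d'\<close> and
  \<open>f'\<close>, solves all of them at once.\<close>

lemma resolution_step:
  assumes d: "arr d" "src d = A" and f: "arr f" "src f = A" and Y: "arr e" "tgt e = tgt f"
  obtains d' f' where "src d' \<in> Proj C" "arr d'" "tgt d' = A" "arr f'" "src f' = src d'" "tgt f' = src e"
    "d \<bullet> d' = zer (src d') (tgt d)" "e \<bullet> f' = f \<bullet> d'"
    "\<And>P q y. \<lbrakk>P \<in> Proj C; isar q P A; isar y P (src e); d \<bullet> q = zer P (tgt d); e \<bullet> y = f \<bullet> q\<rbrakk>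
       \<Longrightarrow> \<exists>q'. isar q' P (src d') \<and> d' \<bullet> q' = q \<and> f' \<bullet> q' = y"
proof -
  note [simp] = assms
  have [simp]: "A \<in> Obj C" using src_in_Obj[OF d(1)] by simp
  define p1 where "p1 = pr1 A (src e)"
  define p2 where "p2 = pr2 A (src e)"
  have [simp]: "arr p1" "arr p2" "src p1 = Bip A (src e)" "src p2 = Bip A (src e)" "tgt p1 = A" "tgt p2 = src e"
    by (simp_all add: p1_def p2_def)
  let ?\<phi> = "pair (d \<bullet> p1) (f \<bullet> p1 \<boxplus> \<boxminus> (e \<bullet> p2))"
  obtain i where i: "kern i ?\<phi>" by (rule kernel_exists[of ?\<phi>]) simp
  have [simp]: "arr i" "tgt i = Bip A (src e)" using kernD(2,4)[OF i] by simp_all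
  obtain c where c: "aepi c" "src c \<in> Proj C" "tgt c = src i" by (rule projective_cover[of "src i"]) simp
  have [simp]: "arr c" using aepi_arr[OF c(1)] .
  have cs: "psurj c" using c(1) cnf_psurj by (auto simp: aepi_def)
  have "pair (d \<bullet> p1 \<bullet> i) (f \<bullet> p1 \<bullet> i \<boxplus> \<boxminus> (e \<bullet> p2 \<bullet> i)) = zer (src i) (Bip (tgt d) (tgt f))"
    using kernD(5)[OF i] by simp
  then have z: "d \<bullet> p1 \<bullet> i = zer (src i) (tgt d)" "f \<bullet> p1 \<bullet> i \<boxplus> \<boxminus> (e \<bullet> p2 \<bullet> i) = zer (src i) (tgt f)"
    by (simp_all add: pair_eq_zer_iff)
  have z2: "f \<bullet> p1 \<bullet> i = e \<bullet> p2 \<bullet> i" by (rule diff_zerD) (use z(2) in simp_all)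
  have z3: "d \<bullet> p1 \<bullet> i \<bullet> c = zer (src c) (tgt d)" "e \<bullet> p2 \<bullet> i \<bullet> c = f \<bullet> p1 \<bullet> i \<bullet> c"
    using arg_cong[OF z(1), of "\<lambda>x. x \<bullet> c"] arg_cong[OF z2, of "\<lambda>x. x \<bullet> c"] c(3) by simp_all
  show ?thesis
  proof (rule that[of "p1 \<bullet> i \<bullet> c" "p2 \<bullet> i \<bullet> c"])
    fix P q y assume P: "P \<in> Proj C" and q: "isar q P A" and y: "isar y P (src e)"
      and dq: "d \<bullet> q = zer P (tgt d)" and ey: "e \<bullet> y = f \<bullet> q"
    have pp: "p1 \<bullet> pair q y = q" "p2 \<bullet> pair q y = y" using q y by (simp_all add: p1_def p2_def)
    have "?\<phi> \<bullet> pair q y = zer P (Bip (tgt d) (tgt f))"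
      using q y P by (simp add: pp dq ey pair_zer)
    then obtain h where h: "arr h" "src h = P" "tgt h = src i" "i \<bullet> h = pair q y"
      using kern_lift[OF i, of "pair q y"] q y by auto
    obtain q' where q': "arr q'" "src q' = P" "tgt q' = src c" "c \<bullet> q' = h"
      by (rule psurjD[OF cs P, of h]) (use h c in simp_all)
    show "\<exists>q'. isar q' P (src (p1 \<bullet> i \<bullet> c)) \<and> (p1 \<bullet> i \<bullet> c) \<bullet> q' = q \<and> (p2 \<bullet> i \<bullet> c) \<bullet> q' = y"
      using q' c h pp by (intro exI[of _ q']) simp
  qed (use c z3 in simp_all)
qed

text \<open>The resolution grows upwards from zero. A state is the pair of the differential and the
  comparison map in the current degree, and the relation between consecutive states records that the
  lifting problems of that degree are solved.\<close>

lemma resolution_from: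
  assumes Y [simp]: "is_cplx C Y"
  obtains Q g where "cmap Q Y g" "\<And>n. ob Q n \<in> Proj C" "\<And>m. m < N \<Longrightarrow> is_zero_object C (ob Q m)"
    "\<And>m. N - 1 \<le> m \<Longrightarrow> lifting Q Y g m"
proof -
  obtain Z where Z: "is_zero_object C Z" using zero_object by blast
  have ZP [simp]: "Z \<in> Proj C" "Z \<in> Obj C" using zero_object_Proj[OF Z] by simp_all
  \<comment> \<open>The degree of stage \<open>i\<close>. Stage \<open>0\<close> sits in degree
    \<open>N - 1\<close>, where the complex is still zero, so the first step covers the cycles of
    \<open>Y\<close> in degree \<open>N\<close> and provides the lifting property in degree
    \<open>N - 1\<close>.\<close>
  let ?r = "\<lambda>i. N - 1 + int i"
  define ivt where "ivt i s \<longleftrightarrow> (case s of (d, f) \<Rightarrow> src d \<in> Proj C \<and> arr d \<and> isar f (src d) (ob Y (?r i)) \<and>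
     (i = 0 \<longrightarrow> d = zer Z Z \<and> f = zer Z (ob Y (N - 1))))" for i s
  define rel where "rel i s s' \<longleftrightarrow> (case s of (d, f) \<Rightarrow> case s' of (d', f') \<Rightarrow>
     tgt d' = src d \<and> d \<bullet> d' = zer (src d') (tgt d) \<and> D Y (?r i + 1) \<bullet> f' = f \<bullet> d' \<and>
     (\<forall>P q y. P \<in> Proj C \<and> isar q P (src d) \<and> isar y P (ob Y (?r i + 1)) \<and> d \<bullet> q = zer P (tgt d) \<and> D Y (?r i + 1) \<bullet> y = f \<bullet> q
        \<longrightarrow> (\<exists>q'. isar q' P (src d') \<and> d' \<bullet> q' = q \<and> f' \<bullet> q' = y)))" for i s s'
  have "\<exists>s. \<forall>i. ivt i (s i) \<and> rel i (s i) (s (Suc i))"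
  proof (rule dependent_nat_choice)
    show "\<exists>x. ivt 0 x" by (rule exI[of _ "(zer Z Z, zer Z (ob Y (N - 1)))"]) (simp add: ivt_def)
    fix s i assume "ivt i s"
    then obtain d f where s: "s = (d, f)" "src d \<in> Proj C" "arr d" "arr f" "src f = src d" "tgt f = ob Y (?r i)"
      by (auto simp: ivt_def split: prod.splits)
    define r where "r = ?r i"
    note s = s[folded r_def]
    have r1: "?r (Suc i) = r + 1" by (simp add: r_def)
    obtain d' f' where n: "src d' \<in> Proj C" "arr d'" "tgt d' = src d" "arr f'" "src f' = src d'" "tgt f' = src (D Y (r + 1))"
      "d \<bullet> d' = zer (src d') (tgt d)" "D Y (r + 1) \<bullet> f' = f \<bullet> d'"
      "\<And>P q y. \<lbrakk>P \<in> Proj C; isar q P (src d); isar y P (src (D Y (r + 1))); d \<bullet> q = zer P (tgt d); D Y (r + 1) \<bullet> y = f \<bullet> q\<rbrakk>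
       \<Longrightarrow> \<exists>q'. isar q' P (src d') \<and> d' \<bullet> q' = q \<and> f' \<bullet> q' = y"
      by (rule resolution_step[of d "src d" f "D Y (r + 1)"]) (use s in simp_all)
    have "ivt (Suc i) (d', f')" using n(1-6) unfolding ivt_def r1 by simp
    moreover have "rel i s (d', f')" unfolding rel_def s(1) r_def[symmetric] using n by simp
    ultimately show "\<exists>t. ivt (Suc i) t \<and> rel i s t" by blast
  qed
  then obtain s where s: "\<And>i. ivt i (s i)" "\<And>i. rel i (s i) (s (Suc i))" by blast
  define d where "d i = fst (s i)" for i
  define f where "f i = snd (s i)" for i
  have I: "src (d i) \<in> Proj C" "arr (d i)" "isar (f i) (src (d i)) (ob Y (?r i))"
    "d 0 = zer Z Z" "f 0 = zer Z (ob Y (N - 1))" for i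
    using s(1)[of i] s(1)[of 0] by (auto simp: ivt_def d_def f_def split: prod.splits)
  have R: "tgt (d (Suc i)) = src (d i)" "d i \<bullet> d (Suc i) = zer (src (d (Suc i))) (tgt (d i))"
     "D Y (?r i + 1) \<bullet> f (Suc i) = f i \<bullet> d (Suc i)"
     "\<And>P q y. \<lbrakk>P \<in> Proj C; isar q P (src (d i)); isar y P (ob Y (?r i + 1)); d i \<bullet> q = zer P (tgt (d i)); D Y (?r i + 1) \<bullet> y = f i \<bullet> q\<rbrakk>
        \<Longrightarrow> \<exists>q'. isar q' P (src (d (Suc i))) \<and> d (Suc i) \<bullet> q' = q \<and> f (Suc i) \<bullet> q' = y" for i
    using s(2)[of i] unfolding rel_def d_def f_def by (simp_all split: prod.splits)
  define w where "w m = (if m < N - 1 then Z else src (d (nat (m - (N - 1)))))" for m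
  define e where "e m = (if m < N - 1 then zer Z Z else d (nat (m - (N - 1))))" for m
  define g where "g m = (if m < N - 1 then zer Z (ob Y m) else f (nat (m - (N - 1))))" for m
  have lo: "w m = Z" "e m = zer Z Z" "g m = zer Z (ob Y m)" if "m < N - 1" for m
    using that by (simp_all add: w_def e_def g_def)
  have hi: "w (?r i) = src (d i)" "e (?r i) = d i" "g (?r i) = f i" for i
    by (simp_all add: w_def e_def g_def)
  have cs: "m < N - 1 \<or> (\<exists>i. m = ?r i)" for m
  proof (cases "m < N - 1")
    case False
    then have "m = ?r (nat (m - (N - 1)))" by simp
    then show ?thesis by blast
  qed simp
  have hi1: "w (?r (Suc i) - 1) = src (d i)" "e (?r (Suc i) - 1) = d i" "g (?r (Suc i) - 1) = f i" for i
  proof -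
    have "?r (Suc i) - 1 = ?r i" by simp
    then show "w (?r (Suc i) - 1) = src (d i)" "e (?r (Suc i) - 1) = d i" "g (?r (Suc i) - 1) = f i"
      using hi[of i] by (simp_all only:)
  qed
  have te: "isar (e m) (w m) (w (m - 1))" for m
  proof (cases "m < N - 1")
    case True
    then show ?thesis by (simp add: lo)
  next
    case False
    then obtain i where m: "m = ?r i" using cs by blast
    show ?thesis
    proof (cases i)
      case 0
      then show ?thesis using m I(1,2)[of 0] I(4) lo[of "m - 1"] hi[of 0] by simp
    next
      case (Suc j)
      show ?thesis unfolding m Suc hi hi1 using I(2) R(1) by simp
    qed
  qed
  have ee: "e (m - 1) \<bullet> e m = zer (w m) (w (m - 1 - 1))" for m
  proof (cases "m \<le> N - 1")
    case True
    then have "e (m - 1) = zer (w (m - 1)) (w (m - 1 - 1))" using lo[of "m - 1"] lo[of "m - 1 - 1"] by simp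
    then show ?thesis using te[of m] te[of "m - 1"] by simp
  next
    case False
    then obtain i where m: "m = ?r i" using cs[of m] by force
    then obtain j where j: "i = Suc j" using False by (cases i) auto
    have "tgt (d j) = w (m - 1 - 1)" using te[of "m - 1"] unfolding m j hi hi1 by simp
    then show ?thesis using R(2)[of j] unfolding m j hi hi1 by simp
  qed
  define Q where "Q = mkc w e"
  have Q [simp]: "is_cplx C Q" unfolding Q_def by (rule is_cplx_mkc) (use te ee in blast)+
  have DQ: "D Q m = e m" for m unfolding Q_def by (rule D_mkc[of e m w, OF te])
  have oQ: "ob Q = w" by (simp add: Q_def)
  have "cmap Q Y g"
    unfolding cmap_def
  proof (intro conjI allI)
    fix m
    have tg: "isar (g m) (w m) (ob Y m)" for m
      using cs[of m] lo hi I(3) by (metis Y arr_zer cplx_ob src_zer tgt_zer ZP(2))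
    show "arr (g m)" "src (g m) = ob Q m" "tgt (g m) = ob Y m" using tg[of m] by (simp_all add: oQ)
    show "D Y m \<bullet> g m = g (m - 1) \<bullet> D Q m"
    proof (cases "m \<le> N - 1")
      case True
      then have "w m = Z" using lo(1)[of m] hi(1)[of 0] I(4) by (cases "m = N - 1") simp_all
      then show ?thesis
        using zero_object_arr_from[OF Z, of "D Y m \<bullet> g m"] zero_object_arr_from[OF Z, of "g (m - 1) \<bullet> D Q m"]
          tg[of m] tg[of "m - 1"] by (simp add: oQ)
    next
      case False
      then obtain i where m: "m = ?r i" using cs[of m] by force
      then obtain j where j: "i = Suc j" using False by (cases i) auto
      have "?r j + 1 = ?r i" using j by simp
      then show ?thesis using R(3)[of j] unfolding DQ m j hi hi1 by simp
    qed
  qed simp_all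
  moreover have "ob Q n \<in> Proj C" for n
    using cs[of n] lo hi I(1) by (metis oQ ZP(1))
  moreover have "is_zero_object C (ob Q m)" if "m < N" for m
  proof (cases "m < N - 1")
    case False
    then have "m = ?r 0" using that by simp
    then show ?thesis using hi(1)[of 0] I(4) Z by (simp add: oQ)
  qed (use Z lo in \<open>simp add: oQ\<close>)
  moreover have "lifting Q Y g m" if Nm: "N - 1 \<le> m" for m
  proof (rule liftingI)
    obtain i where m: "m = ?r i" using cs[of m] Nm by force
    have m1: "m + 1 = ?r (Suc i)" using m by simp
    fix P q y assume a: "P \<in> Proj C" "arr q" "src q = P" "tgt q = ob Q m" "arr y" "src y = P" "tgt y = ob Y (m + 1)"
      "D Q m \<bullet> q = zer P (ob Q (m - 1))" "D Y (m + 1) \<bullet> y = g m \<bullet> q"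
    have "ob Q (m - 1) = tgt (d i)" using te[of m] unfolding m hi oQ by simp
    then show "\<exists>q'. isar q' P (ob Q (m + 1)) \<and> D Q (m + 1) \<bullet> q' = q \<and> g (m + 1) \<bullet> q' = y"
      using R(4)[of P q i y] a hi[of i] hi[of "Suc i"] unfolding m1 DQ oQ by (simp add: m)
  qed
  ultimately show ?thesis using that by blast
qed

section \<open>Null homotopies and K-projective complexes\<close>

definition nullh :: "('o, 'm) cplx \<Rightarrow> ('o, 'm) cplx \<Rightarrow> (int \<Rightarrow> ('o, 'm) arrow) \<Rightarrow> bool" where
  "nullh X N f \<longleftrightarrow> (\<exists>h. (\<forall>n. isar (h n) (ob X n) (ob N (n + 1))) \<and>
     (\<forall>n. f n = D N (n + 1) \<bullet> h n \<boxplus> h (n - 1) \<bullet> D X n))"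

text \<open>Only chain maps of degree zero occur. The other degrees of the Hom complex are covered
  because the acyclic complexes are closed under the shifts \<open>Sh\<close>, with either sign of
  the differential.\<close>

definition kproj :: "('o, 'm) cplx \<Rightarrow> bool" where
  "kproj X \<longleftrightarrow> is_cplx C X \<and> (\<forall>n. ob X n \<in> Proj C) \<and> (\<forall>N f. N \<in> acyclics C \<and> cmap X N f \<longrightarrow> nullh X N f)"

lemma kprojD: "kproj X \<Longrightarrow> is_cplx C X" "kproj X \<Longrightarrow> ob X n \<in> Proj C"
  by (simp_all add: kproj_def)

lemma kproj_nullh:
  assumes "kproj X" "N \<in> acyclics C" "cmap X N f"
  obtains h where "\<And>n. arr (h n)" "\<And>n. src (h n) = ob X n" "\<And>n. tgt (h n) = ob N (n + 1)"
    "\<And>n. f n = D N (n + 1) \<bullet> h n \<boxplus> h (n - 1) \<bullet> D X n"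
  using assms unfolding kproj_def nullh_def by blast

text \<open>The null homotopy is built upwards. The invariant says that \<open>d h\<close> and
  \<open>f\<close> agree on boundaries, so that \<open>f - h d\<close> in the next degree consists
  of cycles; as its source is projective and \<open>B\<close> is exact, it lifts along the
  differential to the next \<open>h\<close>.\<close>

lemma kproj_bounded_below:
  assumes X [simp]: "is_cplx C X" and P: "\<And>n. ob X n \<in> Proj C" and z: "\<And>m. m < N \<Longrightarrow> is_zero_object C (ob X m)"
  shows "kproj X"
  unfolding kproj_def
proof (intro conjI allI impI)
  fix B f assume "B \<in> acyclics C \<and> cmap X B f"
  then have f: "cmap X B f" and e: "\<And>n. ex_at B n" by (auto simp: acyclic_iff)
  note [simp] = cmapD(2-5)[OF f]
  let ?r = "\<lambda>i. N - 1 + int i"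
  define ivt where "ivt i h \<longleftrightarrow> isar h (ob X (?r i)) (ob B (?r i + 1)) \<and>
     D B (?r i + 1) \<bullet> h \<bullet> D X (?r i + 1) = f (?r i) \<bullet> D X (?r i + 1)" for i h
  define rel where "rel i h h' \<longleftrightarrow> f (?r i + 1) = D B (?r i + 2) \<bullet> h' \<boxplus> h \<bullet> D X (?r i + 1)" for i h h'
  have "\<exists>s. \<forall>i. ivt i (s i) \<and> rel i (s i) (s (Suc i))"
  proof (rule dependent_nat_choice)
    have "f (N - 1) = zer (ob X (N - 1)) (ob B (N - 1))"
      using zero_object_arr_from[OF z[of "N - 1"], of "f (N - 1)"] by simp
    then show "\<exists>x. ivt 0 x"
      by (intro exI[of _ "zer (ob X (N - 1)) (ob B N)"]) (simp add: ivt_def)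
    fix h i assume "ivt i h"
    then have h: "arr h" "src h = ob X (?r i)" "tgt h = ob B (?r i + 1)"
      "D B (?r i + 1) \<bullet> h \<bullet> D X (?r i + 1) = f (?r i) \<bullet> D X (?r i + 1)" by (auto simp: ivt_def)
    define r where "r = ?r i"
    have r: "?r (Suc i) = r + 1" by (simp add: r_def)
    note h = h[folded r_def]
    let ?x = "f (r + 1) \<boxplus> \<boxminus> (h \<bullet> D X (r + 1))"
    obtain h' where h': "arr h'" "src h' = src ?x" "tgt h' = ob B (r + 1 + 1)" "D B (r + 1 + 1) \<bullet> h' = ?x"
      by (rule ex_atE[OF e[of "r + 1"], of ?x]) (use P h cmapD(6)[OF f, of "r + 1"] in simp_all)
    have fr: "f (r + 1) = D B (r + 2) \<bullet> h' \<boxplus> h \<bullet> D X (r + 1)"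
      using h' h(1-3) by (simp add: add_ac)
    have "f (r + 1) \<bullet> D X (r + 2) = D B (r + 2) \<bullet> h' \<bullet> D X (r + 2)"
      unfolding fr using h'(1-3) h(1-3) by simp
    then have "ivt (Suc i) h'" unfolding ivt_def r using h' h(1-3) by (simp add: add.commute[of _ 2])
    moreover have "rel i h h'" unfolding rel_def r_def[symmetric] using fr by simp
    ultimately show "\<exists>y. ivt (Suc i) y \<and> rel i h y" by blast
  qed
  then obtain s where s: "\<And>i. ivt i (s i)" "\<And>i. rel i (s i) (s (Suc i))" by blast
  define h where "h m = (if m < N then zer (ob X m) (ob B (m + 1)) else s (nat (m - (N - 1))))" for m
  have hi: "h (?r i) = s i" for i
  proof (cases i)
    case 0
    have "s 0 = zer (ob X (N - 1)) (ob B N)"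
      using s(1)[of 0] zero_object_arr_from[OF z[of "N - 1"], of "s 0"] by (simp add: ivt_def)
    then show ?thesis using 0 by (simp add: h_def)
  qed (simp add: h_def nat_add_distrib)
  have th: "isar (h m) (ob X m) (ob B (m + 1))" for m
  proof (cases "m < N")
    case False
    then have "m = ?r (nat (m - (N - 1)))" by simp
    then show ?thesis using s(1)[of "nat (m - (N - 1))"] hi by (metis ivt_def)
  qed (simp add: h_def)
  have "f m = D B (m + 1) \<bullet> h m \<boxplus> h (m - 1) \<bullet> D X m" for m
  proof (cases "m < N")
    case True
    show ?thesis
      using zero_object_arr_from[OF z[OF True], of "f m"] th[of "m - 1"]
        zero_object_arr_from[OF z[OF True], of "D B (m + 1) \<bullet> h m \<boxplus> h (m - 1) \<bullet> D X m"] th[of m] by simp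
  next
    case False
    define i where "i = nat (m - N)"
    have m: "m = ?r (Suc i)" "m - 1 = ?r i" "?r i + 1 = m" "?r i + 2 = m + 1" using False by (simp_all add: i_def)
    have "h m = s (Suc i)" using hi[of "Suc i"] by (simp only: m(1))
    moreover have "h (m - 1) = s i" using hi[of i] by (simp only: m(2))
    ultimately show ?thesis using s(2)[of i] unfolding rel_def m(3,4) by (simp only:)
  qed
  then show "nullh X B f" unfolding nullh_def using th by blast
qed (use P in simp_all)

text \<open>The flag \<open>b\<close> negates the differential. Cycles of degree \<open>n\<close> in
  a Hom complex are chain maps into the shift by \<open>n\<close>, negated for odd \<open>n\<close>,
  whereas AB4-k is transported by shifts without sign.\<close>

definition Sh :: "bool \<Rightarrow> int \<Rightarrow> ('o, 'm) cplx \<Rightarrow> ('o, 'm) cplx" where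
  "Sh b k N = mkc (\<lambda>i. ob N (i + k)) (\<lambda>i. if b then \<boxminus> D N (i + k) else D N (i + k))"

lemma shift_index: "(i :: int) - 1 + k = i + k - 1" "i - 2 + k = i + k - 2" "i + 1 + k = i + k + 1"
  by simp_all

lemma ob_Sh [simp]: "ob (Sh b k N) i = ob N (i + k)"
  by (simp add: Sh_def)

lemma D_Sh: "is_cplx C N \<Longrightarrow> D (Sh b k N) i = (if b then \<boxminus> D N (i + k) else D N (i + k))"
  unfolding Sh_def by (rule D_mkc) (simp add: shift_index)

lemma is_cplx_Sh [simp]: "is_cplx C N \<Longrightarrow> is_cplx C (Sh b k N)"
  unfolding is_cplx_iff[of "Sh b k N"] by (simp add: D_Sh shift_index)

lemma ex_at_Sh:
  assumes N [simp]: "is_cplx C N" and e: "ex_at N (n + k)"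
  shows "ex_at (Sh b k N) n"
proof (rule ex_atI)
  fix P x assume P: "P \<in> Proj C" and x: "arr x" "src x = P" "tgt x = ob (Sh b k N) n" "D (Sh b k N) n \<bullet> x = zer P (ob (Sh b k N) (n - 1))"
  have z: "D N (n + k) \<bullet> x = zer P (ob N (n + k - 1))"
  proof (cases b)
    case True
    then have "\<boxminus> (D N (n + k) \<bullet> x) = zer P (ob N (n + k - 1))" using x by (simp add: D_Sh shift_index)
    then have "\<boxminus> \<boxminus> (D N (n + k) \<bullet> x) = \<boxminus> zer P (ob N (n + k - 1))" by (simp only:)
    then show ?thesis using x(1-3) by simp
  qed (use x in \<open>simp add: D_Sh shift_index\<close>)
  obtain y where y: "arr y" "src y = src x" "tgt y = ob N (n + k + 1)" "D N (n + k + 1) \<bullet> y = x"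
    by (rule ex_atE[OF e, of x]) (use x(1-3) P z in simp_all)
  show "\<exists>y. isar y P (ob (Sh b k N) (n + 1)) \<and> D (Sh b k N) (n + 1) \<bullet> y = x"
    using y x(2) by (intro exI[of _ "if b then \<boxminus> y else y"]) (auto simp: D_Sh shift_index)
qed

lemma acyclic_Sh: "N \<in> acyclics C \<Longrightarrow> Sh b k N \<in> acyclics C"
  by (simp add: acyclic_iff ex_at_Sh)

lemma kprojI:
  assumes "is_cplx C X" "\<And>n. ob X n \<in> Proj C" "\<And>N f. \<lbrakk>N \<in> acyclics C; cmap X N f\<rbrakk> \<Longrightarrow> nullh X N f"
  shows "kproj X"
  using assms by (simp add: kproj_def)

lemma nullhI:
  assumes "\<And>n. arr (h n)" "\<And>n. src (h n) = ob X n" "\<And>n. tgt (h n) = ob N (n + 1)"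
    "\<And>n. f n = D N (n + 1) \<bullet> h n \<boxplus> h (n - 1) \<bullet> D X n"
  shows "nullh X N f"
  using assms unfolding nullh_def by blast

text \<open>A chain map out of the suspension is a chain map from \<open>X\<close> into the shift of
  \<open>N\<close> with negated differential, which is again acyclic.\<close>

lemma kproj_Sg:
  assumes X: "kproj X" shows "kproj (Sg X)"
proof (rule kprojI)
  note [simp] = kprojD[OF X]
  show "is_cplx C (Sg X)" "ob (Sg X) n \<in> Proj C" for n by simp_all
  fix N f assume N: "N \<in> acyclics C" and f: "cmap (Sg X) N f"
  note [simp] = cmapD(2-5)[OF f]
  have c: "cmap X (Sh True 1 N) (\<lambda>i. f (i + 1))"
    unfolding cmap_def using cmapD(6)[OF f] by (simp add: D_Sh)
  obtain h where h: "\<And>n. arr (h n)" "\<And>n. src (h n) = ob X n" "\<And>n. tgt (h n) = ob (Sh True 1 N) (n + 1)"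
    "\<And>n. f (n + 1) = D (Sh True 1 N) (n + 1) \<bullet> h n \<boxplus> h (n - 1) \<bullet> D X n"
    by (rule kproj_nullh[OF X acyclic_Sh[OF N, of True 1] c]) blast
  show "nullh (Sg X) N f"
  proof (rule nullhI[of "\<lambda>n. \<boxminus> h (n - 1)"])
    fix n
    have "f n = \<boxminus> D N (n + 1) \<bullet> h (n - 1) \<boxplus> h (n - 1 - 1) \<bullet> D X (n - 1)"
      using h(4)[of "n - 1"] by (simp add: D_Sh)
    then show "f n = D N (n + 1) \<bullet> \<boxminus> h (n - 1) \<boxplus> \<boxminus> h (n - 1 - 1) \<bullet> D (Sg X) n"
      using h(1,2) by simp
  qed (use h(1-3) in simp_all)
qed

text \<open>The restriction to \<open>B\<close> is null homotopic by some \<open>h\<close>.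
  Subtracting \<open>h \<theta>\<close> from the restriction to \<open>A\<close> makes it a chain
  map \<open>w\<close>, and a null homotopy of \<open>w\<close> completes \<open>h\<close>.\<close>

lemma kproj_Tw:
  assumes t: "twist B A \<theta>" and B: "kproj B" and A: "kproj A"
  shows "kproj (Tw B A \<theta>)"
proof (rule kprojI)
  note tt [simp] = twistD(1-5)[OF t]
  show "is_cplx C (Tw B A \<theta>)" "ob (Tw B A \<theta>) n \<in> Proj C" for n using t A B by (simp_all add: Proj_Bip kprojD)
  fix N f assume N: "N \<in> acyclics C" and f: "cmap (Tw B A \<theta>) N f"
  note [simp] = cmapD(2-5)[OF f]
  define u where "u n = f n \<bullet> in1 (ob B n) (ob A n)" for n
  define v where "v n = f n \<bullet> in2 (ob B n) (ob A n)" for n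
  have tv [simp]: "arr (v n)" "src (v n) = ob A n" "tgt (v n) = ob N n" for n by (simp_all add: v_def)
  have u: "cmap B N u" unfolding u_def by (rule cmap_cmp[OF cmap_in1[OF t] f])
  note [simp] = cmapD(3-5)[OF u]
  have fc: "f n = cop (u n) (v n)" for n
    using cop_eta[of "f n" "ob B n" "ob A n"] by (simp add: u_def v_def)
  have dv: "D N n \<bullet> v n = u (n - 1) \<bullet> \<theta> n \<boxplus> v (n - 1) \<bullet> D A n" for n
  proof -
    have "D N n \<bullet> v n = f (n - 1) \<bullet> D (Tw B A \<theta>) n \<bullet> in2 (ob B n) (ob A n)"
      unfolding v_def by (simp add: cmapD(7)[OF f])
    also have "\<dots> = cop (u (n - 1)) (v (n - 1)) \<bullet> pair (\<theta> n) (D A n)"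
      by (simp only: D_Tw_in2[OF t] fc)
    finally show ?thesis by simp
  qed
  obtain h where h: "\<And>n. arr (h n)" "\<And>n. src (h n) = ob B n" "\<And>n. tgt (h n) = ob N (n + 1)"
    "\<And>n. u n = D N (n + 1) \<bullet> h n \<boxplus> h (n - 1) \<bullet> D B n"
    by (rule kproj_nullh[OF B N u]) blast
  note [simp] = h(1-3)
  define w where "w n = v n \<boxplus> \<boxminus> (h (n - 1) \<bullet> \<theta> n)" for n
  have tw [simp]: "arr (w n)" "src (w n) = ob A n" "tgt (w n) = ob N n" for n by (simp_all add: w_def)
  have w: "cmap A N w"
    unfolding cmap_def
  proof (intro conjI allI)
    fix n
    have "u (n - 1) = D N n \<bullet> h (n - 1) \<boxplus> h (n - 1 - 1) \<bullet> D B (n - 1)" using h(4)[of "n - 1"] by simp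
    then show "D N n \<bullet> w n = w (n - 1) \<bullet> D A n"
      unfolding w_def by (simp add: dv canc twistD(7)[OF t] twistD(6)[OF t])
  qed simp_all
  obtain k where k: "\<And>n. arr (k n)" "\<And>n. src (k n) = ob A n" "\<And>n. tgt (k n) = ob N (n + 1)"
    "\<And>n. w n = D N (n + 1) \<bullet> k n \<boxplus> k (n - 1) \<bullet> D A n"
    by (rule kproj_nullh[OF A N w]) blast
  note [simp] = k(1-3)
  show "nullh (Tw B A \<theta>) N f"
  proof (rule nullhI[of "\<lambda>n. cop (h n) (k n)"])
    fix n
    have v: "v n = w n \<boxplus> h (n - 1) \<bullet> \<theta> n" by (simp add: w_def canc)
    show "f n = D N (n + 1) \<bullet> cop (h n) (k n) \<boxplus> cop (h (n - 1)) (k (n - 1)) \<bullet> D (Tw B A \<theta>) n"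
    proof (rule bip_ext[of _ _ "ob B n" "ob A n"])
      have "cop (h (n - 1)) (k (n - 1)) \<bullet> D (Tw B A \<theta>) n \<bullet> in1 (ob B n) (ob A n) = h (n - 1) \<bullet> D B n"
        unfolding D_Tw_in1[OF t] by (simp add: cop_in(1)[THEN cmp_reassoc])
      then show "f n \<bullet> in1 (ob B n) (ob A n) = (D N (n + 1) \<bullet> cop (h n) (k n) \<boxplus> cop (h (n - 1)) (k (n - 1)) \<bullet> D (Tw B A \<theta>) n) \<bullet> in1 (ob B n) (ob A n)"
        using h(4)[of n] by (simp flip: u_def)
      have "cop (h (n - 1)) (k (n - 1)) \<bullet> D (Tw B A \<theta>) n \<bullet> in2 (ob B n) (ob A n) = h (n - 1) \<bullet> \<theta> n \<boxplus> k (n - 1) \<bullet> D A n"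
        unfolding D_Tw_in2[OF t] by simp
      then show "f n \<bullet> in2 (ob B n) (ob A n) = (D N (n + 1) \<bullet> cop (h n) (k n) \<boxplus> cop (h (n - 1)) (k (n - 1)) \<bullet> D (Tw B A \<theta>) n) \<bullet> in2 (ob B n) (ob A n)"
        using k(4)[of n] v by (simp add: add_ac flip: v_def)
    qed (simp_all add: t)
  qed simp_all
qed

lemma kproj_retract:
  assumes Y: "kproj Y" and s: "cmap X Y s" and r: "cmap Y X r" and rs: "\<And>n. r n \<bullet> s n = idn (ob X n)"
  shows "kproj X"
proof (rule kprojI)
  note [simp] = cmapD(1-5)[OF s] cmapD(1-5)[OF r]
  show "is_cplx C X" by simp
  show "ob X n \<in> Proj C" for n by (rule Proj_retract[OF kprojD(2)[OF Y, of n], of "s n" _ "r n"]) (simp_all add: rs)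
  fix N f assume N: "N \<in> acyclics C" and f: "cmap X N f"
  note [simp] = cmapD(1-5)[OF f]
  obtain h where h: "\<And>n. arr (h n)" "\<And>n. src (h n) = ob Y n" "\<And>n. tgt (h n) = ob N (n + 1)"
    "\<And>n. f n \<bullet> r n = D N (n + 1) \<bullet> h n \<boxplus> h (n - 1) \<bullet> D Y n"
    by (rule kproj_nullh[OF Y N cmap_cmp[OF r f]]) blast
  show "nullh X N f"
  proof (rule nullhI[of "\<lambda>n. h n \<bullet> s n"])
    fix n
    have "f n = f n \<bullet> r n \<bullet> s n" by (simp add: rs)
    also have "\<dots> = (D N (n + 1) \<bullet> h n \<boxplus> h (n - 1) \<bullet> D Y n) \<bullet> s n" by (simp only: h(4)[symmetric] cmp_assoc)
    also have "\<dots> = D N (n + 1) \<bullet> (h n \<bullet> s n) \<boxplus> (h (n - 1) \<bullet> s (n - 1)) \<bullet> D X n" using h(1-3) by (simp add: cmapD(6)[OF s])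
    finally show "f n = D N (n + 1) \<bullet> (h n \<bullet> s n) \<boxplus> (h (n - 1) \<bullet> s (n - 1)) \<bullet> D X n" .
  qed (use h(1-3) in simp_all)
qed

text \<open>A countable coproduct in terms of arrows. Existence and uniqueness of the induced arrow
  are separate, so that uniqueness serves as an extensionality rule.\<close>

definition cpr :: "(nat \<Rightarrow> ('o, 'm) arrow) \<Rightarrow> 'o \<Rightarrow> bool" where
  "cpr j S \<longleftrightarrow> S \<in> Obj C \<and> (\<forall>m. arr (j m) \<and> tgt (j m) = S) \<and>
     (\<forall>T g. (\<forall>m. isar (g m) (src (j m)) T) \<longrightarrow> (\<exists>h. isar h S T \<and> (\<forall>m. h \<bullet> j m = g m))) \<and>
     (\<forall>h h'. arr h \<and> arr h' \<and> src h = S \<and> src h' = S \<and> tgt h = tgt h' \<and> (\<forall>m. h \<bullet> j m = h' \<bullet> j m) \<longrightarrow> h = h')"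

lemma cprD: "cpr j S \<Longrightarrow> arr (j m)" "cpr j S \<Longrightarrow> tgt (j m) = S" "cpr j S \<Longrightarrow> S \<in> Obj C"
  unfolding cpr_def by blast+

lemma cpr_desc:
  assumes "cpr j S" "\<And>m. isar (g m) (src (j m)) T"
  shows "\<exists>h. isar h S T \<and> (\<forall>m. h \<bullet> j m = g m)"
  using assms unfolding cpr_def by blast

lemma cpr_ext:
  assumes "cpr j S" "\<And>m. h \<bullet> j m = h' \<bullet> j m" "arr h" "arr h'" "src h = S" "src h' = S" "tgt h = tgt h'"
  shows "h = h'"
  using assms unfolding cpr_def by blast

lemma cpr_of_coproduct:
  assumes c: "is_coproduct C UNIV P S j" and P: "\<And>m. P m \<in> Obj C"
  shows "cpr (\<lambda>m. Arrow (P m) S (j m)) S"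
  unfolding cpr_def
proof (intro conjI allI impI)
  have S: "S \<in> Obj C" and j: "\<And>n. j n \<in> Hom C (P n) S"
    and u: "\<And>T g. \<lbrakk>T \<in> Obj C; \<And>n. g n \<in> Hom C (P n) T\<rbrakk> \<Longrightarrow> \<exists>!h. h \<in> Hom C S T \<and> (\<forall>n. h \<cdot> j n = g n)"
    using c by (auto simp: is_coproduct_def)
  show "S \<in> Obj C" "arr (Arrow (P m) S (j m))" "tgt (Arrow (P m) S (j m)) = S" for m using S j P by simp_all
  fix T g assume g: "\<forall>m. isar (g m) (src (Arrow (P m) S (j m))) T"
  then have T: "T \<in> Obj C" using tgt_in_Obj[of "g 0"] by simp
  have "val (g m) \<in> Hom C (P m) T" for m using g by (intro val_Hom) simp
  then obtain h where h: "h \<in> Hom C S T" "\<And>m. h \<cdot> j m = val (g m)" using u[OF T, of "\<lambda>m. val (g m)"] by blast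
  have "Arrow S T h \<bullet> Arrow (P m) S (j m) = g m" for m
    using h S T P j Arrow_val[of "g m" "P m" T] g by (simp add: cmp_Arrow)
  then show "\<exists>h. isar h S T \<and> (\<forall>m. h \<bullet> Arrow (P m) S (j m) = g m)" using h(1) S T by (intro exI[of _ "Arrow S T h"]) simp
next
  have S: "S \<in> Obj C" and j: "\<And>n. j n \<in> Hom C (P n) S"
    and u: "\<And>T g. \<lbrakk>T \<in> Obj C; \<And>n. g n \<in> Hom C (P n) T\<rbrakk> \<Longrightarrow> \<exists>!h. h \<in> Hom C S T \<and> (\<forall>n. h \<cdot> j n = g n)"
    using c by (auto simp: is_coproduct_def)
  fix h h' assume a: "arr h \<and> arr h' \<and> src h = S \<and> src h' = S \<and> tgt h = tgt h' \<and> (\<forall>m. h \<bullet> Arrow (P m) S (j m) = h' \<bullet> Arrow (P m) S (j m))"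
  then have v: "val h \<in> Hom C S (tgt h)" "val h' \<in> Hom C S (tgt h)" by (auto intro!: val_Hom)
  have e: "val h \<cdot> j m = val h' \<cdot> j m" for m
    using a val_cmp[of h "Arrow (P m) S (j m)"] val_cmp[of h' "Arrow (P m) S (j m)"] P S j by simp
  have "val h \<cdot> j m \<in> Hom C (P m) (tgt h)" for m
    using comp_closed[of "P m" S "tgt h" "j m" "val h"] P S j v a by simp
  then have "\<exists>!x. x \<in> Hom C S (tgt h) \<and> (\<forall>n. x \<cdot> j n = val h \<cdot> j n)" using u[of "tgt h" "\<lambda>n. val h \<cdot> j n"] a by simp
  then have "val h = val h'" using v e by metis
  then show "h = h'" using a by (intro arrow_eqI) simp_all
qed

text \<open>The coproduct is formed degreewise, so null homotopies chosen on the summands assemble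
  without any compatibility between them.\<close>

lemma kproj_cpr:
  assumes P: "\<And>m. kproj (P m)" and S [simp]: "is_cplx C S" and SP: "\<And>n. ob S n \<in> Proj C"
    and j: "\<And>m. cmap (P m) S (j m)" and c: "\<And>n. cpr (\<lambda>m. j m n) (ob S n)"
  shows "kproj S"
proof (rule kprojI)
  note [simp] = cmapD(1-5)[OF j]
  fix N f assume N: "N \<in> acyclics C" and f: "cmap S N f"
  note [simp] = cmapD(2-5)[OF f]
  have "\<exists>h. (\<forall>n. isar (h n) (ob (P m) n) (ob N (n + 1))) \<and> (\<forall>n. f n \<bullet> j m n = D N (n + 1) \<bullet> h n \<boxplus> h (n - 1) \<bullet> D (P m) n)" for m
    using P[of m] N cmap_cmp[OF j[of m] f] unfolding kproj_def nullh_def by blast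
  then obtain H where H: "\<And>m n. isar (H m n) (ob (P m) n) (ob N (n + 1))"
    "\<And>m n. f n \<bullet> j m n = D N (n + 1) \<bullet> H m n \<boxplus> H m (n - 1) \<bullet> D (P m) n" by metis
  have "\<exists>h. isar h (ob S n) (ob N (n + 1)) \<and> (\<forall>m. h \<bullet> j m n = H m n)" for n
    by (rule cpr_desc[OF c]) (use H(1) in simp)
  then obtain h where h: "\<And>n. isar (h n) (ob S n) (ob N (n + 1))" "\<And>n m. h n \<bullet> j m n = H m n" by metis
  show "nullh S N f"
  proof (rule nullhI[of h])
    fix n
    show "f n = D N (n + 1) \<bullet> h n \<boxplus> h (n - 1) \<bullet> D S n"
      by (rule cpr_ext[OF c[of n]])
         (use h(1) in \<open>simp_all add: h(2) H(2) cmapD(6)[OF j] h(2)[THEN cmp_reassoc]\<close>)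
  qed (use h in simp_all)
qed (use SP in simp_all)

subsection \<open>Approximation by bounded below complexes\<close>

lemma cmap_from_cpr:
  assumes j: "\<And>m. cmap (P m) S (j m)" and c: "\<And>n. cpr (\<lambda>m. j m n) (ob S n)" and g: "\<And>m. cmap (P m) T (g m)"
  obtains h where "cmap S T h" "\<And>m n. h n \<bullet> j m n = g m n"
proof -
  note [simp] = cmapD(1-5)[OF j] cmapD(1-5)[OF g]
  have "\<exists>h. isar h (ob S n) (ob T n) \<and> (\<forall>m. h \<bullet> j m n = g m n)" for n
    by (rule cpr_desc[OF c]) simp
  then obtain h where h: "\<And>n. isar (h n) (ob S n) (ob T n)" "\<And>n m. h n \<bullet> j m n = g m n" by metis
  have "cmap S T h"
    unfolding cmap_def
  proof (intro conjI allI)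
    fix n
    show "D T n \<bullet> h n = h (n - 1) \<bullet> D S n"
      by (rule cpr_ext[OF c[of n]])
         (use h(1) in \<open>simp_all add: h(2) cmapD(6)[OF j] cmapD(6)[OF g] h(2)[THEN cmp_reassoc]\<close>)
  qed (use h(1) cmapD(1,2)[OF j[of 0]] cmapD(2)[OF g[of 0]] in simp_all)
  then show ?thesis using that h(2) by blast
qed

lemma cmap_Sh:
  assumes "cmap X Y f" shows "cmap (Sh False c X) (Sh False c Y) (\<lambda>r. f (r + c))"
  unfolding cmap_def using cmapD[OF assms] by (simp add: D_Sh shift_index)

lemma cmap_Sh_swap:
  assumes X: "is_cplx C X" and f: "cmap (Sh False c X) Y f" shows "cmap X (Sh False (- c) Y) (\<lambda>r. f (r - c))"
  unfolding cmap_def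
proof (intro conjI allI)
  fix n
  have i: "n - 1 - c = n - c - 1" by simp
  show "D (Sh False (- c) Y) n \<bullet> f (n - c) = f (n - 1 - c) \<bullet> D X n"
    unfolding i using cmapD(6)[OF f, of "n - c"] X cmapD(2)[OF f] by (simp add: D_Sh)
qed (use X cmapD[OF f] in simp_all)

lemma cmap_Sh_swap':
  assumes X: "is_cplx C X" and f: "cmap Y (Sh False c X) f" shows "cmap (Sh False (- c) Y) X (\<lambda>r. f (r - c))"
  unfolding cmap_def
proof (intro conjI allI)
  fix n
  have i: "n - 1 - c = n - c - 1" by simp
  show "D X n \<bullet> f (n - c) = f (n - 1 - c) \<bullet> D (Sh False (- c) Y) n"
    unfolding i using cmapD(6)[OF f, of "n - c"] X cmapD(1)[OF f] by (simp add: D_Sh)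
qed (use X cmapD[OF f] in simp_all)

lemma cone_pairE:
  assumes "cmap A X f" "arr z" "src z = P" "tgt z = ob (cone A X f) n"
  obtains b a where "arr b" "arr a" "src b = P" "src a = P" "tgt b = ob X n" "tgt a = ob A (n - 1)" "z = pair b a"
proof -
  have "tgt z = Bip (ob X n) (ob (Sg A) n)" using assms(4) by simp
  from Tw_pairE[OF twist_cone[OF assms(1)] assms(2,3) this] show ?thesis using that by (metis ob_Sg)
qed

text \<open>Families over the stages of a sequence stopped at \<open>n\<close> are anchored at
  \<open>n\<close>, where the value is known, and continued in both directions. Such families are
  obtained from \<open>nat_bidirectional_rec\<close>, and this rule proves facts about them.\<close>

lemma nat_bidirectional_induct:
  fixes n :: nat
  assumes "Q n" "\<And>m. n \<le> m \<Longrightarrow> Q m \<Longrightarrow> Q (Suc m)" "\<And>m. m < n \<Longrightarrow> Q (Suc m) \<Longrightarrow> Q m"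
  shows "Q m"
proof (cases "n \<le> m")
  case True
  then show ?thesis by (induction rule: dec_induct) (use assms in auto)
next
  case False
  then have "m \<le> n" by simp
  then show ?thesis by (induction rule: inc_induct) (use assms in auto)
qed

lemma nat_bidirectional_rec:
  fixes n :: nat
  obtains F where "F n = z" "\<And>m. n \<le> m \<Longrightarrow> F (Suc m) = up m (F m)" "\<And>m. m < n \<Longrightarrow> F m = down m (F (Suc m))"
proof -
  define F where "F m = (if n \<le> m then rec_nat z (\<lambda>i. up (n + i)) (m - n) else rec_nat z (\<lambda>i. down (n - Suc i)) (n - m))" for m
  show ?thesis
  proof (rule that[of F])
    show "F n = z" by (simp add: F_def)
    show "F (Suc m) = up m (F m)" if "n \<le> m" for m using that by (simp add: F_def Suc_diff_le)
    show "F m = down m (F (Suc m))" if "m < n" for m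
    proof -
      have "n - m = Suc (n - Suc m)" using that by simp
      moreover have "F (Suc m) = rec_nat z (\<lambda>i. down (n - Suc i)) (n - Suc m)"
        using that by (cases "Suc m = n") (simp_all add: F_def)
      ultimately show ?thesis using that by (simp add: F_def)
    qed
  qed
qed

lemma bounded_below_Bip:
  assumes "bounded_below C A" "bounded_below C B" "\<And>m. ob T m = Bip (ob A m) (ob B (m - e))" "e \<ge> 0"
  shows "bounded_below C T"
proof -
  obtain M N where "\<And>m. m < M \<Longrightarrow> is_zero_object C (ob A m)" "\<And>m. m < N \<Longrightarrow> is_zero_object C (ob B m)"
    using assms(1,2) by (auto simp: bounded_below_def)
  then have "\<forall>m < min M N. is_zero_object C (ob T m)" using assms(3,4) by (simp add: zero_object_Bip)
  then show ?thesis unfolding bounded_below_def by blast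
qed

text \<open>A resolution of the cone that vanishes below \<open>N + 1\<close> has the lifting
  property from degree \<open>N\<close> on, and the twisted sum with it remains bounded below. The
  difference of one is that of \<open>resolution_from\<close>.\<close>

lemma partial_factorization:
  assumes f: "cmap A X f" and A: "\<And>n. ob A n \<in> Proj C" "bounded_below C A"
  obtains B \<pi> s where "cmap B X \<pi>" "\<And>n. ob B n \<in> Proj C" "bounded_below C B" "cmap A B s"
    "\<And>n. \<pi> n \<bullet> s n = f n" "\<And>m. N \<le> m \<Longrightarrow> lifting B X \<pi> m"
proof -
  obtain Q g where Q: "cmap Q (cone A X f) g" "\<And>n. ob Q n \<in> Proj C" "\<And>m. m < N + 1 \<Longrightarrow> is_zero_object C (ob Q m)"
    "\<And>m. N + 1 - 1 \<le> m \<Longrightarrow> lifting Q (cone A X f) g m"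
    using resolution_from[OF is_cplx_cone[OF f], of "N + 1"] by metis
  obtain \<theta> \<pi> where t: "twist A Q \<theta>" "cmap (Tw A Q \<theta>) X \<pi>" "\<And>n. \<pi> n \<bullet> in1 (ob A n) (ob Q n) = f n"
    "\<And>m. lifting Q (cone A X f) g m \<Longrightarrow> lifting (Tw A Q \<theta>) X \<pi> m"
    using lifting_factorization[OF f Q(1)] by metis
  have "bounded_below C Q" using Q(3) unfolding bounded_below_def by blast
  then have bb: "bounded_below C (Tw A Q \<theta>)" by (rule bounded_below_Bip[OF A(2), of Q _ 0]) simp_all
  show ?thesis
    by (rule that[OF t(2) _ bb cmap_in1[OF t(1)] t(3)]) (use A(1) Q(2,4) t(4) in \<open>simp_all add: Proj_Bip\<close>)
qed

lemma zero_cplx: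
  obtains Z where "is_cplx C Z" "\<And>n. is_zero_object C (ob Z n)"
proof -
  obtain Z where Z: "is_zero_object C Z" using zero_object by blast
  then have "Z \<in> Obj C" by (simp add: is_zero_object_def)
  then have "is_cplx C (mkc (\<lambda>_. Z) (\<lambda>_. zer Z Z))" by (intro is_cplx_mkc) simp_all
  then show ?thesis by (rule that) (simp add: Z)
qed

lemma cmap_zer: "is_cplx C X \<Longrightarrow> is_cplx C Y \<Longrightarrow> cmap X Y (\<lambda>n. zer (ob X n) (ob Y n))"
  by (simp add: cmap_def)

text \<open>The zero complex over \<open>X\<close> is the start, and each stage factors the
  augmentation of the previous one by \<open>partial_factorization\<close>. Hence the transition
  maps commute with the augmentations, while the degree from which \<open>X\<close> is resolved
  decreases by one.\<close>

lemma approximating_sequence: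
  assumes X: "is_cplx C X"
  obtains P \<pi> s where "\<And>n. cmap (P n) X (\<pi> n)" "\<And>n r. ob (P n) r \<in> Proj C" "\<And>n. bounded_below C (P n)"
    "\<And>n. cmap (P n) (P (Suc n)) (s n)" "\<And>n r. \<pi> (Suc n) r \<bullet> s n r = \<pi> n r"
    "\<And>n m. - int n \<le> m \<Longrightarrow> lifting (P n) X (\<pi> n) m"
proof -
  define ivt where "ivt n p \<longleftrightarrow> (case p of (P, \<pi>) \<Rightarrow> cmap P X \<pi> \<and> (\<forall>r. ob P r \<in> Proj C) \<and> bounded_below C P \<and>
    (\<forall>m. - int n \<le> m \<longrightarrow> lifting P X \<pi> m))" for n p
  define rel where "rel (n :: nat) p p' \<longleftrightarrow> (case p of (P, \<pi>) \<Rightarrow> case p' of (P', \<pi>') \<Rightarrow>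
    \<exists>s. cmap P P' s \<and> (\<forall>r. \<pi>' r \<bullet> s r = \<pi> r))" for n p p'
  have step: "\<exists>p'. ivt n' p' \<and> rel n (P, \<pi>) p'" if p: "cmap P X \<pi>" "\<And>r. ob P r \<in> Proj C" "bounded_below C P" for P \<pi> n n'
  proof -
    obtain B \<pi>' s where "cmap B X \<pi>'" "\<And>n. ob B n \<in> Proj C" "bounded_below C B" "cmap P B s"
      "\<And>n. \<pi>' n \<bullet> s n = \<pi> n" "\<And>m. - int n' \<le> m \<Longrightarrow> lifting B X \<pi>' m"
      using partial_factorization[OF p, of "- int n'"] by metis
    then have "ivt n' (B, \<pi>') \<and> rel n (P, \<pi>) (B, \<pi>')" unfolding ivt_def rel_def by auto
    then show ?thesis by blast
  qed
  have "\<exists>p. \<forall>n. ivt n (p n) \<and> rel n (p n) (p (Suc n))"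
  proof (rule dependent_nat_choice)
    obtain Z where Z: "is_cplx C Z" "\<And>n. is_zero_object C (ob Z n)" using zero_cplx by blast
    then have "bounded_below C Z" by (auto simp: bounded_below_def)
    then show "\<exists>p. ivt 0 p" using step[OF cmap_zer[OF Z(1) X]] Z zero_object_Proj by blast
    show "\<exists>y. ivt (Suc n) y \<and> rel n x y" if i: "ivt n x" for x n
    proof -
      obtain P \<pi> where x: "x = (P, \<pi>)" by (cases x)
      have "cmap P X \<pi>" "\<And>r. ob P r \<in> Proj C" "bounded_below C P" using i by (simp_all add: ivt_def x)
      then show ?thesis unfolding x by (rule step)
    qed
  qed
  then obtain p where p: "\<And>n. ivt n (p n)" "\<And>n. rel n (p n) (p (Suc n))" by blast
  have "\<exists>s. cmap (fst (p n)) (fst (p (Suc n))) s \<and> (\<forall>r. snd (p (Suc n)) r \<bullet> s r = snd (p n) r)" for n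
    using p(2)[of n] unfolding rel_def by (simp add: case_prod_beta)
  then obtain s where "\<And>n. cmap (fst (p n)) (fst (p (Suc n))) (s n)" "\<And>n r. snd (p (Suc n)) r \<bullet> s n r = snd (p n) r"
    by metis
  moreover have "cmap (fst (p n)) X (snd (p n))" "ob (fst (p n)) r \<in> Proj C" "bounded_below C (fst (p n))"
    "- int n \<le> m \<Longrightarrow> lifting (fst (p n)) X (snd (p n)) m" for n r m
    using p(1)[of n] unfolding ivt_def by (simp_all add: case_prod_beta)
  ultimately show ?thesis using that[of "\<lambda>n. fst (p n)" "\<lambda>n. snd (p n)" s] by blast
qed

text \<open>A cycle \<open>(b, a)\<close> has \<open>a = d b\<close>, so it is the boundary of
  \<open>(0, - b)\<close>.\<close>

lemma ex_at_cone_id: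
  assumes X [simp]: "is_cplx C X" and f: "\<And>n. f n = idn (ob X n)"
  shows "ex_at (cone X X f) r"
proof (rule ex_atI)
  have c: "cmap X X f" using cmap_id[OF X] f by (simp add: cmap_def)
  fix P z assume P: "P \<in> Proj C" and z: "arr z" "src z = P" "tgt z = ob (cone X X f) r" "D (cone X X f) r \<bullet> z = zer P (ob (cone X X f) (r - 1))"
  note PO [simp] = Proj_Obj[OF P]
  obtain b a where q: "arr b" "arr a" "src b = P" "src a = P" "tgt b = ob X r" "tgt a = ob X (r - 1)" "z = pair b a"
    by (rule cone_pairE[OF c z(1-3)])
  have "pair (D X r \<bullet> b \<boxplus> \<boxminus> a) (\<boxminus> (D X (r - 1) \<bullet> a)) = zer P (Bip (ob X (r - 1)) (ob X (r - 1 - 1)))"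
    using z(4) q(1-6) unfolding q(7) by (simp add: D_cone_pair[OF c] f)
  then have "D X r \<bullet> b \<boxplus> \<boxminus> a = zer P (ob X (r - 1))"
    using q(1-6) by (simp add: pair_eq_zer_iff)
  then have e: "D X r \<bullet> b = a" using diff_zerD[of "D X r \<bullet> b" a] q(1-6) by simp
  have "D (cone X X f) (r + 1) \<bullet> pair (zer P (ob X (r + 1))) (\<boxminus> b) = z"
    using q(1-6) by (simp add: D_cone_pair[OF c] f e q(7))
  then show "\<exists>y. isar y P (ob (cone X X f) (r + 1)) \<and> D (cone X X f) (r + 1) \<bullet> y = z"
    using q(1-6) by (intro exI[of _ "pair (zer P (ob X (r + 1))) (\<boxminus> b)"]) simp
qed

text \<open>Two resolutions of \<open>X\<close> are compared over \<open>X\<close>. For a cycle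
  \<open>(b, a)\<close> the lifting property of \<open>A\<close> gives \<open>a'\<close> with
  boundary \<open>a\<close> and the same image in \<open>X\<close> as \<open>b\<close>; then
  \<open>b - s a'\<close> is a cycle with image zero and bounds by the lifting property of
  \<open>B\<close>. Degree \<open>r\<close> of the cone involves degree \<open>r - 1\<close> for
  \<open>A\<close>.\<close>

lemma ex_at_cone_lifting:
  assumes s: "cmap A B s" and pA: "cmap A X pA" and pB: "cmap B X pB" and e: "\<And>n. pB n \<bullet> s n = pA n"
    and lA: "lifting A X pA (r - 1)" and lB: "lifting B X pB r"
  shows "ex_at (cone A B s) r"
proof (rule ex_atI)
  note [simp] = cmapD(1-5)[OF s] cmapD(1-5)[OF pA] cmapD(1-5)[OF pB]
  fix P z assume P: "P \<in> Proj C" and z: "arr z" "src z = P" "tgt z = ob (cone A B s) r" "D (cone A B s) r \<bullet> z = zer P (ob (cone A B s) (r - 1))"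
  note PO [simp] = Proj_Obj[OF P]
  obtain b a where q: "arr b" "arr a" "src b = P" "src a = P" "tgt b = ob B r" "tgt a = ob A (r - 1)" "z = pair b a"
    by (rule cone_pairE[OF s z(1-3)])
  have "pair (D B r \<bullet> b \<boxplus> \<boxminus> (s (r - 1) \<bullet> a)) (\<boxminus> (D A (r - 1) \<bullet> a)) = zer P (Bip (ob B (r - 1)) (ob A (r - 1 - 1)))"
    using z(4) q(1-6) unfolding q(7) by (simp add: D_cone_pair[OF s])
  then have z1: "D B r \<bullet> b \<boxplus> \<boxminus> (s (r - 1) \<bullet> a) = zer P (ob B (r - 1))" and z2: "\<boxminus> (D A (r - 1) \<bullet> a) = zer P (ob A (r - 1 - 1))"
    using q(1-6) by (simp_all add: pair_eq_zer_iff)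
  have e1: "D B r \<bullet> b = s (r - 1) \<bullet> a" by (rule diff_zerD) (use z1 q(1-6) in simp_all)
  have e2: "D A (r - 1) \<bullet> a = zer P (ob A (r - 1 - 1))"
    using arg_cong[OF z2, of neg] q(1-6) by simp
  obtain a' where a': "arr a'" "src a' = P" "tgt a' = ob A (r - 1 + 1)" "D A (r - 1 + 1) \<bullet> a' = a" "pA (r - 1 + 1) \<bullet> a' = pB r \<bullet> b"
    by (rule liftingE[OF lA P, of a "pB r \<bullet> b"])
       (use q(1-6) e2 in \<open>simp_all add: cmapD(7)[OF pB] e1 e[THEN cmp_reassoc]\<close>)
  then have a': "arr a'" "src a' = P" "tgt a' = ob A r" "D A r \<bullet> a' = a" "pA r \<bullet> a' = pB r \<bullet> b" by simp_all
  obtain b' where b': "arr b'" "src b' = P" "tgt b' = ob B (r + 1)" "D B (r + 1) \<bullet> b' = b \<boxplus> \<boxminus> (s r \<bullet> a')" "pB (r + 1) \<bullet> b' = zer P (ob X (r + 1))"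
    by (rule liftingE[OF lB P, of "b \<boxplus> \<boxminus> (s r \<bullet> a')" "zer P (ob X (r + 1))"])
       (use q(1-6) a' in \<open>simp_all add: cmapD(7)[OF s] e1 e[THEN cmp_reassoc]\<close>)
  have "D (cone A B s) (r + 1) \<bullet> pair b' (\<boxminus> a') = z"
    using q(1-6) a' b' by (simp add: D_cone_pair[OF s] q(7) canc)
  then show "\<exists>y. isar y P (ob (cone A B s) (r + 1)) \<and> D (cone A B s) (r + 1) \<bullet> y = z"
    using b' a' by (intro exI[of _ "pair b' (\<boxminus> a')"]) simp
qed

end

section \<open>Coproducts of complexes and the use of AB4-k\<close>

locale AB4_category = projective_exact_category C for C :: "('o, 'm) excat" (structure) +
  fixes k :: int
  assumes coproducts: "countable_coproducts_of_projectives C"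
    and AB4: "projectives_AB4 C k"
begin

text \<open>This coproduct is formed in each degree. A coproduct in \<open>Ch C\<close> with a bound
  on its homology comes from AB4-k instead, and \<open>telescope_stage\<close> compares the
  two.\<close>

lemma coproduct_cplx:
  assumes P: "\<And>m :: nat. is_cplx C (P m)" "\<And>m n. ob (P m) n \<in> Proj C"
  obtains S j where "is_cplx C S" "\<And>n. ob S n \<in> Proj C" "\<And>m. cmap (P m) S (j m)" "\<And>n. cpr (\<lambda>m. j m n) (ob S n)"
proof -
  note [simp] = P(1)
  have "\<exists>S j. is_coproduct C UNIV (\<lambda>m. ob (P m) n) S j" for n
    using coproducts[unfolded countable_coproducts_of_projectives_def, rule_format, of UNIV "\<lambda>m. ob (P m) n"] P(2) by simp
  then obtain w j0 where w: "\<And>n. is_coproduct C UNIV (\<lambda>m. ob (P m) n) (w n) (j0 n)" by metis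
  define j where "j m n = Arrow (ob (P m) n) (w n) (j0 n m)" for m n
  have c: "cpr (\<lambda>m. j m n) (w n)" for n unfolding j_def by (rule cpr_of_coproduct[OF w]) simp
  have wP: "w n \<in> Proj C" for n by (rule Proj_coproduct[OF _ w[of n]]) (simp add: P(2))
  have [simp]: "src (j m n) = ob (P m) n" "tgt (j m n) = w n" for m n by (simp_all add: j_def)
  have [simp]: "arr (j m n)" for m n using cprD(1)[OF c] .
  have "\<exists>d. isar d (w n) (w (n - 1)) \<and> (\<forall>m. d \<bullet> j m n = j m (n - 1) \<bullet> D (P m) n)" for n
    by (rule cpr_desc[OF c[of n]]) simp
  then obtain d where d: "\<And>n. isar (d n) (w n) (w (n - 1))" "\<And>n m. d n \<bullet> j m n = j m (n - 1) \<bullet> D (P m) n" by metis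
  have dd: "d (n - 1) \<bullet> d n = zer (w n) (w (n - 1 - 1))" for n
    by (rule cpr_ext[OF c[of n]]) (use d(1) wP in \<open>simp_all add: d(2) d(2)[THEN cmp_reassoc]\<close>)
  define S where "S = mkc w d"
  have S: "is_cplx C S" unfolding S_def by (rule is_cplx_mkc) (use d(1) dd in blast)+
  have DS: "D S n = d n" for n unfolding S_def by (rule D_mkc[of d n w, OF d(1)])
  have oS: "ob S = w" by (simp add: S_def)
  show ?thesis
    by (rule that[of S j]) (use S c wP in \<open>simp_all add: oS cmap_def DS d(2)\<close>)
qed

text \<open>AB4-k is applied after shifting by \<open>c\<close>: the summands then are exact in
  degrees \<open>\<ge> 0\<close>, the coproduct is exact in degrees \<open>\<ge> - k + 1\<close>,
  and shifting back adds \<open>c\<close>. Of the universal property the existence part is recorded,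
  which is what exhibits another complex as a retract of \<open>S\<close>.\<close>

lemma AB4_shifted:
  assumes B: "\<And>m :: nat. is_cplx C (B m)" "\<And>m n. ob (B m) n \<in> Proj C" "\<And>m. bounded_below C (B m)"
    and e: "\<And>m r. c \<le> r \<Longrightarrow> ex_at (B m) r"
  obtains S j where "is_cplx C S" "\<And>m. cmap (B m) S (j m)" "\<And>r. c - k + 1 \<le> r \<Longrightarrow> ex_at S r"
    "\<And>T g. (\<And>m. cmap (B m) T (g m)) \<Longrightarrow> \<exists>h. cmap S T h \<and> (\<forall>m r. h r \<bullet> j m r = g m r)"
proof -
  note [simp] = B(1)
  define B0 where "B0 m = Sh False c (B m)" for m
  have B0 [simp]: "is_cplx C (B0 m)" for m by (simp add: B0_def)
  have "bounded_below C (B0 m)" for m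
  proof -
    obtain N where "\<And>r. r < N \<Longrightarrow> is_zero_object C (ob (B m) r)" using B(3)[of m] by (auto simp: bounded_below_def)
    then have "\<forall>r < N - c. is_zero_object C (ob (B0 m) r)" by (simp add: B0_def)
    then show ?thesis by (auto simp: bounded_below_def)
  qed
  moreover have "homologically_concentrated_le C 0 (B0 m)" for m
    by (rule ex_at_imp_concentrated) (use e in \<open>simp_all add: B0_def ex_at_Sh\<close>)
  ultimately obtain S0 j0 where S0: "is_coproduct (Ch C) UNIV B0 S0 j0" "homologically_concentrated_le C (- k + 1) S0"
    using AB4 B(2) unfolding projectives_AB4_def by (metis B0 B0_def ob_Sh)
  have S0c [simp]: "is_cplx C S0" and j0: "\<And>m. j0 m \<in> chain_maps C (B0 m) S0"
    and u0: "\<And>T g. \<lbrakk>is_cplx C T; \<And>m. g m \<in> chain_maps C (B0 m) T\<rbrakk> \<Longrightarrow>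
      \<exists>h. h \<in> chain_maps C S0 T \<and> (\<forall>m. (\<lambda>n. h n \<cdot> j0 m n) = g m)"
    using S0(1) unfolding is_coproduct_def Ch_def by (simp_all, blast)
  define J where "J = (\<lambda>m n. Arrow (ob (B0 m) n) (ob S0 n) (j0 m n))"
  have J: "cmap (B0 m) S0 (J m)" for m using j0[of m] by (simp add: chain_map_iff J_def)
  let ?S = "Sh False (- c) S0"
  have j: "cmap (B m) ?S (\<lambda>r. J m (r - c))" for m
    by (rule cmap_Sh_swap) (use J[of m] in \<open>simp_all add: B0_def\<close>)
  show ?thesis
  proof (rule that[of ?S, OF _ j])
    show "ex_at ?S r" if "c - k + 1 \<le> r" for r
      by (rule ex_at_Sh) (use that concentrated_imp_ex_at[OF S0c S0(2)] in simp_all)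
    fix T g assume g: "\<And>m. cmap (B m) T (g m)"
    have T [simp]: "is_cplx C T" using cmapD(2)[OF g] .
    have g0: "cmap (B0 m) (Sh False c T) (\<lambda>r. g m (r + c))" for m unfolding B0_def by (rule cmap_Sh[OF g])
    obtain h where h: "h \<in> chain_maps C S0 (Sh False c T)" "\<And>m. (\<lambda>n. h n \<cdot> j0 m n) = (\<lambda>n. val (g m (n + c)))"
      using u0[of "Sh False c T" "\<lambda>m n. val (g m (n + c))"] cmap_val[OF g0] by auto
    define H where "H = (\<lambda>n. Arrow (ob S0 n) (ob (Sh False c T) n) (h n))"
    have H: "cmap S0 (Sh False c T) H" using h(1) by (simp add: chain_map_iff H_def)
    have HJ: "H n \<bullet> J m n = g m (n + c)" for m n
    proof -
      have "H n \<bullet> J m n = Arrow (ob (B0 m) n) (ob (Sh False c T) n) (h n \<cdot> j0 m n)"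
        using cmapD(3)[OF H, of n] cmapD(3)[OF J, of m n] unfolding H_def J_def by (simp add: cmp_def)
      also have "\<dots> = g m (n + c)"
        using fun_cong[OF h(2)[of m], of n] cmap_Arrow_val[OF g0, of m n] by simp
      finally show ?thesis .
    qed
    have "cmap ?S T (\<lambda>r. H (r - c))" by (rule cmap_Sh_swap'[OF T H])
    then show "\<exists>h. cmap ?S T h \<and> (\<forall>m r. h r \<bullet> J m (r - c) = g m r)" using HJ by (intro exI[of _ "\<lambda>r. H (r - c)"]) simp
  qed simp
qed

subsection \<open>The telescope\<close>

text \<open>\<open>S\<close> is the coproduct of all \<open>P m\<close>, and \<open>S'\<close> is the coproduct of the \<open>P (min m n)\<close>. The telescope of the
  eventually constant sequence \<open>P (min m n)\<close> contracts onto \<open>P n\<close>, which \<open>h\<close>, \<open>\<rho>\<close> and \<open>\<sigma>\<close> express. The cone of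
  \<open>P (min m n) \<rightarrow> P m\<close> is exact in high degrees uniformly in \<open>m\<close>, so AB4-k makes the cone of \<open>S' \<rightarrow> S\<close> exact
  there as well.\<close>

lemma telescope_stage:
  assumes P: "\<And>m r. ob (P m) r \<in> Proj C" "\<And>m. bounded_below C (P m)"
    and s: "\<And>m. cmap (P m) (P (Suc m)) (s m)" and p: "\<And>m. cmap (P m) X (\<pi> m)"
    and ps: "\<And>m r. \<pi> (Suc m) r \<bullet> s m r = \<pi> m r"
    and l: "\<And>m r. - int m \<le> r \<Longrightarrow> lifting (P m) X (\<pi> m) r"
    and j: "\<And>m. cmap (P m) S (j m)" and c: "\<And>r. cpr (\<lambda>m. j m r) (ob S r)"
    and t: "cmap S S t" and tj: "\<And>m r. t r \<bullet> j m r = j (Suc m) r \<bullet> s m r"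
  obtains S' u t' h \<rho> \<sigma> where "cmap S' S u" "cmap S' S' t'" "cmap S' S' h" "cmap S' (P n) \<rho>" "cmap (P n) S' \<sigma>"
    "\<And>r. h r \<boxplus> \<boxminus> (h r \<bullet> t' r) = idn (ob S' r)"
    "\<And>r. \<sigma> r \<bullet> \<rho> r \<boxplus> h r \<boxplus> \<boxminus> (t' r \<bullet> h r) = idn (ob S' r)"
    "\<And>r. \<rho> r \<bullet> t' r = \<rho> r" "\<And>r. u r \<bullet> t' r = t r \<bullet> u r" "\<And>r. u r \<bullet> \<sigma> r = j n r"
    "\<And>r. 2 - k - int n \<le> r \<Longrightarrow> ex_at (cone S' S u) r"
proof -
  note [simp] = cmapD(1-5)[OF p] cmapD(3-5)[OF s] cmapD(2-5)[OF j] cmapD(3-5)[OF t]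
  define P' where "P' m = P (min m n)" for m
  have P'lo: "P' m = P m" if "m \<le> n" for m using that by (simp add: P'_def min_def)
  have P'hi: "P' m = P n" if "n \<le> m" for m using that by (simp add: P'_def min_def)
  have [simp]: "is_cplx C (P' m)" for m by (simp add: P'_def)
  define s' where "s' m = (if m < n then s m else (\<lambda>r. idn (ob (P n) r)))" for m
  have s': "cmap (P' m) (P' (Suc m)) (s' m)" for m
    using s[of m] cmap_id[of "P n"] by (simp add: s'_def P'lo P'hi)
  note [simp] = cmapD(3-5)[OF s']
  obtain S' j' where S' [simp]: "is_cplx C S'" and j': "\<And>m. cmap (P' m) S' (j' m)" and c': "\<And>r. cpr (\<lambda>m. j' m r) (ob S' r)"
    using coproduct_cplx[of P'] P(1) by (metis P'_def cmapD(1) p)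
  note [simp] = cmapD(3-5)[OF j']
  have j'm: "arr (j' n r)" "src (j' n r) = ob (P n) r" "tgt (j' n r) = ob S' r" for r by (simp_all add: P'_def)
  obtain t' where t': "cmap S' S' t'" and tj': "\<And>m r. t' r \<bullet> j' m r = j' (Suc m) r \<bullet> s' m r"
    using cmap_from_cpr[OF j' c' cmap_cmp[OF s' j']] by metis
  note [simp] = cmapD(3-5)[OF t']

  \<comment> \<open>The transition map \<open>P (min m n) \<rightarrow> P m\<close>: the identity up
    to \<open>n\<close>, and from there on a composite of the maps \<open>s\<close>.\<close>
  obtain U where U: "U n = (\<lambda>r. idn (ob (P n) r))" "\<And>m. n \<le> m \<Longrightarrow> U (Suc m) = (\<lambda>r. s m r \<bullet> U m r)"
    "\<And>m. m < n \<Longrightarrow> U m = (\<lambda>r. idn (ob (P m) r))"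
    by (rule nat_bidirectional_rec[where n = n and z = "\<lambda>r. idn (ob (P n) r)" and up = "\<lambda>m f r. s m r \<bullet> f r" and down = "\<lambda>m f r. idn (ob (P m) r)"], rule that)
  have Uc: "cmap (P' m) (P m) (U m)" for m
  proof (induction m rule: nat_bidirectional_induct[of _ n])
    case 1 show ?case using cmap_id[of "P n"] by (simp add: P'_def U(1))
  next
    case (2 m) then show ?case using cmap_cmp[OF _ s[of m], of "P' m" "U m"] by (simp add: U(2) P'hi)
  next
    case (3 m) then show ?case using cmap_id[of "P m"] by (simp add: U(3) P'lo)
  qed
  note [simp] = cmapD(3-5)[OF Uc]
  have Us: "U (Suc m) r \<bullet> s' m r = s m r \<bullet> U m r" for m r
  proof (cases "m < n")
    case True
    then have "U (Suc m) = (\<lambda>r. idn (ob (P (Suc m)) r))" using U(1) U(3)[of "Suc m"] by (cases "Suc m = n") auto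
    then show ?thesis using True U(3)[of m] by (simp add: s'_def)
  next
    case False
    then have "tgt (U m r) = ob (P m) r" "src (U m r) = ob (P n) r" using P'hi[of m] by simp_all
    then show ?thesis using False U(2)[of m] by (simp add: s'_def)
  qed
  obtain u where u: "cmap S' S u" and uj: "\<And>m r. u r \<bullet> j' m r = j m r \<bullet> U m r"
    using cmap_from_cpr[OF j' c' cmap_cmp[OF Uc j]] by metis
  note [simp] = cmapD(3-5)[OF u]

  \<comment> \<open>The map \<open>P (min m n) \<rightarrow> P n\<close>: a composite of the maps
    \<open>s\<close> below \<open>n\<close> and the identity from \<open>n\<close> on. These are
    compatible with \<open>s'\<close>, which will give \<open>\<rho> t' = \<rho>\<close>.\<close>
  obtain R where R: "R n = (\<lambda>r. idn (ob (P n) r))" "\<And>m. n \<le> m \<Longrightarrow> R (Suc m) = R m"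
    "\<And>m. m < n \<Longrightarrow> R m = (\<lambda>r. R (Suc m) r \<bullet> s m r)"
    by (rule nat_bidirectional_rec[where n = n and z = "\<lambda>r. idn (ob (P n) r)" and up = "\<lambda>m f. f" and down = "\<lambda>m f r. f r \<bullet> s m r"], rule that)
  have Rc: "cmap (P' m) (P n) (R m)" for m
  proof (induction m rule: nat_bidirectional_induct[of _ n])
    case 1 show ?case using cmap_id[of "P n"] by (simp add: P'_def R(1))
  next
    case (2 m) then show ?case by (simp add: R(2) P'hi)
  next
    case (3 m) then show ?case using cmap_cmp[OF s[of m], of "P n" "R (Suc m)"] by (simp add: R(3) P'lo)
  qed
  note [simp] = cmapD(3-5)[OF Rc]
  have Rs: "R (Suc m) r \<bullet> s' m r = R m r" for m r
  proof (cases "m < n")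
    case False
    then have "src (R m r) = ob (P n) r" using P'hi[of m] by simp
    then show ?thesis using False R(2)[of m] by (simp add: s'_def)
  qed (simp add: s'_def R(3))
  obtain \<rho> where \<rho>: "cmap S' (P n) \<rho>" and \<rho>j: "\<And>m r. \<rho> r \<bullet> j' m r = R m r"
    using cmap_from_cpr[OF j' c' Rc] by metis
  note [simp] = cmapD(3-5)[OF \<rho>]

  \<comment> \<open>The map \<open>h\<close> has to satisfy \<open>h - h t' = id\<close>, that is,
    \<open>L m = j' m + L (m + 1) s'\<close>. With value zero at \<open>n\<close> the solution is,
    along the transition maps, \<open>j' m + ... + j' (n - 1)\<close> below \<open>n\<close> and
    \<open>- (j' n + ... + j' (m - 1))\<close> above: a finite substitute for the geometric series
    of \<open>t'\<close>.\<close>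
  obtain L where L: "L n = (\<lambda>r. zer (ob (P n) r) (ob S' r))" "\<And>m. n \<le> m \<Longrightarrow> L (Suc m) = (\<lambda>r. L m r \<boxplus> \<boxminus> j' m r)"
    "\<And>m. m < n \<Longrightarrow> L m = (\<lambda>r. j' m r \<boxplus> L (Suc m) r \<bullet> s m r)"
    by (rule nat_bidirectional_rec[where n = n and z = "\<lambda>r. zer (ob (P n) r) (ob S' r)" and up = "\<lambda>m f r. f r \<boxplus> \<boxminus> j' m r" and down = "\<lambda>m f r. j' m r \<boxplus> f r \<bullet> s m r"], rule that)
  have Lc: "cmap (P' m) S' (L m)" for m
  proof (induction m rule: nat_bidirectional_induct[of _ n])
    case 1 show ?case using cmap_zer[of "P n" S'] by (simp add: P'_def L(1))
  next
    case (2 m) then show ?case using cmap_add[OF _ cmap_neg[OF j'[of m]], of "L m"] by (simp add: L(2) P'hi)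
  next
    case (3 m)
    then have "cmap (P' m) S' (\<lambda>r. L (Suc m) r \<bullet> s m r)" using cmap_cmp[OF s[of m], of S' "L (Suc m)"] by (simp add: P'lo)
    then show ?case using cmap_add[OF j'[of m]] 3 by (simp add: L(3))
  qed
  note [simp] = cmapD(3-5)[OF Lc]
  have Ls: "L m r = j' m r \<boxplus> L (Suc m) r \<bullet> s' m r" for m r
  proof (cases "m < n")
    case False
    then have o: "ob (P' m) r = ob (P n) r" using P'hi[of m] by simp
    have "L (Suc m) r \<bullet> s' m r = L (Suc m) r" using False cmapD(3,4)[OF Lc, of "Suc m" r] P'hi[of "Suc m"] by (simp add: s'_def)
    then show ?thesis using False L(2)[of m] o by (simp add: canc)
  qed (simp add: s'_def L(3))
  obtain h where h: "cmap S' S' h" and hj: "\<And>m r. h r \<bullet> j' m r = L m r"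
    using cmap_from_cpr[OF j' c' Lc] by metis
  note [simp] = cmapD(3-5)[OF h]
  \<comment> \<open>Applying \<open>id - t'\<close> to the finite sum telescopes. It leaves
    \<open>j' m\<close> and the end term at stage \<open>n\<close>, which is
    \<open>j' n \<bullet> R m\<close>; so on this side \<open>h\<close> inverts
    \<open>id - t'\<close> only up to the projection onto \<open>P n\<close>.\<close>
  have E: "j' n r \<bullet> R m r \<boxplus> L m r \<boxplus> \<boxminus> (t' r \<bullet> L m r) = j' m r" for m r
  proof (induction m rule: nat_bidirectional_induct[of _ n])
    case 1 show ?case using j'm[of r] by (simp add: R(1) L(1))
  next
    case (2 m)
    have o: "ob (P' m) r = ob (P n) r" "ob (P' (Suc m)) r = ob (P n) r" using 2(1) by (simp_all add: P'hi)
    have tt: "t' r \<bullet> j' m r = j' (Suc m) r" using tj'[of r m] 2(1) o by (simp add: s'_def)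
    have nn: "\<boxminus> \<boxminus> j' (Suc m) r = j' (Suc m) r" by simp
    have "j' n r \<bullet> R (Suc m) r \<boxplus> L (Suc m) r \<boxplus> \<boxminus> (t' r \<bullet> L (Suc m) r)
       = (j' n r \<bullet> R m r \<boxplus> L m r \<boxplus> \<boxminus> (t' r \<bullet> L m r)) \<boxplus> (\<boxminus> j' m r \<boxplus> j' (Suc m) r)"
      unfolding R(2)[OF 2(1)] L(2)[OF 2(1)] by (simp only: cmp_add_right cmp_neg_right neg_add tt nn add_ac)
    also have "\<dots> = j' (Suc m) r" unfolding 2(2) using o by simp
    finally show ?case .
  next
    case (3 m)
    have o: "ob (P' m) r = ob (P m) r" "ob (P' (Suc m)) r = ob (P (Suc m)) r" using 3(1) by (simp_all add: P'lo)
    have tt: "t' r \<bullet> j' m r = j' (Suc m) r \<bullet> s m r" using tj'[of r m] 3(1) by (simp add: s'_def)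
    have "j' n r \<bullet> R m r \<boxplus> L m r \<boxplus> \<boxminus> (t' r \<bullet> L m r)
       = (j' n r \<bullet> R (Suc m) r \<boxplus> L (Suc m) r \<boxplus> \<boxminus> (t' r \<bullet> L (Suc m) r)) \<bullet> s m r \<boxplus> (j' m r \<boxplus> \<boxminus> (j' (Suc m) r \<bullet> s m r))"
      unfolding R(3)[OF 3(1)] L(3)[OF 3(1)]
      by (simp only: cmp_add_right cmp_add_left cmp_neg_left cmp_assoc neg_add tt add_ac)
    also have "\<dots> = j' m r" unfolding 3(2) using o by (simp add: canc)
    finally show ?case .
  qed

  have piU: "\<pi> m r \<bullet> U m r = \<pi> n r" if "n \<le> m" for m r
    using that
  proof (induction m rule: dec_induct)
    case base
    then show ?case by (simp add: U(1))
  next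
    case (step m)
    then show ?case by (simp add: U(2) ps[THEN cmp_reassoc])
  qed
  \<comment> \<open>Below \<open>n\<close> this is the cone of an identity. From \<open>n\<close>
    on, both \<open>P n\<close> and \<open>P m\<close> resolve \<open>X\<close> in degrees
    \<open>\<ge> - int n\<close>, and degree \<open>r\<close> of the cone involves degree
    \<open>r - 1\<close> of \<open>P n\<close>, whence \<open>1 - int n\<close>. The bound is
    independent of \<open>m\<close>, as AB4-k demands.\<close>
  have exm: "ex_at (cone (P' m) (P m) (U m)) r" if "1 - int n \<le> r" for m r
  proof (cases "m < n")
    case True
    then show ?thesis using ex_at_cone_id[of "P m" "U m"] by (simp add: P'lo U(3))
  next
    case False
    then have nm: "n \<le> m" by simp
    have U': "cmap (P n) (P m) (U m)" using Uc[of m] P'hi[OF nm] by simp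
    show ?thesis unfolding P'hi[OF nm]
      by (rule ex_at_cone_lifting[OF U' p p piU[OF nm]]) (use l[of n "r - 1"] l[of m r] that nm in simp_all)
  qed
  define B where "B m = cone (P' m) (P m) (U m)" for m
  have Bc [simp]: "is_cplx C (B m)" for m unfolding B_def by (rule is_cplx_cone[OF Uc])
  have BP: "ob (B m) r \<in> Proj C" for m r by (simp add: B_def Proj_Bip P(1) P'_def)
  have Bb: "bounded_below C (B m)" for m
    by (rule bounded_below_Bip[of "P m" "P' m" _ 1]) (use P(2) in \<open>simp_all add: B_def P'_def\<close>)
  have Be: "ex_at (B m) r" if "1 - int n \<le> r" for m r unfolding B_def using exm that by blast
  obtain SB jB where SB: "is_cplx C SB" and jB: "\<And>m. cmap (B m) SB (jB m)"
    and eSB: "\<And>r. 1 - int n - k + 1 \<le> r \<Longrightarrow> ex_at SB r"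
    and uSB: "\<And>T g. (\<And>m. cmap (B m) T (g m)) \<Longrightarrow> \<exists>h. cmap SB T h \<and> (\<forall>m r. h r \<bullet> jB m r = g m r)"
    using AB4_shifted[of B "1 - int n", OF Bc BP Bb Be] by metis
  note [simp] = SB cmapD(3-5)[OF jB]
  define M where "M = cone S' S u"
  have Mc [simp]: "is_cplx C M" unfolding M_def by (rule is_cplx_cone[OF u])
  have oM [simp]: "ob M r = Bip (ob S r) (ob S' (r - 1))" for r by (simp add: M_def)
  have oB [simp]: "ob (B m) r = Bip (ob (P m) r) (ob (P' m) (r - 1))" for m r by (simp add: B_def)
  define \<iota> where "\<iota> m r = pair (j m r \<bullet> pr1 (ob (P m) r) (ob (P' m) (r - 1))) (j' m (r - 1) \<bullet> pr2 (ob (P m) r) (ob (P' m) (r - 1)))" for m r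
  have ti [simp]: "arr (\<iota> m r)" "src (\<iota> m r) = ob (B m) r" "tgt (\<iota> m r) = ob M r" for m r by (simp_all add: \<iota>_def)
  have iin: "\<iota> m r \<bullet> in1 (ob (P m) r) (ob (P' m) (r - 1)) = in1 (ob S r) (ob S' (r - 1)) \<bullet> j m r"
    "\<iota> m r \<bullet> in2 (ob (P m) r) (ob (P' m) (r - 1)) = in2 (ob S r) (ob S' (r - 1)) \<bullet> j' m (r - 1)" for m r
    by (simp_all add: \<iota>_def) (simp_all add: pair_def)
  have \<iota>: "cmap (B m) M (\<iota> m)" for m
    unfolding cmap_def
  proof (intro conjI allI)
    fix r
    let ?p = "pr1 (ob (P m) r) (ob (P' m) (r - 1))" and ?q = "pr2 (ob (P m) r) (ob (P' m) (r - 1))"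
    have b: "D (B m) r \<bullet> pair ?p ?q = pair (D (P m) r \<bullet> ?p \<boxplus> \<boxminus> (U m (r - 1) \<bullet> ?q)) (\<boxminus> (D (P' m) (r - 1) \<bullet> ?q))"
      unfolding B_def by (rule D_cone_pair[OF Uc]) simp_all
    have d: "D M r \<bullet> \<iota> m r = pair (D S r \<bullet> j m r \<bullet> ?p \<boxplus> \<boxminus> (u (r - 1) \<bullet> j' m (r - 1) \<bullet> ?q)) (\<boxminus> (D S' (r - 1) \<bullet> j' m (r - 1) \<bullet> ?q))"
      unfolding M_def \<iota>_def by (rule D_cone_pair[OF u]) simp_all
    have "D M r \<bullet> \<iota> m r = \<iota> m (r - 1) \<bullet> (D (B m) r \<bullet> pair ?p ?q)"
      unfolding d b by (simp add: \<iota>_def cmapD(7)[OF j] cmapD(7)[OF j'] uj[THEN cmp_reassoc])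
    then show "D M r \<bullet> \<iota> m r = \<iota> m (r - 1) \<bullet> D (B m) r" by simp
  qed simp_all
  \<comment> \<open>The inclusions of the single cones into \<open>M\<close> are jointly epic in
    each degree, because those of the summands into \<open>S\<close> and \<open>S'\<close>
    are.\<close>
  have jext: "f = g" if "arr f" "arr g" "src f = ob M r" "src g = ob M r" "tgt f = tgt g" "\<And>m. f \<bullet> \<iota> m r = g \<bullet> \<iota> m r" for f g r
  proof (rule bip_ext[of _ _ "ob S r" "ob S' (r - 1)"])
    have o: "src f = Bip (ob S r) (ob S' (r - 1))" "src g = Bip (ob S r) (ob S' (r - 1))" using that by simp_all
    have j1: "(f \<bullet> in1 (ob S r) (ob S' (r - 1))) \<bullet> j m r = (g \<bullet> in1 (ob S r) (ob S' (r - 1))) \<bullet> j m r" for m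
      using arg_cong[OF that(6)[of m], of "\<lambda>x. x \<bullet> in1 (ob (P m) r) (ob (P' m) (r - 1))"] by (simp only: cmp_assoc iin)
    show "f \<bullet> in1 (ob S r) (ob S' (r - 1)) = g \<bullet> in1 (ob S r) (ob S' (r - 1))"
      by (rule cpr_ext[OF c[of r] j1]) (use that(1,2,5) o in simp_all)
    have j2: "(f \<bullet> in2 (ob S r) (ob S' (r - 1))) \<bullet> j' m (r - 1) = (g \<bullet> in2 (ob S r) (ob S' (r - 1))) \<bullet> j' m (r - 1)" for m
      using arg_cong[OF that(6)[of m], of "\<lambda>x. x \<bullet> in2 (ob (P m) r) (ob (P' m) (r - 1))"] by (simp only: cmp_assoc iin)
    show "f \<bullet> in2 (ob S r) (ob S' (r - 1)) = g \<bullet> in2 (ob S r) (ob S' (r - 1))"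
      by (rule cpr_ext[OF c'[of "r - 1"] j2]) (use that(1,2,5) o in simp_all)
  qed (use that in simp_all)
  \<comment> \<open>The AB4 coproduct \<open>SB\<close> of the cones and the cone \<open>M\<close>
    of the coproducts are compared by \<open>\<phi>\<close> and \<open>\<psi>\<close>, both
    determined on the summands. Since \<open>\<phi> \<bullet> \<psi>\<close> is the identity,
    \<open>M\<close> is a retract of \<open>SB\<close> and inherits its exactness.\<close>
  obtain \<phi> where \<phi>: "cmap SB M \<phi>" and \<phi>j: "\<And>m r. \<phi> r \<bullet> jB m r = \<iota> m r" using uSB[OF \<iota>] by blast
  note [simp] = cmapD(3-5)[OF \<phi>]
  have "\<exists>f. isar f (ob M r) (ob SB r) \<and> (\<forall>m. f \<bullet> \<iota> m r = jB m r)" for r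
  proof -
    obtain f1 where f1: "isar f1 (ob S r) (ob SB r)" "\<And>m. f1 \<bullet> j m r = jB m r \<bullet> in1 (ob (P m) r) (ob (P' m) (r - 1))"
      using cpr_desc[OF c[of r], of "\<lambda>m. jB m r \<bullet> in1 (ob (P m) r) (ob (P' m) (r - 1))" "ob SB r"] by auto
    obtain f2 where f2: "isar f2 (ob S' (r - 1)) (ob SB r)" "\<And>m. f2 \<bullet> j' m (r - 1) = jB m r \<bullet> in2 (ob (P m) r) (ob (P' m) (r - 1))"
      using cpr_desc[OF c'[of "r - 1"], of "\<lambda>m. jB m r \<bullet> in2 (ob (P m) r) (ob (P' m) (r - 1))" "ob SB r"] by auto
    have "cop f1 f2 \<bullet> \<iota> m r = jB m r" for m
      by (rule bip_ext[of _ _ "ob (P m) r" "ob (P' m) (r - 1)"])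
         (use f1(1) f2(1) in \<open>simp_all add: iin f1(2) f2(2) cop_in(1)[THEN cmp_reassoc] cop_in(2)[THEN cmp_reassoc]\<close>)
    then show ?thesis using f1(1) f2(1) by (intro exI[of _ "cop f1 f2"]) simp
  qed
  then obtain \<psi> where \<psi>t: "\<And>r. isar (\<psi> r) (ob M r) (ob SB r)" and \<psi>i: "\<And>m r. \<psi> r \<bullet> \<iota> m r = jB m r" by metis
  have \<psi>: "cmap M SB \<psi>"
    unfolding cmap_def
  proof (intro conjI allI)
    fix r
    show "D SB r \<bullet> \<psi> r = \<psi> (r - 1) \<bullet> D M r"
      by (rule jext[of _ _ r])
         (use \<psi>t in \<open>simp_all add: \<psi>i cmapD(6)[OF jB] cmapD(6)[OF \<iota>] \<psi>i[THEN cmp_reassoc] del: oM oB\<close>)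
  qed (use \<psi>t in simp_all)
  have \<phi>\<psi>: "\<phi> r \<bullet> \<psi> r = idn (ob M r)" for r
    by (rule jext[of _ _ r]) (use \<psi>t in \<open>simp_all add: \<psi>i \<phi>j del: oM oB\<close>)
  show ?thesis
  proof (rule that[OF u t' h \<rho>])
    show "cmap (P n) S' (j' n)" using j'[of n] by (simp add: P'_def)
    fix r
    show "h r \<boxplus> \<boxminus> (h r \<bullet> t' r) = idn (ob S' r)"
    proof (rule cpr_ext[OF c'[of r]])
      fix m
      have "h r \<bullet> t' r \<bullet> j' m r = L (Suc m) r \<bullet> s' m r" by (simp add: tj' hj[THEN cmp_reassoc])
      then show "(h r \<boxplus> \<boxminus> (h r \<bullet> t' r)) \<bullet> j' m r = idn (ob S' r) \<bullet> j' m r"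
        using Ls[of m r] by (simp add: hj canc)
    qed simp_all
    show "j' n r \<bullet> \<rho> r \<boxplus> h r \<boxplus> \<boxminus> (t' r \<bullet> h r) = idn (ob S' r)"
      by (rule cpr_ext[OF c'[of r]]) (use j'm[of r] E in \<open>simp_all add: \<rho>j hj\<close>)
    show "\<rho> r \<bullet> t' r = \<rho> r"
      by (rule cpr_ext[OF c'[of r]]) (simp_all add: \<rho>j tj' \<rho>j[THEN cmp_reassoc] Rs)
    show "u r \<bullet> t' r = t r \<bullet> u r"
      by (rule cpr_ext[OF c'[of r]]) (simp_all add: uj tj' uj[THEN cmp_reassoc] tj[THEN cmp_reassoc] Us)
    show "u r \<bullet> j' n r = j n r" by (simp add: uj U(1))
    \<comment> \<open>The bound is \<open>c - k + 1\<close> for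
      \<open>c = 1 - int n\<close>.\<close>
    show "ex_at (cone S' S u) r" if "2 - k - int n \<le> r"
      unfolding M_def[symmetric] by (rule ex_at_retract[OF \<psi> \<phi> \<phi>\<psi> eSB]) (use that in simp)
  qed
qed

text \<open>A cycle \<open>z = (a, b)\<close> of \<open>Q\<close> is moved twice within its homology
  class. Exactness of the cone of \<open>u\<close> replaces it by the image of the cycle
  \<open>(- a2, - b1)\<close> of the telescope of \<open>S'\<close>, and the contraction of that
  telescope leaves a cycle \<open>y0\<close> of the single complex \<open>P n\<close>. There the
  lifting problem is solvable, because \<open>n\<close> is chosen large for the degree at
  hand.\<close>

theorem kproj_resolution:
  assumes X [simp]: "is_cplx C X"
  obtains Q g where "kproj Q" "cmap Q X g" "\<And>m. lifting Q X g m"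
proof -
  obtain P \<pi> s where p: "\<And>n. cmap (P n) X (\<pi> n)" and PP: "\<And>n r. ob (P n) r \<in> Proj C" and Pb: "\<And>n. bounded_below C (P n)"
    and s: "\<And>n. cmap (P n) (P (Suc n)) (s n)" and ps: "\<And>n r. \<pi> (Suc n) r \<bullet> s n r = \<pi> n r"
    and l: "\<And>n m. - int n \<le> m \<Longrightarrow> lifting (P n) X (\<pi> n) m"
    using approximating_sequence[OF X] by metis
  note [simp] = cmapD(1,3-5)[OF p] cmapD(3-5)[OF s]
  obtain S j where S [simp]: "is_cplx C S" and SP: "\<And>n. ob S n \<in> Proj C" and j: "\<And>m. cmap (P m) S (j m)" and c: "\<And>n. cpr (\<lambda>m. j m n) (ob S n)"
    using coproduct_cplx[of P] PP by (metis cmapD(1) p)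
  note [simp] = cmapD(3-5)[OF j]
  obtain t where t: "cmap S S t" and tj: "\<And>m r. t r \<bullet> j m r = j (Suc m) r \<bullet> s m r"
    using cmap_from_cpr[OF j c cmap_cmp[OF s j]] by metis
  obtain \<kappa> where \<kappa>: "cmap S X \<kappa>" and \<kappa>j: "\<And>m r. \<kappa> r \<bullet> j m r = \<pi> m r"
    using cmap_from_cpr[OF j c p] by metis
  note [simp] = cmapD(3-5)[OF t] cmapD(3-5)[OF \<kappa>]
  have \<kappa>t: "\<kappa> r \<bullet> t r = \<kappa> r" for r
    by (rule cpr_ext[OF c[of r]]) (simp_all add: \<kappa>j tj \<kappa>j[THEN cmp_reassoc] ps)
  have "kproj (P m)" for m
  proof -
    obtain N where "\<And>i. i < N \<Longrightarrow> is_zero_object C (ob (P m) i)" using Pb[of m] by (auto simp: bounded_below_def)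
    then show ?thesis by (intro kproj_bounded_below[of _ N]) (simp_all add: PP)
  qed
  then have kS: "kproj S" by (rule kproj_cpr[OF _ S SP j c])
  define d where "d r = idn (ob S r) \<boxplus> \<boxminus> t r" for r
  have dc: "cmap S S d" unfolding d_def by (rule cmap_add[OF cmap_id[OF S] cmap_neg[OF t]])
  note [simp] = cmapD(3-5)[OF dc]
  define \<theta> where "\<theta> r = d (r - 1)" for r
  have tw: "twist S (Sg S) \<theta>" unfolding \<theta>_def by (rule twist_Sg[OF dc])
  define Q where "Q = Tw S (Sg S) \<theta>"
  have kQ: "kproj Q" unfolding Q_def by (rule kproj_Tw[OF tw kS kproj_Sg[OF kS]])
  \<comment> \<open>Zero on the suspended summand is compatible with the differentials, because
    \<open>\<kappa>\<close> annihilates \<open>d\<close> by \<open>\<kappa>t\<close>.\<close>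
  define g where "g r = cop (\<kappa> r) (zer (ob S (r - 1)) (ob X r))" for r
  have g: "cmap Q X g" unfolding Q_def g_def
    by (rule cmap_from_Tw[OF tw \<kappa>]) (simp_all add: \<theta>_def d_def \<kappa>t)
  have "lifting Q X g r" for r
  proof (rule liftingI)
    fix T z x assume T: "T \<in> Proj C" and z: "arr z" "src z = T" "tgt z = ob Q r"
      and x [simp]: "arr x" "src x = T" "tgt x = ob X (r + 1)" and dz: "D Q r \<bullet> z = zer T (ob Q (r - 1))" and dx0: "D X (r + 1) \<bullet> x = g r \<bullet> z"
    note TO [simp] = Proj_Obj[OF T]
    have z3: "tgt z = Bip (ob S r) (ob (Sg S) r)" using z(3) by (simp add: Q_def)
    obtain a b where ab [simp]: "arr a" "arr b" "src a = T" "src b = T" "tgt a = ob S r" "tgt b = ob (Sg S) r" and zab: "z = pair a b"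
      by (rule Tw_pairE[OF tw z(1,2) z3])
    have [simp]: "tgt b = ob S (r - 1)" by simp
    have "pair (D S r \<bullet> a \<boxplus> d (r - 1) \<bullet> b) (\<boxminus> (D S (r - 1) \<bullet> b)) = zer T (Bip (ob S (r - 1)) (ob S (r - 1 - 1)))"
      using dz unfolding zab Q_def by (simp add: D_Tw_pair[OF tw] \<theta>_def)
    then have z1: "D S r \<bullet> a \<boxplus> d (r - 1) \<bullet> b = zer T (ob S (r - 1))" and z2: "\<boxminus> (D S (r - 1) \<bullet> b) = zer T (ob S (r - 1 - 1))"
      by (simp_all add: pair_eq_zer_iff)
    have Db: "D S (r - 1) \<bullet> b = zer T (ob S (r - 1 - 1))" using arg_cong[OF z2, of neg] by simp
    have db: "d (r - 1) \<bullet> b = \<boxminus> (D S r \<bullet> a)" by (rule add_eq_zerD[OF z1]) simp_all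
    have "D S r \<bullet> a = \<boxminus> (d (r - 1) \<bullet> b)" unfolding db by simp
    then have Da: "D S r \<bullet> a = \<boxminus> b \<boxplus> t (r - 1) \<bullet> b" by (simp add: d_def)
    have dx: "D X (r + 1) \<bullet> x = \<kappa> r \<bullet> a" using dx0 unfolding zab g_def by simp
    \<comment> \<open>The cone of \<open>u\<close> is used in degrees \<open>r - 1\<close> and
      \<open>r\<close>, which needs \<open>2 - k - int n \<le> r - 1\<close>; the lifting property
      of \<open>P n\<close> is used in degree \<open>r\<close>, which needs
      \<open>- int n \<le> r\<close>.\<close>
    define n where "n = nat (max (- r) (3 - k - r))"
    have n: "- int n \<le> r" "2 - k - int n \<le> r - 1" unfolding n_def by arith+
    obtain S' u t' h \<rho> \<sigma> where u: "cmap S' S u" and t': "cmap S' S' t'" and h: "cmap S' S' h" and \<rho>: "cmap S' (P n) \<rho>" and \<sigma>: "cmap (P n) S' \<sigma>"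
      and ht: "\<And>r. h r \<boxplus> \<boxminus> (h r \<bullet> t' r) = idn (ob S' r)"
      and hs: "\<And>r. \<sigma> r \<bullet> \<rho> r \<boxplus> h r \<boxplus> \<boxminus> (t' r \<bullet> h r) = idn (ob S' r)"
      and \<rho>t: "\<And>r. \<rho> r \<bullet> t' r = \<rho> r" and ut: "\<And>r. u r \<bullet> t' r = t r \<bullet> u r" and us: "\<And>r. u r \<bullet> \<sigma> r = j n r"
      and eu: "\<And>r. 2 - k - int n \<le> r \<Longrightarrow> ex_at (cone S' S u) r"
      using telescope_stage[OF PP Pb s p ps l j c t tj, of n] by metis
    note [simp] = cmapD(1,3-5)[OF u] cmapD(3-5)[OF t'] cmapD(3-5)[OF h] cmapD(3-5)[OF \<rho>] cmapD(3-5)[OF \<sigma>]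
    \<comment> \<open>As \<open>b\<close> is a cycle of \<open>S\<close>, the pair
      \<open>(b, 0)\<close> is a cycle of the cone. A chain \<open>(c0, b1)\<close> bounding it
      expresses \<open>b\<close> as \<open>d c0 - u b1\<close> with a cycle \<open>b1\<close> of
      \<open>S'\<close>.\<close>
    have cb: "D (cone S' S u) (r - 1) \<bullet> pair b (zer T (ob S' (r - 1 - 1))) = zer T (ob (cone S' S u) (r - 1 - 1))"
      by (simp add: D_cone_pair[OF u] Db pair_zer)
    obtain y where y: "arr y" "src y = src (pair b (zer T (ob S' (r - 1 - 1))))" "tgt y = ob (cone S' S u) (r - 1 + 1)"
       "D (cone S' S u) (r - 1 + 1) \<bullet> y = pair b (zer T (ob S' (r - 1 - 1)))"
      by (rule ex_atE[OF eu[of "r - 1"], of "pair b (zer T (ob S' (r - 1 - 1)))"]) (use n cb T in simp_all)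
    then have y: "arr y" "src y = T" "tgt y = ob (cone S' S u) r" "D (cone S' S u) r \<bullet> y = pair b (zer T (ob S' (r - 1 - 1)))" by simp_all
    obtain c0 b1 where cb1 [simp]: "arr c0" "arr b1" "src c0 = T" "src b1 = T" "tgt c0 = ob S r" "tgt b1 = ob S' (r - 1)" and yc: "y = pair c0 b1"
      by (rule cone_pairE[OF u y(1-3)])
    have "pair (D S r \<bullet> c0 \<boxplus> \<boxminus> (u (r - 1) \<bullet> b1)) (\<boxminus> (D S' (r - 1) \<bullet> b1)) = pair b (zer T (ob S' (r - 1 - 1)))"
      using y(4) unfolding yc by (simp add: D_cone_pair[OF u])
    then have q1: "D S r \<bullet> c0 \<boxplus> \<boxminus> (u (r - 1) \<bullet> b1) = b" and q2: "\<boxminus> (D S' (r - 1) \<bullet> b1) = zer T (ob S' (r - 1 - 1))"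
      by (simp_all add: pair_eq_iff)
    have Dc0: "D S r \<bullet> c0 = b \<boxplus> u (r - 1) \<bullet> b1" unfolding q1[symmetric] by (simp add: canc)
    have Db1: "D S' (r - 1) \<bullet> b1 = zer T (ob S' (r - 1 - 1))" using arg_cong[OF q2, of neg] by simp
    \<comment> \<open>This pair is again a cycle of the cone, one degree higher. A chain
      \<open>(c2, a2)\<close> bounding it satisfies \<open>d a2 = - b1 + t' b1\<close>, so that
      \<open>(- a2, - b1)\<close> is a cycle of the telescope of \<open>S'\<close>.\<close>
    let ?e1 = "a \<boxplus> c0 \<boxplus> \<boxminus> (t r \<bullet> c0)" and ?e2 = "b1 \<boxplus> \<boxminus> (t' (r - 1) \<bullet> b1)"
    have ce: "D (cone S' S u) r \<bullet> pair ?e1 ?e2 = zer T (ob (cone S' S u) (r - 1))"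
      by (simp add: D_cone_pair[OF u] Da Dc0 Db1 cmapD(7)[OF t] cmapD(7)[OF t'] ut[THEN cmp_reassoc] canc pair_zer)
    obtain y2 where y2: "arr y2" "src y2 = src (pair ?e1 ?e2)" "tgt y2 = ob (cone S' S u) (r + 1)" "D (cone S' S u) (r + 1) \<bullet> y2 = pair ?e1 ?e2"
      by (rule ex_atE[OF eu[of r], of "pair ?e1 ?e2"]) (use n ce T in simp_all)
    then have y2: "arr y2" "src y2 = T" "tgt y2 = ob (cone S' S u) (r + 1)" "D (cone S' S u) (r + 1) \<bullet> y2 = pair ?e1 ?e2" by simp_all
    obtain c2 a2' where ca' : "arr c2" "arr a2'" "src c2 = T" "src a2' = T" "tgt c2 = ob S (r + 1)" "tgt a2' = ob S' (r + 1 - 1)" and yc2: "y2 = pair c2 a2'"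
      by (rule cone_pairE[OF u y2(1-3)])
    define a2 where "a2 = a2'"
    have ca [simp]: "arr c2" "arr a2" "src c2 = T" "src a2 = T" "tgt c2 = ob S (r + 1)" "tgt a2 = ob S' r"
      using ca' by (simp_all add: a2_def)
    have "pair (D S (r + 1) \<bullet> c2 \<boxplus> \<boxminus> (u r \<bullet> a2)) (\<boxminus> (D S' r \<bullet> a2)) = pair ?e1 ?e2"
      using y2(4) unfolding yc2 a2_def[symmetric] by (simp add: D_cone_pair[OF u])
    then have q3: "D S (r + 1) \<bullet> c2 \<boxplus> \<boxminus> (u r \<bullet> a2) = ?e1" and q4: "\<boxminus> (D S' r \<bullet> a2) = ?e2"
      by (simp_all add: pair_eq_iff)
    have Da2: "D S' r \<bullet> a2 = \<boxminus> b1 \<boxplus> t' (r - 1) \<bullet> b1" using arg_cong[OF q4, of neg] by simp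
    have Dc2: "D S (r + 1) \<bullet> c2 = a \<boxplus> c0 \<boxplus> \<boxminus> (t r \<bullet> c0) \<boxplus> u r \<bullet> a2"
    proof -
      have "D S (r + 1) \<bullet> c2 = (D S (r + 1) \<bullet> c2 \<boxplus> \<boxminus> (u r \<bullet> a2)) \<boxplus> u r \<bullet> a2" by (simp add: canc)
      then show ?thesis unfolding q3 by (simp add: add_ac)
    qed
    \<comment> \<open>The correction \<open>u h a2\<close> cancels the summand \<open>u b1\<close>
      in the boundary of \<open>c0\<close>, because \<open>h - h t' = id\<close>; thus
      \<open>e\<close> has boundary \<open>b\<close> exactly.\<close>
    define e where "e = c0 \<boxplus> u r \<bullet> h r \<bullet> a2"
    have [simp]: "arr e" "src e = T" "tgt e = ob S r" by (simp_all add: e_def)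
    have hb: "h (r - 1) \<bullet> b1 \<boxplus> \<boxminus> (h (r - 1) \<bullet> t' (r - 1) \<bullet> b1) = b1"
      using arg_cong[OF ht[of "r - 1"], of "\<lambda>f. f \<bullet> b1"] by simp
    have De: "D S r \<bullet> e = b"
    proof -
      have "D S r \<bullet> e = b \<boxplus> u (r - 1) \<bullet> (b1 \<boxplus> \<boxminus> (h (r - 1) \<bullet> b1 \<boxplus> \<boxminus> (h (r - 1) \<bullet> t' (r - 1) \<bullet> b1)))"
        by (simp add: e_def Dc0 cmapD(7)[OF u] cmapD(7)[OF h] Da2 add_ac)
      also have "\<dots> = b" unfolding hb by simp
      finally show ?thesis .
    qed
    \<comment> \<open>What the contraction leaves of \<open>a2\<close> is its image in
      \<open>P n\<close>, which is a cycle because \<open>\<rho> t' = \<rho>\<close>.\<close>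
    define y0 where "y0 = \<boxminus> (\<rho> r \<bullet> a2)"
    have [simp]: "arr y0" "src y0 = T" "tgt y0 = ob (P n) r" by (simp_all add: y0_def)
    have Dy0: "D (P n) r \<bullet> y0 = zer T (ob (P n) (r - 1))"
      by (simp add: y0_def cmapD(7)[OF \<rho>] Da2 \<rho>t[THEN cmp_reassoc])
    have ua: "u r \<bullet> a2 = \<boxminus> (j n r \<bullet> y0) \<boxplus> u r \<bullet> h r \<bullet> a2 \<boxplus> \<boxminus> (t r \<bullet> u r \<bullet> h r \<bullet> a2)"
    proof -
      have "u r \<bullet> a2 = u r \<bullet> (\<sigma> r \<bullet> \<rho> r \<boxplus> h r \<boxplus> \<boxminus> (t' r \<bullet> h r)) \<bullet> a2" unfolding hs by simp
      then show ?thesis by (simp add: us[THEN cmp_reassoc] ut[THEN cmp_reassoc] y0_def)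
    qed
    \<comment> \<open>In \<open>Q\<close> the boundary of \<open>(c2, - e)\<close> is therefore
      \<open>(a - j n y0, b)\<close>, and only \<open>(j n y0, 0)\<close> is left of
      \<open>z\<close>.\<close>
    have Dc2': "D S (r + 1) \<bullet> c2 = a \<boxplus> e \<boxplus> \<boxminus> (t r \<bullet> e) \<boxplus> \<boxminus> (j n r \<bullet> y0)"
      unfolding Dc2 ua e_def by (simp only: cmp_add_right neg_add add_ac)
    \<comment> \<open>The chain \<open>y'\<close> bounds \<open>y0\<close>, and its image in
      \<open>X\<close> is the part of \<open>x\<close> that \<open>c2\<close> does not yet account
      for.\<close>
    obtain y' where y': "arr y'" "src y' = T" "tgt y' = ob (P n) (r + 1)" "D (P n) (r + 1) \<bullet> y' = y0" "\<pi> n (r + 1) \<bullet> y' = x \<boxplus> \<boxminus> (\<kappa> (r + 1) \<bullet> c2)"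
      by (rule liftingE[OF l[OF n(1)] T, of y0 "x \<boxplus> \<boxminus> (\<kappa> (r + 1) \<bullet> c2)"])
         (simp_all add: Dy0 dx cmapD(7)[OF \<kappa>] Dc2' \<kappa>t[THEN cmp_reassoc] \<kappa>j[THEN cmp_reassoc] canc)
    have w1: "D Q (r + 1) \<bullet> pair (c2 \<boxplus> j n (r + 1) \<bullet> y') (\<boxminus> e) = z"
      unfolding Q_def using y'(1-4)
      by (simp add: D_Tw_pair[OF tw] \<theta>_def d_def zab De Dc2' cmapD(7)[OF j] canc)
    have w2: "g (r + 1) \<bullet> pair (c2 \<boxplus> j n (r + 1) \<bullet> y') (\<boxminus> e) = x"
      unfolding g_def using y'(1-3,5) by (simp add: \<kappa>j[THEN cmp_reassoc] canc)
    show "\<exists>q'. isar q' T (ob Q (r + 1)) \<and> D Q (r + 1) \<bullet> q' = z \<and> g (r + 1) \<bullet> q' = x"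
    proof (intro exI[of _ "pair (c2 \<boxplus> j n (r + 1) \<bullet> y') (\<boxminus> e)"] conjI w1 w2)
    qed (use y'(1-3) in \<open>simp_all add: Q_def\<close>)
  qed
  then show ?thesis using that kQ g by blast
qed

end

subsection \<open>The classes of the cotorsion pairs\<close>

context projective_exact_category
begin

text \<open>Any lift \<open>q1\<close> of \<open>y\<close> has a boundary that differs from
  \<open>q\<close> by a cycle of the kernel \<open>K\<close>. This cycle bounds in \<open>K\<close>,
  and adding the bounding chain corrects \<open>q1\<close> without changing its image.\<close>

lemma lifting_of_kernel_ex_at:
  assumes k: "cmap K Q k" and g: "cmap Q Y g" and c: "\<And>n. cnf (k n) (g n)" and e: "\<And>n. ex_at K n"
  shows "lifting Q Y g m"
proof (rule liftingI)
  note [simp] = cmapD(1-5)[OF k] cmapD(1-5)[OF g]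
  fix P q y assume P: "P \<in> Proj C" and q [simp]: "arr q" "src q = P" "tgt q = ob Q m" and y [simp]: "arr y" "src y = P" "tgt y = ob Y (m + 1)"
    and dq: "D Q m \<bullet> q = zer P (ob Q (m - 1))" and dy: "D Y (m + 1) \<bullet> y = g m \<bullet> q"
  note [simp] = Proj_Obj[OF P]
  obtain q1 where q1 [simp]: "arr q1" "src q1 = P" "tgt q1 = ob Q (m + 1)" and gq1: "g (m + 1) \<bullet> q1 = y"
    by (rule psurjD[OF cnf_psurj[OF c[of "m + 1"]] P, of y]) simp_all
  let ?z = "q \<boxplus> \<boxminus> (D Q (m + 1) \<bullet> q1)"
  have "g m \<bullet> ?z = zer P (ob Y m)"
    using cmapD(7)[OF g, of "m + 1" q1, symmetric] by (simp add: gq1 dy)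
  then obtain z where z [simp]: "arr z" "src z = P" "tgt z = ob K m" and kz: "k m \<bullet> z = ?z"
    using kern_lift[OF cnf_kern[OF c[of m]], of ?z] by auto
  have "k (m - 1) \<bullet> (D K m \<bullet> z) = k (m - 1) \<bullet> zer P (ob K (m - 1))"
    using cmapD(7)[OF k, of m z] by (simp add: kz dq)
  then have "D K m \<bullet> z = zer P (ob K (m - 1))"
    by (rule monoD[OF kernD(1)[OF cnf_kern[OF c]]]) simp_all
  then obtain w where w [simp]: "arr w" "src w = P" "tgt w = ob K (m + 1)" and dw: "D K (m + 1) \<bullet> w = z"
    using ex_atE[OF e[of m], of z] P by auto
  have kg: "g (m + 1) \<bullet> k (m + 1) \<bullet> w = zer P (ob Y (m + 1))"
    using cmp_reassoc[OF kernD(5)[OF cnf_kern[OF c[of "m + 1"]]], of w] by simp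
  have "D Q (m + 1) \<bullet> (q1 \<boxplus> k (m + 1) \<bullet> w) = q" "g (m + 1) \<bullet> (q1 \<boxplus> k (m + 1) \<bullet> w) = y"
    by (simp_all add: cmapD(7)[OF k] dw kz gq1 kg canc)
  then show "\<exists>q'. isar q' P (ob Q (m + 1)) \<and> D Q (m + 1) \<bullet> q' = q \<and> g (m + 1) \<bullet> q' = y"
    by (intro exI[of _ "q1 \<boxplus> k (m + 1) \<bullet> w"]) simp
qed

text \<open>The lifting property is applied to a cycle of \<open>K\<close> and the zero chain of
  \<open>Y\<close>; the resulting chain maps to zero and so lies in \<open>K\<close>.\<close>

lemma kernel_ex_at_of_lifting:
  assumes k: "cmap K Q k" and g: "cmap Q Y g" and c: "\<And>n. cnf (k n) (g n)" and l: "lifting Q Y g m"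
  shows "ex_at K m"
proof (rule ex_atI)
  note [simp] = cmapD(1-5)[OF k] cmapD(1-5)[OF g]
  have gk: "g n \<bullet> k n = zer (ob K n) (ob Y n)" for n using kernD(5)[OF cnf_kern[OF c[of n]]] by simp
  fix P x assume P: "P \<in> Proj C" and x [simp]: "arr x" "src x = P" "tgt x = ob K m" and dx: "D K m \<bullet> x = zer P (ob K (m - 1))"
  note [simp] = Proj_Obj[OF P]
  obtain q where q [simp]: "arr q" "src q = P" "tgt q = ob Q (m + 1)" and dq: "D Q (m + 1) \<bullet> q = k m \<bullet> x" and gq: "g (m + 1) \<bullet> q = zer P (ob Y (m + 1))"
    by (rule liftingE[OF l P, of "k m \<bullet> x" "zer P (ob Y (m + 1))"])
       (simp_all add: cmapD(7)[OF k] dx gk[THEN cmp_reassoc])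
  obtain z where z [simp]: "arr z" "src z = P" "tgt z = ob K (m + 1)" and kz: "k (m + 1) \<bullet> z = q"
    using kern_lift[OF cnf_kern[OF c[of "m + 1"]], of q] gq by auto
  have "k m \<bullet> (D K (m + 1) \<bullet> z) = k m \<bullet> x" using cmapD(7)[OF k, of "m + 1" z] by (simp add: kz dq)
  then have "D K (m + 1) \<bullet> z = x" by (rule monoD[OF kernD(1)[OF cnf_kern[OF c]]]) simp_all
  then show "\<exists>y. isar y P (ob K (m + 1)) \<and> D K (m + 1) \<bullet> y = x" using z by blast
qed

lemma kernel_cplx:
  assumes g: "cmap Q Y g" and s: "\<And>n. psurj (g n)"
  obtains K k where "cmap K Q k" "\<And>n. cnf (k n) (g n)"
proof -
  note [simp] = cmapD(1-5)[OF g]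
  have "\<exists>k. cnf k (g n)" for n using cnf_exists[OF s[of n]] by blast
  then obtain k where c: "\<And>n. cnf (k n) (g n)" by metis
  have t [simp]: "arr (k n)" "tgt (k n) = ob Q n" for n using cnf_types[OF c[of n]] by simp_all
  have gk: "g n \<bullet> k n = zer (src (k n)) (ob Y n)" for n using kernD(5)[OF cnf_kern[OF c[of n]]] by simp
  have "\<exists>d. isar d (src (k n)) (src (k (n - 1))) \<and> k (n - 1) \<bullet> d = D Q n \<bullet> k n" for n
  proof -
    have "g (n - 1) \<bullet> (D Q n \<bullet> k n) = zer (src (k n)) (ob Y (n - 1))"
      unfolding cmapD(7)[OF g, symmetric] by (simp add: gk)
    then show ?thesis using kern_lift[OF cnf_kern[OF c[of "n - 1"]], of "D Q n \<bullet> k n"] by auto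
  qed
  then obtain d where d: "\<And>n. isar (d n) (src (k n)) (src (k (n - 1)))" "\<And>n. k (n - 1) \<bullet> d n = D Q n \<bullet> k n" by metis
  have dd: "d (n - 1) \<bullet> d n = zer (src (k n)) (src (k (n - 1 - 1)))" for n
  proof (rule monoD[OF kernD(1)[OF cnf_kern[OF c[of "n - 1 - 1"]]]])
    show "k (n - 1 - 1) \<bullet> (d (n - 1) \<bullet> d n) = k (n - 1 - 1) \<bullet> zer (src (k n)) (src (k (n - 1 - 1)))"
      using cmp_reassoc[OF d(2)[of "n - 1"], of "d n"] by (simp add: d(2))
  qed (use d(1) in simp_all)
  define K where "K = mkc (\<lambda>n. src (k n)) d"
  have K: "is_cplx C K" unfolding K_def by (rule is_cplx_mkc) (use d(1) dd in blast)+
  have "D K n = d n" for n unfolding K_def by (rule D_mkc) (use d(1) in blast)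
  then have "cmap K Q k" using K by (simp add: cmap_def d(2) K_def)
  then show ?thesis using that c by blast
qed

section \<open>Contractible complexes\<close>

definition contractible :: "('o, 'm) cplx \<Rightarrow> bool" where
  "contractible X \<longleftrightarrow> is_cplx C X \<and> nullh X X (\<lambda>n. idn (ob X n))"

lemma contractibleE:
  assumes "contractible X"
  obtains h where "\<And>n. arr (h n)" "\<And>n. src (h n) = ob X n" "\<And>n. tgt (h n) = ob X (n + 1)"
    "\<And>n. D X (n + 1) \<bullet> h n \<boxplus> h (n - 1) \<bullet> D X n = idn (ob X n)"
  using assms unfolding contractible_def nullh_def by metis

lemma contractible_ex_at:
  assumes "contractible X" shows "ex_at X n"
proof (rule ex_atI)
  have [simp]: "is_cplx C X" using assms by (simp add: contractible_def)
  obtain h where h: "\<And>n. arr (h n)" "\<And>n. src (h n) = ob X n" "\<And>n. tgt (h n) = ob X (n + 1)"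
    "\<And>n. D X (n + 1) \<bullet> h n \<boxplus> h (n - 1) \<bullet> D X n = idn (ob X n)"
    using contractibleE[OF assms] by blast
  fix P x assume P: "P \<in> Proj C" and x: "arr x" "src x = P" "tgt x = ob X n" "D X n \<bullet> x = zer P (ob X (n - 1))"
  have "(D X (n + 1) \<bullet> h n \<boxplus> h (n - 1) \<bullet> D X n) \<bullet> x = x" unfolding h(4) using x by simp
  then have "D X (n + 1) \<bullet> h n \<bullet> x = x" using x h(1-3) P by simp
  then show "\<exists>y. isar y P (ob X (n + 1)) \<and> D X (n + 1) \<bullet> y = x" using h(1-3) x by (intro exI[of _ "h n \<bullet> x"]) simp
qed

lemma contractible_retract:
  assumes Y: "contractible Y" and s: "cmap X Y s" and r: "cmap Y X r" and rs: "\<And>n. r n \<bullet> s n = idn (ob X n)"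
  shows "contractible X"
proof -
  note [simp] = cmapD(1-5)[OF s] cmapD(1-5)[OF r]
  obtain h where h: "\<And>n. arr (h n)" "\<And>n. src (h n) = ob Y n" "\<And>n. tgt (h n) = ob Y (n + 1)"
    "\<And>n. D Y (n + 1) \<bullet> h n \<boxplus> h (n - 1) \<bullet> D Y n = idn (ob Y n)"
    using contractibleE[OF Y] by blast
  have "nullh X X (\<lambda>n. idn (ob X n))"
  proof (rule nullhI[of "\<lambda>n. r (n + 1) \<bullet> h n \<bullet> s n"])
    fix n
    have "idn (ob X n) = r n \<bullet> (D Y (n + 1) \<bullet> h n \<boxplus> h (n - 1) \<bullet> D Y n) \<bullet> s n" unfolding h(4) by (simp add: rs)
    also have "\<dots> = D X (n + 1) \<bullet> (r (n + 1) \<bullet> h n \<bullet> s n) \<boxplus> (r (n - 1 + 1) \<bullet> h (n - 1) \<bullet> s (n - 1)) \<bullet> D X n"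
      using h(1-3) by (simp add: cmapD(7)[OF r] cmapD(6)[OF s])
    finally show "idn (ob X n) = D X (n + 1) \<bullet> (r (n + 1) \<bullet> h n \<bullet> s n) \<boxplus> (r (n - 1 + 1) \<bullet> h (n - 1) \<bullet> s (n - 1)) \<bullet> D X n" .
  qed (use h(1-3) in simp_all)
  then show ?thesis by (simp add: contractible_def)
qed

text \<open>If the cycles are projective, each \<open>X n\<close> splits as the sum of
  \<open>Z n\<close> and \<open>Z (n - 1)\<close>, and the contraction is the projection to
  \<open>Z n\<close> followed by the section into the next degree. Conversely a contraction makes
  \<open>Z n\<close> a retract of the object in degree \<open>n + 1\<close>.\<close>

lemma tilde_Proj_iff: "X \<in> tilde C (Proj C) \<longleftrightarrow> contractible X \<and> (\<forall>n. ob X n \<in> Proj C)"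
proof
  assume "X \<in> tilde C (Proj C)"
  then obtain Z i p where a: "acyclic_via C X Z i p" and ZP: "\<And>n. Z n \<in> Proj C" by (auto simp: tilde_def)
  define I where "I n = Arrow (Z n) (ob X n) (i n)" for n
  define P where "P n = Arrow (ob X n) (Z (n - 1)) (p n)" for n
  have X [simp]: "is_cplx C X" and c: "cnf (I n) (P n)" and d: "D X n = I (n - 1) \<bullet> P n" for n
    using acyclic_viaD[OF a] by (simp_all add: I_def P_def)
  have [simp]: "src (I n) = Z n" "tgt (I n) = ob X n" "src (P n) = ob X n" "tgt (P n) = Z (n - 1)" for n
    by (simp_all add: I_def P_def)
  have [simp]: "arr (I n)" "arr (P n)" for n using cnf_types[OF c[of n]] by simp_all
  note [simp] = Proj_Obj[OF ZP]
  have "\<exists>s. isar s (Z (n - 1)) (ob X n) \<and> P n \<bullet> s = idn (Z (n - 1))" for n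
    using psurjD[OF cnf_psurj[OF c[of n]] ZP[of "n - 1"], of "idn (Z (n - 1))"] by auto
  then obtain s where s: "\<And>n. isar (s n) (Z (n - 1)) (ob X n)" "\<And>n. P n \<bullet> s n = idn (Z (n - 1))" by metis
  note [simp] = s(1)[THEN conjunct1] s(1)[THEN conjunct2, THEN conjunct1] s(1)[THEN conjunct2, THEN conjunct2]
  have "\<exists>k. isar k (ob X n) (Z n) \<and> I n \<bullet> k = idn (ob X n) \<boxplus> \<boxminus> (s n \<bullet> P n)" for n
    using kern_lift[OF cnf_kern[OF c[of n]], of "idn (ob X n) \<boxplus> \<boxminus> (s n \<bullet> P n)"] by (auto simp: s(2)[THEN cmp_reassoc])
  then obtain k where k: "\<And>n. isar (k n) (ob X n) (Z n)" "\<And>n. I n \<bullet> k n = idn (ob X n) \<boxplus> \<boxminus> (s n \<bullet> P n)" by metis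
  note [simp] = k(1)[THEN conjunct1] k(1)[THEN conjunct2, THEN conjunct1] k(1)[THEN conjunct2, THEN conjunct2]
  have PI: "P n \<bullet> I n = zer (Z n) (Z (n - 1))" for n using kernD(5)[OF cnf_kern[OF c[of n]]] by simp
  have kI: "k n \<bullet> I n = idn (Z n)" for n
    by (rule monoD[OF kernD(1)[OF cnf_kern[OF c[of n]]]]) (simp_all add: k(2)[THEN cmp_reassoc] PI)
  have ik: "I n \<bullet> k n \<boxplus> s n \<bullet> P n = idn (ob X n)" for n unfolding k(2) by (simp add: canc)
  have XP: "ob X n \<in> Proj C" for n
    by (rule Proj_retract[OF Proj_Bip[OF ZP[of n] ZP[of "n - 1"]], of "pair (k n) (P n)" _ "cop (I n) (s n)"]) (simp_all add: ik)
  have "nullh X X (\<lambda>n. idn (ob X n))"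
  proof (rule nullhI[of "\<lambda>n. s (n + 1) \<bullet> k n"])
    fix n
    have "D X (n + 1) \<bullet> s (n + 1) \<bullet> k n = I n \<bullet> k n"
      unfolding d using s(2)[of "n + 1", THEN cmp_reassoc, of "k n"] by simp
    moreover have "(s (n - 1 + 1) \<bullet> k (n - 1)) \<bullet> D X n = s n \<bullet> P n"
      unfolding d using kI[of "n - 1", THEN cmp_reassoc, of "P n"] by simp
    ultimately show "idn (ob X n) = D X (n + 1) \<bullet> (s (n + 1) \<bullet> k n) \<boxplus> (s (n - 1 + 1) \<bullet> k (n - 1)) \<bullet> D X n"
      using ik by simp
  qed simp_all
  then show "contractible X \<and> (\<forall>n. ob X n \<in> Proj C)" using XP by (simp add: contractible_def)
next
  assume a: "contractible X \<and> (\<forall>n. ob X n \<in> Proj C)"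
  then have X [simp]: "is_cplx C X" by (simp add: contractible_def)
  obtain h where h: "\<And>n. arr (h n)" "\<And>n. src (h n) = ob X n" "\<And>n. tgt (h n) = ob X (n + 1)"
    "\<And>n. D X (n + 1) \<bullet> h n \<boxplus> h (n - 1) \<bullet> D X n = idn (ob X n)"
    using contractibleE[OF conjunct1[OF a]] by blast
  have "\<exists>i. kern i (D X n)" for n using kernel_exists[of "D X n"] by (metis arr_D X)
  then obtain i where i: "\<And>n. kern (i n) (D X n)" by metis
  have ti [simp]: "arr (i n)" "tgt (i n) = ob X n" for n using kernD(2,4)[OF i[of n]] by simp_all
  have Di: "D X n \<bullet> i n = zer (src (i n)) (ob X (n - 1))" for n using kernD(5)[OF i[of n]] by simp
  obtain p where p: "acyclic_via C X (\<lambda>n. src (i n)) (\<lambda>n. val (i n)) p"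
    using acyclic_viaI[OF X contractible_ex_at[OF conjunct1[OF a]] i] by blast
  have "src (i n) \<in> Proj C" for n
  proof -
    obtain q where q: "arr q" "src q = ob X (n + 1)" "tgt q = src (i n)" "i n \<bullet> q = D X (n + 1)"
      using kern_lift[OF i[of n], of "D X (n + 1)"] by auto
    have "(D X (n + 1) \<bullet> h n \<boxplus> h (n - 1) \<bullet> D X n) \<bullet> i n = i n" unfolding h(4) by simp
    then have "D X (n + 1) \<bullet> h n \<bullet> i n = i n" using h(1-3) by (simp add: Di)
    then have e: "i n \<bullet> (q \<bullet> h n \<bullet> i n) = i n \<bullet> idn (src (i n))" by (simp add: q(4)[THEN cmp_reassoc])
    have Zr: "q \<bullet> h n \<bullet> i n = idn (src (i n))" by (rule monoD[OF kernD(1)[OF i] e]) (use q h(1-3) in simp_all)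
    show ?thesis
      by (rule Proj_retract[OF conjunct2[OF a, rule_format, of "n + 1"], of "h n \<bullet> i n" _ q]) (use Zr q h(1-3) in simp_all)
  qed
  then show "X \<in> tilde C (Proj C)" using p unfolding tilde_def by blast
qed

lemma tilde_Obj: "tilde C (Obj C) = acyclics C"
proof -
  have "Z n \<in> Obj C" if "acyclic_via C X Z i p" for X Z i p n
    using that conf_objects unfolding acyclic_via_def by blast
  then show ?thesis unfolding tilde_def acyclics_def by blast
qed

lemma kproj_contractible:
  assumes "contractible X" "\<And>n. ob X n \<in> Proj C" shows "kproj X"
proof (rule kprojI)
  show X [simp]: "is_cplx C X" using assms by (simp add: contractible_def)
  obtain h where h: "\<And>n. arr (h n)" "\<And>n. src (h n) = ob X n" "\<And>n. tgt (h n) = ob X (n + 1)"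
    "\<And>n. D X (n + 1) \<bullet> h n \<boxplus> h (n - 1) \<bullet> D X n = idn (ob X n)"
    using contractibleE[OF assms(1)] by blast
  fix N f assume f: "cmap X N f"
  note [simp] = cmapD(2-5)[OF f]
  show "nullh X N f"
  proof (rule nullhI[of "\<lambda>n. f (n + 1) \<bullet> h n"])
    fix n
    have "f n = f n \<bullet> (D X (n + 1) \<bullet> h n \<boxplus> h (n - 1) \<bullet> D X n)" unfolding h(4) by simp
    then show "f n = D N (n + 1) \<bullet> (f (n + 1) \<bullet> h n) \<boxplus> (f (n - 1 + 1) \<bullet> h (n - 1)) \<bullet> D X n"
      using h(1-3) by (simp add: cmapD(7)[OF f])
  qed (use h(1-3) in simp_all)
qed (use assms in simp)

lemma contractible_of_kproj:
  assumes "kproj X" "X \<in> acyclics C" shows "contractible X"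
  using assms cmap_id[of X] kprojD(1)[OF assms(1)] unfolding contractible_def kproj_def by blast

section \<open>The Hom complex in terms of arrows\<close>

definition hdif :: "('o, 'm) cplx \<Rightarrow> ('o, 'm) cplx \<Rightarrow> int \<Rightarrow> (int \<Rightarrow> ('o, 'm) arrow) \<Rightarrow> int \<Rightarrow> ('o, 'm) arrow" where
  "hdif X B n F i = D B (i + n) \<bullet> F i \<boxplus> (if even n then \<boxminus> (F (i - 1) \<bullet> D X i) else F (i - 1) \<bullet> D X i)"

lemma carrier_hom_cplx: "carrier (hom_cplx C X B n) = {f. \<forall>i. f i \<in> Hom C (ob X i) (ob B (i + n))}"
  by (auto simp: hom_cplx_def PiE_def extensional_def)

lemma hom_cplx_dif_Arrow:
  assumes [simp]: "is_cplx C X" "is_cplx C B" and f: "\<And>i. f i \<in> Hom C (ob X i) (ob B (i + n))"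
  shows "Arrow (ob X i) (ob B (i + (n - 1))) (hom_cplx_dif C X B n f i) = hdif X B n (\<lambda>i. Arrow (ob X i) (ob B (i + n)) (f i)) i"
proof -
  have ix: "i - 1 + n = i + (n - 1)" "i + n - 1 = i + (n - 1)" by simp_all
  have a1: "D B (i + n) \<bullet> Arrow (ob X i) (ob B (i + n)) (f i) = Arrow (ob X i) (ob B (i + (n - 1))) (dif B (i + n) \<cdot> f i)"
    using f[of i] arr_D[of B "i + n"] by (simp add: cmp_def) (simp add: D_def ix)
  have a2: "Arrow (ob X (i - 1)) (ob B (i - 1 + n)) (f (i - 1)) \<bullet> D X i = Arrow (ob X i) (ob B (i + (n - 1))) (f (i - 1) \<cdot> dif X i)"
    using f[of "i - 1"] arr_D[of X i] unfolding ix by (simp add: cmp_def) (simp add: D_def)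
  have c: "arr (Arrow (ob X i) (ob B (i + (n - 1))) (dif B (i + n) \<cdot> f i))" "arr (Arrow (ob X i) (ob B (i + (n - 1))) (f (i - 1) \<cdot> dif X i))"
    unfolding a1[symmetric] a2[symmetric] using f[of i] f[of "i - 1"] by simp_all
  have c2: "arr (\<boxminus> Arrow (ob X i) (ob B (i + (n - 1))) (f (i - 1) \<cdot> dif X i))" using c(2) by simp
  show ?thesis
  proof (cases "even n")
    case True
    then show ?thesis unfolding hdif_def a1 a2 hom_cplx_dif_def Let_def
      using c c2 by (simp add: neg_Arrow add_Arrow)
  next
    case False
    then show ?thesis unfolding hdif_def a1 a2 hom_cplx_dif_def Let_def
      using c by (simp add: add_Arrow)
  qed
qed

lemma hdif_types:
  assumes [simp]: "is_cplx C X" "is_cplx C B" and F: "\<And>i. isar (F i) (ob X i) (ob B (i + n))"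
  shows "isar (hdif X B n F i) (ob X i) (ob B (i + (n - 1)))"
proof -
  have ix: "i - 1 + n = i + (n - 1)" "i + n - 1 = i + (n - 1)" by simp_all
  have "isar (F (i - 1)) (ob X (i - 1)) (ob B (i + (n - 1)))" using F[of "i - 1"] unfolding ix(1) .
  moreover have "isar (D B (i + n)) (ob B (i + n)) (ob B (i + (n - 1)))" by (simp add: ix)
  ultimately show ?thesis using F[of i] by (simp add: hdif_def)
qed

lemma hdif_hdif:
  assumes X [simp]: "is_cplx C X" and B [simp]: "is_cplx C B" and H: "\<And>i. isar (H i) (ob X i) (ob B (i + (n + 1)))"
  shows "hdif X B n (hdif X B (n + 1) H) i = zer (ob X i) (ob B (i + (n - 1)))"
proof -
  have ix: "i - 1 + (n + 1) = i + n" "i + (n + 1) - 1 = i + n" "i + n - 1 = i + (n - 1)" "i - 1 - 1 + (n + 1) = i + (n - 1)" "i + n + - 1 = i + (n - 1)" by simp_all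
  define b c d where "b = D B (i + n)" and "c = D X i" and "d = D B (i + (n + 1))"
  define x y z where "x = H i" and "y = H (i - 1)" and "z = H (i - 1 - 1)"
  define c' where "c' = D X (i - 1)"
  have t: "isar x (ob X i) (ob B (i + (n + 1)))" "isar y (ob X (i - 1)) (ob B (i + n))" "isar z (ob X (i - 1 - 1)) (ob B (i + (n - 1)))"
    using H[of i] H[of "i - 1"] H[of "i - 1 - 1"] unfolding ix x_def y_def z_def by simp_all
  have bt: "isar b (ob B (i + n)) (ob B (i + (n - 1)))" "isar d (ob B (i + (n + 1))) (ob B (i + n))"
    "isar c (ob X i) (ob X (i - 1))" "isar c' (ob X (i - 1)) (ob X (i - 1 - 1))"
    unfolding b_def d_def c_def c'_def by (simp_all add: ix)
  have bd: "b \<bullet> d = zer (ob B (i + (n + 1))) (ob B (i + (n - 1)))" "c' \<bullet> c = zer (ob X i) (ob X (i - 1 - 1))"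
    unfolding b_def d_def c_def c'_def by (simp_all add: ix)
  have e: "hdif X B (n + 1) H i = d \<bullet> x \<boxplus> (if even n then y \<bullet> c else \<boxminus> (y \<bullet> c))"
    "hdif X B (n + 1) H (i - 1) = b \<bullet> y \<boxplus> (if even n then z \<bullet> c' else \<boxminus> (z \<bullet> c'))"
    unfolding hdif_def ix b_def c_def d_def x_def y_def z_def c'_def by simp_all
  have o: "ob X i \<in> Obj C" "ob B (i + (n - 1)) \<in> Obj C" "ob X (i - 1) \<in> Obj C" by simp_all
  show ?thesis
    unfolding hdif_def[of X B n] e b_def[symmetric] c_def[symmetric]
    using t bt bd(1)[THEN cmp_reassoc] bd(2) o by (cases "even n") (simp_all add: canc)
qed

text \<open>Boundaries are cycles by \<open>hdif_hdif\<close>, so exactness reduces to the statement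
  that cycles are boundaries, here for families of arrows.\<close>

lemma hom_cplx_exact_iff:
  assumes X [simp]: "is_cplx C X" and B [simp]: "is_cplx C B"
  shows "hom_cplx_exact C X B \<longleftrightarrow> (\<forall>n F. (\<forall>i. isar (F i) (ob X i) (ob B (i + n))) \<and> (\<forall>i. hdif X B n F i = zer (ob X i) (ob B (i + (n - 1)))) \<longrightarrow>
     (\<exists>H. (\<forall>i. isar (H i) (ob X i) (ob B (i + (n + 1)))) \<and> (\<forall>i. hdif X B (n + 1) H i = F i)))"
    (is "_ = ?R")
proof
  have one: "\<one>\<^bsub>hom_cplx C X B n\<^esub> i = Zero C (ob X i) (ob B (i + n))" for n i by (simp add: hom_cplx_def)
  have z: "zer (ob X i) (ob B m) = Arrow (ob X i) (ob B m) (Zero C (ob X i) (ob B m))" for i m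
    by (simp add: zer_eq_Arrow)
  {
    assume h: "hom_cplx_exact C X B"
    show ?R
    proof (intro allI impI)
      fix n F assume F: "(\<forall>i. isar (F i) (ob X i) (ob B (i + n))) \<and> (\<forall>i. hdif X B n F i = zer (ob X i) (ob B (i + (n - 1))))"
      define f where "f i = val (F i)" for i
      have f: "f i \<in> Hom C (ob X i) (ob B (i + n))" and Ff: "Arrow (ob X i) (ob B (i + n)) (f i) = F i" for i
        using F val_Hom[of "F i"] Arrow_val[of "F i"] by (auto simp: f_def)
      have "hom_cplx_dif C X B n f i = Zero C (ob X i) (ob B (i + (n - 1)))" for i
        using hom_cplx_dif_Arrow[OF X B, of f n i] f F unfolding Ff z by simp
      then have "hom_cplx_dif C X B n f = \<one>\<^bsub>hom_cplx C X B (n - 1)\<^esub>" by (intro ext) (simp add: one)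
      then have "f \<in> kernel (hom_cplx C X B n) (hom_cplx C X B (n - 1)) (hom_cplx_dif C X B n)"
        using f by (simp add: kernel_def carrier_hom_cplx)
      then have "f \<in> hom_cplx_dif C X B (n + 1) ` carrier (hom_cplx C X B (n + 1))"
        using h unfolding hom_cplx_exact_def by blast
      then obtain g where g: "\<And>i. g i \<in> Hom C (ob X i) (ob B (i + (n + 1)))" "f = hom_cplx_dif C X B (n + 1) g"
        by (auto simp: carrier_hom_cplx)
      show "\<exists>H. (\<forall>i. isar (H i) (ob X i) (ob B (i + (n + 1)))) \<and> (\<forall>i. hdif X B (n + 1) H i = F i)"
      proof (intro exI[of _ "\<lambda>i. Arrow (ob X i) (ob B (i + (n + 1))) (g i)"] conjI allI)
        fix i
        have "n + 1 - 1 = n" by simp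
        then show "hdif X B (n + 1) (\<lambda>i. Arrow (ob X i) (ob B (i + (n + 1))) (g i)) i = F i"
          using hom_cplx_dif_Arrow[OF X B, of g "n + 1" i] g Ff[of i] by simp
      qed (use g(1) in simp_all)
    qed
  }
  assume R: ?R
  show "hom_cplx_exact C X B"
    unfolding hom_cplx_exact_def
  proof (intro allI equalityI subsetI)
    fix n f assume "f \<in> hom_cplx_dif C X B (n + 1) ` carrier (hom_cplx C X B (n + 1))"
    then obtain g where g: "\<And>i. g i \<in> Hom C (ob X i) (ob B (i + (n + 1)))" "f = hom_cplx_dif C X B (n + 1) g"
      by (auto simp: carrier_hom_cplx)
    define H where "H = (\<lambda>i. Arrow (ob X i) (ob B (i + (n + 1))) (g i))"
    have H: "isar (H i) (ob X i) (ob B (i + (n + 1)))" for i using g(1) by (simp add: H_def)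
    have n1: "n + 1 - 1 = n" by simp
    have Ff: "Arrow (ob X i) (ob B (i + n)) (f i) = hdif X B (n + 1) H i" for i
      using hom_cplx_dif_Arrow[OF X B, of g "n + 1" i] g unfolding n1 H_def by simp
    have "arr (Arrow (ob X i) (ob B (i + n)) (f i))" for i unfolding Ff using hdif_types[OF X B H, of i] by simp
    then have f: "f i \<in> Hom C (ob X i) (ob B (i + n))" for i by simp
    have "hom_cplx_dif C X B n f i = Zero C (ob X i) (ob B (i + (n - 1)))" for i
      using hom_cplx_dif_Arrow[OF X B, of f n i] f hdif_hdif[OF X B H, of i] unfolding Ff z by simp
    then have "hom_cplx_dif C X B n f = \<one>\<^bsub>hom_cplx C X B (n - 1)\<^esub>" by (intro ext) (simp add: one)
    then show "f \<in> kernel (hom_cplx C X B n) (hom_cplx C X B (n - 1)) (hom_cplx_dif C X B n)"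
      using f by (simp add: kernel_def carrier_hom_cplx)
  next
    fix n f assume "f \<in> kernel (hom_cplx C X B n) (hom_cplx C X B (n - 1)) (hom_cplx_dif C X B n)"
    then have f: "\<And>i. f i \<in> Hom C (ob X i) (ob B (i + n))" and d: "hom_cplx_dif C X B n f = \<one>\<^bsub>hom_cplx C X B (n - 1)\<^esub>"
      by (auto simp: kernel_def carrier_hom_cplx)
    define F where "F = (\<lambda>i. Arrow (ob X i) (ob B (i + n)) (f i))"
    have "\<forall>i. hdif X B n F i = zer (ob X i) (ob B (i + (n - 1)))"
      using hom_cplx_dif_Arrow[OF X B, of f n] f one[of "n - 1"] unfolding F_def d z by simp
    moreover have "\<forall>i. isar (F i) (ob X i) (ob B (i + n))" using f by (simp add: F_def)
    ultimately obtain H where H: "\<And>i. isar (H i) (ob X i) (ob B (i + (n + 1)))" "\<And>i. hdif X B (n + 1) H i = F i" using R by blast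
    define g where "g i = val (H i)" for i
    have g: "g i \<in> Hom C (ob X i) (ob B (i + (n + 1)))" and Hg: "Arrow (ob X i) (ob B (i + (n + 1))) (g i) = H i" for i
      using H(1)[of i] val_Hom[of "H i"] Arrow_val[of "H i"] by (auto simp: g_def)
    have n1: "n + 1 - 1 = n" by simp
    have "hom_cplx_dif C X B (n + 1) g i = f i" for i
      using hom_cplx_dif_Arrow[OF X B, of g "n + 1" i] g H(2)[of i] unfolding n1 Hg F_def by simp
    then have "f = hom_cplx_dif C X B (n + 1) g" by (intro ext) simp
    then show "f \<in> hom_cplx_dif C X B (n + 1) ` carrier (hom_cplx C X B (n + 1))"
      using g by (auto simp: carrier_hom_cplx)
  qed
qed

text \<open>A cycle of degree \<open>n\<close> in the Hom complex is a chain map into the shift of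
  \<open>B\<close> by \<open>n\<close>, with the differential negated for odd \<open>n\<close>; a
  null homotopy of it is, up to sign, a chain of degree \<open>n + 1\<close> that bounds it.\<close>

lemma hom_cplx_exact_of_nullh:
  assumes X [simp]: "is_cplx C X" and B [simp]: "is_cplx C B"
    and nh: "\<And>b n f. cmap X (Sh b n B) f \<Longrightarrow> nullh X (Sh b n B) f"
  shows "hom_cplx_exact C X B"
  unfolding hom_cplx_exact_iff[OF X B]
proof (intro allI impI)
  fix n F assume a: "(\<forall>i. isar (F i) (ob X i) (ob B (i + n))) \<and> (\<forall>i. hdif X B n F i = zer (ob X i) (ob B (i + (n - 1))))"
  then have F: "isar (F i) (ob X i) (ob B (i + n))" for i by blast
  have ix: "i - 1 + n = i + (n - 1)" "i + n - 1 = i + (n - 1)" for i by simp_all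
  have F1: "isar (F (i - 1)) (ob X (i - 1)) (ob B (i + (n - 1)))" for i using F[of "i - 1"] unfolding ix(1) .
  have dt: "isar (D B (i + n)) (ob B (i + n)) (ob B (i + (n - 1)))" for i by (simp add: ix)
  have "cmap X (Sh (odd n) n B) F"
    unfolding cmap_def
  proof (intro conjI allI)
    fix i
    have "D B (i + n) \<bullet> F i \<boxplus> (if even n then \<boxminus> (F (i - 1) \<bullet> D X i) else F (i - 1) \<bullet> D X i) = zer (ob X i) (ob B (i + (n - 1)))"
      using a unfolding hdif_def by blast
    note e = this
    show "D (Sh (odd n) n B) i \<bullet> F i = F (i - 1) \<bullet> D X i"
    proof (cases "even n")
      case True
      have "D B (i + n) \<bullet> F i = F (i - 1) \<bullet> D X i"
        by (rule diff_zerD) (use e True F[of i] F1[of i] dt[of i] in simp_all)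
      then show ?thesis using True by (simp add: D_Sh)
    next
      case False
      have "F (i - 1) \<bullet> D X i = \<boxminus> (D B (i + n) \<bullet> F i)"
        by (rule add_eq_zerD[OF e[unfolded if_not_P[OF False]]]) (use F[of i] F1[of i] dt[of i] in simp_all)
      then show ?thesis using False by (simp add: D_Sh)
    qed
  qed (use F in simp_all)
  then have "nullh X (Sh (odd n) n B) F" by (rule nh)
  then obtain h where h: "\<And>i. isar (h i) (ob X i) (ob (Sh (odd n) n B) (i + 1))"
    and Fh: "\<And>i. F i = D (Sh (odd n) n B) (i + 1) \<bullet> h i \<boxplus> h (i - 1) \<bullet> D X i" unfolding nullh_def by blast
  have ix1: "i + 1 + n = i + (n + 1)" for i by simp
  have h: "isar (h i) (ob X i) (ob B (i + (n + 1)))" for i using h[of i] by (simp add: ix1)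
  show "\<exists>H. (\<forall>i. isar (H i) (ob X i) (ob B (i + (n + 1)))) \<and> (\<forall>i. hdif X B (n + 1) H i = F i)"
  proof (cases "even n")
    case True
    have "hdif X B (n + 1) h i = F i" for i
      unfolding Fh[of i] hdif_def using True by (simp add: D_Sh ix1)
    then show ?thesis using h by blast
  next
    case False
    \<comment> \<open>For odd \<open>n\<close> the shift carries \<open>- d\<close>, while the Hom
      differential in the even degree \<open>n + 1\<close> carries \<open>+ d\<close> and subtracts
      the other term; negating \<open>h\<close> reconciles the two.\<close>
    have "hdif X B (n + 1) (\<lambda>i. \<boxminus> h i) i = F i" for i
    proof -
      have i1: "i - 1 + (n + 1) = i + n" by simp
      have h1: "isar (h (i - 1)) (ob X (i - 1)) (ob B (i + n))" using h[of "i - 1"] unfolding i1 .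
      show ?thesis unfolding Fh[of i] hdif_def using False h1 by (simp add: D_Sh ix1)
    qed
    then show ?thesis using h by (intro exI[of _ "\<lambda>i. \<boxminus> h i"]) simp
  qed
qed

lemma nullh_of_hom_cplx_exact:
  assumes h: "hom_cplx_exact C X B" and f: "cmap X B f" shows "nullh X B f"
proof -
  note [simp] = cmapD(1-5)[OF f]
  have "\<forall>i. hdif X B 0 f i = zer (ob X i) (ob B (i + (0 - 1)))" by (simp add: hdif_def cmapD(6)[OF f])
  moreover have "\<forall>i. isar (f i) (ob X i) (ob B (i + 0))" by simp
  ultimately obtain H where H: "\<And>i. isar (H i) (ob X i) (ob B (i + (0 + 1)))" "\<And>i. hdif X B (0 + 1) H i = f i"
    using h unfolding hom_cplx_exact_iff[OF cmapD(1,2)[OF f]] by blast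
  show ?thesis
    by (rule nullhI[of H]) (use H(1) H(2)[symmetric] in \<open>simp_all add: hdif_def\<close>)
qed

lemma dg_left_eq: "dg_left C (Proj C) (Obj C) = Collect kproj"
proof (intro equalityI subsetI CollectI)
  fix X assume a: "X \<in> dg_left C (Proj C) (Obj C)"
  show "kproj X" by (rule kprojI) (use a in \<open>auto simp: dg_left_def tilde_Obj intro: nullh_of_hom_cplx_exact\<close>)
next
  fix X assume "X \<in> Collect kproj"
  then have k: "kproj X" by simp
  have "hom_cplx_exact C X B" if "B \<in> acyclics C" for B
    by (rule hom_cplx_exact_of_nullh) (use k that acyclic_Sh[OF that] in \<open>auto simp: kproj_def acyclic_cplx\<close>)
  then show "X \<in> dg_left C (Proj C) (Obj C)" using kprojD[OF k] by (simp add: dg_left_def tilde_Obj)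
qed

text \<open>Composing with a contraction of \<open>A\<close> yields a null homotopy of every chain
  map out of \<open>A\<close>, so \<open>hom_cplx_exact C A X\<close> holds for each complex
  \<open>X\<close>.\<close>

lemma dg_right_eq: "dg_right C (Proj C) (Obj C) = Collect (is_cplx C)"
proof (intro equalityI subsetI CollectI)
  fix X assume "X \<in> dg_right C (Proj C) (Obj C)" then show "is_cplx C X" by (simp add: dg_right_def)
next
  fix X assume "X \<in> Collect (is_cplx C)"
  then have X: "is_cplx C X" by simp
  have "hom_cplx_exact C A X" if "A \<in> tilde C (Proj C)" for A
  proof (rule hom_cplx_exact_of_nullh[OF _ X])
    have c: "contractible A" using that by (simp add: tilde_Proj_iff)
    then show A: "is_cplx C A" by (simp add: contractible_def)
    fix b n f assume f: "cmap A (Sh b n X) f"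
    obtain h where h: "\<And>n. arr (h n)" "\<And>n. src (h n) = ob A n" "\<And>n. tgt (h n) = ob A (n + 1)"
      "\<And>n. D A (n + 1) \<bullet> h n \<boxplus> h (n - 1) \<bullet> D A n = idn (ob A n)" using contractibleE[OF c] by blast
    show "nullh A (Sh b n X) f"
    proof (rule nullhI[of "\<lambda>n. f (n + 1) \<bullet> h n"])
      fix m
      have "f m = f m \<bullet> (D A (m + 1) \<bullet> h m \<boxplus> h (m - 1) \<bullet> D A m)" unfolding h(4) using cmapD[OF f] by simp
      also have "\<dots> = D (Sh b n X) (m + 1) \<bullet> (f (m + 1) \<bullet> h m) \<boxplus> (f (m - 1 + 1) \<bullet> h (m - 1)) \<bullet> D A m"
        using h(1-3) by (simp add: cmapD(7)[OF f])
      finally show "f m = D (Sh b n X) (m + 1) \<bullet> (f (m + 1) \<bullet> h m) \<boxplus> (f (m - 1 + 1) \<bullet> h (m - 1)) \<bullet> D A m" .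
    qed (use h(1-3) cmapD[OF f] in simp_all)
  qed
  then show "X \<in> dg_right C (Proj C) (Obj C)" using X by (simp add: dg_right_def)
qed

text \<open>The identity of an acyclic K-projective complex is a map into an acyclic complex, hence
  null homotopic.\<close>

lemma dg_left_acyclics: "dg_left C (Proj C) (Obj C) \<inter> acyclics C = tilde C (Proj C)"
proof -
  have "X \<in> acyclics C" if "contractible X" for X
    using that contractible_ex_at[OF that] by (simp add: acyclic_iff contractible_def)
  then show ?thesis
    using kproj_contractible contractible_of_kproj kprojD(2) unfolding dg_left_eq tilde_Proj_iff[abs_def]
    by (auto simp: tilde_Proj_iff)
qed

subsection \<open>Short exact sequences of complexes\<close>

definition ses :: "('o, 'm) cplx \<Rightarrow> ('o, 'm) cplx \<Rightarrow> ('o, 'm) cplx \<Rightarrow> (int \<Rightarrow> ('o, 'm) arrow) \<Rightarrow> (int \<Rightarrow> ('o, 'm) arrow) \<Rightarrow> bool" where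
  "ses A B Q i c \<longleftrightarrow> cmap A B i \<and> cmap B Q c \<and> (\<forall>n. cnf (i n) (c n))"

lemma sesD: "ses A B Q i c \<Longrightarrow> cmap A B i" "ses A B Q i c \<Longrightarrow> cmap B Q c" "ses A B Q i c \<Longrightarrow> cnf (i n) (c n)"
  by (simp_all add: ses_def)

lemma ses_mono: "ses A B Q i c \<Longrightarrow> mono (i n)" and ses_epi: "ses A B Q i c \<Longrightarrow> epi (c n)"
  and ses_psurj: "ses A B Q i c \<Longrightarrow> psurj (c n)"
  using sesD(3) cnf_kern kernD(1) cnf_cker ckerD(1) cnf_psurj by blast+

lemma ses_zero:
  assumes "ses A B Q i c" shows "c n \<bullet> i n = zer (ob A n) (ob Q n)"
  using kernD(5)[OF cnf_kern[OF sesD(3)[OF assms]], of n] cmapD[OF sesD(1)[OF assms]] cmapD[OF sesD(2)[OF assms]] by simp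

lemma ses_lift:
  assumes s: "ses A B Q i c" and x: "arr x" "src x = P" "tgt x = ob B n" "c n \<bullet> x = zer P (ob Q n)"
  obtains y where "arr y" "src y = P" "tgt y = ob A n" "i n \<bullet> y = x"
proof -
  note [simp] = cmapD(1-5)[OF sesD(1)[OF s]] cmapD(1-5)[OF sesD(2)[OF s]]
  obtain y where "arr y" "src y = src x" "tgt y = src (i n)" "i n \<bullet> y = x"
    by (rule kern_lift[OF cnf_kern[OF sesD(3)[OF s, of n]], of x]) (use x in simp_all)
  then show ?thesis using that x by simp
qed

lemma ses_surj:
  assumes s: "ses A B Q i c" and P: "P \<in> Proj C" and x: "arr x" "src x = P" "tgt x = ob Q n"
  obtains y where "arr y" "src y = P" "tgt y = ob B n" "c n \<bullet> y = x"
proof -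
  note [simp] = cmapD(1-5)[OF sesD(2)[OF s]]
  show ?thesis by (rule psurjD[OF ses_psurj[OF s, of n] P, of x]) (use x that in simp_all)
qed

lemma ses_of_psurj:
  assumes g: "cmap Q Y g" and s: "\<And>n. psurj (g n)"
  obtains K k where "ses K Q Y k g"
  using kernel_cplx[OF assms] g that unfolding ses_def by metis

lemma ses_Tw: "twist B A \<theta> \<Longrightarrow> ses B (Tw B A \<theta>) A (\<lambda>n. in1 (ob B n) (ob A n)) (\<lambda>n. pr2 (ob B n) (ob A n))"
  unfolding ses_def using cmap_in1 cmap_pr2 cnf_bip[of "ob B _" "ob A _"] twistD(1,2) by simp

lemma twist_zer: "is_cplx C B \<Longrightarrow> is_cplx C A \<Longrightarrow> twist B A (\<lambda>n. zer (ob A n) (ob B (n - 1)))"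
  by (simp add: twist_def)

lemma cnf_zero_idn:
  assumes Z: "is_zero_object C Z" and [simp]: "X \<in> Obj C" shows "cnf (zer Z X) (idn X)"
  unfolding cnf_iff kern_def mono_def
proof (intro conjI allI impI)
  have [simp]: "Z \<in> Obj C" using Z by (simp add: is_zero_object_def)
  show "arr (zer Z X)" "arr (idn X)" "src (idn X) = tgt (zer Z X)" "idn X \<bullet> zer Z X = zer (src (zer Z X)) (tgt (idn X))" by simp_all
  show "psurj (idn X)" by (rule psurj_split[of _ X X "idn X"]) simp_all
  fix g assume g: "arr g \<and> tgt g = src (idn X) \<and> idn X \<bullet> g = zer (src g) (tgt (idn X))"
  then have "g = zer (src g) X" by (elim conjE) simp
  then show "\<exists>h. isar h (src g) (src (zer Z X)) \<and> zer Z X \<bullet> h = g"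
    using g by (intro exI[of _ "zer (src g) Z"]) simp
next
  have [simp]: "Z \<in> Obj C" using Z by (simp add: is_zero_object_def)
  fix g h assume a: "arr g \<and> arr h \<and> src g = src h \<and> tgt g = src (zer Z X) \<and> tgt h = src (zer Z X) \<and> zer Z X \<bullet> g = zer Z X \<bullet> h"
  then have "g = zer (src h) Z" "h = zer (src h) Z"
    using zero_object_arr_to[OF Z, of g] zero_object_arr_to[OF Z, of h] by simp_all
  then show "g = h" by simp
qed

lemma cnf_idn_zero:
  assumes Z: "is_zero_object C Z" and [simp]: "X \<in> Obj C" shows "cnf (idn X) (zer X Z)"
  unfolding cnf_iff kern_def mono_def
proof (intro conjI allI impI)
  have [simp]: "Z \<in> Obj C" using Z by (simp add: is_zero_object_def)
  show "arr (idn X)" "arr (zer X Z)" "src (zer X Z) = tgt (idn X)" "zer X Z \<bullet> idn X = zer (src (idn X)) (tgt (zer X Z))" by simp_all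
  show "psurj (zer X Z)"
    by (rule psurj_split[of _ X Z "zer Z X"]) (simp_all add: zero_object_idn[OF Z])
  fix g assume g: "arr g \<and> tgt g = src (zer X Z) \<and> zer X Z \<bullet> g = zer (src g) (tgt (zer X Z))"
  then show "\<exists>h. isar h (src g) (src (idn X)) \<and> idn X \<bullet> h = g" by (intro exI[of _ g]) simp
next
  fix g h assume a: "arr g \<and> arr h \<and> src g = src h \<and> tgt g = src (idn X) \<and> tgt h = src (idn X) \<and> idn X \<bullet> g = idn X \<bullet> h"
  then show "g = h" by (elim conjE) simp
qed

lemma ses_zero_idn:
  assumes "is_cplx C Z" "\<And>n. is_zero_object C (ob Z n)" "is_cplx C X"
  shows "ses Z X X (\<lambda>n. zer (ob Z n) (ob X n)) (\<lambda>n. idn (ob X n))"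
  unfolding ses_def using cmap_zer[OF assms(1,3)] cmap_id[OF assms(3)] cnf_zero_idn[OF assms(2)] assms by simp

lemma ses_idn_zero:
  assumes "is_cplx C Z" "\<And>n. is_zero_object C (ob Z n)" "is_cplx C X"
  shows "ses X X Z (\<lambda>n. idn (ob X n)) (\<lambda>n. zer (ob X n) (ob Z n))"
  unfolding ses_def using cmap_zer[OF assms(3,1)] cmap_id[OF assms(3)] cnf_idn_zero[OF assms(2)] assms by simp

lemma ses_degreewise_split:
  assumes s: "ses A B Q i c" and Q: "\<And>n. ob Q n \<in> Proj C"
  obtains \<sigma> \<rho> where "\<And>n. arr (\<sigma> n)" "\<And>n. src (\<sigma> n) = ob Q n" "\<And>n. tgt (\<sigma> n) = ob B n"
    "\<And>n. arr (\<rho> n)" "\<And>n. src (\<rho> n) = ob B n" "\<And>n. tgt (\<rho> n) = ob A n"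
    "\<And>n. c n \<bullet> \<sigma> n = idn (ob Q n)" "\<And>n. i n \<bullet> \<rho> n \<boxplus> \<sigma> n \<bullet> c n = idn (ob B n)" "\<And>n. \<rho> n \<bullet> i n = idn (ob A n)"
proof -
  note [simp] = cmapD(1-5)[OF sesD(1)[OF s]] cmapD(1-5)[OF sesD(2)[OF s]]
  have "\<exists>\<sigma>. isar \<sigma> (ob Q n) (ob B n) \<and> c n \<bullet> \<sigma> = idn (ob Q n)" for n
    using ses_surj[OF s Q[of n], of "idn (ob Q n)" n] by auto
  then obtain \<sigma> where S: "\<And>n. isar (\<sigma> n) (ob Q n) (ob B n)" "\<And>n. c n \<bullet> \<sigma> n = idn (ob Q n)" by metis
  note [simp] = S(1)[THEN conjunct1] S(1)[THEN conjunct2, THEN conjunct1] S(1)[THEN conjunct2, THEN conjunct2]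
  have "\<exists>\<rho>. isar \<rho> (ob B n) (ob A n) \<and> i n \<bullet> \<rho> = idn (ob B n) \<boxplus> \<boxminus> (\<sigma> n \<bullet> c n)" for n
    using ses_lift[OF s, of "idn (ob B n) \<boxplus> \<boxminus> (\<sigma> n \<bullet> c n)" "ob B n" n] by (auto simp: S(2)[THEN cmp_reassoc])
  then obtain \<rho> where R: "\<And>n. isar (\<rho> n) (ob B n) (ob A n)" "\<And>n. i n \<bullet> \<rho> n = idn (ob B n) \<boxplus> \<boxminus> (\<sigma> n \<bullet> c n)" by metis
  note [simp] = R(1)[THEN conjunct1] R(1)[THEN conjunct2, THEN conjunct1] R(1)[THEN conjunct2, THEN conjunct2]
  have "\<rho> n \<bullet> i n = idn (ob A n)" for n
    by (rule monoD[OF ses_mono[OF s, of n]]) (simp_all add: R(2)[THEN cmp_reassoc] ses_zero[OF s])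
  moreover have "i n \<bullet> \<rho> n \<boxplus> \<sigma> n \<bullet> c n = idn (ob B n)" for n unfolding R(2) by (simp add: canc)
  ultimately show ?thesis using that[of \<sigma> \<rho>] S(2) by simp
qed

section \<open>Lifting problems and twisting families\<close>

text \<open>This is the vanishing that solves lifting problems: a degreewise lift fails to be a chain map by a twisting
  family from \<open>Q\<close> to \<open>K\<close>, and a null homotopy of that family corrects it.\<close>

definition twist_null :: "('o, 'm) cplx \<Rightarrow> ('o, 'm) cplx \<Rightarrow> bool" where
  "twist_null K Q \<longleftrightarrow> (\<forall>\<phi>. twist K Q \<phi> \<longrightarrow> (\<exists>\<psi>. (\<forall>n. isar (\<psi> n) (ob Q n) (ob K n)) \<and>
     (\<forall>n. \<phi> n = D K n \<bullet> \<psi> n \<boxplus> \<boxminus> (\<psi> (n - 1) \<bullet> D Q n))))"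

text \<open>A twisting family is a chain map into the shift by \<open>- 1\<close> with negated
  differential, which is acyclic along with \<open>K\<close>. Negating its null homotopy matches the
  sign convention of \<open>twist_null\<close>.\<close>

lemma twist_null_kproj:
  assumes Q: "kproj Q" and K: "K \<in> acyclics C" shows "twist_null K Q"
  unfolding twist_null_def
proof (intro allI impI)
  fix \<phi> assume t: "twist K Q \<phi>"
  note [simp] = twistD(1-5)[OF t]
  have c: "cmap Q (Sh True (- 1) K) \<phi>"
    unfolding cmap_def using twistD(6)[OF t] by (simp add: D_Sh)
  obtain h where h: "\<And>n. arr (h n)" "\<And>n. src (h n) = ob Q n" "\<And>n. tgt (h n) = ob (Sh True (- 1) K) (n + 1)"
    "\<And>n. \<phi> n = D (Sh True (- 1) K) (n + 1) \<bullet> h n \<boxplus> h (n - 1) \<bullet> D Q n"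
    by (rule kproj_nullh[OF Q acyclic_Sh[OF K, of True "- 1"] c]) blast
  have "\<phi> n = D K n \<bullet> \<boxminus> h n \<boxplus> \<boxminus> (\<boxminus> h (n - 1) \<bullet> D Q n)" for n
    using h(4)[of n] h(1-3) by (simp add: D_Sh)
  then show "\<exists>\<psi>. (\<forall>n. isar (\<psi> n) (ob Q n) (ob K n)) \<and> (\<forall>n. \<phi> n = D K n \<bullet> \<psi> n \<boxplus> \<boxminus> (\<psi> (n - 1) \<bullet> D Q n))"
    using h(1-3) by (intro exI[of _ "\<lambda>n. \<boxminus> h n"]) simp
qed

lemma twist_null_contractible:
  assumes Q: "contractible Q" shows "twist_null K Q"
  unfolding twist_null_def
proof (intro allI impI)
  fix \<phi> assume t: "twist K Q \<phi>"
  note [simp] = twistD(1-5)[OF t]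
  obtain h where h: "\<And>n. arr (h n)" "\<And>n. src (h n) = ob Q n" "\<And>n. tgt (h n) = ob Q (n + 1)"
    "\<And>n. D Q (n + 1) \<bullet> h n \<boxplus> h (n - 1) \<bullet> D Q n = idn (ob Q n)" using contractibleE[OF Q] by blast
  have "\<phi> n = D K n \<bullet> \<boxminus> (\<phi> (n + 1) \<bullet> h n) \<boxplus> \<boxminus> (\<boxminus> (\<phi> (n - 1 + 1) \<bullet> h (n - 1)) \<bullet> D Q n)" for n
  proof -
    have "\<phi> n = \<phi> n \<bullet> (D Q (n + 1) \<bullet> h n \<boxplus> h (n - 1) \<bullet> D Q n)" unfolding h(4) by simp
    then show ?thesis using h(1-3) by (simp add: twistD(7)[OF t])
  qed
  then show "\<exists>\<psi>. (\<forall>n. isar (\<psi> n) (ob Q n) (ob K n)) \<and> (\<forall>n. \<phi> n = D K n \<bullet> \<psi> n \<boxplus> \<boxminus> (\<psi> (n - 1) \<bullet> D Q n))"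
    using h(1-3) by (intro exI[of _ "\<lambda>n. \<boxminus> (\<phi> (n + 1) \<bullet> h n)"]) simp
qed

lemma ses_lifting_property:
  assumes s: "ses A B Q i c" and Q: "\<And>n. ob Q n \<in> Proj C" and q: "ses K X Y k p" and tn: "twist_null K Q"
    and u: "cmap A X u" and v: "cmap B Y v" and e: "\<And>n. p n \<bullet> u n = v n \<bullet> i n"
  shows "\<exists>h. cmap B X h \<and> (\<forall>n. h n \<bullet> i n = u n) \<and> (\<forall>n. p n \<bullet> h n = v n)"
proof -
  note ci = sesD(1)[OF s] and cc = sesD(2)[OF s] and ck = sesD(1)[OF q] and cp = sesD(2)[OF q]
  note [simp] = cmapD(1-5)[OF ci] cmapD(1-5)[OF cc] cmapD(1-5)[OF ck] cmapD(1-5)[OF cp] cmapD(3-5)[OF u] cmapD(3-5)[OF v]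
  obtain \<sigma> \<rho> where sr [simp]: "\<And>n. arr (\<sigma> n)" "\<And>n. src (\<sigma> n) = ob Q n" "\<And>n. tgt (\<sigma> n) = ob B n"
    "\<And>n. arr (\<rho> n)" "\<And>n. src (\<rho> n) = ob B n" "\<And>n. tgt (\<rho> n) = ob A n"
    and cs: "\<And>n. c n \<bullet> \<sigma> n = idn (ob Q n)" and ir: "\<And>n. i n \<bullet> \<rho> n \<boxplus> \<sigma> n \<bullet> c n = idn (ob B n)" and ri: "\<And>n. \<rho> n \<bullet> i n = idn (ob A n)"
    using ses_degreewise_split[OF s Q] by blast
  note ci0 = ses_zero[OF s] and pk0 = ses_zero[OF q]
  have "\<exists>\<tau>. isar \<tau> (ob Q n) (ob X n) \<and> p n \<bullet> \<tau> = v n \<bullet> \<sigma> n" for n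
    using ses_surj[OF q Q[of n], of "v n \<bullet> \<sigma> n" n] by auto
  then obtain \<tau> where T: "\<And>n. isar (\<tau> n) (ob Q n) (ob X n)" "\<And>n. p n \<bullet> \<tau> n = v n \<bullet> \<sigma> n" by metis
  note [simp] = T(1)[THEN conjunct1] T(1)[THEN conjunct2, THEN conjunct1] T(1)[THEN conjunct2, THEN conjunct2]
  \<comment> \<open>\<open>g\<close> solves the lifting problem in each degree separately: it is
    \<open>u\<close> on the part coming from \<open>A\<close>, and on the complement
    \<open>Q\<close> a lift of \<open>v\<close>, which exists because \<open>Q\<close> is degreewise
    projective.\<close>
  define g where "g n = u n \<bullet> \<rho> n \<boxplus> \<tau> n \<bullet> c n" for n
  have [simp]: "arr (g n)" "src (g n) = ob B n" "tgt (g n) = ob X n" for n by (simp_all add: g_def)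
  have gi: "g n \<bullet> i n = u n" for n by (simp add: g_def ri ci0)
  have pg: "p n \<bullet> g n = v n" for n
  proof -
    have "p n \<bullet> g n = v n \<bullet> (i n \<bullet> \<rho> n \<boxplus> \<sigma> n \<bullet> c n)" by (simp add: g_def e[THEN cmp_reassoc] T(2)[THEN cmp_reassoc])
    then show ?thesis unfolding ir by simp
  qed
  \<comment> \<open>The defect of \<open>g\<close> as a chain map. It vanishes on \<open>A\<close>
    and becomes zero in \<open>Y\<close>, so it is induced by a family \<open>\<phi>\<close> from
    \<open>Q\<close> to \<open>K\<close> of degree \<open>- 1\<close>.\<close>
  define d where "d n = D X n \<bullet> g n \<boxplus> \<boxminus> (g (n - 1) \<bullet> D B n)" for n
  have [simp]: "arr (d n)" "src (d n) = ob B n" "tgt (d n) = ob X (n - 1)" for n by (simp_all add: d_def)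
  have di: "d n \<bullet> i n = zer (ob A n) (ob X (n - 1))" for n
    by (simp add: d_def gi cmapD(6)[OF u] cmapD(6)[OF ci] gi[THEN cmp_reassoc])
  have pd: "p (n - 1) \<bullet> d n = zer (ob B n) (ob Y (n - 1))" for n
  proof -
    have "p (n - 1) \<bullet> D X n \<bullet> g n = v (n - 1) \<bullet> D B n"
      using cmapD(7)[OF cp, of n "g n"] by (simp add: pg cmapD(6)[OF v])
    then show ?thesis by (simp add: d_def pg[THEN cmp_reassoc])
  qed
  have ds: "d n \<bullet> \<sigma> n \<bullet> c n = d n" for n
  proof -
    have "d n = d n \<bullet> (i n \<bullet> \<rho> n \<boxplus> \<sigma> n \<bullet> c n)" unfolding ir by simp
    then show ?thesis by (simp add: di[THEN cmp_reassoc])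
  qed
  have "\<exists>\<phi>. isar \<phi> (ob Q n) (ob K (n - 1)) \<and> k (n - 1) \<bullet> \<phi> = d n \<bullet> \<sigma> n" for n
    using ses_lift[OF q, of "d n \<bullet> \<sigma> n" "ob Q n" "n - 1"] by (auto simp: pd[THEN cmp_reassoc])
  then obtain \<phi> where F: "\<And>n. isar (\<phi> n) (ob Q n) (ob K (n - 1))" "\<And>n. k (n - 1) \<bullet> \<phi> n = d n \<bullet> \<sigma> n" by metis
  note [simp] = F(1)[THEN conjunct1] F(1)[THEN conjunct2, THEN conjunct1] F(1)[THEN conjunct2, THEN conjunct2]
  have kfc: "k (n - 1) \<bullet> \<phi> n \<bullet> c n = d n" for n by (simp add: F(2)[THEN cmp_reassoc] ds)
  have Dd: "D X (n - 1) \<bullet> d n = \<boxminus> (d (n - 1) \<bullet> D B n)" for n by (simp add: d_def)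
  have tw: "twist K Q \<phi>"
    unfolding twist_def
  proof (intro conjI allI)
    fix n
    have a: "k (n - 1 - 1) \<bullet> D K (n - 1) \<bullet> \<phi> n \<bullet> c n = D X (n - 1) \<bullet> d n"
      using cmapD(7)[OF ck, of "n - 1" "\<phi> n \<bullet> c n"] by (simp add: kfc)
    have b: "k (n - 1 - 1) \<bullet> \<phi> (n - 1) \<bullet> D Q n \<bullet> c n = d (n - 1) \<bullet> D B n"
      using kfc[of "n - 1", THEN cmp_reassoc, of "D B n"] by (simp add: cmapD(6)[OF cc])
    have "D K (n - 1) \<bullet> \<phi> n \<bullet> c n = \<boxminus> (\<phi> (n - 1) \<bullet> D Q n \<bullet> c n)"
      by (rule monoD[OF ses_mono[OF q, of "n - 1 - 1"]]) (use a b Dd[of n] in simp_all)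
    then have f: "(D K (n - 1) \<bullet> \<phi> n) \<bullet> c n = (\<boxminus> (\<phi> (n - 1) \<bullet> D Q n)) \<bullet> c n" by simp
    show "D K (n - 1) \<bullet> \<phi> n = \<boxminus> (\<phi> (n - 1) \<bullet> D Q n)"
      by (rule epiD[OF ses_epi[OF s, of n] f]) simp_all
  qed simp_all
  obtain \<psi> where P: "\<And>n. isar (\<psi> n) (ob Q n) (ob K n)" "\<And>n. \<phi> n = D K n \<bullet> \<psi> n \<boxplus> \<boxminus> (\<psi> (n - 1) \<bullet> D Q n)"
    using tn tw unfolding twist_null_def by blast
  note [simp] = P(1)[THEN conjunct1] P(1)[THEN conjunct2, THEN conjunct1] P(1)[THEN conjunct2, THEN conjunct2]
  \<comment> \<open>The correction factors through \<open>Q\<close> and through \<open>K\<close>, so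
    it leaves the two triangles intact.\<close>
  define h where "h n = g n \<boxplus> \<boxminus> (k n \<bullet> \<psi> n \<bullet> c n)" for n
  have [simp]: "arr (h n)" "src (h n) = ob B n" "tgt (h n) = ob X n" for n by (simp_all add: h_def)
  have "D X n \<bullet> h n = h (n - 1) \<bullet> D B n" for n
  proof -
    have "D X n \<bullet> g n = d n \<boxplus> g (n - 1) \<bullet> D B n" by (simp add: d_def canc)
    also have "d n = k (n - 1) \<bullet> (D K n \<bullet> \<psi> n \<boxplus> \<boxminus> (\<psi> (n - 1) \<bullet> D Q n)) \<bullet> c n"
      unfolding kfc[of n, symmetric] by (subst P(2)) (rule refl)
    finally have "D X n \<bullet> g n = k (n - 1) \<bullet> (D K n \<bullet> \<psi> n \<boxplus> \<boxminus> (\<psi> (n - 1) \<bullet> D Q n)) \<bullet> c n \<boxplus> g (n - 1) \<bullet> D B n" .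
    then show ?thesis by (simp add: h_def cmapD(7)[OF ck] cmapD(6)[OF cc] canc)
  qed
  moreover have "h n \<bullet> i n = u n" for n by (simp add: h_def gi ci0)
  moreover have "p n \<bullet> h n = v n" for n by (simp add: h_def pg pk0[THEN cmp_reassoc])
  ultimately show ?thesis by (intro exI[of _ h]) (simp add: cmap_def)
qed

lemma split_mono_cokernel:
  assumes l: "cmap A B l" and r: "\<And>n. isar (r n) (ob B n) (ob A n)" "\<And>n. r n \<bullet> l n = idn (ob A n)"
  obtains Q c where "ses A B Q l c"
proof -
  note [simp] = cmapD(1-5)[OF l] r(1)[THEN conjunct1] r(1)[THEN conjunct2, THEN conjunct1] r(1)[THEN conjunct2, THEN conjunct2]
  have "\<exists>j. kern j (r n)" for n using kernel_exists[of "r n"] by (metis r(1))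
  then obtain j where j: "\<And>n. kern (j n) (r n)" by metis
  have [simp]: "arr (j n)" "tgt (j n) = ob B n" for n using kernD(2,4)[OF j[of n]] by simp_all
  have rj: "r n \<bullet> j n = zer (src (j n)) (ob A n)" for n using kernD(5)[OF j[of n]] by simp
  have "\<exists>c. isar c (ob B n) (src (j n)) \<and> j n \<bullet> c = idn (ob B n) \<boxplus> \<boxminus> (l n \<bullet> r n)" for n
    using kern_lift[OF j[of n], of "idn (ob B n) \<boxplus> \<boxminus> (l n \<bullet> r n)"] by (auto simp: r(2)[THEN cmp_reassoc])
  then obtain c where c: "\<And>n. isar (c n) (ob B n) (src (j n))" "\<And>n. j n \<bullet> c n = idn (ob B n) \<boxplus> \<boxminus> (l n \<bullet> r n)" by metis
  note [simp] = c(1)[THEN conjunct1] c(1)[THEN conjunct2, THEN conjunct1] c(1)[THEN conjunct2, THEN conjunct2]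
  have cj: "c n \<bullet> j n = idn (src (j n))" for n
    by (rule monoD[OF kernD(1)[OF j[of n]]]) (simp_all add: c(2)[THEN cmp_reassoc] rj)
  have cl: "c n \<bullet> l n = zer (ob A n) (src (j n))" for n
    by (rule monoD[OF kernD(1)[OF j[of n]]]) (simp_all add: c(2)[THEN cmp_reassoc] r(2))
  define d where "d n = c (n - 1) \<bullet> D B n \<bullet> j n" for n
  have [simp]: "arr (d n)" "src (d n) = src (j n)" "tgt (d n) = src (j (n - 1))" for n by (simp_all add: d_def)
  have dc: "d n \<bullet> c n = c (n - 1) \<bullet> D B n" for n
    by (simp add: d_def c(2) cmapD(7)[OF l] cl[THEN cmp_reassoc])
  have dd: "d (n - 1) \<bullet> d n = zer (src (j n)) (src (j (n - 1 - 1)))" for n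
  proof -
    have "d (n - 1) \<bullet> d n = (d (n - 1) \<bullet> c (n - 1)) \<bullet> D B n \<bullet> j n" by (simp add: d_def[of n])
    then show ?thesis unfolding dc by simp
  qed
  define Q where "Q = mkc (\<lambda>n. src (j n)) d"
  have Qc: "is_cplx C Q" unfolding Q_def by (rule is_cplx_mkc) (simp_all add: dd)
  have DQ: "D Q n = d n" for n unfolding Q_def by (rule D_mkc) simp
  have cm: "cmap B Q c" using Qc by (simp add: cmap_def DQ dc) (simp add: Q_def)
  have "cnf (l n) (c n)" for n
    unfolding cnf_iff kern_def mono_def
  proof (intro conjI allI impI)
    show "psurj (c n)" by (rule psurj_split[of _ "ob B n" "src (j n)" "j n"]) (simp_all add: cj)
    fix g assume g: "arr g \<and> tgt g = src (c n) \<and> c n \<bullet> g = zer (src g) (tgt (c n))"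
    then have g1: "arr g" "tgt g = ob B n" by simp_all
    have "j n \<bullet> c n \<bullet> g = zer (src g) (ob B n)" using g by simp
    moreover have "j n \<bullet> c n \<bullet> g = g \<boxplus> \<boxminus> (l n \<bullet> r n \<bullet> g)" using g1 by (simp add: c(2)[THEN cmp_reassoc])
    ultimately have "g \<boxplus> \<boxminus> (l n \<bullet> r n \<bullet> g) = zer (src g) (ob B n)" by simp
    then have "l n \<bullet> r n \<bullet> g = g" using diff_zerD[of g "l n \<bullet> r n \<bullet> g"] g1 by (metis arr_cmp cmapD(3-5)[OF l] r(1) src_cmp tgt_cmp)
    then show "\<exists>h. isar h (src g) (src (l n)) \<and> l n \<bullet> h = g" using g by (intro exI[of _ "r n \<bullet> g"]) simp
  next
    fix g h assume a: "arr g \<and> arr h \<and> src g = src h \<and> tgt g = src (l n) \<and> tgt h = src (l n) \<and> l n \<bullet> g = l n \<bullet> h"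
    then have a': "arr g" "arr h" "tgt g = ob A n" "tgt h = ob A n" by simp_all
    have "r n \<bullet> (l n \<bullet> g) = r n \<bullet> (l n \<bullet> h)" using a by (simp only:)
    then show "g = h" using a' by (simp add: r(2)[THEN cmp_reassoc])
  qed (simp_all add: cl)
  then show ?thesis using that l cm unfolding ses_def by blast
qed

text \<open>Here \<open>l\<close> is a retract of \<open>i\<close> under \<open>A\<close>. It
  inherits the degreewise retraction \<open>\<rho> \<bullet> h\<close>, so it has a cokernel, and
  this is a retract of \<open>Q\<close>.\<close>

lemma ses_of_retract:
  assumes s: "ses A T Q i c" and Q: "\<And>n. ob Q n \<in> Proj C" and l: "cmap A B l"
    and h: "cmap B T h" "\<And>n. h n \<bullet> l n = i n" and p: "cmap T B p" "\<And>n. p n \<bullet> h n = idn (ob B n)" "\<And>n. p n \<bullet> i n = l n"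
  obtains Q' c' a b where "ses A B Q' l c'" "cmap Q' Q a" "cmap Q Q' b" "\<And>n. b n \<bullet> a n = idn (ob Q' n)"
proof -
  note ci = sesD(1)[OF s] and cc = sesD(2)[OF s]
  note [simp] = cmapD(1-5)[OF ci] cmapD(1-5)[OF cc] cmapD(1-5)[OF l] cmapD(3-5)[OF h(1)] cmapD(3-5)[OF p(1)]
  obtain \<sigma> \<rho> where sr [simp]: "\<And>n. arr (\<sigma> n)" "\<And>n. src (\<sigma> n) = ob Q n" "\<And>n. tgt (\<sigma> n) = ob T n"
    "\<And>n. arr (\<rho> n)" "\<And>n. src (\<rho> n) = ob T n" "\<And>n. tgt (\<rho> n) = ob A n"
    and cs: "\<And>n. c n \<bullet> \<sigma> n = idn (ob Q n)" and ir: "\<And>n. i n \<bullet> \<rho> n \<boxplus> \<sigma> n \<bullet> c n = idn (ob T n)" and ri: "\<And>n. \<rho> n \<bullet> i n = idn (ob A n)"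
    using ses_degreewise_split[OF s Q] by blast
  obtain Q' c' where s': "ses A B Q' l c'"
    by (rule split_mono_cokernel[OF l, of "\<lambda>n. \<rho> n \<bullet> h n"]) (simp_all add: h(2) ri)
  note c' = sesD(2)[OF s']
  note [simp] = cmapD(2-5)[OF c']
  have "\<exists>a. isar a (ob Q' n) (ob Q n) \<and> a \<bullet> c' n = c n \<bullet> h n" for n
    using cker_desc[OF cnf_cker[OF sesD(3)[OF s', of n]], of "c n \<bullet> h n"] by (auto simp: h(2) ses_zero[OF s])
  then obtain a where a: "\<And>n. isar (a n) (ob Q' n) (ob Q n)" "\<And>n. a n \<bullet> c' n = c n \<bullet> h n" by metis
  have "\<exists>b. isar b (ob Q n) (ob Q' n) \<and> b \<bullet> c n = c' n \<bullet> p n" for n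
    using cker_desc[OF cnf_cker[OF sesD(3)[OF s, of n]], of "c' n \<bullet> p n"] by (auto simp: p(3) ses_zero[OF s'])
  then obtain b where b: "\<And>n. isar (b n) (ob Q n) (ob Q' n)" "\<And>n. b n \<bullet> c n = c' n \<bullet> p n" by metis
  note [simp] = a(1)[THEN conjunct1] a(1)[THEN conjunct2, THEN conjunct1] a(1)[THEN conjunct2, THEN conjunct2]
    b(1)[THEN conjunct1] b(1)[THEN conjunct2, THEN conjunct1] b(1)[THEN conjunct2, THEN conjunct2]
  have "D Q n \<bullet> a n = a (n - 1) \<bullet> D Q' n" for n
  proof (rule epiD[OF ses_epi[OF s', of n]])
    have "a (n - 1) \<bullet> D Q' n \<bullet> c' n = c (n - 1) \<bullet> h (n - 1) \<bullet> D B n" by (simp add: cmapD(6)[OF c'] a(2)[THEN cmp_reassoc])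
    then show "(D Q n \<bullet> a n) \<bullet> c' n = (a (n - 1) \<bullet> D Q' n) \<bullet> c' n" by (simp add: a(2) cmapD(7)[OF cc] cmapD(6)[OF h(1)])
  qed simp_all
  then have ca: "cmap Q' Q a" by (simp add: cmap_def)
  have "D Q' n \<bullet> b n = b (n - 1) \<bullet> D Q n" for n
  proof (rule epiD[OF ses_epi[OF s, of n]])
    have "b (n - 1) \<bullet> D Q n \<bullet> c n = c' (n - 1) \<bullet> p (n - 1) \<bullet> D T n" by (simp add: cmapD(6)[OF cc] b(2)[THEN cmp_reassoc])
    then show "(D Q' n \<bullet> b n) \<bullet> c n = (b (n - 1) \<bullet> D Q n) \<bullet> c n" by (simp add: b(2) cmapD(7)[OF c'] cmapD(6)[OF p(1)])
  qed simp_all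
  then have cb: "cmap Q Q' b" by (simp add: cmap_def)
  have "b n \<bullet> a n = idn (ob Q' n)" for n
    by (rule epiD[OF ses_epi[OF s', of n]]) (simp_all add: a(2) b(2)[THEN cmp_reassoc] p(2))
  then show ?thesis using that s' ca cb by blast
qed

section \<open>Test complexes for the right lifting property\<close>

lemma zero_diff_cplx:
  assumes "\<And>n. P n \<in> Obj C"
  shows "is_cplx C (mkc P (\<lambda>n. zer (P n) (P (n - 1))))" "D (mkc P (\<lambda>n. zer (P n) (P (n - 1)))) n = zer (P n) (P (n - 1))"
  using assms by (auto intro!: is_cplx_mkc D_mkc)

lemma kproj_zero_diff:
  assumes P: "\<And>n. P n \<in> Proj C"
  shows "kproj (mkc P (\<lambda>n. zer (P n) (P (n - 1))))" (is "kproj ?S")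
proof (rule kprojI)
  note z = zero_diff_cplx[of P, OF Proj_Obj[OF P]]
  show "is_cplx C ?S" by (rule z)
  show "ob ?S n \<in> Proj C" for n using P by simp
  fix N f assume N: "N \<in> acyclics C" and f: "cmap ?S N f"
  note [simp] = cmapD(2-5)[OF f] Proj_Obj[OF P]
  have "\<exists>h. isar h (P n) (ob N (n + 1)) \<and> D N (n + 1) \<bullet> h = f n" for n
  proof -
    have "ex_at N n" using N by (simp add: acyclic_iff)
    moreover have "D N n \<bullet> f n = zer (P n) (ob N (n - 1))" by (simp add: cmapD(6)[OF f] z(2))
    ultimately show ?thesis using ex_atE[of N n "f n"] P by auto
  qed
  then obtain h where h: "\<And>n. isar (h n) (P n) (ob N (n + 1))" "\<And>n. D N (n + 1) \<bullet> h n = f n" by metis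
  show "nullh ?S N f"
    by (rule nullhI[of h]) (use h(1) in \<open>simp_all add: h(2) z(2)\<close>)
qed

text \<open>The disks on projective covers \<open>\<pi> n\<close> of all objects of \<open>X\<close>
  are taken together: \<open>P n\<close> sits in degrees \<open>n\<close> and \<open>n - 1\<close>,
  joined by the identity, and is mapped to \<open>X\<close> by \<open>\<pi> n\<close> and
  \<open>d \<pi> n\<close>.\<close>

lemma contractible_cover:
  assumes X [simp]: "is_cplx C X"
  obtains Q q where "contractible Q" "\<And>n. ob Q n \<in> Proj C" "cmap Q X q" "\<And>n. psurj (q n)"
proof -
  have "\<exists>q. psurj q \<and> src q \<in> Proj C \<and> tgt q = ob X n" for n
    using projective_cover[of "ob X n"] cnf_psurj unfolding aepi_def by (metis X cplx_ob)
  then obtain \<pi> where \<pi>: "\<And>n. psurj (\<pi> n)" "\<And>n. src (\<pi> n) \<in> Proj C" "\<And>n. tgt (\<pi> n) = ob X n" by metis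
  have [simp]: "arr (\<pi> n)" for n using \<pi>(1) by (simp add: psurj_def)
  define P where "P n = src (\<pi> n)" for n
  have P: "P n \<in> Proj C" for n using \<pi>(2) by (simp add: P_def)
  have sP [simp]: "src (\<pi> n) = P n" "tgt (\<pi> n) = ob X n" for n by (simp_all add: P_def \<pi>(3))
  note [simp] = Proj_Obj[OF P]
  define A where "A = mkc (\<lambda>n. P (n + 1)) (\<lambda>n. zer (P (n + 1)) (P (n - 1 + 1)))"
  define B where "B = mkc P (\<lambda>n. zer (P n) (P (n - 1)))"
  have A [simp]: "is_cplx C A" "D A n = zer (P (n + 1)) (P n)" "ob A n = P (n + 1)" for n
    unfolding A_def using zero_diff_cplx[of "\<lambda>n. P (n + 1)"] by simp_all
  have B [simp]: "is_cplx C B" "D B n = zer (P n) (P (n - 1))" "ob B n = P n" for n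
    unfolding B_def using zero_diff_cplx[of P] by simp_all
  define \<theta> where "\<theta> n = idn (P n)" for n
  have tw: "twist A B \<theta>" unfolding twist_def \<theta>_def by simp
  define Q where "Q = Tw A B \<theta>"
  have Q [simp]: "is_cplx C Q" "ob Q n = Bip (P (n + 1)) (P n)" for n unfolding Q_def using tw by simp_all
  define q where "q n = cop (D X (n + 1) \<bullet> \<pi> (n + 1)) (\<pi> n)" for n
  have q: "cmap Q X q"
    unfolding Q_def q_def by (rule cmap_from_Tw[OF tw]) (simp_all add: cmap_def \<theta>_def)
  have qs: "psurj (q n)" for n
    unfolding psurj_def
  proof (intro conjI ballI allI impI)
    show "arr (q n)" by (simp add: q_def)
    fix T y assume T: "T \<in> Proj C" and y: "isar y T (tgt (q n))"
    have "tgt (q n) = ob X n" by (simp add: q_def)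
    then obtain x where x: "arr x" "src x = T" "tgt x = P n" "\<pi> n \<bullet> x = y" using psurjD[OF \<pi>(1)[of n] T, of y] y by auto
    have "q n \<bullet> pair (zer T (P (n + 1))) x = y"
      using x Proj_Obj[OF T] y by (simp add: q_def)
    then show "\<exists>x. isar x T (src (q n)) \<and> q n \<bullet> x = y"
      using x Proj_Obj[OF T] by (intro exI[of _ "pair (zer T (P (n + 1))) x"]) (simp add: q_def)
  qed
  have "nullh Q Q (\<lambda>n. idn (ob Q n))"
  proof (rule nullhI[of "\<lambda>n. pair (zer (Bip (P (n + 1)) (P n)) (P (n + 1 + 1))) (pr1 (P (n + 1)) (P n))"])
    fix n
    let ?B = "Bip (P (n + 1)) (P n)"
    have a: "D Q (n + 1) \<bullet> pair (zer ?B (P (n + 1 + 1))) (pr1 (P (n + 1)) (P n)) = pair (pr1 (P (n + 1)) (P n)) (zer ?B (P n))"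
      unfolding Q_def by (simp add: D_Tw_pair[OF tw] \<theta>_def)
    have "D Q n \<bullet> pair (pr1 (P (n + 1)) (P n)) (pr2 (P (n + 1)) (P n)) = pair (pr2 (P (n + 1)) (P n)) (zer ?B (P (n - 1)))"
      unfolding Q_def by (simp add: D_Tw_pair[OF tw] \<theta>_def del: pair_pr)
    then have "D Q n = pair (pr2 (P (n + 1)) (P n)) (zer ?B (P (n - 1)))" by simp
    then have b: "pair (zer (Bip (P (n - 1 + 1)) (P (n - 1))) (P (n - 1 + 1 + 1))) (pr1 (P (n - 1 + 1)) (P (n - 1))) \<bullet> D Q n = pair (zer ?B (P (n + 1))) (pr2 (P (n + 1)) (P n))"
      by simp
    show "idn (ob Q n) = D Q (n + 1) \<bullet> pair (zer ?B (P (n + 1 + 1))) (pr1 (P (n + 1)) (P n)) \<boxplus>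
      pair (zer (Bip (P (n - 1 + 1)) (P (n - 1))) (P (n - 1 + 1 + 1))) (pr1 (P (n - 1 + 1)) (P (n - 1))) \<bullet> D Q n"
      unfolding a b by (simp add: pair_add)
  qed simp_all
  then have "contractible Q" by (simp add: contractible_def)
  moreover have "ob Q n \<in> Proj C" for n by (simp add: Proj_Bip P)
  ultimately show ?thesis using that q qs by blast
qed

text \<open>The twisted sum of \<open>S\<close> with itself along identities plays the role of the
  disk, and its inclusion has the K-projective cokernel \<open>S\<close>. Having \<open>P\<close> in
  every degree of \<open>S\<close> makes the complexes uniform; only the maps \<open>u\<close> and
  \<open>w\<close> are concentrated in one degree.\<close>

lemma lifting_of_right_lifting:
  assumes p: "cmap X Y p"
    and l: "\<And>A B Q i c u v. \<lbrakk>ses A B Q i c; kproj Q; cmap A X u; cmap B Y v; \<And>n. p n \<bullet> u n = v n \<bullet> i n\<rbrakk>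
      \<Longrightarrow> \<exists>h. cmap B X h \<and> (\<forall>n. h n \<bullet> i n = u n) \<and> (\<forall>n. p n \<bullet> h n = v n)"
  shows "lifting X Y p m"
proof (rule liftingI)
  note [simp] = cmapD(1-5)[OF p]
  fix P q y assume P: "P \<in> Proj C" and q [simp]: "arr q" "src q = P" "tgt q = ob X m" and y [simp]: "arr y" "src y = P" "tgt y = ob Y (m + 1)"
    and dq: "D X m \<bullet> q = zer P (ob X (m - 1))" and dy: "D Y (m + 1) \<bullet> y = p m \<bullet> q"
  note [simp] = Proj_Obj[OF P]
  define S where "S = mkc (\<lambda>_. P) (\<lambda>_. zer P P)"
  have S [simp]: "is_cplx C S" "D S n = zer P P" "ob S n = P" for n
    unfolding S_def using zero_diff_cplx[of "\<lambda>_. P"] by simp_all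
  have kS: "kproj S" unfolding S_def using kproj_zero_diff[of "\<lambda>_. P"] P by simp
  have tw: "twist S S (\<lambda>n. idn P)" by (simp add: twist_def)
  define u where "u n = (if n = m then q else zer P (ob X n))" for n
  have u: "cmap S X u" unfolding cmap_def u_def using dq by auto
  define w where "w n = (if n = m + 1 then y else zer P (ob Y n))" for n
  have v: "cmap (Tw S S (\<lambda>n. idn P)) Y (\<lambda>n. cop (p n \<bullet> u n) (w n))"
  proof (rule cmap_from_Tw[OF tw cmap_cmp[OF u p]])
    fix n
    show "isar (w n) (ob S n) (ob Y n)" by (simp add: w_def)
    have "n - 1 = m \<longleftrightarrow> n = m + 1" by auto
    then show "D Y n \<bullet> w n = (p (n - 1) \<bullet> u (n - 1)) \<bullet> idn P \<boxplus> w (n - 1) \<bullet> D S n"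
      by (cases "n = m + 1") (simp_all add: w_def u_def dy)
  qed
  have tu [simp]: "arr (u n)" "src (u n) = P" "tgt (u n) = ob X n" "arr (w n)" "src (w n) = P" "tgt (w n) = ob Y n" for n by (simp_all add: u_def w_def)
  have "\<exists>h. cmap (Tw S S (\<lambda>n. idn P)) X h \<and> (\<forall>n. h n \<bullet> in1 (ob S n) (ob S n) = u n) \<and> (\<forall>n. p n \<bullet> h n = cop (p n \<bullet> u n) (w n))"
    by (rule l[OF ses_Tw[OF tw] kS u v]) simp
  then obtain h where h: "cmap (Tw S S (\<lambda>n. idn P)) X h" "\<And>n. h n \<bullet> in1 P P = u n" "\<And>n. p n \<bullet> h n = cop (p n \<bullet> u n) (w n)" by auto
  note [simp] = cmapD(3-5)[OF h(1)]
  have "D X (m + 1) \<bullet> h (m + 1) \<bullet> in2 P P = h m \<bullet> D (Tw S S (\<lambda>n. idn P)) (m + 1) \<bullet> in2 (ob S (m + 1)) (ob S (m + 1))"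
    by (simp add: cmapD(7)[OF h(1)])
  also have "\<dots> = h m \<bullet> in1 P P" unfolding D_Tw_in2[OF tw] by (simp add: pair_def)
  also have "\<dots> = q" unfolding h(2) by (simp add: u_def)
  finally have 1: "D X (m + 1) \<bullet> h (m + 1) \<bullet> in2 P P = q" .
  have 2: "p (m + 1) \<bullet> h (m + 1) \<bullet> in2 P P = y" by (simp add: h(3)[THEN cmp_reassoc] w_def u_def)
  show "\<exists>q'. isar q' P (ob X (m + 1)) \<and> D X (m + 1) \<bullet> q' = q \<and> p (m + 1) \<bullet> q' = y"
    using 1 2 by (intro exI[of _ "h (m + 1) \<bullet> in2 P P"]) simp
qed

text \<open>The test map is the inclusion of zero into a contractible cover \<open>Q\<close> of
  \<open>Y\<close>: its lift factors \<open>q\<close> through \<open>p\<close>, so \<open>p\<close>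
  inherits surjectivity from \<open>q\<close>.\<close>

lemma psurj_of_right_lifting:
  assumes p: "cmap X Y p"
    and l: "\<And>A B Q i c u v. \<lbrakk>ses A B Q i c; Q \<in> tilde C (Proj C); cmap A X u; cmap B Y v; \<And>n. p n \<bullet> u n = v n \<bullet> i n\<rbrakk>
      \<Longrightarrow> \<exists>h. cmap B X h \<and> (\<forall>n. h n \<bullet> i n = u n) \<and> (\<forall>n. p n \<bullet> h n = v n)"
  shows "psurj (p n)"
proof -
  note [simp] = cmapD(1-5)[OF p]
  obtain Q q where Q: "contractible Q" "\<And>n. ob Q n \<in> Proj C" "cmap Q Y q" "\<And>n. psurj (q n)"
    using contractible_cover[of Y] by auto
  note [simp] = cmapD(1,3-5)[OF Q(3)]
  obtain Z where Z [simp]: "is_cplx C Z" "\<And>n. is_zero_object C (ob Z n)" using zero_cplx by blast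
  have "\<exists>h. cmap Q X h \<and> (\<forall>n. h n \<bullet> zer (ob Z n) (ob Q n) = zer (ob Z n) (ob X n)) \<and> (\<forall>n. p n \<bullet> h n = q n)"
    by (rule l[OF ses_zero_idn[OF Z] _ cmap_zer Q(3)]) (use Q in \<open>simp_all add: tilde_Proj_iff\<close>)
  then obtain h where h: "cmap Q X h" "\<And>n. p n \<bullet> h n = q n" by blast
  note [simp] = cmapD(3-5)[OF h(1)]
  show ?thesis
    unfolding psurj_def
  proof (intro conjI ballI allI impI)
    fix P y assume P: "P \<in> Proj C" and y: "isar y P (tgt (p n))"
    obtain x where x: "arr x" "src x = P" "tgt x = ob Q n" "q n \<bullet> x = y"
      using psurjD[OF Q(4)[of n] P, of y] y by auto
    then show "\<exists>x. isar x P (src (p n)) \<and> p n \<bullet> x = y"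
      by (intro exI[of _ "h n \<bullet> x"]) (simp add: h(2)[THEN cmp_reassoc])
  qed simp
qed

subsection \<open>Quasi-isomorphisms\<close>

text \<open>Injectivity and surjectivity of \<open>f\<close> on the homology of \<open>Hom(P, -)\<close>, for all projective \<open>P\<close>.
  Cokernels need not exist, so there are no homology objects to compare.\<close>

definition hinj :: "('o, 'm) cplx \<Rightarrow> ('o, 'm) cplx \<Rightarrow> (int \<Rightarrow> ('o, 'm) arrow) \<Rightarrow> bool" where
  "hinj X Y f \<longleftrightarrow> (\<forall>r. \<forall>P \<in> Proj C. \<forall>x y. isar x P (ob X r) \<and> isar y P (ob Y (r + 1)) \<and> D X r \<bullet> x = zer P (ob X (r - 1)) \<and>
     D Y (r + 1) \<bullet> y = f r \<bullet> x \<longrightarrow> (\<exists>z. isar z P (ob X (r + 1)) \<and> D X (r + 1) \<bullet> z = x))"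

definition hsurj :: "('o, 'm) cplx \<Rightarrow> ('o, 'm) cplx \<Rightarrow> (int \<Rightarrow> ('o, 'm) arrow) \<Rightarrow> bool" where
  "hsurj X Y f \<longleftrightarrow> (\<forall>r. \<forall>P \<in> Proj C. \<forall>y. isar y P (ob Y r) \<and> D Y r \<bullet> y = zer P (ob Y (r - 1)) \<longrightarrow>
     (\<exists>x z. isar x P (ob X r) \<and> isar z P (ob Y (r + 1)) \<and> D X r \<bullet> x = zer P (ob X (r - 1)) \<and> y = f r \<bullet> x \<boxplus> D Y (r + 1) \<bullet> z))"

lemma hinjE:
  assumes "hinj X Y f" "P \<in> Proj C" "isar x P (ob X r)" "isar y P (ob Y (r + 1))" "D X r \<bullet> x = zer P (ob X (r - 1))" "D Y (r + 1) \<bullet> y = f r \<bullet> x"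
  obtains z where "arr z" "src z = P" "tgt z = ob X (r + 1)" "D X (r + 1) \<bullet> z = x"
  using assms unfolding hinj_def by blast

lemma hsurjE:
  assumes "hsurj X Y f" "P \<in> Proj C" "isar y P (ob Y r)" "D Y r \<bullet> y = zer P (ob Y (r - 1))"
  obtains x z where "arr x" "src x = P" "tgt x = ob X r" "arr z" "src z = P" "tgt z = ob Y (r + 1)"
    "D X r \<bullet> x = zer P (ob X (r - 1))" "y = f r \<bullet> x \<boxplus> D Y (r + 1) \<bullet> z"
  using assms unfolding hsurj_def by metis

lemma hinjI:
  assumes "\<And>r P x y. \<lbrakk>P \<in> Proj C; arr x; src x = P; tgt x = ob X r; arr y; src y = P; tgt y = ob Y (r + 1);
    D X r \<bullet> x = zer P (ob X (r - 1)); D Y (r + 1) \<bullet> y = f r \<bullet> x\<rbrakk> \<Longrightarrow> \<exists>z. isar z P (ob X (r + 1)) \<and> D X (r + 1) \<bullet> z = x"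
  shows "hinj X Y f"
  using assms unfolding hinj_def by blast

lemma hsurjI:
  assumes "\<And>r P y. \<lbrakk>P \<in> Proj C; arr y; src y = P; tgt y = ob Y r; D Y r \<bullet> y = zer P (ob Y (r - 1))\<rbrakk> \<Longrightarrow>
    \<exists>x z. isar x P (ob X r) \<and> isar z P (ob Y (r + 1)) \<and> D X r \<bullet> x = zer P (ob X (r - 1)) \<and> y = f r \<bullet> x \<boxplus> D Y (r + 1) \<bullet> z"
  shows "hsurj X Y f"
  using assms unfolding hsurj_def by blast

section \<open>Composition and cancellation of maps on homology\<close>

lemma hinj_of_cmp:
  assumes f: "cmap X Y f" and g: "cmap Y Z g" and h: "hinj X Z (\<lambda>n. g n \<bullet> f n)" shows "hinj X Y f"
proof (rule hinjI)
  note [simp] = cmapD(1-5)[OF f] cmapD(1-5)[OF g]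
  fix r P x y assume P: "P \<in> Proj C" and x [simp]: "arr x" "src x = P" "tgt x = ob X r" and y [simp]: "arr y" "src y = P" "tgt y = ob Y (r + 1)"
    and dx: "D X r \<bullet> x = zer P (ob X (r - 1))" and dy: "D Y (r + 1) \<bullet> y = f r \<bullet> x"
  obtain z where "arr z" "src z = P" "tgt z = ob X (r + 1)" "D X (r + 1) \<bullet> z = x"
    by (rule hinjE[OF h P, of x r "g (r + 1) \<bullet> y"]) (simp_all add: dx cmapD(7)[OF g] dy)
  then show "\<exists>z. isar z P (ob X (r + 1)) \<and> D X (r + 1) \<bullet> z = x" by blast
qed

lemma hsurj_of_cmp:
  assumes f: "cmap X Y f" and g: "cmap Y Z g" and h: "hsurj X Z (\<lambda>n. g n \<bullet> f n)" shows "hsurj Y Z g"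
proof (rule hsurjI)
  note [simp] = cmapD(1-5)[OF f] cmapD(1-5)[OF g]
  fix r P y assume P: "P \<in> Proj C" and y: "arr y" "src y = P" "tgt y = ob Z r" "D Z r \<bullet> y = zer P (ob Z (r - 1))"
  obtain x z where x: "arr x" "src x = P" "tgt x = ob X r" "arr z" "src z = P" "tgt z = ob Z (r + 1)"
    "D X r \<bullet> x = zer P (ob X (r - 1))" "y = (g r \<bullet> f r) \<bullet> x \<boxplus> D Z (r + 1) \<bullet> z"
    by (rule hsurjE[OF h P, of y r]) (use y in simp_all)
  show "\<exists>x z. isar x P (ob Y r) \<and> isar z P (ob Z (r + 1)) \<and> D Y r \<bullet> x = zer P (ob Y (r - 1)) \<and> y = g r \<bullet> x \<boxplus> D Z (r + 1) \<bullet> z"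
    by (intro exI[of _ "f r \<bullet> x"] exI[of _ z]) (use x(1-7) Proj_Obj[OF P] in \<open>simp add: cmapD(7)[OF f] x(8)\<close>)
qed

lemma hsurj_cancel_left:
  assumes f: "cmap X Y f" and g: "cmap Y Z g" and h: "hsurj X Z (\<lambda>n. g n \<bullet> f n)" and i: "hinj Y Z g" shows "hsurj X Y f"
proof (rule hsurjI)
  note [simp] = cmapD(1-5)[OF f] cmapD(1-5)[OF g]
  fix r P y assume P: "P \<in> Proj C" and y [simp]: "arr y" "src y = P" "tgt y = ob Y r" and dy: "D Y r \<bullet> y = zer P (ob Y (r - 1))"
  note [simp] = Proj_Obj[OF P]
  obtain x z where x [simp]: "arr x" "src x = P" "tgt x = ob X r" "arr z" "src z = P" "tgt z = ob Z (r + 1)"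
    and dx: "D X r \<bullet> x = zer P (ob X (r - 1))" and e: "g r \<bullet> y = (g r \<bullet> f r) \<bullet> x \<boxplus> D Z (r + 1) \<bullet> z"
    by (rule hsurjE[OF h P, of "g r \<bullet> y" r]) (simp_all add: cmapD(7)[OF g] dy)
  obtain w where w [simp]: "arr w" "src w = P" "tgt w = ob Y (r + 1)" and dw: "D Y (r + 1) \<bullet> w = y \<boxplus> \<boxminus> (f r \<bullet> x)"
    by (rule hinjE[OF i P, of "y \<boxplus> \<boxminus> (f r \<bullet> x)" r z]) (simp_all add: dy cmapD(7)[OF f] dx e canc)
  have "y = f r \<bullet> x \<boxplus> D Y (r + 1) \<bullet> w" unfolding dw by (simp add: canc)
  then show "\<exists>x z. isar x P (ob X r) \<and> isar z P (ob Y (r + 1)) \<and> D X r \<bullet> x = zer P (ob X (r - 1)) \<and> y = f r \<bullet> x \<boxplus> D Y (r + 1) \<bullet> z"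
    using x(1-3) w dx by blast
qed

lemma hinj_cancel_right:
  assumes f: "cmap X Y f" and g: "cmap Y Z g" and h: "hinj X Z (\<lambda>n. g n \<bullet> f n)" and s: "hsurj X Y f" shows "hinj Y Z g"
proof (rule hinjI)
  note [simp] = cmapD(1-5)[OF f] cmapD(1-5)[OF g]
  fix r P y z assume P: "P \<in> Proj C" and y [simp]: "arr y" "src y = P" "tgt y = ob Y r" and z [simp]: "arr z" "src z = P" "tgt z = ob Z (r + 1)"
    and dy: "D Y r \<bullet> y = zer P (ob Y (r - 1))" and dz: "D Z (r + 1) \<bullet> z = g r \<bullet> y"
  note [simp] = Proj_Obj[OF P]
  obtain x w where x [simp]: "arr x" "src x = P" "tgt x = ob X r" "arr w" "src w = P" "tgt w = ob Y (r + 1)"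
    and dx: "D X r \<bullet> x = zer P (ob X (r - 1))" and e: "y = f r \<bullet> x \<boxplus> D Y (r + 1) \<bullet> w"
    by (rule hsurjE[OF s P, of y r]) (simp_all add: dy)
  have dz': "D Z (r + 1) \<bullet> (z \<boxplus> \<boxminus> (g (r + 1) \<bullet> w)) = (g r \<bullet> f r) \<bullet> x"
    by (simp add: dz cmapD(7)[OF g]) (simp add: e canc)
  obtain x' where x' [simp]: "arr x'" "src x' = P" "tgt x' = ob X (r + 1)" and dx': "D X (r + 1) \<bullet> x' = x"
    by (rule hinjE[OF h P _ _ dx dz']) simp_all
  have "D Y (r + 1) \<bullet> (f (r + 1) \<bullet> x' \<boxplus> w) = y" by (simp add: cmapD(7)[OF f] dx') (simp add: e)
  then show "\<exists>z. isar z P (ob Y (r + 1)) \<and> D Y (r + 1) \<bullet> z = y" by (intro exI[of _ "f (r + 1) \<bullet> x' \<boxplus> w"]) simp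
qed

lemma hinj_cmp:
  assumes f: "cmap X Y f" and g: "cmap Y Z g" and "hinj X Y f" "hinj Y Z g" shows "hinj X Z (\<lambda>n. g n \<bullet> f n)"
proof (rule hinjI)
  note [simp] = cmapD(1-5)[OF f] cmapD(1-5)[OF g]
  fix r P x z assume P: "P \<in> Proj C" and x [simp]: "arr x" "src x = P" "tgt x = ob X r" and z [simp]: "arr z" "src z = P" "tgt z = ob Z (r + 1)"
    and dx: "D X r \<bullet> x = zer P (ob X (r - 1))" and dz: "D Z (r + 1) \<bullet> z = (g r \<bullet> f r) \<bullet> x"
  note [simp] = Proj_Obj[OF P]
  obtain y where y: "arr y" "src y = P" "tgt y = ob Y (r + 1)" "D Y (r + 1) \<bullet> y = f r \<bullet> x"
    by (rule hinjE[OF assms(4) P, of "f r \<bullet> x" r z]) (simp_all add: dz cmapD(7)[OF f] dx)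
  obtain w where "arr w" "src w = P" "tgt w = ob X (r + 1)" "D X (r + 1) \<bullet> w = x"
    by (rule hinjE[OF assms(3) P, of x r y]) (use y dx in simp_all)
  then show "\<exists>z. isar z P (ob X (r + 1)) \<and> D X (r + 1) \<bullet> z = x" by blast
qed

lemma hsurj_cmp:
  assumes f: "cmap X Y f" and g: "cmap Y Z g" and "hsurj X Y f" "hsurj Y Z g" shows "hsurj X Z (\<lambda>n. g n \<bullet> f n)"
proof (rule hsurjI)
  note [simp] = cmapD(1-5)[OF f] cmapD(1-5)[OF g]
  fix r P z assume P: "P \<in> Proj C" and z: "arr z" "src z = P" "tgt z = ob Z r" "D Z r \<bullet> z = zer P (ob Z (r - 1))"
  obtain y w where y: "arr y" "src y = P" "tgt y = ob Y r" "arr w" "src w = P" "tgt w = ob Z (r + 1)"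
    "D Y r \<bullet> y = zer P (ob Y (r - 1))" and ez: "z = g r \<bullet> y \<boxplus> D Z (r + 1) \<bullet> w"
    by (rule hsurjE[OF assms(4) P, of z r]) (use z in simp_all)
  obtain x v where x: "arr x" "src x = P" "tgt x = ob X r" "arr v" "src v = P" "tgt v = ob Y (r + 1)"
    "D X r \<bullet> x = zer P (ob X (r - 1))" and ey: "y = f r \<bullet> x \<boxplus> D Y (r + 1) \<bullet> v"
    by (rule hsurjE[OF assms(3) P, of y r]) (use y in simp_all)
  have Z: "z = (g r \<bullet> f r) \<bullet> x \<boxplus> D Z (r + 1) \<bullet> (g (r + 1) \<bullet> v \<boxplus> w)"
    unfolding ez ey using x(1-6) y(4-6) by (simp add: cmapD(7)[OF g] add_ac)
  show "\<exists>x w. isar x P (ob X r) \<and> isar w P (ob Z (r + 1)) \<and> D X r \<bullet> x = zer P (ob X (r - 1)) \<and> z = (g r \<bullet> f r) \<bullet> x \<boxplus> D Z (r + 1) \<bullet> w"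
    by (intro exI[of _ x] exI[of _ "g (r + 1) \<bullet> v \<boxplus> w"] conjI Z) (use x(1-7) y(4-6) in simp_all)
qed

lemma hinj_id: "is_cplx C X \<Longrightarrow> hinj X X (\<lambda>n. idn (ob X n))"
  by (rule hinjI) auto

lemma hsurj_id:
  assumes [simp]: "is_cplx C X" shows "hsurj X X (\<lambda>n. idn (ob X n))"
proof (rule hsurjI)
  fix r P y assume "P \<in> Proj C" "arr y" "src y = P" "tgt y = ob X r" "D X r \<bullet> y = zer P (ob X (r - 1))"
  then show "\<exists>x z. isar x P (ob X r) \<and> isar z P (ob X (r + 1)) \<and> D X r \<bullet> x = zer P (ob X (r - 1)) \<and> y = idn (ob X r) \<bullet> x \<boxplus> D X (r + 1) \<bullet> z"
    by (intro exI[of _ y] exI[of _ "zer P (ob X (r + 1))"]) simp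
qed

text \<open>The content of the long exact homology sequence, obtained by chasing elements with
  projective source. If \<open>K\<close> is acyclic, the lifting property yields both
  halves.\<close>

lemma quasi_iso_epi_iff:
  assumes s: "ses K X Y k p"
  shows "hinj X Y p \<and> hsurj X Y p \<longleftrightarrow> K \<in> acyclics C"
proof
  note ck = sesD(1)[OF s] and cp = sesD(2)[OF s]
  note [simp] = cmapD(1-5)[OF ck] cmapD(1-5)[OF cp]
  {
    assume "K \<in> acyclics C"
    then have e: "\<And>n. ex_at K n" by (simp add: acyclic_iff)
    have l: "lifting X Y p m" for m by (rule lifting_of_kernel_ex_at[OF ck cp sesD(3)[OF s] e])
    have "hinj X Y p"
    proof (rule hinjI)
      fix r P x y assume a: "P \<in> Proj C" "arr x" "src x = P" "tgt x = ob X r" "arr y" "src y = P" "tgt y = ob Y (r + 1)"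
        "D X r \<bullet> x = zer P (ob X (r - 1))" "D Y (r + 1) \<bullet> y = p r \<bullet> x"
      show "\<exists>z. isar z P (ob X (r + 1)) \<and> D X (r + 1) \<bullet> z = x"
        using liftingE[OF l[of r] a(1), of x y] a by blast
    qed
    moreover have "hsurj X Y p"
    proof (rule hsurjI)
      fix r P y assume P: "P \<in> Proj C" and y: "arr y" "src y = P" "tgt y = ob Y r" "D Y r \<bullet> y = zer P (ob Y (r - 1))"
      note [simp] = Proj_Obj[OF P]
      obtain x where x: "arr x" "src x = P" "tgt x = ob X (r - 1 + 1)" "D X (r - 1 + 1) \<bullet> x = zer P (ob X (r - 1))" "p (r - 1 + 1) \<bullet> x = y"
        by (rule liftingE[OF l[of "r - 1"] P, of "zer P (ob X (r - 1))" y]) (use y in simp_all)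
      then show "\<exists>x z. isar x P (ob X r) \<and> isar z P (ob Y (r + 1)) \<and> D X r \<bullet> x = zer P (ob X (r - 1)) \<and> y = p r \<bullet> x \<boxplus> D Y (r + 1) \<bullet> z"
        using y by (intro exI[of _ x] exI[of _ "zer P (ob Y (r + 1))"]) simp
    qed
    ultimately show "hinj X Y p \<and> hsurj X Y p" by blast
  }
  assume a: "hinj X Y p \<and> hsurj X Y p"
  have "ex_at K m" for m
  proof (rule ex_atI)
    fix P x assume P: "P \<in> Proj C" and x [simp]: "arr x" "src x = P" "tgt x = ob K m" and dx: "D K m \<bullet> x = zer P (ob K (m - 1))"
    note [simp] = Proj_Obj[OF P]
    have pk: "p n \<bullet> k n \<bullet> z = zer (src z) (ob Y n)" if "arr z" "tgt z = ob K n" for n z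
      using ses_zero[OF s, of n, THEN cmp_reassoc, of z] that by simp
    obtain z where z [simp]: "arr z" "src z = P" "tgt z = ob X (m + 1)" and dz: "D X (m + 1) \<bullet> z = k m \<bullet> x"
      by (rule hinjE[OF conjunct1[OF a] P, of "k m \<bullet> x" m "zer P (ob Y (m + 1))"]) (simp_all add: cmapD(7)[OF ck] dx pk)
    obtain w y where w [simp]: "arr w" "src w = P" "tgt w = ob X (m + 1)" "arr y" "src y = P" "tgt y = ob Y (m + 1 + 1)"
      and dw: "D X (m + 1) \<bullet> w = zer P (ob X (m + 1 - 1))" and e: "p (m + 1) \<bullet> z = p (m + 1) \<bullet> w \<boxplus> D Y (m + 1 + 1) \<bullet> y"
      by (rule hsurjE[OF conjunct2[OF a] P, of "p (m + 1) \<bullet> z" "m + 1"]) (simp_all add: cmapD(7)[OF cp] dz pk)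
    obtain v where v [simp]: "arr v" "src v = P" "tgt v = ob X (m + 1 + 1)" and pv: "p (m + 1 + 1) \<bullet> v = y"
      by (rule ses_surj[OF s P, of y "m + 1 + 1"]) simp_all
    have pdv: "p (m + 1) \<bullet> D X (m + 1 + 1) \<bullet> v = D Y (m + 1 + 1) \<bullet> y"
      using cmapD(7)[OF cp, of "m + 1 + 1" v] unfolding pv by simp
    \<comment> \<open>The chain \<open>z\<close> bounds \<open>k m \<bullet> x\<close> in
      \<open>X\<close> but may leave \<open>K\<close>. Its image in \<open>Y\<close> is a cycle,
      hence the image of a cycle \<open>w\<close> plus the boundary of \<open>y\<close>; with
      \<open>v\<close> over \<open>y\<close>, subtracting \<open>w\<close> and \<open>d v\<close>
      keeps the boundary and makes the image zero.\<close>
    let ?t = "z \<boxplus> \<boxminus> w \<boxplus> \<boxminus> (D X (m + 1 + 1) \<bullet> v)"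
    obtain t where t [simp]: "arr t" "src t = P" "tgt t = ob K (m + 1)" and kt: "k (m + 1) \<bullet> t = ?t"
      by (rule ses_lift[OF s, of ?t P "m + 1"]) (use e pdv in \<open>simp_all add: canc\<close>)
    have "k m \<bullet> (D K (m + 1) \<bullet> t) = k m \<bullet> x"
      using cmapD(7)[OF ck, of "m + 1" t] dw by (simp add: kt dz)
    then have "D K (m + 1) \<bullet> t = x" by (rule monoD[OF ses_mono[OF s]]) simp_all
    then show "\<exists>y. isar y P (ob K (m + 1)) \<and> D K (m + 1) \<bullet> y = x" using t by blast
  qed
  then show "K \<in> acyclics C" by (simp add: acyclic_iff)
qed

lemma quasi_iso_mono_iff:
  assumes s: "ses A B Q i c"
  shows "hinj A B i \<and> hsurj A B i \<longleftrightarrow> Q \<in> acyclics C"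
proof
  note ci = sesD(1)[OF s] and cc = sesD(2)[OF s]
  note [simp] = cmapD(1-5)[OF ci] cmapD(1-5)[OF cc]
  have ci0: "c n \<bullet> i n \<bullet> z = zer (src z) (ob Q n)" if "arr z" "tgt z = ob A n" for n z
    using ses_zero[OF s, of n, THEN cmp_reassoc, of z] that by simp
  {
    assume "Q \<in> acyclics C"
    then have e: "\<And>n. ex_at Q n" by (simp add: acyclic_iff)
    \<comment> \<open>If the image of \<open>b\<close> in \<open>Q\<close> is a cycle, it bounds
      there, so up to a boundary of \<open>B\<close> the element \<open>b\<close> comes from
      \<open>A\<close>. This is applied to a bounding chain for injectivity and to a cycle for
      surjectivity.\<close>
    have key: "\<exists>a b'. isar a P (ob A r) \<and> isar b' P (ob B (r + 1)) \<and> b = i r \<bullet> a \<boxplus> D B (r + 1) \<bullet> b'"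
      if P: "P \<in> Proj C" and b [simp]: "arr b" "src b = P" "tgt b = ob B r" and cb: "D Q r \<bullet> c r \<bullet> b = zer P (ob Q (r - 1))" for P b r
    proof -
      note [simp] = Proj_Obj[OF P]
      obtain q where q [simp]: "arr q" "src q = src (c r \<bullet> b)" "tgt q = ob Q (r + 1)" and dq: "D Q (r + 1) \<bullet> q = c r \<bullet> b"
        by (rule ex_atE[OF e[of r], of "c r \<bullet> b"]) (use P cb in simp_all)
      obtain b' where b' [simp]: "arr b'" "src b' = P" "tgt b' = ob B (r + 1)" and cb': "c (r + 1) \<bullet> b' = q"
        by (rule ses_surj[OF s P, of q "r + 1"]) simp_all
      have "c r \<bullet> D B (r + 1) \<bullet> b' = c r \<bullet> b" using cmapD(7)[OF cc, of "r + 1" b'] by (simp add: cb' dq)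
      then obtain a where a [simp]: "arr a" "src a = P" "tgt a = ob A r" and ia: "i r \<bullet> a = b \<boxplus> \<boxminus> (D B (r + 1) \<bullet> b')"
        using ses_lift[OF s, of "b \<boxplus> \<boxminus> (D B (r + 1) \<bullet> b')" P r] by auto
      have "b = i r \<bullet> a \<boxplus> D B (r + 1) \<bullet> b'" unfolding ia by (simp add: canc)
      then show ?thesis using a b' by blast
    qed
    have "hinj A B i"
    proof (rule hinjI)
      fix r P x y assume P: "P \<in> Proj C" and x [simp]: "arr x" "src x = P" "tgt x = ob A r" and y [simp]: "arr y" "src y = P" "tgt y = ob B (r + 1)"
        and dx: "D A r \<bullet> x = zer P (ob A (r - 1))" and dy: "D B (r + 1) \<bullet> y = i r \<bullet> x"
      have "D Q (r + 1) \<bullet> c (r + 1) \<bullet> y = zer P (ob Q (r + 1 - 1))" by (simp add: cmapD(7)[OF cc] dy ci0)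
      then obtain a b' where ab: "isar a P (ob A (r + 1))" "isar b' P (ob B (r + 1 + 1))" and e: "y = i (r + 1) \<bullet> a \<boxplus> D B (r + 1 + 1) \<bullet> b'"
        using key[OF P, of y "r + 1"] by auto
      have "i r \<bullet> (D A (r + 1) \<bullet> a) = i r \<bullet> x"
        using cmapD(7)[OF ci, of "r + 1" a] ab unfolding dy[symmetric] by (simp add: e)
      then have "D A (r + 1) \<bullet> a = x" by (rule monoD[OF ses_mono[OF s]]) (use ab in simp_all)
      then show "\<exists>z. isar z P (ob A (r + 1)) \<and> D A (r + 1) \<bullet> z = x" using ab by blast
    qed
    moreover have "hsurj A B i"
    proof (rule hsurjI)
      fix r P y assume P: "P \<in> Proj C" and y [simp]: "arr y" "src y = P" "tgt y = ob B r" and dy: "D B r \<bullet> y = zer P (ob B (r - 1))"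
      note [simp] = Proj_Obj[OF P]
      have "D Q r \<bullet> c r \<bullet> y = zer P (ob Q (r - 1))" by (simp add: cmapD(7)[OF cc] dy)
      then obtain a b' where ab: "isar a P (ob A r)" "isar b' P (ob B (r + 1))" and e: "y = i r \<bullet> a \<boxplus> D B (r + 1) \<bullet> b'"
        using key[OF P y] by blast
      have "D B r \<bullet> (i r \<bullet> a \<boxplus> D B (r + 1) \<bullet> b') = zer P (ob B (r - 1))" using dy e by simp
      then have "i (r - 1) \<bullet> (D A r \<bullet> a) = i (r - 1) \<bullet> zer P (ob A (r - 1))"
        using ab by (simp add: cmapD(7)[OF ci])
      then have "D A r \<bullet> a = zer P (ob A (r - 1))" by (rule monoD[OF ses_mono[OF s]]) (use ab in simp_all)
      then show "\<exists>x z. isar x P (ob A r) \<and> isar z P (ob B (r + 1)) \<and> D A r \<bullet> x = zer P (ob A (r - 1)) \<and> y = i r \<bullet> x \<boxplus> D B (r + 1) \<bullet> z"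
        using ab e by blast
    qed
    ultimately show "hinj A B i \<and> hsurj A B i" by blast
  }
  assume h: "hinj A B i \<and> hsurj A B i"
  have "ex_at Q r" for r
  proof (rule ex_atI)
    fix P q assume P: "P \<in> Proj C" and q [simp]: "arr q" "src q = P" "tgt q = ob Q r" and dq: "D Q r \<bullet> q = zer P (ob Q (r - 1))"
    note [simp] = Proj_Obj[OF P]
    obtain b where b [simp]: "arr b" "src b = P" "tgt b = ob B r" and cb: "c r \<bullet> b = q"
      by (rule ses_surj[OF s P, of q r]) simp_all
    have "c (r - 1) \<bullet> D B r \<bullet> b = zer P (ob Q (r - 1))" using cmapD(7)[OF cc, of r b] by (simp add: cb dq)
    then obtain a where a [simp]: "arr a" "src a = P" "tgt a = ob A (r - 1)" and ia: "i (r - 1) \<bullet> a = D B r \<bullet> b"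
      using ses_lift[OF s, of "D B r \<bullet> b" P "r - 1"] by auto
    have "i (r - 1 - 1) \<bullet> (D A (r - 1) \<bullet> a) = i (r - 1 - 1) \<bullet> zer P (ob A (r - 1 - 1))"
      using cmapD(7)[OF ci, of "r - 1" a] by (simp add: ia)
    then have da: "D A (r - 1) \<bullet> a = zer P (ob A (r - 1 - 1))" by (rule monoD[OF ses_mono[OF s]]) simp_all
    \<comment> \<open>The boundary of \<open>b\<close> is the image of the cycle \<open>a\<close>,
      which bounds some \<open>a'\<close> by injectivity. Then \<open>b - i a'\<close> is a cycle
      with the same image \<open>q\<close>, to which surjectivity applies.\<close>
    obtain a' where a'0: "arr a'" "src a' = P" "tgt a' = ob A (r - 1 + 1)" "D A (r - 1 + 1) \<bullet> a' = a"
      by (rule hinjE[OF conjunct1[OF h] P, of a "r - 1" b]) (simp_all add: da ia)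
    then have a' [simp]: "arr a'" "src a' = P" "tgt a' = ob A r" and da': "D A r \<bullet> a' = a" by simp_all
    obtain x z where x [simp]: "arr x" "src x = P" "tgt x = ob A r" "arr z" "src z = P" "tgt z = ob B (r + 1)"
      and e: "b \<boxplus> \<boxminus> (i r \<bullet> a') = i r \<bullet> x \<boxplus> D B (r + 1) \<bullet> z"
      by (rule hsurjE[OF conjunct2[OF h] P, of "b \<boxplus> \<boxminus> (i r \<bullet> a')" r]) (simp_all add: cmapD(7)[OF ci] da' ia)
    have "c r \<bullet> (b \<boxplus> \<boxminus> (i r \<bullet> a')) = c r \<bullet> (i r \<bullet> x \<boxplus> D B (r + 1) \<bullet> z)" by (simp only: e)
    then have "D Q (r + 1) \<bullet> c (r + 1) \<bullet> z = q" by (simp add: cb ci0 cmapD(7)[OF cc])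
    then show "\<exists>y. isar y P (ob Q (r + 1)) \<and> D Q (r + 1) \<bullet> y = q" by (intro exI[of _ "c (r + 1) \<bullet> z"]) simp
  qed
  then show "Q \<in> acyclics C" by (simp add: acyclic_iff)
qed

end

subsection \<open>The exact category of complexes\<close>

context category
begin

lemma lifts_against_cmp_left:
  assumes o: "X \<in> Obj C" "Y \<in> Obj C" "Z \<in> Obj C" "A \<in> Obj C" "B \<in> Obj C"
    and f: "f \<in> Hom C X Y" "g \<in> Hom C Y Z" "p \<in> Hom C A B"
    and l: "lifts_against C (X, Y, f) (A, B, p)" "lifts_against C (Y, Z, g) (A, B, p)"
  shows "lifts_against C (X, Z, g \<cdot> f) (A, B, p)"
  unfolding lifts_against.simps
proof (intro ballI impI)
  fix u v assume u: "u \<in> Hom C X A" and v: "v \<in> Hom C Z B" and e: "p \<cdot> u = v \<cdot> (g \<cdot> f)"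
  have vg: "v \<cdot> g \<in> Hom C Y B" using comp_closed o f v by blast
  have "p \<cdot> u = (v \<cdot> g) \<cdot> f" using e comp_assoc[of X Y Z B f g v] o f v by simp
  then obtain h1 where h1: "h1 \<in> Hom C Y A" "h1 \<cdot> f = u" "p \<cdot> h1 = v \<cdot> g" using l(1) u vg by auto
  then obtain h where h: "h \<in> Hom C Z A" "h \<cdot> g = h1" "p \<cdot> h = v" using l(2) v by auto
  have "h \<cdot> (g \<cdot> f) = u" using comp_assoc[of X Y Z A f g h] o f h h1 by simp
  then show "\<exists>h \<in> Hom C Z A. h \<cdot> (g \<cdot> f) = u \<and> p \<cdot> h = v" using h by blast
qed

lemma lifts_against_cmp_right:
  assumes o: "X \<in> Obj C" "Y \<in> Obj C" "Z \<in> Obj C" "A \<in> Obj C" "B \<in> Obj C"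
    and f: "f \<in> Hom C X Y" "g \<in> Hom C Y Z" "i \<in> Hom C A B"
    and l: "lifts_against C (A, B, i) (X, Y, f)" "lifts_against C (A, B, i) (Y, Z, g)"
  shows "lifts_against C (A, B, i) (X, Z, g \<cdot> f)"
  unfolding lifts_against.simps
proof (intro ballI impI)
  fix u v assume u: "u \<in> Hom C A X" and v: "v \<in> Hom C B Z" and e: "(g \<cdot> f) \<cdot> u = v \<cdot> i"
  have fu: "f \<cdot> u \<in> Hom C A Y" using comp_closed o f u by blast
  have "g \<cdot> (f \<cdot> u) = v \<cdot> i" using e comp_assoc[of A X Y Z u f g] o f u by simp
  then obtain h1 where h1: "h1 \<in> Hom C B Y" "h1 \<cdot> i = f \<cdot> u" "g \<cdot> h1 = v" using l(2) v fu by auto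
  obtain h where h: "h \<in> Hom C B X" "h \<cdot> i = u" "f \<cdot> h = h1"
    using l(1)[unfolded lifts_against.simps, rule_format, OF u h1(1)] h1(2) by auto
  have "(g \<cdot> f) \<cdot> h = v" using comp_assoc[of B X Y Z h f g] o f h h1 by simp
  then show "\<exists>h \<in> Hom C B X. h \<cdot> i = u \<and> (g \<cdot> f) \<cdot> h = v" using h by blast
qed

lemma lifts_against_ide:
  assumes o: "X \<in> Obj C" "A \<in> Obj C" "B \<in> Obj C" and p: "p \<in> Hom C A B"
  shows "lifts_against C (X, X, Ide C X) (A, B, p)" "lifts_against C (A, B, p) (X, X, Ide C X)"
  unfolding lifts_against.simps
proof (intro ballI impI)
  fix u v assume "u \<in> Hom C X A" "v \<in> Hom C X B" "p \<cdot> u = v \<cdot> Ide C X"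
  then show "\<exists>h \<in> Hom C X A. h \<cdot> Ide C X = u \<and> p \<cdot> h = v" using o by (intro bexI[of _ u]) (simp_all add: ide_right)
next
  show "\<forall>u \<in> Hom C A X. \<forall>v \<in> Hom C B X. Ide C X \<cdot> u = v \<cdot> p \<longrightarrow> (\<exists>h \<in> Hom C B X. h \<cdot> p = u \<and> Ide C X \<cdot> h = v)"
  proof (intro ballI impI)
    fix u v assume "u \<in> Hom C A X" "v \<in> Hom C B X" "Ide C X \<cdot> u = v \<cdot> p"
    then show "\<exists>h \<in> Hom C B X. h \<cdot> p = u \<and> Ide C X \<cdot> h = v" using o by (intro bexI[of _ v]) (simp_all add: ide_left)
  qed
qed

text \<open>Identities and composites inherit lifting properties, and each class consists of all
  morphisms with a lifting property. Closure under composition is obtained in this way rather than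
  by composing short exact sequences of complexes.\<close>

lemma wide_subcategory_of_wfs:
  assumes w: "weak_factorisation_system C L R"
  shows "wide_subcategory C L" "wide_subcategory C R"
proof -
  have L: "L = {l \<in> Mor C. \<forall>r \<in> R. lifts_against C l r}" and R: "R = {r \<in> Mor C. \<forall>l \<in> L. lifts_against C l r}"
    using w unfolding weak_factorisation_system_def by blast+
  have LMor: "L \<subseteq> Mor C" by (subst L) blast
  have RMor: "R \<subseteq> Mor C" by (subst R) blast
  have LM: "(X, Y, f) \<in> L \<Longrightarrow> X \<in> Obj C \<and> Y \<in> Obj C \<and> f \<in> Hom C X Y"
    and RM: "(X, Y, f) \<in> R \<Longrightarrow> X \<in> Obj C \<and> Y \<in> Obj C \<and> f \<in> Hom C X Y" for X Y f
    using LMor RMor unfolding Mor_def by blast+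
  have lift: "lifts_against C l r" if "l \<in> L" "r \<in> R" for l r
    using that(1) by (subst (asm) L) (use that(2) in blast)
  show "wide_subcategory C L"
    unfolding wide_subcategory_def
  proof (intro conjI ballI allI impI)
    show "L \<subseteq> Mor C" by (rule LMor)
    fix X assume X: "X \<in> Obj C"
    have "lifts_against C (X, X, Ide C X) r" if "r \<in> R" for r
      using that RM lifts_against_ide(1)[OF X] by (cases r) blast
    then show "(X, X, Ide C X) \<in> L" using X ide_closed by (subst L) (simp add: Mor_def)
  next
    fix X Y Z f g assume a: "(X, Y, f) \<in> L \<and> (Y, Z, g) \<in> L"
    have "lifts_against C (X, Z, g \<cdot> f) r" if r: "r \<in> R" for r
    proof (cases r)
      case (fields A B p)
      show ?thesis unfolding fields
        by (rule lifts_against_cmp_left[of X Y Z]) (use a LM RM lift r fields in blast)+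
    qed
    moreover have "(X, Z, g \<cdot> f) \<in> Mor C" using LM[of X Y f] LM[of Y Z g] a comp_closed[of X Y Z f g] by (simp add: Mor_def)
    ultimately show "(X, Z, g \<cdot> f) \<in> L" by (subst L) simp
  qed
  show "wide_subcategory C R"
    unfolding wide_subcategory_def
  proof (intro conjI ballI allI impI)
    show "R \<subseteq> Mor C" by (rule RMor)
    fix X assume X: "X \<in> Obj C"
    have "lifts_against C l (X, X, Ide C X)" if "l \<in> L" for l
      using that LM lifts_against_ide(2)[OF X] by (cases l) blast
    then show "(X, X, Ide C X) \<in> R" using X ide_closed by (subst R) (simp add: Mor_def)
  next
    fix X Y Z f g assume a: "(X, Y, f) \<in> R \<and> (Y, Z, g) \<in> R"
    have "lifts_against C l (X, Z, g \<cdot> f)" if l: "l \<in> L" for l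
    proof (cases l)
      case (fields A B i)
      show ?thesis unfolding fields
        by (rule lifts_against_cmp_right[of X Y Z]) (use a LM RM lift l fields in blast)+
    qed
    moreover have "(X, Z, g \<cdot> f) \<in> Mor C" using RM[of X Y f] RM[of Y Z g] a comp_closed[of X Y Z f g] by (simp add: Mor_def)
    ultimately show "(X, Z, g \<cdot> f) \<in> R" by (subst R) simp
  qed
qed

end

section \<open>Vanishing of extensions and splitting\<close>

context preadditive_category
begin

text \<open>A split extension exists and is equivalent to exactly the split ones, so a single
  equivalence class means that every extension splits. The setting is preadditive in order to cover
  both \<open>C\<close> and \<open>Ch C\<close>.\<close>

lemma Ext1_vanishes_iff:
  assumes conf: "\<And>i B p. Conf C A i B p Z \<Longrightarrow> is_kernel C A i B p Z \<and> B \<in> Obj C \<and> p \<in> Hom C B Z"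
    and o: "A \<in> Obj C" "Z \<in> Obj C"
    and split: "\<exists>i B p s. Conf C A i B p Z \<and> s \<in> Hom C Z B \<and> p \<cdot> s = Ide C Z"
  shows "Ext1_vanishes C Z A \<longleftrightarrow> (\<forall>i B p. Conf C A i B p Z \<longrightarrow> (\<exists>s \<in> Hom C Z B. p \<cdot> s = Ide C Z))"
proof
  let ?X = "extensions C Z A" and ?r = "ext_equiv C Z A"
  obtain i0 B0 p0 s0 where c0: "Conf C A i0 B0 p0 Z" and s0: "s0 \<in> Hom C Z B0" "p0 \<cdot> s0 = Ide C Z" using split by blast
  have x0: "(i0, B0, p0) \<in> ?X" using c0 by (simp add: extensions_def)
  have i0: "i0 \<in> Hom C A B0" "B0 \<in> Obj C" "p0 \<in> Hom C B0 Z" using conf[OF c0] by (auto simp: is_kernel_def)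
  {
    assume "Ext1_vanishes C Z A"
    then obtain q where q: "?X // ?r = {q}" unfolding Ext1_vanishes_def Ext1_def is_singleton_def by blast
    show "\<forall>i B p. Conf C A i B p Z \<longrightarrow> (\<exists>s \<in> Hom C Z B. p \<cdot> s = Ide C Z)"
    proof (intro allI impI)
      fix i B p assume c: "Conf C A i B p Z"
      then have x: "(i, B, p) \<in> ?X" by (simp add: extensions_def)
      have B: "B \<in> Obj C" "p \<in> Hom C B Z" using conf[OF c] by auto
      have "?r `` {(i, B, p)} = ?r `` {(i0, B0, p0)}" using quotientI[OF x, of ?r] quotientI[OF x0, of ?r] q by simp
      moreover have "((i0, B0, p0), (i0, B0, p0)) \<in> ?r"
      proof -
        have "is_iso C B0 B0 (Ide C B0)" using i0 ide_closed ide_left by (auto simp: is_iso_def)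
        moreover have "Ide C B0 \<cdot> i0 = i0" "p0 \<cdot> Ide C B0 = p0" using i0 o ide_left ide_right by simp_all
        ultimately show ?thesis using x0 by (auto simp: ext_equiv_def)
      qed
      ultimately have "((i, B, p), (i0, B0, p0)) \<in> ?r" by blast
      then obtain h where h: "is_iso C B B0 h" "p0 \<cdot> h = p" by (auto simp: ext_equiv_def)
      then obtain g where g: "h \<in> Hom C B B0" "g \<in> Hom C B0 B" "h \<cdot> g = Ide C B0" by (auto simp: is_iso_def)
      have gs: "g \<cdot> s0 \<in> Hom C Z B" using comp_closed[of Z B0 B s0 g] g s0 o i0 B by simp
      have "p \<cdot> (g \<cdot> s0) = p0 \<cdot> (h \<cdot> (g \<cdot> s0))"
        unfolding h(2)[symmetric] by (rule comp_assoc) (use o i0 B g gs in simp_all)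
      also have "h \<cdot> (g \<cdot> s0) = (h \<cdot> g) \<cdot> s0" by (rule comp_assoc[symmetric]) (use o i0 B g s0 in simp_all)
      also have "\<dots> = s0" unfolding g(3) using ide_left s0 o i0 by simp
      finally show "\<exists>s \<in> Hom C Z B. p \<cdot> s = Ide C Z" using gs s0 by auto
    qed
  }
  assume R: "\<forall>i B p. Conf C A i B p Z \<longrightarrow> (\<exists>s \<in> Hom C Z B. p \<cdot> s = Ide C Z)"
  have rel: "((i, B, p), (i', B', p')) \<in> ?r" if c: "Conf C A i B p Z" and c': "Conf C A i' B' p' Z" for i B p i' B' p'
  proof -
    obtain s s' where s: "s \<in> Hom C Z B" "p \<cdot> s = Ide C Z" and s': "s' \<in> Hom C Z B'" "p' \<cdot> s' = Ide C Z" using R c c' by blast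
    have B: "B \<in> Obj C" "p \<in> Hom C B Z" "B' \<in> Obj C" "p' \<in> Hom C B' Z" using conf[OF c] conf[OF c'] by auto
    define I P I' P' S S' where "I = Arrow A B i" and "P = Arrow B Z p" and "I' = Arrow A B' i'" and "P' = Arrow B' Z p'" and "S = Arrow Z B s" and "S' = Arrow Z B' s'"
    have k: "kern I P" and k': "kern I' P'"
      using conf[OF c] conf[OF c'] o B by (auto simp: I_def P_def I'_def P'_def is_kernel_iff)
    have [simp]: "arr I" "arr P" "arr I'" "arr P'" using kernD(2,3)[OF k] kernD(2,3)[OF k'] by simp_all
    have [simp]: "arr S" "arr S'" using s s' o B by (simp_all add: S_def S'_def)
    have [simp]: "src I = A" "tgt I = B" "src P = B" "tgt P = Z" "src I' = A" "tgt I' = B'" "src P' = B'" "tgt P' = Z"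
      "src S = Z" "tgt S = B" "src S' = Z" "tgt S' = B'" "A \<in> Obj C" "B \<in> Obj C" "B' \<in> Obj C" "Z \<in> Obj C"
      using o B by (simp_all add: I_def P_def I'_def P'_def S_def S'_def)
    have PS: "P \<bullet> S = idn Z" and PS': "P' \<bullet> S' = idn Z"
      using s s' o B by (simp_all add: P_def S_def P'_def S'_def cmp_Arrow idn_eq_Arrow)
    have PI: "P \<bullet> I = zer A Z" and PI': "P' \<bullet> I' = zer A Z" using kernD(5)[OF k] kernD(5)[OF k'] by simp_all
    obtain Q where Q [simp]: "arr Q" "src Q = B" "tgt Q = A" and IQ: "I \<bullet> Q = idn B \<boxplus> \<boxminus> (S \<bullet> P)"
      using kern_lift[OF k, of "idn B \<boxplus> \<boxminus> (S \<bullet> P)"] by (auto simp: PS[THEN cmp_reassoc])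
    obtain Q' where Q' [simp]: "arr Q'" "src Q' = B'" "tgt Q' = A" and IQ': "I' \<bullet> Q' = idn B' \<boxplus> \<boxminus> (S' \<bullet> P')"
      using kern_lift[OF k', of "idn B' \<boxplus> \<boxminus> (S' \<bullet> P')"] by (auto simp: PS'[THEN cmp_reassoc])
    have QI: "Q \<bullet> I = idn A" by (rule monoD[OF kernD(1)[OF k]]) (simp_all add: IQ[THEN cmp_reassoc] PI)
    have QI': "Q' \<bullet> I' = idn A" by (rule monoD[OF kernD(1)[OF k']]) (simp_all add: IQ'[THEN cmp_reassoc] PI')
    have QS: "Q \<bullet> S = zer Z A" by (rule monoD[OF kernD(1)[OF k]]) (simp_all add: IQ[THEN cmp_reassoc] PS)
    have QS': "Q' \<bullet> S' = zer Z A" by (rule monoD[OF kernD(1)[OF k']]) (simp_all add: IQ'[THEN cmp_reassoc] PS')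
    \<comment> \<open>The retractions \<open>Q\<close>, \<open>Q'\<close> and the sections identify
      both middle terms with the sum of \<open>A\<close> and \<open>Z\<close>; these are the
      identifications between them in the two directions.\<close>
    let ?h = "I' \<bullet> Q \<boxplus> S' \<bullet> P" and ?g = "I \<bullet> Q' \<boxplus> S \<bullet> P'"
    note re = QI[THEN cmp_reassoc] QS[THEN cmp_reassoc] PI[THEN cmp_reassoc] PS[THEN cmp_reassoc]
      QI'[THEN cmp_reassoc] QS'[THEN cmp_reassoc] PI'[THEN cmp_reassoc] PS'[THEN cmp_reassoc]
    have "?g \<bullet> ?h = I \<bullet> Q \<boxplus> S \<bullet> P" by (simp add: re)
    then have gh: "?g \<bullet> ?h = idn B" unfolding IQ by (simp add: canc)
    have "?h \<bullet> ?g = I' \<bullet> Q' \<boxplus> S' \<bullet> P'" by (simp add: re)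
    then have hg: "?h \<bullet> ?g = idn B'" unfolding IQ' by (simp add: canc)
    have ish: "isom ?h" by (rule isomI[OF _ _ gh hg]) simp_all
    have hI: "?h \<bullet> I = I'" by (simp add: QI PI)
    have Ph: "P' \<bullet> ?h = P" by (simp add: re)
    have ht: "isar ?h B B'" by simp
    have "is_iso C B B' (val ?h)" using ish is_iso_iff[of B B' "val ?h"] Arrow_val[OF ht] by simp
    moreover have "val ?h \<cdot> i = i'"
    proof -
      have "val (?h \<bullet> I) = val ?h \<cdot> val I" by (rule val_cmp) simp_all
      then show ?thesis unfolding hI by (simp add: I_def I'_def del: cmp_add_left)
    qed
    moreover have "p' \<cdot> val ?h = p"
    proof -
      have "val (P' \<bullet> ?h) = val P' \<cdot> val ?h" by (rule val_cmp) simp_all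
      then show ?thesis unfolding Ph by (simp add: P_def P'_def)
    qed
    ultimately show ?thesis using c c' unfolding ext_equiv_def extensions_def by blast
  qed
  have "?r `` {x} = ?X" if x: "x \<in> ?X" for x
  proof
    show "?r `` {x} \<subseteq> ?X" by (auto simp: ext_equiv_def)
    show "?X \<subseteq> ?r `` {x}" using x rel by (cases x) (auto simp: extensions_def)
  qed
  then have "?X // ?r = {?X}" using x0 unfolding quotient_def by blast
  then show "Ext1_vanishes C Z A" unfolding Ext1_vanishes_def Ext1_def by (simp add: is_singleton_def)
qed

end

section \<open>Translation between \<open>Ch C\<close> and families of arrows\<close>

context projective_exact_category
begin

text \<open>A morphism of \<open>Ch C\<close> is a family of raw morphisms without source and
  target; \<open>tm\<close> supplies these. As it is injective for fixed complexes, equations of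
  arrows can be transported back.\<close>

definition tm :: "('o, 'm) cplx \<Rightarrow> ('o, 'm) cplx \<Rightarrow> (int \<Rightarrow> 'm) \<Rightarrow> int \<Rightarrow> ('o, 'm) arrow" where
  "tm X Y f = (\<lambda>n. Arrow (ob X n) (ob Y n) (f n))"

lemma Ch_sel:
  "Obj (Ch C) = Collect (is_cplx C)" "Hom (Ch C) X Y = chain_maps C X Y"
  "g \<cdot>\<^bsub>Ch C\<^esub> f = (\<lambda>n. g n \<cdot> f n)" "Ide (Ch C) X = (\<lambda>n. Ide C (ob X n))"
  "Zero (Ch C) X Y = (\<lambda>n. Zero C (ob X n) (ob Y n))"
  "f \<otimes>\<^bsub>HomG (Ch C) X Y\<^esub> f' = (\<lambda>n. f n \<otimes>\<^bsub>HomG C (ob X n) (ob Y n)\<^esub> f' n)"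
  by (simp_all add: Ch_def product_group_def restrict_def)

lemma tm_cmap: "is_cplx C X \<Longrightarrow> is_cplx C Y \<Longrightarrow> f \<in> chain_maps C X Y \<longleftrightarrow> cmap X Y (tm X Y f)"
  unfolding tm_def by (rule chain_map_iff)

lemma tm_val: "cmap X Y F \<Longrightarrow> tm X Y (\<lambda>n. val (F n)) = F"
  by (rule ext) (simp add: tm_def cmap_Arrow_val)

lemma tm_inj: "tm X Y f = tm X Y g \<Longrightarrow> f = g"
  by (auto simp: tm_def fun_eq_iff)

lemma tm_cmp: "cmap X Y (tm X Y f) \<Longrightarrow> cmap Y Z (tm Y Z g) \<Longrightarrow> tm X Z (\<lambda>n. g n \<cdot> f n) n = tm Y Z g n \<bullet> tm X Y f n"
  using cmapD(3)[of X Y "tm X Y f" n] cmapD(3)[of Y Z "tm Y Z g" n] by (simp add: tm_def cmp_Arrow)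

lemma tm_Ide: "is_cplx C X \<Longrightarrow> tm X X (\<lambda>n. Ide C (ob X n)) = (\<lambda>n. idn (ob X n))"
  by (simp add: tm_def idn_eq_Arrow)

lemma tm_Zero: "is_cplx C X \<Longrightarrow> is_cplx C Y \<Longrightarrow> tm X Y (\<lambda>n. Zero C (ob X n) (ob Y n)) = (\<lambda>n. zer (ob X n) (ob Y n))"
  by (simp add: tm_def zer_eq_Arrow)

lemma Mor_Ch: "(X, Y, f) \<in> Mor (Ch C) \<longleftrightarrow> cmap X Y (tm X Y f)"
  using tm_cmap[of X Y f] cmapD(1,2)[of X Y "tm X Y f"] by (auto simp: Mor_def Ch_sel)

lemma Conf_Ch: "Conf (Ch C) X f Y g Z \<longleftrightarrow> ses X Y Z (tm X Y f) (tm Y Z g)"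
proof -
  have "ses X Y Z (tm X Y f) (tm Y Z g) \<longleftrightarrow> is_cplx C X \<and> is_cplx C Y \<and> is_cplx C Z \<and> ses X Y Z (tm X Y f) (tm Y Z g)"
    using cmapD(1,2) unfolding ses_def by blast
  then show ?thesis by (auto simp: Ch_def ses_def tm_cmap) (auto simp: tm_def Conf_iff_cnf)
qed

lemma Conf_Ch_val: "ses X Y Z i c \<Longrightarrow> Conf (Ch C) X (\<lambda>n. val (i n)) Y (\<lambda>n. val (c n)) Z"
  by (simp add: Conf_Ch ses_def tm_val)

lemma adm_monos_Ch: "(X, Y, f) \<in> adm_monos_coker_in (Ch C) S \<longleftrightarrow> (\<exists>Q \<in> S. \<exists>c. ses X Y Q (tm X Y f) c)"
proof
  assume "\<exists>Q \<in> S. \<exists>c. ses X Y Q (tm X Y f) c"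
  then obtain Q c where "Q \<in> S" "ses X Y Q (tm X Y f) c" by blast
  then have "Conf (Ch C) X f Y (\<lambda>n. val (c n)) Q" using tm_val[OF sesD(2)] by (simp add: Conf_Ch)
  then show "(X, Y, f) \<in> adm_monos_coker_in (Ch C) S" using \<open>Q \<in> S\<close> by (auto simp: adm_monos_coker_in_def)
qed (auto simp: adm_monos_coker_in_def Conf_Ch)

lemma adm_epis_Ch: "(X, Y, f) \<in> adm_epis_ker_in (Ch C) T \<longleftrightarrow> (\<exists>K \<in> T. \<exists>k. ses K X Y k (tm X Y f))"
proof
  assume "\<exists>K \<in> T. \<exists>k. ses K X Y k (tm X Y f)"
  then obtain K k where "K \<in> T" "ses K X Y k (tm X Y f)" by blast
  then have "Conf (Ch C) K (\<lambda>n. val (k n)) X f Y" using tm_val[OF sesD(1)] by (simp add: Conf_Ch)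
  then show "(X, Y, f) \<in> adm_epis_ker_in (Ch C) T" using \<open>K \<in> T\<close> by (auto simp: adm_epis_ker_in_def)
qed (auto simp: adm_epis_ker_in_def Conf_Ch)

definition has_lifts :: "('o, 'm) cplx \<Rightarrow> ('o, 'm) cplx \<Rightarrow> (int \<Rightarrow> ('o, 'm) arrow) \<Rightarrow> ('o, 'm) cplx \<Rightarrow> ('o, 'm) cplx \<Rightarrow> (int \<Rightarrow> ('o, 'm) arrow) \<Rightarrow> bool" where
  "has_lifts A B i X Y p \<longleftrightarrow> (\<forall>u v. cmap A X u \<and> cmap B Y v \<and> (\<forall>n. p n \<bullet> u n = v n \<bullet> i n) \<longrightarrow>
     (\<exists>h. cmap B X h \<and> (\<forall>n. h n \<bullet> i n = u n) \<and> (\<forall>n. p n \<bullet> h n = v n)))"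

lemma lifts_against_Ch:
  assumes i: "cmap A B (tm A B i)" and p: "cmap X Y (tm X Y p)"
  shows "lifts_against (Ch C) (A, B, i) (X, Y, p) \<longleftrightarrow> has_lifts A B (tm A B i) X Y (tm X Y p)"
proof
  note [simp] = cmapD(1,2)[OF i] cmapD(1,2)[OF p]
  assume l: "lifts_against (Ch C) (A, B, i) (X, Y, p)"
  show "has_lifts A B (tm A B i) X Y (tm X Y p)"
    unfolding has_lifts_def
  proof (intro allI impI)
    fix u v assume a: "cmap A X u \<and> cmap B Y v \<and> (\<forall>n. tm X Y p n \<bullet> u n = v n \<bullet> tm A B i n)"
    define u' where "u' = (\<lambda>n. val (u n))"
    define v' where "v' = (\<lambda>n. val (v n))"
    have u: "tm A X u' = u" and v: "tm B Y v' = v" using a tm_val by (auto simp: u'_def v'_def)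
    have "tm A Y (\<lambda>n. p n \<cdot> u' n) n = tm A Y (\<lambda>n. v' n \<cdot> i n) n" for n
      using a i p u v tm_cmp[of A X u' Y p n] tm_cmp[of A B i Y v' n] by simp
    then have e: "(\<lambda>n. p n \<cdot> u' n) = (\<lambda>n. v' n \<cdot> i n)" by (intro tm_inj[of A Y] ext)
    have "u' \<in> chain_maps C A X" "v' \<in> chain_maps C B Y" using a u v by (simp_all add: tm_cmap)
    then obtain h where h: "h \<in> chain_maps C B X" "(\<lambda>n. h n \<cdot> i n) = u'" "(\<lambda>n. p n \<cdot> h n) = v'"
      using l e by (auto simp: Ch_sel)
    have hc: "cmap B X (tm B X h)" using h(1) by (simp add: tm_cmap)
    have "tm B X h n \<bullet> tm A B i n = u n" "tm X Y p n \<bullet> tm B X h n = v n" for n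
      using tm_cmp[OF i hc, of n] tm_cmp[OF hc p, of n] u v unfolding h(2,3) by simp_all
    then show "\<exists>h. cmap B X h \<and> (\<forall>n. h n \<bullet> tm A B i n = u n) \<and> (\<forall>n. tm X Y p n \<bullet> h n = v n)" using hc by blast
  qed
next
  note [simp] = cmapD(1,2)[OF i] cmapD(1,2)[OF p]
  assume l: "has_lifts A B (tm A B i) X Y (tm X Y p)"
  show "lifts_against (Ch C) (A, B, i) (X, Y, p)"
    unfolding lifts_against.simps Ch_sel
  proof (intro ballI impI)
    fix u v assume u: "u \<in> chain_maps C A X" and v: "v \<in> chain_maps C B Y" and e: "(\<lambda>n. p n \<cdot> u n) = (\<lambda>n. v n \<cdot> i n)"
    have uc: "cmap A X (tm A X u)" and vc: "cmap B Y (tm B Y v)" using u v by (simp_all add: tm_cmap)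
    have "tm X Y p n \<bullet> tm A X u n = tm B Y v n \<bullet> tm A B i n" for n
      using tm_cmp[OF uc p, of n] tm_cmp[OF i vc, of n] unfolding e by simp
    then obtain h where h: "cmap B X h" "\<And>n. h n \<bullet> tm A B i n = tm A X u n" "\<And>n. tm X Y p n \<bullet> h n = tm B Y v n"
      using l uc vc unfolding has_lifts_def by blast
    define h' where "h' = (\<lambda>n. val (h n))"
    have hh: "tm B X h' = h" using tm_val[OF h(1)] by (simp add: h'_def)
    then have hc: "cmap B X (tm B X h')" using h(1) by simp
    have "tm A X (\<lambda>n. h' n \<cdot> i n) = tm A X u" "tm B Y (\<lambda>n. p n \<cdot> h' n) = tm B Y v"
      using tm_cmp[OF i hc] tm_cmp[OF hc p] h(2,3) by (auto simp: hh)
    then have "(\<lambda>n. h' n \<cdot> i n) = u" "(\<lambda>n. p n \<cdot> h' n) = v" using tm_inj by blast+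
    moreover have "h' \<in> chain_maps C B X" using hc by (simp add: tm_cmap)
    ultimately show "\<exists>h \<in> chain_maps C B X. (\<lambda>n. h n \<cdot> i n) = u \<and> (\<lambda>n. p n \<cdot> h n) = v" by blast
  qed
qed

text \<open>This makes the splitting criterion for extensions and the closure of lifting classes
  under composition applicable to complexes.\<close>

lemma preadditive_Ch: "preadditive_category (Ch C)"
proof -
  have hom: "f n \<in> Hom C (ob X n) (ob Y n)" if "f \<in> chain_maps C X Y" for f X Y n
    using that by (simp add: chain_maps_def)
  show ?thesis
  proof (intro preadditive_category.intro category.intro preadditive_category_axioms.intro)
    fix X Y Z :: "('o, 'm) cplx" and f g
    assume "X \<in> Obj (Ch C)" "Y \<in> Obj (Ch C)" "Z \<in> Obj (Ch C)" "f \<in> Hom (Ch C) X Y" "g \<in> Hom (Ch C) Y Z"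
    then have c: "cmap X Y (tm X Y f)" "cmap Y Z (tm Y Z g)" and o: "is_cplx C X" "is_cplx C Z" by (simp_all add: Ch_sel tm_cmap)
    then have "cmap X Z (tm X Z (\<lambda>n. g n \<cdot> f n))" using cmap_cmp[OF c] tm_cmp[OF c] by (simp add: cmap_def)
    then show "g \<cdot>\<^bsub>Ch C\<^esub> f \<in> Hom (Ch C) X Z" using o by (simp add: Ch_sel tm_cmap)
  next
    fix X assume "X \<in> Obj (Ch C)"
    then show "Ide (Ch C) X \<in> Hom (Ch C) X X" using cmap_id[of X] by (simp add: Ch_sel tm_cmap tm_Ide)
  next
    fix W X Y Z :: "('o, 'm) cplx" and f g h
    assume "W \<in> Obj (Ch C)" "X \<in> Obj (Ch C)" "Y \<in> Obj (Ch C)" "Z \<in> Obj (Ch C)"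
      "f \<in> Hom (Ch C) W X" "g \<in> Hom (Ch C) X Y" "h \<in> Hom (Ch C) Y Z"
    then have "(h n \<cdot> g n) \<cdot> f n = h n \<cdot> (g n \<cdot> f n)" for n
      using comp_assoc[of "ob W n" "ob X n" "ob Y n" "ob Z n" "f n" "g n" "h n"] by (simp add: Ch_sel hom)
    then show "h \<cdot>\<^bsub>Ch C\<^esub> g \<cdot>\<^bsub>Ch C\<^esub> f = h \<cdot>\<^bsub>Ch C\<^esub> (g \<cdot>\<^bsub>Ch C\<^esub> f)" by (simp add: Ch_sel)
  next
    fix X Y f assume "X \<in> Obj (Ch C)" "Y \<in> Obj (Ch C)" "f \<in> Hom (Ch C) X Y"
    then have "Ide C (ob Y n) \<cdot> f n = f n" "f n \<cdot> Ide C (ob X n) = f n" for n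
      using ide_left[of "ob X n" "ob Y n" "f n"] ide_right[of "ob X n" "ob Y n" "f n"] by (simp_all add: Ch_sel hom)
    then show "Ide (Ch C) Y \<cdot>\<^bsub>Ch C\<^esub> f = f" "f \<cdot>\<^bsub>Ch C\<^esub> Ide (Ch C) X = f" by (simp_all add: Ch_sel)
  next
    fix X Y :: "('o, 'm) cplx" assume "X \<in> Obj (Ch C)" "Y \<in> Obj (Ch C)"
    then have o [simp]: "is_cplx C X" "is_cplx C Y" by (simp_all add: Ch_sel)
    note m = hom_mon[OF cplx_ob[OF o(1)] cplx_ob[OF o(2)]]
    have add: "(\<lambda>n. f n \<otimes>\<^bsub>HomG C (ob X n) (ob Y n)\<^esub> g n) \<in> chain_maps C X Y" if "f \<in> chain_maps C X Y" "g \<in> chain_maps C X Y" for f g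
    proof -
      have c: "cmap X Y (tm X Y f)" "cmap X Y (tm X Y g)" using that by (simp_all add: tm_cmap)
      have "tm X Y (\<lambda>n. f n \<otimes>\<^bsub>HomG C (ob X n) (ob Y n)\<^esub> g n) = (\<lambda>n. tm X Y f n \<boxplus> tm X Y g n)"
        using cmapD(3)[OF c(1)] cmapD(3)[OF c(2)] by (intro ext) (simp add: tm_def add_Arrow)
      then show ?thesis using cmap_add[OF c] by (simp add: tm_cmap)
    qed
    have ng: "(\<lambda>n. inv\<^bsub>HomG C (ob X n) (ob Y n)\<^esub> (f n)) \<in> chain_maps C X Y" if "f \<in> chain_maps C X Y" for f
    proof -
      have c: "cmap X Y (tm X Y f)" using that by (simp add: tm_cmap)
      have "tm X Y (\<lambda>n. inv\<^bsub>HomG C (ob X n) (ob Y n)\<^esub> (f n)) = (\<lambda>n. \<boxminus> tm X Y f n)"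
        using cmapD(3)[OF c] by (intro ext) (simp add: tm_def neg_Arrow)
      then show ?thesis using cmap_neg[OF c] by (simp add: tm_cmap)
    qed
    show "comm_group (HomG (Ch C) X Y)"
    proof (rule comm_groupI; (unfold Ch_sel)?)
      show "(\<lambda>n. Zero C (ob X n) (ob Y n)) \<in> chain_maps C X Y" using cmap_zer[OF o] by (simp add: tm_cmap tm_Zero)
      fix f assume f: "f \<in> chain_maps C X Y"
      show "(\<lambda>n. Zero C (ob X n) (ob Y n) \<otimes>\<^bsub>HomG C (ob X n) (ob Y n)\<^esub> f n) = f"
        using hom[OF f] by (intro ext) (simp add: monoid.l_one[OF m])
      have "(\<lambda>n. inv\<^bsub>HomG C (ob X n) (ob Y n)\<^esub> (f n) \<otimes>\<^bsub>HomG C (ob X n) (ob Y n)\<^esub> f n) = (\<lambda>n. Zero C (ob X n) (ob Y n))"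
        using hom[OF f] by (intro ext) (simp add: group.l_inv[OF hom_grp])
      then show "\<exists>g \<in> chain_maps C X Y. (\<lambda>n. g n \<otimes>\<^bsub>HomG C (ob X n) (ob Y n)\<^esub> f n) = (\<lambda>n. Zero C (ob X n) (ob Y n))"
        using ng[OF f] by (intro bexI[where x = "\<lambda>n. inv\<^bsub>HomG C (ob X n) (ob Y n)\<^esub> (f n)"])
      fix g assume g: "g \<in> chain_maps C X Y"
      show "(\<lambda>n. f n \<otimes>\<^bsub>HomG C (ob X n) (ob Y n)\<^esub> g n) \<in> chain_maps C X Y" by (rule add[OF f g])
      show "(\<lambda>n. f n \<otimes>\<^bsub>HomG C (ob X n) (ob Y n)\<^esub> g n) = (\<lambda>n. g n \<otimes>\<^bsub>HomG C (ob X n) (ob Y n)\<^esub> f n)"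
        using hom[OF f] hom[OF g] by (intro ext) (simp add: comm_monoid.m_comm[OF hom_monoid])
      fix h assume h: "h \<in> chain_maps C X Y"
      show "(\<lambda>n. (f n \<otimes>\<^bsub>HomG C (ob X n) (ob Y n)\<^esub> g n) \<otimes>\<^bsub>HomG C (ob X n) (ob Y n)\<^esub> h n)
         = (\<lambda>n. f n \<otimes>\<^bsub>HomG C (ob X n) (ob Y n)\<^esub> (g n \<otimes>\<^bsub>HomG C (ob X n) (ob Y n)\<^esub> h n))"
        using hom[OF f] hom[OF g] hom[OF h] by (intro ext) (simp add: monoid.m_assoc[OF m])
    qed
  next
    fix X Y Z :: "('o, 'm) cplx" and f g g'
    assume "X \<in> Obj (Ch C)" "Y \<in> Obj (Ch C)" "Z \<in> Obj (Ch C)" "f \<in> Hom (Ch C) X Y" "g \<in> Hom (Ch C) Y Z" "g' \<in> Hom (Ch C) Y Z"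
    then have "(g n \<otimes>\<^bsub>HomG C (ob Y n) (ob Z n)\<^esub> g' n) \<cdot> f n = (g n \<cdot> f n) \<otimes>\<^bsub>HomG C (ob X n) (ob Z n)\<^esub> (g' n \<cdot> f n)" for n
      by (intro comp_add_left[of "ob X n" "ob Y n" "ob Z n"]) (simp_all add: Ch_sel hom)
    then show "(g \<otimes>\<^bsub>HomG (Ch C) Y Z\<^esub> g') \<cdot>\<^bsub>Ch C\<^esub> f = (g \<cdot>\<^bsub>Ch C\<^esub> f) \<otimes>\<^bsub>HomG (Ch C) X Z\<^esub> (g' \<cdot>\<^bsub>Ch C\<^esub> f)"
      by (simp add: Ch_sel)
  next
    fix X Y Z :: "('o, 'm) cplx" and f f' g
    assume "X \<in> Obj (Ch C)" "Y \<in> Obj (Ch C)" "Z \<in> Obj (Ch C)" "f \<in> Hom (Ch C) X Y" "f' \<in> Hom (Ch C) X Y" "g \<in> Hom (Ch C) Y Z"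
    then have "g n \<cdot> (f n \<otimes>\<^bsub>HomG C (ob X n) (ob Y n)\<^esub> f' n) = (g n \<cdot> f n) \<otimes>\<^bsub>HomG C (ob X n) (ob Z n)\<^esub> (g n \<cdot> f' n)" for n
      by (intro comp_add_right[of "ob X n" "ob Y n" "ob Z n"]) (simp_all add: Ch_sel hom)
    then show "g \<cdot>\<^bsub>Ch C\<^esub> (f \<otimes>\<^bsub>HomG (Ch C) X Y\<^esub> f') = (g \<cdot>\<^bsub>Ch C\<^esub> f) \<otimes>\<^bsub>HomG (Ch C) X Z\<^esub> (g \<cdot>\<^bsub>Ch C\<^esub> f')"
      by (simp add: Ch_sel)
  qed
qed

lemma ses_kernel_chain_map:
  assumes s: "ses A B Q i c" and g: "cmap T B g" and e: "\<And>n. c n \<bullet> g n = zer (ob T n) (ob Q n)"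
  obtains h where "cmap T A h" "\<And>n. i n \<bullet> h n = g n"
proof -
  note ci = sesD(1)[OF s] and cc = sesD(2)[OF s]
  note [simp] = cmapD(1-5)[OF ci] cmapD(1-5)[OF cc] cmapD(1-5)[OF g]
  have "\<exists>h. isar h (ob T n) (ob A n) \<and> i n \<bullet> h = g n" for n
    using ses_lift[OF s, of "g n" "ob T n" n] e by auto
  then obtain h where h: "\<And>n. isar (h n) (ob T n) (ob A n)" "\<And>n. i n \<bullet> h n = g n" by metis
  have "D A n \<bullet> h n = h (n - 1) \<bullet> D T n" for n
  proof (rule monoD[OF ses_mono[OF s, of "n - 1"]])
    show "i (n - 1) \<bullet> (D A n \<bullet> h n) = i (n - 1) \<bullet> (h (n - 1) \<bullet> D T n)"
      using cmapD(7)[OF ci, of n "h n"] by (simp add: h(2) h(2)[THEN cmp_reassoc] cmapD(6)[OF g])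
  qed (use h(1) in simp_all)
  then have "cmap T A h" using h(1) by (simp add: cmap_def)
  then show ?thesis using that h(2) by blast
qed

lemma Conf_Ch_is_kernel:
  assumes "Conf (Ch C) A i B p Z" shows "is_kernel (Ch C) A i B p Z"
proof -
  have s: "ses A B Z (tm A B i) (tm B Z p)" using assms by (simp add: Conf_Ch)
  note ci = sesD(1)[OF s] and cc = sesD(2)[OF s]
  note [simp] = cmapD(1,2)[OF ci] cmapD(2)[OF cc]
  show ?thesis
    unfolding is_kernel_def Ch_sel
  proof (intro conjI ballI impI)
    show "A \<in> Collect (is_cplx C)" by simp
    show "i \<in> chain_maps C A B" using ci by (simp add: tm_cmap)
    have "tm A Z (\<lambda>n. p n \<cdot> i n) = tm A Z (\<lambda>n. Zero C (ob A n) (ob Z n))"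
      using tm_cmp[OF ci cc] ses_zero[OF s] by (intro ext) (simp add: tm_Zero)
    then show "(\<lambda>n. p n \<cdot> i n) = (\<lambda>n. Zero C (ob A n) (ob Z n))" by (rule tm_inj)
    fix T g assume "T \<in> Collect (is_cplx C)" and g: "g \<in> chain_maps C T B" and e: "(\<lambda>n. p n \<cdot> g n) = (\<lambda>n. Zero C (ob T n) (ob Z n))"
    then have T [simp]: "is_cplx C T" by simp
    have gc: "cmap T B (tm T B g)" using g by (simp add: tm_cmap)
    have "tm B Z p n \<bullet> tm T B g n = zer (ob T n) (ob Z n)" for n
      using tm_cmp[OF gc cc, of n] unfolding e by (simp add: tm_Zero)
    then obtain h where h: "cmap T A h" "\<And>n. tm A B i n \<bullet> h n = tm T B g n" using ses_kernel_chain_map[OF s gc] by blast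
    define h' where "h' = (\<lambda>n. val (h n))"
    have hh: "tm T A h' = h" using tm_val[OF h(1)] by (simp add: h'_def)
    show "\<exists>!h. h \<in> chain_maps C T A \<and> (\<lambda>n. i n \<cdot> h n) = g"
    proof (rule ex1I[of _ h'])
      have hc: "cmap T A (tm T A h')" using h hh by simp
      have "tm T B (\<lambda>n. i n \<cdot> h' n) = tm T B g" using tm_cmp[OF hc ci] h(2) hh by (intro ext) simp
      then show "h' \<in> chain_maps C T A \<and> (\<lambda>n. i n \<cdot> h' n) = g" using hc tm_inj by (auto simp: tm_cmap)
      fix y assume y: "y \<in> chain_maps C T A \<and> (\<lambda>n. i n \<cdot> y n) = g"
      then have yc: "cmap T A (tm T A y)" by (simp add: tm_cmap)
      have "tm A B i n \<bullet> tm T A y n = tm A B i n \<bullet> h n" for n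
        using tm_cmp[OF yc ci, of n] y h(2)[of n] by simp
      then have "tm T A y n = h n" for n
        by (rule monoD[OF ses_mono[OF s]]) (use cmapD[OF yc] cmapD[OF h(1)] cmapD[OF ci] in simp_all)
      then have "tm T A y = tm T A h'" by (intro ext) (simp add: hh)
      then show "y = h'" by (rule tm_inj)
    qed
  qed
qed

text \<open>The twisted sum along the zero family supplies the split extension required by the
  general criterion.\<close>

lemma Ext1_vanishes_Ch:
  assumes [simp]: "is_cplx C A" "is_cplx C Z"
  shows "Ext1_vanishes (Ch C) Z A \<longleftrightarrow> (\<forall>B i c. ses A B Z i c \<longrightarrow> (\<exists>s. cmap Z B s \<and> (\<forall>n. c n \<bullet> s n = idn (ob Z n))))"
proof -
  interpret Ch: preadditive_category "Ch C" by (rule preadditive_Ch)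
  have sec: "(\<exists>s \<in> Hom (Ch C) Z B. p \<cdot>\<^bsub>Ch C\<^esub> s = Ide (Ch C) Z) \<longleftrightarrow> (\<exists>s. cmap Z B s \<and> (\<forall>n. tm B Z p n \<bullet> s n = idn (ob Z n)))"
    if p: "cmap B Z (tm B Z p)" for B p
  proof
    note [simp] = cmapD(1)[OF p]
    assume "\<exists>s \<in> Hom (Ch C) Z B. p \<cdot>\<^bsub>Ch C\<^esub> s = Ide (Ch C) Z"
    then obtain s where s: "s \<in> chain_maps C Z B" "(\<lambda>n. p n \<cdot> s n) = (\<lambda>n. Ide C (ob Z n))" by (auto simp: Ch_sel)
    have sc: "cmap Z B (tm Z B s)" using s(1) by (simp add: tm_cmap)
    have "tm B Z p n \<bullet> tm Z B s n = idn (ob Z n)" for n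
      using tm_cmp[OF sc p, of n] unfolding s(2) by (simp add: tm_Ide)
    then show "\<exists>s. cmap Z B s \<and> (\<forall>n. tm B Z p n \<bullet> s n = idn (ob Z n))" using sc by blast
  next
    note [simp] = cmapD(1)[OF p]
    assume "\<exists>s. cmap Z B s \<and> (\<forall>n. tm B Z p n \<bullet> s n = idn (ob Z n))"
    then obtain s where s: "cmap Z B s" "\<And>n. tm B Z p n \<bullet> s n = idn (ob Z n)" by blast
    have ss: "tm Z B (\<lambda>n. val (s n)) = s" by (rule tm_val[OF s(1)])
    have "tm Z Z (\<lambda>n. p n \<cdot> val (s n)) = tm Z Z (\<lambda>n. Ide C (ob Z n))"
      using tm_cmp[of Z B "\<lambda>n. val (s n)" Z p] s p by (intro ext) (simp add: ss tm_Ide)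
    then have "(\<lambda>n. p n \<cdot> val (s n)) = (\<lambda>n. Ide C (ob Z n))" by (rule tm_inj)
    moreover have "(\<lambda>n. val (s n)) \<in> chain_maps C Z B" by (rule cmap_val[OF s(1)])
    ultimately show "\<exists>s \<in> Hom (Ch C) Z B. p \<cdot>\<^bsub>Ch C\<^esub> s = Ide (Ch C) Z" by (auto simp: Ch_sel)
  qed
  have conf: "is_kernel (Ch C) A i B p Z \<and> B \<in> Obj (Ch C) \<and> p \<in> Hom (Ch C) B Z" if c: "Conf (Ch C) A i B p Z" for i B p
  proof -
    have "cmap B Z (tm B Z p)" using c sesD(2) by (auto simp: Conf_Ch)
    then show ?thesis using Conf_Ch_is_kernel[OF c] cmapD(1) by (auto simp: Ch_sel tm_cmap)
  qed
  have split: "\<exists>i B p s. Conf (Ch C) A i B p Z \<and> s \<in> Hom (Ch C) Z B \<and> p \<cdot>\<^bsub>Ch C\<^esub> s = Ide (Ch C) Z"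
  proof -
    let ?\<theta> = "\<lambda>n. zer (ob Z n) (ob A (n - 1))" and ?i = "\<lambda>n. in1 (ob A n) (ob Z n)" and ?p = "\<lambda>n. pr2 (ob A n) (ob Z n)"
    have tw: "twist A Z ?\<theta>" by (rule twist_zer) simp_all
    have c: "Conf (Ch C) A (\<lambda>n. val (?i n)) (Tw A Z ?\<theta>) (\<lambda>n. val (?p n)) Z" by (rule Conf_Ch_val[OF ses_Tw[OF tw]])
    have pp: "tm (Tw A Z ?\<theta>) Z (\<lambda>n. val (?p n)) = ?p" by (rule tm_val[OF cmap_pr2[OF tw]])
    have "cmap Z (Tw A Z ?\<theta>) (\<lambda>n. in2 (ob A n) (ob Z n))"
      unfolding cmap_def using tw D_Tw_in2[OF tw] by (simp add: pair_def)
    then have ex: "\<exists>s. cmap Z (Tw A Z ?\<theta>) s \<and> (\<forall>n. tm (Tw A Z ?\<theta>) Z (\<lambda>n. val (?p n)) n \<bullet> s n = idn (ob Z n))"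
      unfolding pp by (intro exI[of _ "\<lambda>n. in2 (ob A n) (ob Z n)"]) simp
    have "cmap (Tw A Z ?\<theta>) Z (tm (Tw A Z ?\<theta>) Z (\<lambda>n. val (?p n)))" unfolding pp by (rule cmap_pr2[OF tw])
    from iffD2[OF sec[OF this] ex] c show ?thesis by blast
  qed
  have iff: "Ext1_vanishes (Ch C) Z A \<longleftrightarrow> (\<forall>i B p. Conf (Ch C) A i B p Z \<longrightarrow> (\<exists>s \<in> Hom (Ch C) Z B. p \<cdot>\<^bsub>Ch C\<^esub> s = Ide (Ch C) Z))"
    by (rule Ch.Ext1_vanishes_iff[OF conf _ _ split]) (simp_all add: Ch_sel)
  show ?thesis
    unfolding iff
  proof (intro iffI allI impI)
    fix B i c assume a: "\<forall>i B p. Conf (Ch C) A i B p Z \<longrightarrow> (\<exists>s \<in> Hom (Ch C) Z B. p \<cdot>\<^bsub>Ch C\<^esub> s = Ide (Ch C) Z)" and s: "ses A B Z i c"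
    have "tm B Z (\<lambda>n. val (c n)) = c" by (rule tm_val[OF sesD(2)[OF s]])
    then show "\<exists>s. cmap Z B s \<and> (\<forall>n. c n \<bullet> s n = idn (ob Z n))"
      using sec[of B "\<lambda>n. val (c n)"] a Conf_Ch_val[OF s] sesD(2)[OF s] by auto
  next
    fix i B p assume a: "\<forall>B i c. ses A B Z i c \<longrightarrow> (\<exists>s. cmap Z B s \<and> (\<forall>n. c n \<bullet> s n = idn (ob Z n)))" and "Conf (Ch C) A i B p Z"
    then have s: "ses A B Z (tm A B i) (tm B Z p)" by (simp add: Conf_Ch)
    then show "\<exists>s \<in> Hom (Ch C) Z B. p \<cdot>\<^bsub>Ch C\<^esub> s = Ide (Ch C) Z" using a sec[OF sesD(2)[OF s]] by blast
  qed
qed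

subsection \<open>Weak factorisation systems and the model structure\<close>

text \<open>The scheme behind both systems. Liftings exist by \<open>twist_null\<close>; conversely,
  the left class is recovered by a retract argument, and the right class by testing on suitable
  members of the left class, which is the assumption \<open>rl\<close>.\<close>

lemma wfs_of_classes:
  assumes SP: "\<And>Q n. Q \<in> S \<Longrightarrow> ob Q n \<in> Proj C"
    and ret: "\<And>Q Q' a b. \<lbrakk>Q \<in> S; cmap Q' Q a; cmap Q Q' b; \<And>n. b n \<bullet> a n = idn (ob Q' n)\<rbrakk> \<Longrightarrow> Q' \<in> S"
    and tn: "\<And>K Q. \<lbrakk>K \<in> T; Q \<in> S\<rbrakk> \<Longrightarrow> twist_null K Q"
    and fac: "\<And>X Y f. cmap X Y f \<Longrightarrow> \<exists>E Q K i c k p. Q \<in> S \<and> K \<in> T \<and> ses X E Q i c \<and> ses K E Y k p \<and> (\<forall>n. p n \<bullet> i n = f n)"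
    and rl: "\<And>X Y p. \<lbrakk>cmap X Y p; \<And>A B Q i c u v. \<lbrakk>ses A B Q i c; Q \<in> S; cmap A X u; cmap B Y v; \<And>n. p n \<bullet> u n = v n \<bullet> i n\<rbrakk>
        \<Longrightarrow> \<exists>h. cmap B X h \<and> (\<forall>n. h n \<bullet> i n = u n) \<and> (\<forall>n. p n \<bullet> h n = v n)\<rbrakk> \<Longrightarrow> \<exists>K \<in> T. \<exists>k. ses K X Y k p"
  shows "weak_factorisation_system (Ch C) (adm_monos_coker_in (Ch C) S) (adm_epis_ker_in (Ch C) T)"
proof -
  let ?L = "adm_monos_coker_in (Ch C) S" and ?R = "adm_epis_ker_in (Ch C) T"
  have LM: "cmap A B (tm A B i)" if "(A, B, i) \<in> ?L" for A B i using that sesD(1) by (auto simp: adm_monos_Ch)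
  have RM: "cmap X Y (tm X Y p)" if "(X, Y, p) \<in> ?R" for X Y p using that sesD(2) by (auto simp: adm_epis_Ch)
  have lift: "lifts_against (Ch C) (A, B, i) (X, Y, p)" if l: "(A, B, i) \<in> ?L" and r: "(X, Y, p) \<in> ?R" for A B i X Y p
  proof -
    obtain Q c where Q: "Q \<in> S" "ses A B Q (tm A B i) c" using l by (auto simp: adm_monos_Ch)
    obtain K k where K: "K \<in> T" "ses K X Y k (tm X Y p)" using r by (auto simp: adm_epis_Ch)
    have "has_lifts A B (tm A B i) X Y (tm X Y p)"
      unfolding has_lifts_def using ses_lifting_property[OF Q(2) SP[OF Q(1)] K(2) tn[OF K(1) Q(1)]] by blast
    then show ?thesis using lifts_against_Ch[OF LM[OF l] RM[OF r]] by blast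
  qed
  have fac': "\<exists>E l r. (X, E, l) \<in> ?L \<and> (E, Y, r) \<in> ?R \<and> f = r \<cdot>\<^bsub>Ch C\<^esub> l" if f: "(X, Y, f) \<in> Mor (Ch C)" for X Y f
  proof -
    have "cmap X Y (tm X Y f)" using f by (simp add: Mor_Ch)
    then obtain E Q K i c k p where E: "Q \<in> S" "K \<in> T" "ses X E Q i c" "ses K E Y k p" "\<And>n. p n \<bullet> i n = tm X Y f n"
      using fac by blast
    define i' where "i' = (\<lambda>n. val (i n))"
    define p' where "p' = (\<lambda>n. val (p n))"
    have i: "tm X E i' = i" and p: "tm E Y p' = p" unfolding i'_def p'_def by (rule tm_val[OF sesD(1)[OF E(3)]], rule tm_val[OF sesD(2)[OF E(4)]])
    have "tm X Y (\<lambda>n. p' n \<cdot> i' n) = tm X Y f"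
      using tm_cmp[of X E i' Y p'] sesD(1)[OF E(3)] sesD(2)[OF E(4)] E(5) by (intro ext) (simp add: i p)
    then have "f = (\<lambda>n. p' n \<cdot> i' n)" using tm_inj by metis
    moreover have "(X, E, i') \<in> ?L" using E i by (auto simp: adm_monos_Ch)
    moreover have "(E, Y, p') \<in> ?R" using E p by (auto simp: adm_epis_Ch)
    ultimately show ?thesis by (auto simp: Ch_sel)
  qed
  \<comment> \<open>The retract argument: \<open>l\<close> lifts against the second factor
    \<open>p\<close> of its own factorisation, and the lift makes \<open>l\<close> a retract of the
    first factor \<open>i\<close>.\<close>
  have left: "l \<in> ?L" if l: "l \<in> Mor (Ch C)" "\<And>r. r \<in> ?R \<Longrightarrow> lifts_against (Ch C) l r" for l
  proof (cases l)
    case (fields A B l0)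
    define m where "m = tm A B l0"
    have m: "cmap A B m" using l(1) fields by (simp add: Mor_Ch m_def)
    note [simp] = cmapD(1-5)[OF m]
    obtain E Q K i c k p where E: "Q \<in> S" "K \<in> T" "ses A E Q i c" "ses K E B k p" "\<And>n. p n \<bullet> i n = m n" using fac[OF m] by blast
    note ci = sesD(1)[OF E(3)] and cp = sesD(2)[OF E(4)]
    have p: "tm E B (\<lambda>n. val (p n)) = p" by (rule tm_val[OF cp])
    have "(E, B, \<lambda>n. val (p n)) \<in> ?R" using E p by (auto simp: adm_epis_Ch)
    then have "lifts_against (Ch C) (A, B, l0) (E, B, \<lambda>n. val (p n))" using l(2) fields by blast
    then have "has_lifts A B m E B p" using lifts_against_Ch[of A B l0 E B "\<lambda>n. val (p n)"] m cp by (simp add: m_def p)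
    moreover have "p n \<bullet> i n = idn (ob B n) \<bullet> m n" for n using E(5) by simp
    ultimately obtain h where h: "cmap B E h" "\<And>n. h n \<bullet> m n = i n" "\<And>n. p n \<bullet> h n = idn (ob B n)"
      unfolding has_lifts_def using ci cmap_id[of B] by fastforce
    obtain Q' c' a b where "ses A B Q' m c'" "cmap Q' Q a" "cmap Q Q' b" "\<And>n. b n \<bullet> a n = idn (ob Q' n)"
      using ses_of_retract[OF E(3) SP[OF E(1)] m h(1,2) cp h(3) E(5)] by blast
    then show ?thesis using ret[OF E(1)] fields by (auto simp: adm_monos_Ch m_def)
  qed
  have right: "r \<in> ?R" if r: "r \<in> Mor (Ch C)" "\<And>l. l \<in> ?L \<Longrightarrow> lifts_against (Ch C) l r" for r
  proof (cases r)
    case (fields X Y p0)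
    define p where "p = tm X Y p0"
    have p: "cmap X Y p" using r(1) fields by (simp add: Mor_Ch p_def)
    have "\<exists>K \<in> T. \<exists>k. ses K X Y k p"
    proof (rule rl[OF p])
      fix A B Q i c u v assume s: "ses A B Q i c" and Q: "Q \<in> S" and u: "cmap A X u" and v: "cmap B Y v" and e: "\<And>n. p n \<bullet> u n = v n \<bullet> i n"
      have i: "tm A B (\<lambda>n. val (i n)) = i" by (rule tm_val[OF sesD(1)[OF s]])
      have "(A, B, \<lambda>n. val (i n)) \<in> ?L" using s Q i by (auto simp: adm_monos_Ch)
      then have "lifts_against (Ch C) (A, B, \<lambda>n. val (i n)) (X, Y, p0)" using r(2) fields by blast
      then have "has_lifts A B i X Y p" using lifts_against_Ch[of A B "\<lambda>n. val (i n)" X Y p0] sesD(1)[OF s] p by (simp add: p_def i)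
      then show "\<exists>h. cmap B X h \<and> (\<forall>n. h n \<bullet> i n = u n) \<and> (\<forall>n. p n \<bullet> h n = v n)" using u v e unfolding has_lifts_def by blast
    qed
    then show ?thesis using fields by (auto simp: adm_epis_Ch p_def)
  qed
  show ?thesis
    unfolding weak_factorisation_system_def
  proof (intro conjI allI impI)
    show "?L = {l \<in> Mor (Ch C). \<forall>r \<in> ?R. lifts_against (Ch C) l r}"
    proof (intro equalityI subsetI)
      fix l assume a: "l \<in> ?L"
      show "l \<in> {l \<in> Mor (Ch C). \<forall>r \<in> ?R. lifts_against (Ch C) l r}"
      proof (cases l)
        case (fields A B i)
        have "lifts_against (Ch C) l r" if "r \<in> ?R" for r using lift[of A B i] a that fields by (cases r) auto
        then show ?thesis using LM[of A B i] a fields by (simp add: Mor_Ch)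
      qed
    qed (use left in blast)
    show "?R = {r \<in> Mor (Ch C). \<forall>l \<in> ?L. lifts_against (Ch C) l r}"
    proof (intro equalityI subsetI)
      fix r assume a: "r \<in> ?R"
      show "r \<in> {r \<in> Mor (Ch C). \<forall>l \<in> ?L. lifts_against (Ch C) l r}"
      proof (cases r)
        case (fields X Y p)
        have "lifts_against (Ch C) l r" if "l \<in> ?L" for l using lift[of _ _ _ X Y p] a that fields by (cases l) auto
        then show ?thesis using RM[of X Y p] a fields by (simp add: Mor_Ch)
      qed
    qed (use right in blast)
  qed (use fac' in blast)
qed

text \<open>An extension of \<open>Q\<close> by \<open>K\<close> splits by lifting the identity of
  \<open>Q\<close> along it. Conversely, if \<open>X\<close> is orthogonal to one class, the
  approximation sequence of \<open>X\<close> splits, and \<open>X\<close> is a retract of the middle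
  term, which belongs to the other class.\<close>

lemma complete_cotorsion_pair_of_classes:
  assumes SP: "\<And>Q n. Q \<in> S \<Longrightarrow> ob Q n \<in> Proj C" and Sc: "\<And>Q. Q \<in> S \<Longrightarrow> is_cplx C Q" and Tc: "\<And>K. K \<in> T \<Longrightarrow> is_cplx C K"
    and retS: "\<And>Q Q' a b. \<lbrakk>Q \<in> S; cmap Q' Q a; cmap Q Q' b; \<And>n. b n \<bullet> a n = idn (ob Q' n)\<rbrakk> \<Longrightarrow> Q' \<in> S"
    and retT: "\<And>K K' a b. \<lbrakk>K \<in> T; cmap K' K a; cmap K K' b; \<And>n. b n \<bullet> a n = idn (ob K' n)\<rbrakk> \<Longrightarrow> K' \<in> T"
    and tn: "\<And>K Q. \<lbrakk>K \<in> T; Q \<in> S\<rbrakk> \<Longrightarrow> twist_null K Q"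
    and res: "\<And>X. is_cplx C X \<Longrightarrow> \<exists>Q K k p. Q \<in> S \<and> K \<in> T \<and> ses K Q X k p"
    and cores: "\<And>X. is_cplx C X \<Longrightarrow> \<exists>Q K i c. Q \<in> S \<and> K \<in> T \<and> ses X K Q i c"
  shows "complete_cotorsion_pair (Ch C) S T"
proof -
  have van: "Ext1_vanishes (Ch C) Q K" if Q: "Q \<in> S" and K: "K \<in> T" for Q K
  proof -
    note [simp] = Sc[OF Q] Tc[OF K]
    obtain Z where Z [simp]: "is_cplx C Z" "\<And>n. is_zero_object C (ob Z n)" using zero_cplx by blast
    have "\<exists>s. cmap Q B s \<and> (\<forall>n. c n \<bullet> s n = idn (ob Q n))" if s: "ses K B Q i c" for B i c
    proof -
      note [simp] = cmapD(1-5)[OF sesD(2)[OF s]]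
      have "\<exists>h. cmap Q B h \<and> (\<forall>n. h n \<bullet> zer (ob Z n) (ob Q n) = zer (ob Z n) (ob B n)) \<and> (\<forall>n. c n \<bullet> h n = idn (ob Q n))"
        by (rule ses_lifting_property[OF ses_zero_idn[OF Z] SP[OF Q] s tn[OF K Q] cmap_zer cmap_id]) simp_all
      then show ?thesis by blast
    qed
    then show ?thesis by (simp add: Ext1_vanishes_Ch)
  qed
  have S': "X \<in> S" if X: "is_cplx C X" and e: "\<And>K. K \<in> T \<Longrightarrow> Ext1_vanishes (Ch C) X K" for X
  proof -
    obtain Q K k p where q: "Q \<in> S" "K \<in> T" "ses K Q X k p" using res[OF X] by blast
    obtain s where "cmap X Q s" "\<And>n. p n \<bullet> s n = idn (ob X n)"
      using e[OF q(2)] q(3) Ext1_vanishes_Ch[OF Tc[OF q(2)] X] by blast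
    then show ?thesis using retS[OF q(1) _ sesD(2)[OF q(3)]] by blast
  qed
  have T': "X \<in> T" if X: "is_cplx C X" and e: "\<And>Q. Q \<in> S \<Longrightarrow> Ext1_vanishes (Ch C) Q X" for X
  proof -
    obtain Q K i c where q: "Q \<in> S" "K \<in> T" "ses X K Q i c" using cores[OF X] by blast
    note ci = sesD(1)[OF q(3)] and cc = sesD(2)[OF q(3)]
    note [simp] = cmapD(1-5)[OF ci] cmapD(1-5)[OF cc]
    obtain s where s: "cmap Q K s" "\<And>n. c n \<bullet> s n = idn (ob Q n)"
      using e[OF q(1)] q(3) Ext1_vanishes_Ch[OF X Sc[OF q(1)]] by blast
    note [simp] = cmapD(3-5)[OF s(1)]
    have "cmap K K (\<lambda>n. idn (ob K n) \<boxplus> \<boxminus> (s n \<bullet> c n))"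
      by (rule cmap_add[OF cmap_id cmap_neg[OF cmap_cmp[OF cc s(1)]]]) simp
    then obtain r where r: "cmap K X r" "\<And>n. i n \<bullet> r n = idn (ob K n) \<boxplus> \<boxminus> (s n \<bullet> c n)"
      by (rule ses_kernel_chain_map[OF q(3)]) (simp_all add: s(2)[THEN cmp_reassoc])
    note [simp] = cmapD(3-5)[OF r(1)]
    have "r n \<bullet> i n = idn (ob X n)" for n
      by (rule monoD[OF ses_mono[OF q(3), of n]]) (simp_all add: r(2)[THEN cmp_reassoc] ses_zero[OF q(3)])
    then show ?thesis using retT[OF q(2) ci r(1)] by blast
  qed
  have "cotorsion_pair (Ch C) S T"
    unfolding cotorsion_pair_def Ch_sel using van Sc Tc S' T' by blast
  then show ?thesis
    unfolding complete_cotorsion_pair_def Ch_sel using res cores Conf_Ch_val by (metis mem_Collect_eq)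
qed

section \<open>Contractible complexes of projectives against all complexes\<close>

lemma tilde_Proj_retract:
  assumes "Q \<in> tilde C (Proj C)" "cmap Q' Q a" "cmap Q Q' b" "\<And>n. b n \<bullet> a n = idn (ob Q' n)"
  shows "Q' \<in> tilde C (Proj C)"
proof -
  note [simp] = cmapD(1-5)[OF assms(2)] cmapD(1-5)[OF assms(3)]
  have "ob Q' n \<in> Proj C" for n
    by (rule Proj_retract[of "ob Q n" "a n" _ "b n"]) (use assms(1,4) in \<open>simp_all add: tilde_Proj_iff\<close>)
  then show ?thesis using contractible_retract[OF _ assms(2-4)] assms(1) by (simp add: tilde_Proj_iff)
qed

lemma acyclics_retract:
  assumes "K \<in> acyclics C" "cmap K' K a" "cmap K K' b" "\<And>n. b n \<bullet> a n = idn (ob K' n)"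
  shows "K' \<in> acyclics C"
  using ex_at_retract[OF assms(2-4)] assms(1) cmapD(1)[OF assms(2)] by (simp add: acyclic_iff)

lemma zero_contractible:
  assumes "is_cplx C Z" "\<And>n. is_zero_object C (ob Z n)" shows "Z \<in> tilde C (Proj C)"
proof -
  have o: "ob Z n \<in> Obj C" for n using assms(1) by simp
  have "nullh Z Z (\<lambda>n. idn (ob Z n))"
    by (rule nullhI[of "\<lambda>n. zer (ob Z n) (ob Z (n + 1))"]) (use assms in \<open>simp_all add: zero_object_idn\<close>)
  then show ?thesis using assms zero_object_Proj by (simp add: tilde_Proj_iff contractible_def)
qed

text \<open>The second factor is \<open>(f, q)\<close> on \<open>X \<oplus> Q\<close> for a
  contractible cover \<open>q\<close> of \<open>Y\<close>; the summand \<open>Q\<close> makes it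
  degreewise surjective.\<close>

lemma projective_factorization:
  assumes f: "cmap X Y f"
  shows "\<exists>E Q K i c k p. Q \<in> tilde C (Proj C) \<and> is_cplx C K \<and> ses X E Q i c \<and> ses K E Y k p \<and> (\<forall>n. p n \<bullet> i n = f n)"
proof -
  note [simp] = cmapD(1-5)[OF f]
  obtain Q q where Q: "contractible Q" "\<And>n. ob Q n \<in> Proj C" and q: "cmap Q Y q" "\<And>n. psurj (q n)"
    using contractible_cover[of Y] by auto
  note [simp] = cmapD(1-5)[OF q(1)]
  let ?\<theta> = "\<lambda>n. zer (ob Q n) (ob X (n - 1))"
  have tw: "twist X Q ?\<theta>" by (rule twist_zer) simp_all
  let ?p = "\<lambda>n. cop (f n) (q n)"
  have p: "cmap (Tw X Q ?\<theta>) Y ?p" by (rule cmap_from_Tw[OF tw f]) (simp_all add: cmapD(6)[OF q(1)])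
  have "psurj (?p n)" for n
    unfolding psurj_def
  proof (intro conjI ballI allI impI)
    fix P y assume P: "P \<in> Proj C" and y: "isar y P (tgt (?p n))"
    note [simp] = Proj_Obj[OF P]
    obtain x where x: "arr x" "src x = P" "tgt x = ob Q n" "q n \<bullet> x = y" using psurjD[OF q(2)[of n] P, of y] y by auto
    then have "?p n \<bullet> pair (zer P (ob X n)) x = y" using y by simp
    then show "\<exists>x. isar x P (src (?p n)) \<and> ?p n \<bullet> x = y" using x(1-3) by (intro exI[of _ "pair (zer P (ob X n)) x"]) (simp del: cop_pair)
  qed simp
  then obtain K k where K: "ses K (Tw X Q ?\<theta>) Y k ?p" using ses_of_psurj[OF p] by blast
  have "Q \<in> tilde C (Proj C)" using Q by (simp add: tilde_Proj_iff)
  moreover have "\<forall>n. ?p n \<bullet> in1 (ob X n) (ob Q n) = f n" by simp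
  moreover have "is_cplx C K" using cmapD(1)[OF sesD(1)[OF K]] .
  ultimately show ?thesis using K ses_Tw[OF tw] by blast
qed

theorem projective_wfs:
  "weak_factorisation_system (Ch C) (adm_monos_coker_in (Ch C) (tilde C (Proj C))) (adm_epis_ker_in (Ch C) (Collect (is_cplx C)))"
proof (rule wfs_of_classes)
  fix X Y p assume p: "cmap X Y p"
    and l: "\<And>A B Q i c u v. \<lbrakk>ses A B Q i c; Q \<in> tilde C (Proj C); cmap A X u; cmap B Y v; \<And>n. p n \<bullet> u n = v n \<bullet> i n\<rbrakk>
        \<Longrightarrow> \<exists>h. cmap B X h \<and> (\<forall>n. h n \<bullet> i n = u n) \<and> (\<forall>n. p n \<bullet> h n = v n)"
  have "psurj (p n)" for n by (rule psurj_of_right_lifting[OF p]) (rule l)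
  then obtain K k where K: "ses K X Y k p" using ses_of_psurj[OF p] by blast
  then show "\<exists>K \<in> Collect (is_cplx C). \<exists>k. ses K X Y k p" using cmapD(1)[OF sesD(1)[OF K]] by blast
next
  show "\<exists>E Q K i c k p. Q \<in> tilde C (Proj C) \<and> K \<in> Collect (is_cplx C) \<and> ses X E Q i c \<and> ses K E Y k p \<and> (\<forall>n. p n \<bullet> i n = f n)"
    if "cmap X Y f" for X Y f using projective_factorization[OF that] by simp
next
  fix Q assume Q: "Q \<in> tilde C (Proj C)"
  show "ob Q n \<in> Proj C" for n using Q by (simp only: tilde_Proj_iff)
  show "twist_null K Q" for K using Q twist_null_contractible by (simp only: tilde_Proj_iff)
next
  fix Q Q' a b assume "Q \<in> tilde C (Proj C)" "cmap Q' Q a" "cmap Q Q' b" "\<And>n. b n \<bullet> a n = idn (ob Q' n)"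
  then show "Q' \<in> tilde C (Proj C)" by (rule tilde_Proj_retract)
qed

theorem projective_cotorsion_pair: "complete_cotorsion_pair (Ch C) (tilde C (Proj C)) (Collect (is_cplx C))"
proof (rule complete_cotorsion_pair_of_classes)
  fix X assume X: "is_cplx C X"
  obtain Q q where Q: "contractible Q" "\<And>n. ob Q n \<in> Proj C" and q: "cmap Q X q" "\<And>n. psurj (q n)"
    using contractible_cover[OF X] by blast
  obtain K k where K: "ses K Q X k q" using ses_of_psurj[OF q] by blast
  have "Q \<in> tilde C (Proj C)" using Q by (simp add: tilde_Proj_iff)
  then show "\<exists>Q K k p. Q \<in> tilde C (Proj C) \<and> K \<in> Collect (is_cplx C) \<and> ses K Q X k p"
    using K cmapD(1)[OF sesD(1)[OF K]] by blast
  \<comment> \<open>Every complex belongs to the right class, so the identity of \<open>X\<close>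
    with zero cokernel is the required coresolution.\<close>
  obtain Z where Z: "is_cplx C Z" "\<And>n. is_zero_object C (ob Z n)" using zero_cplx by blast
  show "\<exists>Q K i c. Q \<in> tilde C (Proj C) \<and> K \<in> Collect (is_cplx C) \<and> ses X K Q i c"
    using zero_contractible[OF Z] X ses_idn_zero[OF Z X] by blast
next
  fix Q assume Q: "Q \<in> tilde C (Proj C)"
  show "ob Q n \<in> Proj C" for n using Q by (simp only: tilde_Proj_iff)
  show "is_cplx C Q" using Q by (simp only: tilde_Proj_iff contractible_def)
  show "twist_null K Q" for K using Q twist_null_contractible by (simp only: tilde_Proj_iff)
next
  fix Q Q' a b assume "Q \<in> tilde C (Proj C)" "cmap Q' Q a" "cmap Q Q' b" "\<And>n. b n \<bullet> a n = idn (ob Q' n)"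
  then show "Q' \<in> tilde C (Proj C)" by (rule tilde_Proj_retract)
next
  fix K K' a assume "cmap K' K a"
  then show "K' \<in> Collect (is_cplx C)" using cmapD(1) by blast
qed simp

section \<open>The cotorsion pair on \<open>C\<close>\<close>

lemma Ext1_vanishes_base:
  assumes [simp]: "A \<in> Obj C" "Z \<in> Obj C"
  shows "Ext1_vanishes C Z A \<longleftrightarrow> (\<forall>i p. cnf i p \<and> src i = A \<and> tgt p = Z \<longrightarrow> (\<exists>s. isar s Z (tgt i) \<and> p \<bullet> s = idn Z))"
proof -
  have sec: "(\<exists>s \<in> Hom C Z B. p \<cdot> s = Ide C Z) \<longleftrightarrow> (\<exists>s. isar s Z B \<and> Arrow B Z p \<bullet> s = idn Z)"
    if B: "B \<in> Obj C" "p \<in> Hom C B Z" for B p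
  proof
    assume "\<exists>s \<in> Hom C Z B. p \<cdot> s = Ide C Z"
    then obtain s where "s \<in> Hom C Z B" "p \<cdot> s = Ide C Z" by blast
    then show "\<exists>s. isar s Z B \<and> Arrow B Z p \<bullet> s = idn Z"
      using B by (intro exI[of _ "Arrow Z B s"]) (simp add: cmp_Arrow idn_eq_Arrow)
  next
    assume "\<exists>s. isar s Z B \<and> Arrow B Z p \<bullet> s = idn Z"
    then obtain s where s: "isar s Z B" "Arrow B Z p \<bullet> s = idn Z" by blast
    then have "p \<cdot> val s = Ide C Z" using val_cmp[of "Arrow B Z p" s] B by (simp add: idn_eq_Arrow)
    then show "\<exists>s \<in> Hom C Z B. p \<cdot> s = Ide C Z" using val_Hom[OF s(1)] by blast
  qed
  have "\<exists>i B p s. Conf C A i B p Z \<and> s \<in> Hom C Z B \<and> p \<cdot> s = Ide C Z"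
  proof -
    have "Conf C A (val (in1 A Z)) (Bip A Z) (val (pr2 A Z)) Z" using cnf_bip[of A Z] by (simp add: cnf_def)
    moreover have "val (pr2 A Z) \<in> Hom C (Bip A Z) Z" by (intro val_Hom) simp
    moreover have "Arrow (Bip A Z) Z (val (pr2 A Z)) = pr2 A Z" by (intro Arrow_val) simp
    ultimately have "\<exists>s \<in> Hom C Z (Bip A Z). val (pr2 A Z) \<cdot> s = Ide C Z"
      using sec[of "Bip A Z" "val (pr2 A Z)"] by (auto intro!: exI[of _ "in2 A Z"])
    then show ?thesis using \<open>Conf C A (val (in1 A Z)) (Bip A Z) (val (pr2 A Z)) Z\<close> by blast
  qed
  then have iff: "Ext1_vanishes C Z A \<longleftrightarrow> (\<forall>i B p. Conf C A i B p Z \<longrightarrow> (\<exists>s \<in> Hom C Z B. p \<cdot> s = Ide C Z))"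
    by (intro Ext1_vanishes_iff) (use conf_kernel Conf_homs in auto)
  show ?thesis
    unfolding iff
  proof (intro iffI allI impI)
    fix i p assume a: "\<forall>i B p. Conf C A i B p Z \<longrightarrow> (\<exists>s \<in> Hom C Z B. p \<cdot> s = Ide C Z)" and c: "cnf i p \<and> src i = A \<and> tgt p = Z"
    then have "Conf C A (val i) (tgt i) (val p) Z" and t: "isar p (tgt i) Z" by (auto simp: cnf_def)
    then have "\<exists>s \<in> Hom C Z (tgt i). val p \<cdot> s = Ide C Z" using a by blast
    then show "\<exists>s. isar s Z (tgt i) \<and> p \<bullet> s = idn Z"
      using sec[of "tgt i" "val p"] val_Hom[OF t] Arrow_val[OF t] isar_in_Obj[OF t] by simp
  next
    fix i B p assume a: "\<forall>i p. cnf i p \<and> src i = A \<and> tgt p = Z \<longrightarrow> (\<exists>s. isar s Z (tgt i) \<and> p \<bullet> s = idn Z)" and c: "Conf C A i B p Z"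
    then have "\<exists>s. isar s Z (tgt (Arrow A B i)) \<and> Arrow B Z p \<bullet> s = idn Z" using c unfolding Conf_iff_cnf by (metis arrow.sel)
    then show "\<exists>s \<in> Hom C Z B. p \<cdot> s = Ide C Z" using sec[of B p] Conf_homs[OF c] by simp
  qed
qed

text \<open>Extensions of a projective split. Conversely, if all extensions of \<open>X\<close>
  split, so does a projective cover, and \<open>X\<close> is a retract of a projective.\<close>

theorem base_cotorsion_pair: "cotorsion_pair C (Proj C) (Obj C)"
proof -
  have van: "Ext1_vanishes C P A" if P: "P \<in> Proj C" and A: "A \<in> Obj C" for P A
    unfolding Ext1_vanishes_base[OF A Proj_Obj[OF P]]
  proof (intro allI impI)
    fix i p assume c: "cnf i p \<and> src i = A \<and> tgt p = P"
    then have t: "src p = tgt i" "tgt p = P" and s: "psurj p" using cnf_types cnf_psurj by blast+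
    obtain s where "arr s" "src s = P" "tgt s = src p" "p \<bullet> s = idn P"
      by (rule psurjD[OF s P, of "idn P"]) (simp_all add: t Proj_Obj[OF P])
    then show "\<exists>s. isar s P (tgt i) \<and> p \<bullet> s = idn P" unfolding t by blast
  qed
  have "X \<in> Proj C" if X: "X \<in> Obj C" and e: "\<And>A. A \<in> Obj C \<Longrightarrow> Ext1_vanishes C X A" for X
  proof -
    obtain q where q: "aepi q" "src q \<in> Proj C" "tgt q = X" using projective_cover[OF X] by blast
    then obtain i where i: "cnf i q" by (auto simp: aepi_def)
    have t: "arr i" "src q = tgt i" "arr q" using cnf_types[OF i] by simp_all
    obtain s where "isar s X (src q)" "q \<bullet> s = idn X"
      using e[of "src i"] Ext1_vanishes_base[of "src i" X] X i q(3) t by (metis src_in_Obj)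
    then show ?thesis using Proj_retract[OF q(2), of s X q] q(3) t by simp
  qed
  then show ?thesis unfolding cotorsion_pair_def using van Proj_Obj by blast
qed

section \<open>Weak equivalences\<close>

definition quasi_isos :: "(('o, 'm) cplx \<times> ('o, 'm) cplx \<times> (int \<Rightarrow> 'm)) set" where
  "quasi_isos = {(X, Y, f). cmap X Y (tm X Y f) \<and> hinj X Y (tm X Y f) \<and> hsurj X Y (tm X Y f)}"

lemma wide_subcategory_quasi_isos: "wide_subcategory (Ch C) quasi_isos"
  unfolding wide_subcategory_def
proof (intro conjI ballI allI impI)
  show "quasi_isos \<subseteq> Mor (Ch C)" by (auto simp: quasi_isos_def Mor_Ch)
  fix X assume "X \<in> Obj (Ch C)"
  then show "(X, X, Ide (Ch C) X) \<in> quasi_isos"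
    by (simp add: quasi_isos_def Ch_sel tm_Ide cmap_id hinj_id hsurj_id)
next
  fix X Y Z f g assume a: "(X, Y, f) \<in> quasi_isos \<and> (Y, Z, g) \<in> quasi_isos"
  then have c: "cmap X Y (tm X Y f)" "cmap Y Z (tm Y Z g)" by (auto simp: quasi_isos_def)
  have "tm X Z (\<lambda>n. g n \<cdot> f n) = (\<lambda>n. tm Y Z g n \<bullet> tm X Y f n)" using tm_cmp[OF c] by (intro ext)
  then show "(X, Z, g \<cdot>\<^bsub>Ch C\<^esub> f) \<in> quasi_isos"
    using a cmap_cmp[OF c] hinj_cmp[OF c] hsurj_cmp[OF c] by (simp add: quasi_isos_def Ch_sel)
qed

text \<open>On homology \<open>g\<close> is injective because \<open>h g\<close> is, and surjective
  because \<open>g f\<close> is. With \<open>g\<close> a weak equivalence, \<open>f\<close> and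
  \<open>h\<close> follow by cancellation.\<close>

lemma two_out_of_six_quasi_isos: "two_out_of_six (Ch C) quasi_isos"
  unfolding two_out_of_six_def
proof (intro allI impI)
  fix X Y Z T f g h
  assume a: "(X, Y, f) \<in> Mor (Ch C) \<and> (Y, Z, g) \<in> Mor (Ch C) \<and> (Z, T, h) \<in> Mor (Ch C) \<and>
     (X, Z, g \<cdot>\<^bsub>Ch C\<^esub> f) \<in> quasi_isos \<and> (Y, T, h \<cdot>\<^bsub>Ch C\<^esub> g) \<in> quasi_isos"
  then have f: "cmap X Y (tm X Y f)" and g: "cmap Y Z (tm Y Z g)" and h: "cmap Z T (tm Z T h)" by (simp_all add: Mor_Ch)
  have "tm X Z (\<lambda>n. g n \<cdot> f n) = (\<lambda>n. tm Y Z g n \<bullet> tm X Y f n)" using tm_cmp[OF f g] by (intro ext)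
  then have gf: "hinj X Z (\<lambda>n. tm Y Z g n \<bullet> tm X Y f n)" "hsurj X Z (\<lambda>n. tm Y Z g n \<bullet> tm X Y f n)"
    using a by (simp_all add: quasi_isos_def Ch_sel)
  have "tm Y T (\<lambda>n. h n \<cdot> g n) = (\<lambda>n. tm Z T h n \<bullet> tm Y Z g n)" using tm_cmp[OF g h] by (intro ext)
  then have hg: "hinj Y T (\<lambda>n. tm Z T h n \<bullet> tm Y Z g n)" "hsurj Y T (\<lambda>n. tm Z T h n \<bullet> tm Y Z g n)"
    using a by (simp_all add: quasi_isos_def Ch_sel)
  have gi: "hinj Y Z (tm Y Z g)" by (rule hinj_of_cmp[OF g h hg(1)])
  have gs: "hsurj Y Z (tm Y Z g)" by (rule hsurj_of_cmp[OF f g gf(2)])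
  have "(X, Y, f) \<in> quasi_isos"
    using f hinj_of_cmp[OF f g gf(1)] hsurj_cancel_left[OF f g gf(2) gi] by (simp add: quasi_isos_def)
  moreover have "(Y, Z, g) \<in> quasi_isos" using g gi gs by (simp add: quasi_isos_def)
  moreover have "(Z, T, h) \<in> quasi_isos"
    using h hsurj_of_cmp[OF g h hg(2)] hinj_cancel_right[OF g h hg(1) gs] by (simp add: quasi_isos_def)
  moreover have "(X, T, h \<cdot>\<^bsub>Ch C\<^esub> (g \<cdot>\<^bsub>Ch C\<^esub> f)) \<in> quasi_isos"
    using wide_subcategory_quasi_isos a \<open>(Z, T, h) \<in> quasi_isos\<close> unfolding wide_subcategory_def by blast
  ultimately show "(X, Y, f) \<in> quasi_isos \<and> (Y, Z, g) \<in> quasi_isos \<and> (Z, T, h) \<in> quasi_isos \<and> (X, T, h \<cdot>\<^bsub>Ch C\<^esub> (g \<cdot>\<^bsub>Ch C\<^esub> f)) \<in> quasi_isos"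
    by blast
qed

text \<open>Acyclicity of the cokernel decides whether the monic is a weak equivalence, and a
  K-projective complex is acyclic precisely if it lies in the tilde class of the
  projectives.\<close>

lemma cofibrations_Int_quasi_isos:
  "adm_monos_coker_in (Ch C) (Collect kproj) \<inter> quasi_isos = adm_monos_coker_in (Ch C) (tilde C (Proj C))"
proof (rule Set.set_eqI)
  fix l :: "('o, 'm) cplx \<times> ('o, 'm) cplx \<times> (int \<Rightarrow> 'm)"
  obtain X Y f where l: "l = (X, Y, f)" using prod_cases3 by blast
  have "l \<in> adm_monos_coker_in (Ch C) (Collect kproj) \<inter> quasi_isos \<longleftrightarrow>
     (\<exists>Q c. kproj Q \<and> Q \<in> acyclics C \<and> ses X Y Q (tm X Y f) c)"
    unfolding l using quasi_iso_mono_iff[of X Y _ "tm X Y f"] sesD(1)[of X Y _ "tm X Y f"] by (auto simp: adm_monos_Ch quasi_isos_def)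
  moreover have "kproj Q \<and> Q \<in> acyclics C \<longleftrightarrow> Q \<in> tilde C (Proj C)" for Q
    using dg_left_acyclics dg_left_eq by blast
  ultimately show "l \<in> adm_monos_coker_in (Ch C) (Collect kproj) \<inter> quasi_isos \<longleftrightarrow> l \<in> adm_monos_coker_in (Ch C) (tilde C (Proj C))"
    unfolding l adm_monos_Ch by blast
qed

lemma fibrations_Int_quasi_isos:
  "adm_epis_ker_in (Ch C) (Collect (is_cplx C)) \<inter> quasi_isos = adm_epis_ker_in (Ch C) (acyclics C)"
proof (rule Set.set_eqI)
  fix r :: "('o, 'm) cplx \<times> ('o, 'm) cplx \<times> (int \<Rightarrow> 'm)"
  obtain X Y f where r: "r = (X, Y, f)" using prod_cases3 by blast
  show "r \<in> adm_epis_ker_in (Ch C) (Collect (is_cplx C)) \<inter> quasi_isos \<longleftrightarrow> r \<in> adm_epis_ker_in (Ch C) (acyclics C)"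
    unfolding r using quasi_iso_epi_iff[of _ X Y _ "tm X Y f"] sesD(2)[of _ X Y _ "tm X Y f"] acyclic_cplx
    unfolding adm_epis_Ch quasi_isos_def Int_iff mem_Collect_eq prod.case by blast
qed

end

section \<open>K-projective complexes against acyclic complexes, and the model structure\<close>

context AB4_category
begin

lemma kproj_factorization:
  assumes f: "cmap X Y f"
  obtains E Q i c p where "kproj Q" "ses X E Q i c" "cmap E Y p" "\<And>n. p n \<bullet> i n = f n" "\<And>m. lifting E Y p m"
proof -
  obtain Q g where Q: "kproj Q" "cmap Q (cone X Y f) g" "\<And>m. lifting Q (cone X Y f) g m"
    by (rule kproj_resolution[OF is_cplx_cone[OF f]]) (rule that)
  obtain \<theta> \<pi> where t: "twist X Q \<theta>" "cmap (Tw X Q \<theta>) Y \<pi>" "\<And>n. \<pi> n \<bullet> in1 (ob X n) (ob Q n) = f n"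
    "\<And>m. lifting Q (cone X Y f) g m \<Longrightarrow> lifting (Tw X Q \<theta>) Y \<pi> m"
    by (rule lifting_factorization[OF f Q(2)]) (rule that)
  show ?thesis by (rule that[OF Q(1) ses_Tw[OF t(1)] t(2,3) t(4)[OF Q(3)]])
qed

lemma ses_of_lifting:
  assumes g: "cmap Q Y g" and l: "\<And>m. lifting Q Y g m"
  shows "\<exists>K \<in> acyclics C. \<exists>k. ses K Q Y k g"
proof -
  obtain K k where K: "ses K Q Y k g" using ses_of_psurj[OF g lifting_imp_psurj[OF g l]] by blast
  have "ex_at K m" for m by (rule kernel_ex_at_of_lifting[OF sesD(1)[OF K] g sesD(3)[OF K] l])
  then have "K \<in> acyclics C" using cmapD(1)[OF sesD(1)[OF K]] by (simp add: acyclic_iff)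
  then show ?thesis using K by blast
qed

theorem dg_projective_wfs:
  "weak_factorisation_system (Ch C) (adm_monos_coker_in (Ch C) (Collect kproj)) (adm_epis_ker_in (Ch C) (acyclics C))"
proof (rule wfs_of_classes)
  fix X Y p assume p: "cmap X Y p"
    and l: "\<And>A B Q i c u v. \<lbrakk>ses A B Q i c; Q \<in> Collect kproj; cmap A X u; cmap B Y v; \<And>n. p n \<bullet> u n = v n \<bullet> i n\<rbrakk>
        \<Longrightarrow> \<exists>h. cmap B X h \<and> (\<forall>n. h n \<bullet> i n = u n) \<and> (\<forall>n. p n \<bullet> h n = v n)"
  show "\<exists>K \<in> acyclics C. \<exists>k. ses K X Y k p"
    by (rule ses_of_lifting[OF p lifting_of_right_lifting[OF p l]]) simp_all
next
  fix X Y f assume f: "cmap X Y f"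
  obtain E Q i c p where e: "kproj Q" "ses X E Q i c" "cmap E Y p" "\<And>n. p n \<bullet> i n = f n" "\<And>m. lifting E Y p m"
    by (rule kproj_factorization[OF f]) (rule that)
  then show "\<exists>E Q K i c k p. Q \<in> Collect kproj \<and> K \<in> acyclics C \<and> ses X E Q i c \<and> ses K E Y k p \<and> (\<forall>n. p n \<bullet> i n = f n)"
    using ses_of_lifting[OF e(3,5)] by blast
next
  fix Q assume Q: "Q \<in> Collect kproj"
  show "ob Q n \<in> Proj C" for n using Q by (simp add: kprojD(2))
  show "twist_null K Q" if "K \<in> acyclics C" for K using Q that by (simp add: twist_null_kproj)
next
  fix Q Q' a b assume "Q \<in> Collect kproj" "cmap Q' Q a" "cmap Q Q' b" "\<And>n. b n \<bullet> a n = idn (ob Q' n)"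
  then show "Q' \<in> Collect kproj" using kproj_retract[of Q Q' a b] by simp
qed

theorem dg_projective_cotorsion_pair: "complete_cotorsion_pair (Ch C) (Collect kproj) (acyclics C)"
proof (rule complete_cotorsion_pair_of_classes)
  fix X assume X: "is_cplx C X"
  obtain Q g where Q: "kproj Q" "cmap Q X g" "\<And>m. lifting Q X g m" by (rule kproj_resolution[OF X]) (rule that)
  then show "\<exists>Q K k p. Q \<in> Collect kproj \<and> K \<in> acyclics C \<and> ses K Q X k p" using ses_of_lifting[OF Q(2,3)] by blast
  obtain Z where Z: "is_cplx C Z" "\<And>n. is_zero_object C (ob Z n)" using zero_cplx by blast
  \<comment> \<open>The coresolution is a factorisation of the map from \<open>X\<close> to zero:
    lifting against a zero complex says that every cycle of \<open>E\<close> bounds, so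
    \<open>E\<close> is acyclic.\<close>
  obtain E Q i c p where e: "kproj Q" "ses X E Q i c" "cmap E Z p" "\<And>n. p n \<bullet> i n = zer (ob X n) (ob Z n)" "\<And>m. lifting E Z p m"
    by (rule kproj_factorization[OF cmap_zer[OF X Z(1)]]) (rule that)
  note [simp] = cmapD(1-5)[OF e(3)]
  have "ex_at E m" for m
  proof (rule ex_atI)
    fix P x assume P: "P \<in> Proj C" and x: "arr x" "src x = P" "tgt x = ob E m" "D E m \<bullet> x = zer P (ob E (m - 1))"
    have px: "p m \<bullet> x = zer P (ob Z m)" using zero_object_arr_to[OF Z(2), of "p m \<bullet> x" m] x by simp
    have xz: "isar x P (ob E m)" "isar (zer P (ob Z (m + 1))) P (ob Z (m + 1))"
      "D Z (m + 1) \<bullet> zer P (ob Z (m + 1)) = p m \<bullet> x"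
      unfolding px using x(1-3) Proj_Obj[OF P] Z(1) by simp_all
    obtain y where "arr y" "src y = P" "tgt y = ob E (m + 1)" "D E (m + 1) \<bullet> y = x" "p (m + 1) \<bullet> y = zer P (ob Z (m + 1))"
      by (rule liftingE[OF e(5)[of m] P xz(1) x(4) xz(2,3)])
    then show "\<exists>y. isar y P (ob E (m + 1)) \<and> D E (m + 1) \<bullet> y = x" by blast
  qed
  then have "E \<in> acyclics C" by (simp add: acyclic_iff)
  then show "\<exists>Q K i c. Q \<in> Collect kproj \<and> K \<in> acyclics C \<and> ses X K Q i c" using e(1,2) by blast
next
  fix Q assume Q: "Q \<in> Collect kproj"
  show "ob Q n \<in> Proj C" for n using Q by (simp add: kprojD(2))
  show "is_cplx C Q" using Q by (simp add: kprojD(1))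
  show "twist_null K Q" if "K \<in> acyclics C" for K using Q that by (simp add: twist_null_kproj)
next
  fix Q Q' a b assume "Q \<in> Collect kproj" "cmap Q' Q a" "cmap Q Q' b" "\<And>n. b n \<bullet> a n = idn (ob Q' n)"
  then show "Q' \<in> Collect kproj" using kproj_retract[of Q Q' a b] by simp
next
  fix K K' a b assume "K \<in> acyclics C" "cmap K' K a" "cmap K K' b" "\<And>n. b n \<bullet> a n = idn (ob K' n)"
  then show "K' \<in> acyclics C" by (rule acyclics_retract)
qed (rule acyclic_cplx)

text \<open>The cofibrations are the left class of one weak factorisation system and the fibrations
  the right class of the other, so both are wide subcategories. The two intersection lemmas identify
  the acyclic maps with the remaining classes.\<close>

theorem projective_model_structure:
  "model_structure (Ch C) (adm_monos_coker_in (Ch C) (Collect kproj)) (adm_epis_ker_in (Ch C) (Collect (is_cplx C))) quasi_isos"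
proof -
  interpret Ch: preadditive_category "Ch C" by (rule preadditive_Ch)
  show ?thesis
    unfolding model_structure_def cofibrations_Int_quasi_isos fibrations_Int_quasi_isos
    using Ch.wide_subcategory_of_wfs(1)[OF dg_projective_wfs] Ch.wide_subcategory_of_wfs(2)[OF projective_wfs]
      wide_subcategory_quasi_isos two_out_of_six_quasi_isos projective_wfs dg_projective_wfs by blast
qed

end

theorem theorem2:
  fixes E :: "('o, 'm) excat"
    and L R :: "'o set"
  assumes "exact_category E"
    and "enough_projectives E"
    and "has_kernels E"
    and "countable_coproducts_of_projectives E"
    and "\<exists>k :: int. projectives_AB4 E k"
    and L_def: "L = Proj E"
    and R_def: "R = Obj E"
  shows "cotorsion_pair E L R
    \<and> complete_cotorsion_pair (Ch E) (dg_left E L R) (tilde E R)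
    \<and> complete_cotorsion_pair (Ch E) (tilde E L) (dg_right E L R)
    \<and> dg_left E L R \<inter> acyclics E = tilde E L
    \<and> dg_right E L R \<inter> acyclics E = tilde E R
    \<and> (\<exists>Cof Fib W. model_structure (Ch E) Cof Fib W
         \<and> Cof = adm_monos_coker_in (Ch E) (dg_left E L R)
         \<and> Cof \<inter> W = adm_monos_coker_in (Ch E) (tilde E L)
         \<and> Fib = adm_epis_ker_in (Ch E) (dg_right E L R)
         \<and> Fib \<inter> W = adm_epis_ker_in (Ch E) (tilde E R))"
proof -
  obtain k where k: "projectives_AB4 E k" using assms(5) by blast
  interpret AB4_category E k
    by (intro AB4_category.intro projective_exact_category.intro projective_exact_category_axioms.intro AB4_category_axioms.intro)
       (fact assms k)+
  have "Collect (is_cplx E) \<inter> acyclics E = acyclics E" using acyclic_cplx by blast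
  then show ?thesis
    unfolding L_def R_def dg_left_eq dg_right_eq tilde_Obj
    using base_cotorsion_pair dg_projective_cotorsion_pair projective_cotorsion_pair dg_left_acyclics[unfolded dg_left_eq]
      projective_model_structure cofibrations_Int_quasi_isos fibrations_Int_quasi_isos by blast
qed

end
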